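(* Let $\Omega\subset\mathbb R^n$ be a bounded domain (with Lipschitz boundary) that is star shaped with respect to a ball $B\subset\Omega$. Set $R=\operatorname{diam}(\Omega)$ and $\rho=\operatorname{diam}(B)$. Then, for $\ell\in\{1,\dots,n\}$, the Poincaré-type operator $\mathtt P_\ell$ satisfies, for $u\in L^2(\Omega,\Lambda^\ell)$, $$|\mathtt P_\ell u|_{H^1(\Omega,\Lambda^{\ell-1})}\le C(n,\ell)\,\frac R\rho\,\kappa\,\|u\|_{L^2(\Omega,\Lambda^\ell)},$$ where $C(n,\ell)$ is a constant that only depends on $n$ and $\ell$, and $\kappa=\kappa(\Omega,B,R,\rho)$ is such that 1. if $2\ell>n$, then $\kappa=1$; 2. if $2\ell=n-1$ or $2\ell=n$, then $\kappa=\left(\frac{|\Omega|}{|B|}\right)^{\frac{n-2\ell}{2(n-\ell)}}\left(\log\frac{|\Omega|}{|B|}\right)^{\frac{n}{2(n-\ell)}}$; 3. if $2\ell\le n-2$, then $\kappa=\left(\frac{|\Omega|}{|B|}\right)^{\frac{n-2\ell}{2(n-\ell)}}\left(\log\frac{|\Omega|}{|B|}\right)^{\frac{n}{2(n-\ell-1)}}$.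
   Context: A bounded domain $\Omega$ is star shaped with respect to a ball $B\subset\Omega$ if for every $y\in\Omega$ the convex hull of $B\cup\{y\}$ is contained in $\Omega$. $|E|$ denotes Lebesgue measure. The function $\theta\in C_0^\infty(B)$ satisfies $\int\theta\,dx=1$ and, for multi-indices $\alpha$, $\|\partial^\alpha\theta\|_{L^1}\le c(n,\alpha)\operatorname{diam}(B)^{-|\alpha|}$ and $\|\partial^\alpha\theta\|_{L^\infty}\le c(n,\alpha)\operatorname{diam}(B)^{-n-|\alpha|}$, with constants $c(n,\alpha)$ depending only on $n$ and $\alpha$. Forms: $\Lambda^\ell$ is the space of alternating $\ell$-linear forms on $\mathbb R^n$; an $\ell$-form $u$ on $\Omega$ is written $u=\sum_I u_I\,dx_I$ over increasing $\ell$-tuples $I=(i_1<\dots<i_\ell)$; $\|u\|_{L^2(\Omega,\Lambda^\ell)}^2=\sum_I\|u_I\|_{L^2(\Omega)}^2$ and $|u|_{H^1(\Omega,\Lambda^\ell)}^2=\sum_I|u_I|_{H^1(\Omega)}^2$, where $|\cdot|_{H^1(\Omega)}$ is the seminorm ($L^2$ norm of the gradient). For $z\in\mathbb R^n$, the contraction is $z\lrcorner u=\sum_I u_I\sum_{m=1}^\ell(-1)^{m-1}z_{i_m}\,dx_{\hat I_m}$, where $\hat I_m$ is $I$ with $i_m$ removed. Operator: with $G_k(x,y)=\int_1^\infty(t-1)^{n-k}t^{k-1}\theta(y+t(x-y))\,dt$ for $k\in\{0,\dots,n\}$, $$\mathtt P_\ell u(x)=\int G_{n-\ell+1}(y,x)\,(x-y)\lrcorner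 u(y)\,dy,$$ where $u$ is supported in $\overline\Omega$ (extended by zero).
   Formalization: In cases 2 and 3 the factor log(|Ω|/|B|) in κ is replaced by max(1, log(|Ω|/|B|)), since the literal bound fails as |Ω|/|B| tends to 1 (e.g. n=2, ℓ=1, B a disc, Ω a slightly larger concentric disc, u=dx_1). *)

theory Defs
  imports "HOL-Analysis.Analysis"
begin

section \<open>Smooth functions and multi-index derivatives\<close>

definition partial_deriv :: "'n::finite \<Rightarrow> (real^'n \<Rightarrow> real) \<Rightarrow> real^'n \<Rightarrow> real" where
  "partial_deriv i f = (\<lambda>x. frechet_derivative f (at x) (axis i 1))"

definition iter_partial :: "'n::finite list \<Rightarrow> (real^'n \<Rightarrow> real) \<Rightarrow> real^'n \<Rightarrow> real" where
  "iter_partial is f = foldr partial_deriv is f"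

text \<open>All iterated partial derivatives exist and are Frechet differentiable (hence continuous).
  This is \<open>C\<^sup>\<infinity>\<close>.\<close>

definition smooth :: "(real^'n::finite \<Rightarrow> real) \<Rightarrow> bool" where
  "smooth f \<longleftrightarrow> (\<forall>is x. iter_partial is f differentiable (at x))"

definition multi_deriv ::
    "('n::{finite,linorder} \<Rightarrow> nat) \<Rightarrow> (real^'n::{finite,linorder} \<Rightarrow> real) \<Rightarrow> real^'n::{finite,linorder} \<Rightarrow> real" where
  "multi_deriv \<alpha> = iter_partial (concat (map (\<lambda>i. replicate (\<alpha> i) i) (sorted_list_of_set UNIV)))"

definition multi_order :: "('n::finite \<Rightarrow> nat) \<Rightarrow> nat" where
  "multi_order \<alpha> = (\<Sum>i\<in>UNIV. \<alpha> i)"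

text \<open>\<open>C\<^sub>0\<^sup>\<infinity>(\<Omega>)\<close>, each function being extended by zero to the whole space.\<close>

definition test_functions :: "(real^'n::finite) set \<Rightarrow> (real^'n \<Rightarrow> real) set" where
  "test_functions \<Omega> = {\<phi>. smooth \<phi> \<and> compact (closure {x. \<phi> x \<noteq> 0}) \<and> closure {x. \<phi> x \<noteq> 0} \<subseteq> \<Omega>}"


section \<open>Domains\<close>

definition star_shaped_wrt :: "'a::real_vector set \<Rightarrow> 'a set \<Rightarrow> bool" where
  "star_shaped_wrt \<Omega> B \<longleftrightarrow> (\<forall>y\<in>\<Omega>. convex hull (insert y B) \<subseteq> \<Omega>)"

text \<open>Near each boundary point, \<open>\<Omega>\<close> is the region below the graph of a Lipschitz function over the
  hyperplane orthogonal to some unit vector \<open>e\<close>.\<close>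

definition lipschitz_boundary :: "'a::euclidean_space set \<Rightarrow> bool" where
  "lipschitz_boundary \<Omega> \<longleftrightarrow>
     (\<forall>p\<in>frontier \<Omega>. \<exists>U e L g. open U \<and> p \<in> U \<and> norm e = 1 \<and> L-lipschitz_on {v. v \<bullet> e = 0} g \<and>
        \<Omega> \<inter> U = {x \<in> U. x \<bullet> e < g (x - (x \<bullet> e) *\<^sub>R e)})"


section \<open>Scalar function spaces\<close>

definition L2 :: "'a::euclidean_space set \<Rightarrow> ('a \<Rightarrow> real) \<Rightarrow> bool" where
  "L2 \<Omega> f \<longleftrightarrow> set_borel_measurable lebesgue \<Omega> f \<and> set_integrable lebesgue \<Omega> (\<lambda>x. (f x)\<^sup>2)"

definition L2_norm :: "'a::euclidean_space set \<Rightarrow> ('a \<Rightarrow> real) \<Rightarrow> real" where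
  "L2_norm \<Omega> f = sqrt (LINT x:\<Omega>|lebesgue. (f x)\<^sup>2)"

definition is_weak_partial ::
    "(real^'n::finite) set \<Rightarrow> 'n \<Rightarrow> (real^'n \<Rightarrow> real) \<Rightarrow> (real^'n \<Rightarrow> real) \<Rightarrow> bool" where
  "is_weak_partial \<Omega> i f g \<longleftrightarrow>
     (\<forall>\<phi>\<in>test_functions \<Omega>.
        (LINT x:\<Omega>|lebesgue. f x * partial_deriv i \<phi> x) = - (LINT x:\<Omega>|lebesgue. g x * \<phi> x))"

definition H1 :: "(real^'n::finite) set \<Rightarrow> (real^'n \<Rightarrow> real) \<Rightarrow> bool" where
  "H1 \<Omega> f \<longleftrightarrow> L2 \<Omega> f \<and> (\<forall>i. \<exists>g. L2 \<Omega> g \<and> is_weak_partial \<Omega> i f g)"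

text \<open>For \<open>f\<close> in \<open>H1 \<Omega>\<close> the chosen function is unique up to a null set.\<close>

definition weak_partial ::
    "(real^'n::finite) set \<Rightarrow> 'n \<Rightarrow> (real^'n \<Rightarrow> real) \<Rightarrow> real^'n \<Rightarrow> real" where
  "weak_partial \<Omega> i f = (SOME g. L2 \<Omega> g \<and> is_weak_partial \<Omega> i f g)"

definition H1_seminorm :: "(real^'n::finite) set \<Rightarrow> (real^'n \<Rightarrow> real) \<Rightarrow> real" where
  "H1_seminorm \<Omega> f = sqrt (\<Sum>i\<in>UNIV. (L2_norm \<Omega> (weak_partial \<Omega> i f))\<^sup>2)"


section \<open>Alternating forms on \<open>\<real>\<^sup>n\<close>\<close>

text \<open>An \<open>l\<close>-linear form is a function on lists of vectors, set to zero on lists of length other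
  than \<open>l\<close> so that equality of forms is equality of functions.\<close>

type_synonym 'n form = "(real^'n) list \<Rightarrow> real"

definition alternating_form :: "nat \<Rightarrow> 'n::finite form \<Rightarrow> bool" where
  "alternating_form l \<omega> \<longleftrightarrow>
     (\<forall>vs. length vs \<noteq> l \<longrightarrow> \<omega> vs = 0) \<and>
     (\<forall>vs k. length vs = l \<and> k < l \<longrightarrow> linear (\<lambda>v. \<omega> (vs[k := v]))) \<and>
     (\<forall>vs j k. length vs = l \<and> j < k \<and> k < l \<and> vs ! j = vs ! k \<longrightarrow> \<omega> vs = 0)"

definition increasing_tuples :: "nat \<Rightarrow> 'n::{finite,linorder} list set" where
  "increasing_tuples l = {I. length I = l \<and> sorted_wrt (<) I}"

text \<open>\<open>dx I = dx\<^bsub>I ! 0\<^esub> \<and> \<dots> \<and> dx\<^bsub>I ! (l - 1)\<^esub>\<close>, normalised as a determinant.\<close>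

definition dx :: "'n::finite list \<Rightarrow> 'n form" where
  "dx I = (\<lambda>vs. if length vs = length I
     then \<Sum>p | p permutes {..<length I}. of_int (sign p) * (\<Prod>m<length I. (vs ! m) $ (I ! p m))
     else 0)"

text \<open>The coefficient \<open>\<omega>\<^sub>I\<close> in \<open>\<omega> = (\<Sum>I. \<omega>\<^sub>I dx\<^sub>I)\<close>.\<close>

definition form_coeff :: "'n::finite form \<Rightarrow> 'n list \<Rightarrow> real" where
  "form_coeff \<omega> I = \<omega> (map (\<lambda>i. axis i 1) I)"

text \<open>The index \<open>m\<close> starts at \<open>0\<close> here, so the sign \<open>(-1)\<^bsup>m-1\<^esup>\<close> of the one-based formula is
  \<open>(-1)^m\<close>.\<close>

definition contraction :: "nat \<Rightarrow> real^'n::{finite,linorder} \<Rightarrow> 'n form \<Rightarrow> 'n form" where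
  "contraction l z \<omega> = (\<lambda>vs. \<Sum>I\<in>increasing_tuples l.
     form_coeff \<omega> I * (\<Sum>m<l. (-1)^m * z $ (I ! m) * dx (take m I @ drop (Suc m) I) vs))"

definition form_integral :: "nat \<Rightarrow> (real^'n::{finite,linorder} \<Rightarrow> 'n form) \<Rightarrow> 'n form" where
  "form_integral l F = (\<lambda>vs. \<Sum>I\<in>increasing_tuples l.
     (LINT y|lebesgue. form_coeff (F y) I) * dx I vs)"


section \<open>Function spaces of differential forms\<close>

definition form_L2 ::
    "(real^'n::{finite,linorder}) set \<Rightarrow> nat \<Rightarrow> (real^'n::{finite,linorder} \<Rightarrow> 'n form) \<Rightarrow> bool" where
  "form_L2 \<Omega> l u \<longleftrightarrow>
     (\<forall>x\<in>\<Omega>. alternating_form l (u x)) \<and> (\<forall>I\<in>increasing_tuples l. L2 \<Omega> (\<lambda>x. form_coeff (u x) I))"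

definition form_L2_norm ::
    "(real^'n::{finite,linorder}) set \<Rightarrow> nat \<Rightarrow> (real^'n::{finite,linorder} \<Rightarrow> 'n form) \<Rightarrow> real" where
  "form_L2_norm \<Omega> l u = sqrt (\<Sum>I\<in>increasing_tuples l. (L2_norm \<Omega> (\<lambda>x. form_coeff (u x) I))\<^sup>2)"

definition form_H1 ::
    "(real^'n::{finite,linorder}) set \<Rightarrow> nat \<Rightarrow> (real^'n::{finite,linorder} \<Rightarrow> 'n form) \<Rightarrow> bool" where
  "form_H1 \<Omega> l u \<longleftrightarrow>
     (\<forall>x\<in>\<Omega>. alternating_form l (u x)) \<and> (\<forall>I\<in>increasing_tuples l. H1 \<Omega> (\<lambda>x. form_coeff (u x) I))"

definition form_H1_seminorm ::
    "(real^'n::{finite,linorder}) set \<Rightarrow> nat \<Rightarrow> (real^'n::{finite,linorder} \<Rightarrow> 'n form) \<Rightarrow> real" where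
  "form_H1_seminorm \<Omega> l u =
     sqrt (\<Sum>I\<in>increasing_tuples l. (H1_seminorm \<Omega> (\<lambda>x. form_coeff (u x) I))\<^sup>2)"

definition extend_by_zero :: "(real^'n::finite) set \<Rightarrow> (real^'n \<Rightarrow> 'n form) \<Rightarrow> real^'n \<Rightarrow> 'n form" where
  "extend_by_zero \<Omega> u = (\<lambda>x. if x \<in> \<Omega> then u x else (\<lambda>vs. 0))"


section \<open>The regularized Poincare operator\<close>

text \<open>The constants \<open>c \<alpha>\<close> may depend on \<open>n = CARD('n)\<close> and \<open>\<alpha>\<close> but on nothing else: they are to be
  fixed before the ball \<open>B\<close>.\<close>

definition admissible_weight ::
    "(('n::{finite,linorder} \<Rightarrow> nat) \<Rightarrow> real) \<Rightarrow> (real^'n::{finite,linorder}) set \<Rightarrow> (real^'n::{finite,linorder} \<Rightarrow> real) \<Rightarrow> bool" where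
  "admissible_weight c B \<theta> \<longleftrightarrow>
     \<theta> \<in> test_functions B \<and> (LINT x|lebesgue. \<theta> x) = 1 \<and>
     (\<forall>\<alpha>. (LINT x|lebesgue. \<bar>multi_deriv \<alpha> \<theta> x\<bar>) \<le> c \<alpha> / diameter B ^ multi_order \<alpha> \<and>
          (AE x in lebesgue. \<bar>multi_deriv \<alpha> \<theta> x\<bar> \<le> c \<alpha> / diameter B ^ (CARD('n) + multi_order \<alpha>)))"

definition poincare_kernel ::
    "(real^'n::finite \<Rightarrow> real) \<Rightarrow> nat \<Rightarrow> real^'n \<Rightarrow> real^'n \<Rightarrow> real" where
  "poincare_kernel \<theta> k x y =
     (LINT t:{1..}|lebesgue. (t - 1) ^ (CARD('n) - k) * t powi (int k - 1) * \<theta> (y + t *\<^sub>R (x - y)))"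

definition poincare ::
    "(real^'n::{finite,linorder} \<Rightarrow> real) \<Rightarrow> nat \<Rightarrow> (real^'n::{finite,linorder} \<Rightarrow> 'n form) \<Rightarrow> real^'n::{finite,linorder} \<Rightarrow> 'n form" where
  "poincare \<theta> l u x = form_integral (l - 1)
     (\<lambda>y vs. poincare_kernel \<theta> (CARD('n) - l + 1) y x * contraction l (x - y) (u y) vs)"

text \<open>The logarithm of the volume ratio is read as bounded below by \<open>1\<close>.  With the bare logarithm
  the factor would vanish for \<open>\<Omega> = B\<close>, and tend to \<open>0\<close> as \<open>\<Omega>\<close> shrinks to \<open>B\<close>, which no constant
  depending only on \<open>n\<close> and \<open>l\<close> can compensate.  The two agree as soon as the volume ratio is at
  least \<open>exp 1\<close>.\<close>

definition poincare_kappa :: "nat \<Rightarrow> (real^'n::finite) set \<Rightarrow> (real^'n) set \<Rightarrow> real" where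
  "poincare_kappa l \<Omega> B =
     (let n = real CARD('n);
          q = measure lebesgue \<Omega> / measure lebesgue B;
          lg = max 1 (ln q)
      in if 2 * l > CARD('n) then 1
         else if 2 * l + 1 = CARD('n) \<or> 2 * l = CARD('n)
           then q powr ((n - 2 * real l) / (2 * (n - real l))) * lg powr (n / (2 * (n - real l)))
           else q powr ((n - 2 * real l) / (2 * (n - real l))) * lg powr (n / (2 * (n - real l - 1))))"

end

theory Submission
  imports Defs "HOL-Probability.Characteristic_Functions"
begin

text \<open>
  Write \<open>n\<close> for the dimension. A component of \<open>P u\<close>, paired with \<open>D\<^sub>j \<psi>\<close>, becomes a sum of integrals over
  \<open>t \<ge> 1\<close>, with weight \<open>(t - 1)^(l - 1) * t^(n - l)\<close>, of the double integrals of
  \<open>\<theta> (x + t (y - x)) * (x\<^sub>i - y\<^sub>i) * f y * D\<^sub>j \<psi> x\<close>; each has to be bounded by \<open>\<parallel>f\<parallel> * \<parallel>\<psi>\<parallel>\<close> in \<open>L\<^sup>2\<close>.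

  For \<open>t < 2\<close> the derivative is moved onto \<open>\<theta>\<close>. Schur's test gives a bound of order \<open>(t - 1) powr (- n / 2)\<close>,
  the Cauchy-Schwarz inequality on \<open>\<Omega>\<close> one of order \<open>sqrt (|\<Omega>| / |B|)\<close>; a geometric mean of the two that
  is integrable against the weight produces \<open>\<kappa>\<close>.

  For \<open>t \<ge> 2\<close>, \<open>t * (x\<^sub>i - y\<^sub>i) = (x\<^sub>i - a\<^sub>i) - (z\<^sub>i - a\<^sub>i)\<close> with \<open>z = x + t (y - x)\<close>. Up to a
  term that Schur's test bounds, both parts are averages of a derivative \<open>D\<^sub>j \<omega>\<close>, with \<open>\<omega> = (x\<^sub>i - a\<^sub>i) \<psi>\<close> and weight
  \<open>\<theta>\<close>, and with \<open>\<omega> = \<psi>\<close> and weight \<open>(z\<^sub>i - a\<^sub>i) \<theta>\<close>. By the decay of the Fourier transform of the weight, the transform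
  of such an average at \<open>\<xi>\<close> is bounded by an integral over \<open>t\<close> of \<open>|\<xi>\<^sub>j| / (t\<^sup>2 + \<rho>\<^sup>2 \<xi>\<^sub>j\<^sup>2)\<close>, which has mass at most
  \<open>\<pi> / (2 \<rho>)\<close>, times the modulus of the transform of \<open>\<omega>\<close> at \<open>(1 - 1 / t) \<xi>\<close>.
\<close>

section \<open>Fourier transform and Plancherel inequalities\<close>

text \<open>Absolute values inside the integral fail at both ends of the ray. For large
  \<open>t\<close>, a derivative moved onto the weight brings down \<open>t - 1\<close>, which |x_i
  - y_i| <= R / t merely compensates; Schur's test then decays like \<open>t ^ (- n)\<close> against
  a weight of order \<open>t ^ (n - 1)\<close>, and the integral diverges logarithmically.
  Cancellation is indispensable there; it is exploited by leaving the derivative on the test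
  function, where it becomes the factor \<open>\<xi> $ j\<close>. Near \<open>t = 1\<close> the
  singularity of Schur's bound is integrable against \<open>(t - 1) ^ (l - 1)\<close> exactly if
  \<open>2 * l > n\<close>, which is why the volume ratio enters otherwise. The cut at 2 keeps the
  dilation \<open>1 - 1 / t\<close> between 1/2 and 1, so undoing it costs a dimensional constant.
  In the quotient of the diameters, \<open>R\<close> comes from a coordinate difference on
  \<open>\<Omega>\<close>, and \<open>1 / \<rho>\<close> from a derivative of the weight or from the
  mass of the frequency kernel. All this bounds a pairing with derivatives of test functions; a
  Riesz representation turns it into a weak derivative, and uniqueness identifies that with the one
  chosen by \<open>weak_partial\<close>.\<close>

lemma nn_integral_affine:
  fixes f :: "'a::euclidean_space \<Rightarrow> ennreal"
  assumes [measurable]: "f \<in> borel_measurable borel" and c: "c \<noteq> 0"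
  shows "(\<integral>\<^sup>+x. f (t + c *\<^sub>R x) \<partial>lborel) = ennreal (1 / \<bar>c\<bar> ^ DIM('a)) * (\<integral>\<^sup>+x. f x \<partial>lborel)"
proof -
  have "(\<integral>\<^sup>+x. f x \<partial>lborel) = ennreal (\<bar>c\<bar> ^ DIM('a)) * (\<integral>\<^sup>+x. f (t + c *\<^sub>R x) \<partial>lborel)"
    by (subst lborel_affine[OF c, of t])
       (simp add: nn_integral_density nn_integral_distr nn_integral_cmult)
  then show ?thesis
    using c by (simp add: mult.assoc[symmetric] ennreal_mult'[symmetric])
qed

lemma integrable_affine_iff:
  fixes f :: "'a::euclidean_space \<Rightarrow> 'b::{banach, second_countable_topology}"
  assumes c: "c \<noteq> 0"
  shows "integrable lborel (\<lambda>x. f (t + c *\<^sub>R x)) \<longleftrightarrow> integrable lborel f"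
proof -
  have *: "integrable lborel (\<lambda>x. g (s + d *\<^sub>R x))"
    if g: "integrable lborel g" and d: "d \<noteq> 0" for g :: "'a \<Rightarrow> 'b" and d s
  proof (rule integrableI_bounded)
    have [measurable]: "g \<in> borel_measurable borel" using g by auto
    show "(\<lambda>x. g (s + d *\<^sub>R x)) \<in> borel_measurable lborel" by measurable
    show "(\<integral>\<^sup>+x. ennreal (norm (g (s + d *\<^sub>R x))) \<partial>lborel) < \<infinity>"
      using g d unfolding integrable_iff_bounded
      by (subst nn_integral_affine[where f="\<lambda>x. ennreal (norm (g x))"])
         (auto simp: ennreal_mult_less_top)
  qed
  \<comment> \<open>The converse implication is the same fact for the inverse affine map.\<close>
  show ?thesis
    using *[of f c t] *[of "\<lambda>x. f (t + c *\<^sub>R x)" "1/c" "- (1/c) *\<^sub>R t"] c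
    by (auto simp: scaleR_right_distrib scaleR_right_diff_distrib)
qed

lemma integral_affine:
  fixes f :: "'a::euclidean_space \<Rightarrow> 'b::{banach, second_countable_topology}"
  assumes c: "c \<noteq> 0"
  shows "(\<integral>x. f (t + c *\<^sub>R x) \<partial>lborel) = (1 / \<bar>c\<bar> ^ DIM('a)) *\<^sub>R (\<integral>x. f x \<partial>lborel)"
proof (cases "integrable lborel f")
  case True
  then have [measurable]: "f \<in> borel_measurable borel" by auto
  have "(\<integral>x. f x \<partial>lborel) = (\<bar>c\<bar> ^ DIM('a)) *\<^sub>R (\<integral>x. f (t + c *\<^sub>R x) \<partial>lborel)"
    by (subst lborel_affine[OF c, of t]) (simp add: integral_density integral_distr)
  then show ?thesis using c by simp
next
  case False
  then show ?thesis
    using integrable_affine_iff[OF c, of f t] by (simp add: not_integrable_integral_eq)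
qed

lemma ennreal_half_double:
  assumes "0 \<le> X"
  shows "ennreal (1/2) * (ennreal X + ennreal X) = ennreal X"
proof -
  have "ennreal X = ennreal (1/2 * (X + X))" by simp
  also have "\<dots> = ennreal (1/2) * ennreal (X + X)" by (rule ennreal_mult') simp
  also have "ennreal (X + X) = ennreal X + ennreal X" using assms by (rule ennreal_plus[OF _ assms])
  finally show ?thesis by simp
qed

text \<open>A non-integrable function has Bochner integral 0, so the bound covers it as well.
  Iterated integrals can thus be estimated from the outside inwards before any integrability is
  known.\<close>

lemma integral_norm_bound_ennreal':
  fixes f :: "_ \<Rightarrow> 'b::{banach, second_countable_topology}"
  shows "ennreal (norm (integral\<^sup>L M f)) \<le> (\<integral>\<^sup>+x. ennreal (norm (f x)) \<partial>M)"
  by (cases "integrable M f") (auto simp: integral_norm_bound_ennreal not_integrable_integral_eq)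

lemma integral_norm_bound_integral':
  fixes f :: "_ \<Rightarrow> 'b::{banach, second_countable_topology}"
  assumes "integrable M g" and "\<And>x. norm (f x) \<le> g x"
  shows "norm (integral\<^sup>L M f) \<le> integral\<^sup>L M g"
proof (cases "integrable M f")
  case True
  then show ?thesis
    by (intro order_trans[OF integral_norm_bound] integral_mono integrable_norm assms)
next
  case False
  have "0 \<le> g x" for x using assms(2)[of x] norm_ge_zero order_trans by blast
  then show ?thesis using False by (simp add: not_integrable_integral_eq)
qed

lemma (in pair_sigma_finite) integrable_mult_prod:
  fixes f :: "'a \<Rightarrow> real" and g :: "'b \<Rightarrow> real"
  assumes f: "integrable M1 f" and g: "integrable M2 g"
  shows "integrable (M1 \<Otimes>\<^sub>M M2) (\<lambda>p. f (fst p) * g (snd p))"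
proof (rule Fubini_integrable)
  have [measurable]: "f \<in> borel_measurable M1" "g \<in> borel_measurable M2"
    using f g by auto
  show "(\<lambda>p. f (fst p) * g (snd p)) \<in> borel_measurable (M1 \<Otimes>\<^sub>M M2)"
    by measurable
qed (use f g in \<open>auto simp: abs_mult\<close>)

lemma borel_measurable_cis [measurable (raw)]:
  "f \<in> borel_measurable M \<Longrightarrow> (\<lambda>x. cis (f x)) \<in> borel_measurable M"
  by (rule measurable_compose[where N=borel and g=cis])
     (auto intro!: borel_measurable_continuous_onI continuous_intros)

section \<open>Gaussians and their Fourier transforms\<close>

definition gauss :: "'a::euclidean_space \<Rightarrow> real" where
  "gauss x = exp (- (norm x)\<^sup>2 / 2)"

lemma gauss_le_1: "gauss x \<le> 1"
  by (simp add: gauss_def)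

lemma gauss_nonneg [simp]: "0 \<le> gauss x"
  by (simp add: gauss_def)

lemma continuous_on_gauss: "continuous_on A gauss"
  unfolding gauss_def by (intro continuous_intros) auto

lemma borel_measurable_gauss [measurable]: "gauss \<in> borel_measurable borel"
  by (intro borel_measurable_continuous_onI continuous_on_gauss)

text \<open>This is the characteristic function of the standard normal distribution with the
  normalisation \<open>sqrt (2 * pi)\<close> undone.\<close>

lemma fourier_gauss_1:
  "integrable lborel (\<lambda>s::real. cis (- (s * a)) * of_real (exp (- s\<^sup>2 / 2)))" (is ?A)
  "(\<integral>s. cis (- (s * a)) * of_real (exp (- s\<^sup>2 / 2)) \<partial>lborel) = of_real (sqrt (2 * pi) * exp (- a\<^sup>2 / 2))" (is ?B)
proof -
  have e: "exp (- s\<^sup>2 / 2) = sqrt (2 * pi) * std_normal_density s" for s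
    by (simp add: std_normal_density_def)
  have i: "integrable lborel (\<lambda>s::real. exp (- s\<^sup>2 / 2))"
    unfolding e by (intro integrable_mult_right integrable_normal_density) simp
  show ?A
  proof (rule Bochner_Integration.integrable_bound[OF i])
    show "(\<lambda>s. cis (- (s * a)) * complex_of_real (exp (- s\<^sup>2 / 2))) \<in> borel_measurable lborel"
      unfolding measurable_lborel2 by (intro borel_measurable_continuous_onI continuous_intros) auto
  qed (auto simp: norm_mult)
  have "complex_of_real (exp (- a\<^sup>2 / 2)) = char std_normal_distribution (- a)"
    by (simp add: char_std_normal_distribution)
  also have "\<dots> = (\<integral>s. std_normal_density s *\<^sub>R cis (- (s * a)) \<partial>lborel)"
    unfolding char_def
    by (subst integral_density) (auto simp: cis_conv_exp mult_ac)
  finally have "(\<integral>s. std_normal_density s *\<^sub>R cis (- (s * a)) \<partial>lborel) = complex_of_real (exp (- a\<^sup>2 / 2))" by simp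
  moreover have "(\<integral>s. cis (- (s * a)) * of_real (exp (- s\<^sup>2 / 2)) \<partial>lborel) =
     (\<integral>s. of_real (sqrt (2 * pi)) * (std_normal_density s *\<^sub>R cis (- (s * a))) \<partial>lborel)"
    by (rule Bochner_Integration.integral_cong) (simp_all only: e scaleR_conv_of_real of_real_mult mult_ac)
  ultimately show ?B
    by (simp only: integral_mult_right_zero of_real_mult)
qed

lemma cis_sum: "finite A \<Longrightarrow> cis (\<Sum>i\<in>A. f i) = (\<Prod>i\<in>A. cis (f i))"
  by (induction A rule: finite_induct) (auto simp: cis_mult[symmetric])

text \<open>The character and the Gaussian both factor over the coordinates, and
  \<open>lborel\<close> is the image of a product measure, so the integral is a product of
  one-dimensional ones.\<close>

lemma fourier_gauss_aux:
  fixes x :: "'a::euclidean_space"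
  shows "integrable lborel (\<lambda>\<xi>. cis (- (\<xi> \<bullet> x)) * of_real (gauss \<xi>))" (is ?A)
    and "(\<integral>\<xi>. cis (- (\<xi> \<bullet> x)) * of_real (gauss \<xi>) \<partial>lborel) = of_real (sqrt (2 * pi) ^ DIM('a) * gauss x)" (is ?B)
proof -
  interpret product_sigma_finite "\<lambda>_::'a. lborel :: real measure" ..
  define F where "F b s = cis (- (s * (b \<bullet> x))) * complex_of_real (exp (- s\<^sup>2 / 2))" for b s
  have F: "integrable lborel (F b)" "(\<integral>s. F b s \<partial>lborel) = of_real (sqrt (2 * pi) * exp (- (b \<bullet> x)\<^sup>2 / 2))" for b
    unfolding F_def using fourier_gauss_1[of "b \<bullet> x"] by auto
  have eq: "cis (- ((\<Sum>b\<in>Basis. f b *\<^sub>R b) \<bullet> x)) * of_real (gauss (\<Sum>b\<in>Basis. f b *\<^sub>R b :: 'a)) = (\<Prod>b\<in>Basis. F b (f b))"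
    for f :: "'a \<Rightarrow> real"
  proof -
    have 1: "(\<Sum>b\<in>Basis. f b *\<^sub>R b) \<bullet> x = (\<Sum>b\<in>Basis. f b * (b \<bullet> x))"
      by (simp add: inner_sum_left)
    have 2: "(norm (\<Sum>b\<in>Basis. f b *\<^sub>R b :: 'a))\<^sup>2 = (\<Sum>b\<in>Basis. (f b)\<^sup>2)"
      by (subst norm_sum_Pythagorean) (auto simp: pairwise_def orthogonal_def inner_not_same_Basis)
    have 3: "gauss (\<Sum>b\<in>Basis. f b *\<^sub>R b :: 'a) = (\<Prod>b\<in>Basis. exp (- (f b)\<^sup>2 / 2))"
      by (simp add: gauss_def 2 exp_sum[symmetric] sum_negf sum_divide_distrib)
    show ?thesis
      unfolding 3 1 F_def by (simp add: sum_negf[symmetric] cis_sum prod.distrib)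
  qed
  have I: "integrable (\<Pi>\<^sub>M b\<in>Basis. lborel) (\<lambda>f. \<Prod>b\<in>(Basis::'a set). F b (f b))"
    by (rule product_integrable_prod) (use F in auto)
  have [measurable]: "(\<lambda>\<xi>. cis (- (\<xi> \<bullet> x)) * of_real (gauss \<xi>)) \<in> borel_measurable borel"
    by (intro borel_measurable_continuous_onI continuous_intros continuous_on_gauss)
  show ?A
    by (subst lborel_eq, subst integrable_distr_eq) (use I in \<open>auto simp: eq\<close>)
  have "(\<integral>\<xi>. cis (- (\<xi> \<bullet> x)) * of_real (gauss \<xi>) \<partial>lborel) = (\<integral>f. (\<Prod>b\<in>Basis. F b (f b)) \<partial>(\<Pi>\<^sub>M b\<in>(Basis::'a set). lborel))"
    by (subst lborel_eq, subst integral_distr) (auto simp: eq)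
  also have "\<dots> = (\<Prod>b\<in>(Basis::'a set). \<integral>s. F b s \<partial>lborel)"
    by (rule product_integral_prod) (use F in auto)
  also have "\<dots> = of_real (\<Prod>b\<in>(Basis::'a set). sqrt (2 * pi) * exp (- (b \<bullet> x)\<^sup>2 / 2))"
    by (simp add: F)
  also have "(\<Prod>b\<in>(Basis::'a set). sqrt (2 * pi) * exp (- (b \<bullet> x)\<^sup>2 / 2)) = sqrt (2 * pi) ^ DIM('a) * gauss x"
    by (simp add: prod.distrib gauss_def exp_sum[symmetric] sum_negf sum_divide_distrib[symmetric] norm_eq_sqrt_inner
        euclidean_inner[of x x] power2_eq_square inner_commute sum_nonneg)
  finally show ?B .
qed

definition gauss_mass :: "'a::euclidean_space itself \<Rightarrow> real" where
  "gauss_mass _ = sqrt (2 * pi) ^ DIM('a)"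

lemma gauss_mass_pos: "0 < gauss_mass TYPE('a::euclidean_space)"
  by (simp add: gauss_mass_def)

lemma fourier_gauss:
  fixes x :: "'a::euclidean_space"
  shows "(\<integral>\<xi>. cis (- (\<xi> \<bullet> x)) * of_real (gauss \<xi>) \<partial>lborel) = of_real (gauss_mass TYPE('a) * gauss x)"
  unfolding gauss_mass_def by (rule fourier_gauss_aux)

lemma integrable_gauss: "integrable lborel (gauss :: 'a::euclidean_space \<Rightarrow> real)"
proof -
  have "integrable lborel (\<lambda>\<xi>::'a. norm (cis (- (\<xi> \<bullet> 0)) * of_real (gauss \<xi>)))"
    by (intro integrable_norm fourier_gauss_aux)
  then show ?thesis by simp
qed

lemma integral_gauss: "(\<integral>x. gauss (x::'a::euclidean_space) \<partial>lborel) = gauss_mass TYPE('a)"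
proof -
  have "complex_of_real (\<integral>x. gauss (x::'a) \<partial>lborel) = of_real (gauss_mass TYPE('a))"
    using fourier_gauss[of "0::'a"] by (simp add: gauss_def)
  then show ?thesis using of_real_eq_iff by blast
qed

lemma fourier_gauss_scaled:
  fixes x :: "'a::euclidean_space"
  assumes e: "\<epsilon> > 0"
  shows "(\<integral>\<xi>. cis (- (\<xi> \<bullet> x)) * of_real (gauss (\<epsilon> *\<^sub>R \<xi>)) \<partial>lborel)
    = of_real (gauss_mass TYPE('a) * gauss ((1 / \<epsilon>) *\<^sub>R x) / \<epsilon> ^ DIM('a))"
proof -
  have "(\<integral>\<xi>. cis (- (\<xi> \<bullet> x)) * complex_of_real (gauss (\<epsilon> *\<^sub>R \<xi>)) \<partial>lborel) =
     (\<integral>\<xi>. (\<lambda>\<xi>. cis (- (\<xi> \<bullet> ((1/\<epsilon>) *\<^sub>R x))) * complex_of_real (gauss \<xi>)) (0 + \<epsilon> *\<^sub>R \<xi>) \<partial>lborel)"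
    using e by simp
  also have "\<dots> = (1 / \<bar>\<epsilon>\<bar> ^ DIM('a)) *\<^sub>R (\<integral>\<xi>. cis (- (\<xi> \<bullet> ((1/\<epsilon>) *\<^sub>R x))) * complex_of_real (gauss \<xi>) \<partial>lborel)"
    using e by (intro integral_affine) auto
  finally show ?thesis
    using e by (simp only: fourier_gauss) (simp add: scaleR_conv_of_real)
qed

text \<open>The transform carries no normalising factor; the price is the constant
  \<open>(2 * pi) ^ n\<close>, the square of \<open>gauss_mass\<close>, in both Plancherel
  inequalities.\<close>

definition fourier :: "('a::euclidean_space \<Rightarrow> real) \<Rightarrow> 'a \<Rightarrow> complex" where
  "fourier h \<xi> = (\<integral>x. cis (- (\<xi> \<bullet> x)) * of_real (h x) \<partial>lborel)"

lemma integrable_cis_mult: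
  fixes h :: "'a::euclidean_space \<Rightarrow> real"
  assumes h: "integrable lborel h"
  shows "integrable lborel (\<lambda>x. cis (- (\<xi> \<bullet> x)) * of_real (h x))"
proof (rule Bochner_Integration.integrable_bound[OF h])
  have [measurable]: "h \<in> borel_measurable borel" using h by auto
  show "(\<lambda>x. cis (- (\<xi> \<bullet> x)) * of_real (h x)) \<in> borel_measurable lborel" by measurable
qed (auto simp: norm_mult)

lemma borel_measurable_fourier [measurable]:
  fixes h :: "'a::euclidean_space \<Rightarrow> real"
  assumes [measurable]: "h \<in> borel_measurable borel"
  shows "fourier h \<in> borel_measurable borel"
proof -
  have "(\<lambda>\<xi>. \<integral>x. cis (- (\<xi> \<bullet> x)) * of_real (h x) \<partial>lborel) \<in> borel_measurable borel"
    by measurable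
  then show ?thesis by (simp add: fourier_def[abs_def])
qed

lemma cmod_fourier_le:
  fixes h :: "'a::euclidean_space \<Rightarrow> real"
  shows "cmod (fourier h \<xi>) \<le> (\<integral>x. \<bar>h x\<bar> \<partial>lborel)"
  unfolding fourier_def by (rule order_trans[OF integral_norm_bound]) (simp add: norm_mult)

text \<open>The Gaussian factor makes the triple integral over frequency and two points absolutely
  convergent, so the frequency can be integrated first. That leaves a Gaussian of width
  \<open>\<epsilon>\<close> in \<open>y - x\<close>, and \<open>y = x + \<epsilon> w\<close> absorbs
  its scaling.\<close>

lemma gauss_plancherel:
  fixes h :: "'a::euclidean_space \<Rightarrow> real"
  assumes h: "integrable lborel h" and e: "\<epsilon> > 0"
  shows "(\<integral>\<xi>. (cmod (fourier h \<xi>))\<^sup>2 * gauss (\<epsilon> *\<^sub>R \<xi>) \<partial>lborel)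
    = gauss_mass TYPE('a) * (\<integral>x. \<integral>w. h x * h (x + \<epsilon> *\<^sub>R w) * gauss w \<partial>lborel \<partial>lborel)"
proof -
  let ?Z = "gauss_mass TYPE('a)"
  have hm [measurable]: "h \<in> borel_measurable borel" using h by auto
  define k where "k x y = (?Z * gauss ((1 / \<epsilon>) *\<^sub>R (y - x)) / \<epsilon> ^ DIM('a)) * (h x * h y)" for x y
  define E where "E \<xi> p = cis (- (\<xi> \<bullet> (snd p - fst p))) * of_real (gauss (\<epsilon> *\<^sub>R \<xi>)) * of_real (h (fst p) * h (snd p))"
    for \<xi> :: 'a and p
  have hh: "integrable (lborel \<Otimes>\<^sub>M lborel) (\<lambda>p. h (fst p) * h (snd p))"
    by (rule lborel_pair.integrable_mult_prod[OF h h])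
  have g: "integrable lborel (\<lambda>\<xi>::'a. gauss (\<epsilon> *\<^sub>R \<xi>))"
    using integrable_affine_iff[of \<epsilon> "gauss :: 'a \<Rightarrow> real" 0] integrable_gauss e by simp
  have Em [measurable]: "(\<lambda>q. E (fst q) (snd q)) \<in> borel_measurable (lborel \<Otimes>\<^sub>M (lborel \<Otimes>\<^sub>M lborel))"
    unfolding E_def by measurable
  interpret pair_sigma_finite "lborel :: 'a measure" "lborel \<Otimes>\<^sub>M lborel :: ('a \<times> 'a) measure" ..
  have Ei: "integrable (lborel \<Otimes>\<^sub>M (lborel \<Otimes>\<^sub>M lborel)) (\<lambda>q. E (fst q) (snd q))"
    by (rule Bochner_Integration.integrable_bound[OF integrable_mult_prod[OF g hh] Em])
       (auto simp: E_def norm_mult)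
  \<comment> \<open>The squared modulus is the transform times its conjugate, and the two phases
    merge into one that depends on \<open>y - x\<close>.\<close>
  have *: "of_real ((cmod (fourier h \<xi>))\<^sup>2 * gauss (\<epsilon> *\<^sub>R \<xi>)) = (\<integral>p. E \<xi> p \<partial>(lborel \<Otimes>\<^sub>M lborel))" for \<xi>
  proof -
    have "of_real ((cmod (fourier h \<xi>))\<^sup>2) = cnj (fourier h \<xi>) * fourier h \<xi>"
      by (simp only: complex_norm_square mult.commute)
    also have "cnj (fourier h \<xi>) = (\<integral>x. cis (\<xi> \<bullet> x) * of_real (h x) \<partial>lborel)"
      unfolding fourier_def by (subst Bochner_Integration.integral_cnj[symmetric]) (simp add: cis_cnj)
    finally have "of_real ((cmod (fourier h \<xi>))\<^sup>2 * gauss (\<epsilon> *\<^sub>R \<xi>)) =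
      of_real (gauss (\<epsilon> *\<^sub>R \<xi>)) * (\<integral>x. \<integral>y. (cis (\<xi> \<bullet> x) * of_real (h x)) * (cis (- (\<xi> \<bullet> y)) * of_real (h y)) \<partial>lborel \<partial>lborel)"
      by (simp add: fourier_def mult.commute)
    also have "\<dots> = (\<integral>x. \<integral>y. E \<xi> (x, y) \<partial>lborel \<partial>lborel)"
      unfolding integral_mult_right_zero[symmetric] E_def
      by (simp add: mult_ac cis_mult inner_diff_right)
    also have "\<dots> = (\<integral>p. E \<xi> p \<partial>(lborel \<Otimes>\<^sub>M lborel))"
    proof (rule lborel_pair.integral_fst')
      show "integrable (lborel \<Otimes>\<^sub>M lborel) (E \<xi>)"
        by (rule Bochner_Integration.integrable_bound[OF integrable_mult_right[OF hh, of "gauss (\<epsilon> *\<^sub>R \<xi>)"]])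
           (auto simp: norm_mult E_def[abs_def])
    qed
    finally show ?thesis .
  qed
  have "complex_of_real (\<integral>\<xi>. (cmod (fourier h \<xi>))\<^sup>2 * gauss (\<epsilon> *\<^sub>R \<xi>) \<partial>lborel) = (\<integral>\<xi>. \<integral>p. E \<xi> p \<partial>(lborel \<Otimes>\<^sub>M lborel) \<partial>lborel)"
    unfolding *[symmetric] integral_complex_of_real ..
  also have "\<dots> = (\<integral>p. \<integral>\<xi>. E \<xi> p \<partial>lborel \<partial>(lborel \<Otimes>\<^sub>M lborel))"
    using Fubini_integral[of "\<lambda>\<xi> p. E \<xi> p"] Ei by (simp add: case_prod_beta')
  also have "\<dots> = (\<integral>p. of_real (k (fst p) (snd p)) \<partial>(lborel \<Otimes>\<^sub>M lborel))"
    using e by (simp add: E_def fourier_gauss_scaled k_def)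
  also have "\<dots> = of_real (\<integral>p. k (fst p) (snd p) \<partial>(lborel \<Otimes>\<^sub>M lborel))"
    by simp
  also have "(\<integral>p. k (fst p) (snd p) \<partial>(lborel \<Otimes>\<^sub>M lborel)) = (\<integral>x. \<integral>y. k x y \<partial>lborel \<partial>lborel)"
  proof (subst lborel_pair.integral_fst'[symmetric])
    show "integrable (lborel \<Otimes>\<^sub>M lborel) (\<lambda>p. k (fst p) (snd p))"
    proof (rule Bochner_Integration.integrable_bound[OF integrable_mult_right[OF hh, of "?Z / \<epsilon> ^ DIM('a)"]])
      show "AE p in lborel \<Otimes>\<^sub>M lborel. norm (k (fst p) (snd p)) \<le> norm (?Z / \<epsilon> ^ DIM('a) * (h (fst p) * h (snd p)))"
        using gauss_mass_pos[where 'a='a] e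
        by (auto simp: k_def abs_mult intro!: divide_right_mono mult_right_mono mult_left_le gauss_le_1)
    qed (unfold k_def, measurable)
  qed simp
  also have "(\<lambda>x. \<integral>y. k x y \<partial>lborel) = (\<lambda>x. ?Z * (\<integral>w. h x * h (x + \<epsilon> *\<^sub>R w) * gauss w \<partial>lborel))"
  proof
    fix x
    have "(\<integral>w. h x * h (x + \<epsilon> *\<^sub>R w) * gauss w \<partial>lborel) =
       (\<integral>w. (\<lambda>y. gauss ((1 / \<epsilon>) *\<^sub>R (y - x)) * (h x * h y)) (x + \<epsilon> *\<^sub>R w) \<partial>lborel)"
      using e by (simp add: mult_ac)
    also have "\<dots> = (1 / \<bar>\<epsilon>\<bar> ^ DIM('a)) *\<^sub>R (\<integral>y. gauss ((1 / \<epsilon>) *\<^sub>R (y - x)) * (h x * h y) \<partial>lborel)"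
      using e by (intro integral_affine) auto
    finally show "(\<integral>y. k x y \<partial>lborel) = ?Z * (\<integral>w. h x * h (x + \<epsilon> *\<^sub>R w) * gauss w \<partial>lborel)"
      using e unfolding k_def by (simp add: mult.assoc)
  qed
  finally show ?thesis
    by (simp only: of_real_eq_iff integral_mult_right_zero)
qed

text \<open>Bounding the product \<open>h x * h (x + \<epsilon> w)\<close> by the mean of the two
  squares makes the right side of \<open>gauss_plancherel\<close> independent of
  \<open>\<epsilon>\<close>; Fatou's lemma then removes the Gaussian on the left. This half of
  Plancherel's theorem is applied to the test function.\<close>

lemma nn_integral_cmod_fourier_le:
  fixes h :: "'a::euclidean_space \<Rightarrow> real"
  assumes h: "integrable lborel h" and h2: "integrable lborel (\<lambda>x. (h x)\<^sup>2)"
  shows "(\<integral>\<^sup>+\<xi>. ennreal ((cmod (fourier h \<xi>))\<^sup>2) \<partial>lborel) \<le> ennreal ((gauss_mass TYPE('a))\<^sup>2 * (\<integral>x. (h x)\<^sup>2 \<partial>lborel))"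
proof -
  let ?Z = "gauss_mass TYPE('a)"
  have [measurable]: "h \<in> borel_measurable borel" using h by auto
  have bound: "(\<integral>\<^sup>+\<xi>. ennreal ((cmod (fourier h \<xi>))\<^sup>2 * gauss (\<epsilon> *\<^sub>R \<xi>)) \<partial>lborel) \<le> ennreal (?Z\<^sup>2 * (\<integral>x. (h x)\<^sup>2 \<partial>lborel))"
    if e: "\<epsilon> > 0" for \<epsilon> :: real
  proof -
    have g: "integrable lborel (\<lambda>\<xi>::'a. gauss (\<epsilon> *\<^sub>R \<xi>))"
      using integrable_affine_iff[of \<epsilon> "gauss :: 'a \<Rightarrow> real" 0] integrable_gauss e by simp
    have I: "integrable lborel (\<lambda>\<xi>. (cmod (fourier h \<xi>))\<^sup>2 * gauss (\<epsilon> *\<^sub>R \<xi>))"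
    proof (rule Bochner_Integration.integrable_bound[OF integrable_mult_right[OF g, of "(\<integral>x. \<bar>h x\<bar> \<partial>lborel)\<^sup>2"]])
      show "AE \<xi> in lborel. norm ((cmod (fourier h \<xi>))\<^sup>2 * gauss (\<epsilon> *\<^sub>R \<xi>)) \<le> norm ((\<integral>x. \<bar>h x\<bar> \<partial>lborel)\<^sup>2 * gauss (\<epsilon> *\<^sub>R \<xi>))"
        by (auto simp: abs_mult intro!: mult_right_mono power_mono cmod_fourier_le)
    qed measurable
    \<comment> \<open>Translation invariance in \<open>x\<close>, for each fixed
      \<open>w\<close>.\<close>
    have gy: "(\<integral>\<^sup>+x. \<integral>\<^sup>+w. ennreal ((h (x + \<epsilon> *\<^sub>R w))\<^sup>2 * gauss w) \<partial>lborel \<partial>lborel)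
      = (\<integral>\<^sup>+x. \<integral>\<^sup>+w. ennreal ((h x)\<^sup>2 * gauss (w::'a)) \<partial>lborel \<partial>lborel)"
    proof -
      have "(\<integral>\<^sup>+x. ennreal ((h (x + \<epsilon> *\<^sub>R w))\<^sup>2 * gauss w) \<partial>lborel) = (\<integral>\<^sup>+x. ennreal ((h x)\<^sup>2 * gauss w) \<partial>lborel)" for w
        using nn_integral_affine[of "\<lambda>x. ennreal ((h x)\<^sup>2 * gauss w)" 1 "\<epsilon> *\<^sub>R w"] by (simp add: add.commute)
      then show ?thesis
        using lborel_pair.Fubini'[of "\<lambda>w x. ennreal ((h (x + \<epsilon> *\<^sub>R w))\<^sup>2 * gauss w)"]
          lborel_pair.Fubini'[of "\<lambda>w x. ennreal ((h x)\<^sup>2 * gauss (w::'a))"] by simp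
    qed
    have hg: "(\<integral>\<^sup>+x. \<integral>\<^sup>+w. ennreal ((h x)\<^sup>2 * gauss (w::'a)) \<partial>lborel \<partial>lborel) = ennreal (?Z * (\<integral>x. (h x)\<^sup>2 \<partial>lborel))"
      using h2 gauss_mass_pos[where 'a='a]
      by (simp add: ennreal_mult nn_integral_cmult nn_integral_multc nn_integral_eq_integral integrable_gauss
          integral_gauss mult.commute)
    have pt: "ennreal \<bar>h x * h (x + \<epsilon> *\<^sub>R w) * gauss w\<bar> \<le> ennreal (1/2) * (ennreal ((h x)\<^sup>2 * gauss w) + ennreal ((h (x + \<epsilon> *\<^sub>R w))\<^sup>2 * gauss w))" for x w
    proof -
      have "0 \<le> (\<bar>h x\<bar> - \<bar>h (x + \<epsilon> *\<^sub>R w)\<bar>)\<^sup>2" by simp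
      then have "\<bar>h x\<bar> * \<bar>h (x + \<epsilon> *\<^sub>R w)\<bar> \<le> 1/2 * ((h x)\<^sup>2 + (h (x + \<epsilon> *\<^sub>R w))\<^sup>2)"
        by (simp add: power2_diff)
      from mult_right_mono[OF this gauss_nonneg[of w]]
      have "\<bar>h x * h (x + \<epsilon> *\<^sub>R w) * gauss w\<bar> \<le> (1/2) * ((h x)\<^sup>2 * gauss w + (h (x + \<epsilon> *\<^sub>R w))\<^sup>2 * gauss w)"
        by (simp add: abs_mult algebra_simps)
      then have "ennreal \<bar>h x * h (x + \<epsilon> *\<^sub>R w) * gauss w\<bar> \<le> ennreal ((1/2) * ((h x)\<^sup>2 * gauss w + (h (x + \<epsilon> *\<^sub>R w))\<^sup>2 * gauss w))"
        by (rule ennreal_leI)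
      also have "\<dots> = ennreal (1/2) * (ennreal ((h x)\<^sup>2 * gauss w) + ennreal ((h (x + \<epsilon> *\<^sub>R w))\<^sup>2 * gauss w))"
        by (subst ennreal_mult', simp, subst ennreal_plus) simp_all
      finally show ?thesis .
    qed
    have "\<bar>\<integral>x. \<integral>w. h x * h (x + \<epsilon> *\<^sub>R w) * gauss w \<partial>lborel \<partial>lborel\<bar> \<le> ?Z * (\<integral>x. (h x)\<^sup>2 \<partial>lborel)"
    proof -
      have "ennreal (norm (\<integral>x. \<integral>w. h x * h (x + \<epsilon> *\<^sub>R w) * gauss w \<partial>lborel \<partial>lborel))
         \<le> (\<integral>\<^sup>+x. \<integral>\<^sup>+w. ennreal (norm (h x * h (x + \<epsilon> *\<^sub>R w) * gauss w)) \<partial>lborel \<partial>lborel)"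
        by (rule order_trans[OF integral_norm_bound_ennreal'])
           (intro nn_integral_mono integral_norm_bound_ennreal')
      also have "\<dots> \<le> (\<integral>\<^sup>+x. \<integral>\<^sup>+w. ennreal (1/2) * (ennreal ((h x)\<^sup>2 * gauss w) + ennreal ((h (x + \<epsilon> *\<^sub>R w))\<^sup>2 * gauss w)) \<partial>lborel \<partial>lborel)"
        using pt by (intro nn_integral_mono) simp
      also have "\<dots> = ennreal (1/2) * ((\<integral>\<^sup>+x. \<integral>\<^sup>+w. ennreal ((h x)\<^sup>2 * gauss (w::'a)) \<partial>lborel \<partial>lborel) + (\<integral>\<^sup>+x. \<integral>\<^sup>+w. ennreal ((h (x + \<epsilon> *\<^sub>R w))\<^sup>2 * gauss w) \<partial>lborel \<partial>lborel))"
        by (simp add: nn_integral_cmult nn_integral_add)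
      also have "\<dots> = ennreal (?Z * (\<integral>x. (h x)\<^sup>2 \<partial>lborel))"
        unfolding gy hg by (rule ennreal_half_double) (use gauss_mass_pos[where 'a='a] in simp)
      finally show ?thesis
        using gauss_mass_pos[where 'a='a] by (simp add: ennreal_le_iff)
    qed
    then have "(\<integral>\<xi>. (cmod (fourier h \<xi>))\<^sup>2 * gauss (\<epsilon> *\<^sub>R \<xi>) \<partial>lborel) \<le> ?Z * (?Z * (\<integral>x. (h x)\<^sup>2 \<partial>lborel))"
      using gauss_mass_pos[where 'a='a]
      by (subst gauss_plancherel[OF h e]) (auto intro!: mult_left_mono)
    then show ?thesis
      using I by (subst nn_integral_eq_integral) (auto intro!: ennreal_leI simp: power2_eq_square mult.assoc)
  qed
  have "(\<integral>\<^sup>+\<xi>. ennreal ((cmod (fourier h \<xi>))\<^sup>2) \<partial>lborel)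
    = (\<integral>\<^sup>+\<xi>. liminf (\<lambda>k. ennreal ((cmod (fourier h \<xi>))\<^sup>2 * gauss ((1 / real (Suc k)) *\<^sub>R \<xi>))) \<partial>lborel)"
  proof (rule nn_integral_cong)
    fix \<xi> :: 'a
    have "(\<lambda>k. (cmod (fourier h \<xi>))\<^sup>2 * gauss ((1 / real (Suc k)) *\<^sub>R \<xi>)) \<longlonglongrightarrow> (cmod (fourier h \<xi>))\<^sup>2 * gauss (0 *\<^sub>R \<xi>)"
      by (intro tendsto_intros continuous_on_tendsto_compose[OF continuous_on_gauss[of UNIV]] LIMSEQ_Suc[OF lim_1_over_n]) auto
    then have "(\<lambda>k. ennreal ((cmod (fourier h \<xi>))\<^sup>2 * gauss ((1 / real (Suc k)) *\<^sub>R \<xi>))) \<longlonglongrightarrow> ennreal ((cmod (fourier h \<xi>))\<^sup>2)"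
      by (intro tendsto_ennrealI) (simp add: gauss_def)
    then show "ennreal ((cmod (fourier h \<xi>))\<^sup>2) = liminf (\<lambda>k. ennreal ((cmod (fourier h \<xi>))\<^sup>2 * gauss ((1 / real (Suc k)) *\<^sub>R \<xi>)))"
      by (intro lim_imp_Liminf[symmetric]) auto
  qed
  also have "\<dots> \<le> liminf (\<lambda>k. \<integral>\<^sup>+\<xi>. ennreal ((cmod (fourier h \<xi>))\<^sup>2 * gauss ((1 / real (Suc k)) *\<^sub>R \<xi>)) \<partial>lborel)"
    by (rule nn_integral_liminf) measurable
  also have "\<dots> \<le> limsup (\<lambda>k. \<integral>\<^sup>+\<xi>. ennreal ((cmod (fourier h \<xi>))\<^sup>2 * gauss ((1 / real (Suc k)) *\<^sub>R \<xi>)) \<partial>lborel)"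
    by (intro Liminf_le_Limsup) auto
  also have "\<dots> \<le> ennreal (?Z\<^sup>2 * (\<integral>x. (h x)\<^sup>2 \<partial>lborel))"
    by (intro Limsup_bounded always_eventually allI bound) auto
  finally show ?thesis .
qed

text \<open>Boundedness dominates the integrals on the right of \<open>gauss_plancherel\<close> and
  continuity gives their limit, while the left side never exceeds the full integral because
  \<open>gauss\<close> is at most 1. This half is applied to the ray transform, which is continuous
  with bounded support.\<close>

lemma le_nn_integral_cmod_fourier:
  fixes h :: "'a::euclidean_space \<Rightarrow> real"
  assumes h: "integrable lborel h" and c: "continuous_on UNIV h" and b: "\<And>x. \<bar>h x\<bar> \<le> b"
  shows "ennreal ((gauss_mass TYPE('a))\<^sup>2 * (\<integral>x. (h x)\<^sup>2 \<partial>lborel)) \<le> (\<integral>\<^sup>+\<xi>. ennreal ((cmod (fourier h \<xi>))\<^sup>2) \<partial>lborel)"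
proof -
  let ?Z = "gauss_mass TYPE('a)"
  have hm [measurable]: "h \<in> borel_measurable borel" using h by auto
  define e where "e k = 1 / real (Suc k)" for k
  have e0: "e \<longlonglongrightarrow> 0" unfolding e_def[abs_def] by (rule LIMSEQ_Suc[OF lim_1_over_n])
  have epos: "e k > 0" for k by (simp add: e_def)
  have conv_in: "(\<lambda>k. \<integral>w. h x * h (x + e k *\<^sub>R w) * gauss w \<partial>lborel) \<longlonglongrightarrow> (\<integral>w. h x * h x * gauss (w::'a) \<partial>lborel)" for x
  proof (rule Bochner_Integration.integral_dominated_convergence)
    show "integrable lborel (\<lambda>w::'a. (\<bar>h x\<bar> * b) * gauss w)"
      by (intro integrable_mult_right integrable_gauss)
    show "AE w in lborel. (\<lambda>k. h x * h (x + e k *\<^sub>R w) * gauss w) \<longlonglongrightarrow> h x * h x * gauss w"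
    proof (rule AE_I2)
      fix w :: 'a
      have "(\<lambda>k. h (x + e k *\<^sub>R w)) \<longlonglongrightarrow> h (x + 0 *\<^sub>R w)"
        by (intro continuous_on_tendsto_compose[OF c] tendsto_intros e0) auto
      then show "(\<lambda>k. h x * h (x + e k *\<^sub>R w) * gauss w) \<longlonglongrightarrow> h x * h x * gauss w"
        by (intro tendsto_intros) simp
    qed
    show "AE w in lborel. norm (h x * h (x + e k *\<^sub>R w) * gauss w) \<le> (\<bar>h x\<bar> * b) * gauss w" for k
      by (auto simp: abs_mult intro!: mult_right_mono mult_left_mono b)
  qed measurable
  have conv: "(\<lambda>k. \<integral>x. \<integral>w. h x * h (x + e k *\<^sub>R w) * gauss w \<partial>lborel \<partial>lborel) \<longlonglongrightarrow> (\<integral>x. \<integral>w. h x * h x * gauss (w::'a) \<partial>lborel \<partial>lborel)"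
  proof (rule Bochner_Integration.integral_dominated_convergence)
    show "integrable lborel (\<lambda>x. \<bar>h x\<bar> * (b * ?Z))" using h by (intro integrable_mult_left) auto
    show "AE x in lborel. norm (\<integral>w. h x * h (x + e k *\<^sub>R w) * gauss w \<partial>lborel) \<le> \<bar>h x\<bar> * (b * ?Z)" for k
    proof (rule AE_I2)
      fix x
      have "norm (\<integral>w. h x * h (x + e k *\<^sub>R w) * gauss w \<partial>lborel) \<le> (\<integral>w. (\<bar>h x\<bar> * b) * gauss (w::'a) \<partial>lborel)"
        by (rule integral_norm_bound_integral')
           (auto simp: abs_mult intro!: mult_right_mono mult_left_mono b integrable_gauss)
      also have "\<dots> = \<bar>h x\<bar> * (b * ?Z)" by (simp add: integral_gauss)
      finally show "norm (\<integral>w. h x * h (x + e k *\<^sub>R w) * gauss w \<partial>lborel) \<le> \<bar>h x\<bar> * (b * ?Z)" .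
    qed
  qed (use conv_in in auto)
  have lim: "(\<lambda>k. ?Z * (\<integral>x. \<integral>w. h x * h (x + e k *\<^sub>R w) * gauss w \<partial>lborel \<partial>lborel)) \<longlonglongrightarrow> ?Z\<^sup>2 * (\<integral>x. (h x)\<^sup>2 \<partial>lborel)"
    using tendsto_mult_left[OF conv, of ?Z] by (simp add: integral_gauss power2_eq_square mult_ac)
  show ?thesis
  proof (rule LIMSEQ_le_const2[OF tendsto_ennrealI[OF lim]], intro exI allI impI)
    fix k
    have "ennreal (?Z * (\<integral>x. \<integral>w. h x * h (x + e k *\<^sub>R w) * gauss w \<partial>lborel \<partial>lborel)) =
       ennreal (\<integral>\<xi>. (cmod (fourier h \<xi>))\<^sup>2 * gauss (e k *\<^sub>R \<xi>) \<partial>lborel)"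
      by (simp add: gauss_plancherel[OF h epos])
    also have "\<dots> \<le> ennreal (norm (\<integral>\<xi>. (cmod (fourier h \<xi>))\<^sup>2 * gauss (e k *\<^sub>R \<xi>) \<partial>lborel))"
      by (intro ennreal_leI) auto
    also have "\<dots> \<le> (\<integral>\<^sup>+\<xi>. ennreal (norm ((cmod (fourier h \<xi>))\<^sup>2 * gauss (e k *\<^sub>R \<xi>))) \<partial>lborel)"
      by (rule integral_norm_bound_ennreal')
    also have "\<dots> \<le> (\<integral>\<^sup>+\<xi>. ennreal ((cmod (fourier h \<xi>))\<^sup>2) \<partial>lborel)"
      by (intro nn_integral_mono ennreal_leI) (auto simp: abs_mult intro!: mult_left_le gauss_le_1)
    finally show "ennreal (?Z * (\<integral>x. \<integral>w. h x * h (x + e k *\<^sub>R w) * gauss w \<partial>lborel \<partial>lborel))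
      \<le> (\<integral>\<^sup>+\<xi>. ennreal ((cmod (fourier h \<xi>))\<^sup>2) \<partial>lborel)" .
  qed
qed

section \<open>Partial derivatives and test functions\<close>

text \<open>In contrast to a condition on the closure of the support, this survives multiplication
  by arbitrary functions in one step; together with continuity it yields boundedness and
  integrability.\<close>

definition bounded_support :: "('a::real_normed_vector \<Rightarrow> real) \<Rightarrow> bool" where
  "bounded_support f \<longleftrightarrow> (\<exists>b. \<forall>x. f x \<noteq> 0 \<longrightarrow> norm x \<le> b)"

lemma bounded_support_mult:
  "bounded_support f \<Longrightarrow> bounded_support (\<lambda>x. f x * g x)"
  "bounded_support f \<Longrightarrow> bounded_support (\<lambda>x. g x * f x)"
  unfolding bounded_support_def by fastforce+

lemma bounded_support_bounded:
  fixes f :: "'a::euclidean_space \<Rightarrow> real"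
  assumes c: "continuous_on UNIV f" and s: "bounded_support f"
  obtains B where "\<And>x. \<bar>f x\<bar> \<le> B"
proof -
  obtain b where b: "\<And>x. f x \<noteq> 0 \<Longrightarrow> norm x \<le> b" using s unfolding bounded_support_def by metis
  have "compact (f ` cball 0 b)"
    using c by (intro compact_continuous_image) (auto intro: continuous_on_subset)
  then have "bounded (f ` cball 0 b)" by (rule compact_imp_bounded)
  then obtain B where B: "\<And>x. x \<in> cball 0 b \<Longrightarrow> \<bar>f x\<bar> \<le> B"
    by (metis bounded_iff imageI real_norm_def)
  have "\<bar>f x\<bar> \<le> max 0 B" for x
    using B[of x] b[of x] by (cases "f x = 0") auto
  then show ?thesis by (rule that)
qed

lemma integrable_bounded_support:
  fixes f :: "'a::euclidean_space \<Rightarrow> real"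
  assumes f: "f \<in> borel_measurable borel" and s: "bounded_support f" and B: "\<And>x. \<bar>f x\<bar> \<le> B"
  shows "integrable lborel f"
proof -
  obtain b where b: "\<And>x. f x \<noteq> 0 \<Longrightarrow> norm x \<le> b" using s unfolding bounded_support_def by metis
  show ?thesis
  proof (rule integrableI_bounded_set[where A="cball 0 b" and B=B])
    show "emeasure lborel (cball (0::'a) b) < \<infinity>"
      using emeasure_lborel_cball_finite by (simp add: top.not_eq_extremum)
    show "AE x in lborel. x \<notin> cball 0 b \<longrightarrow> f x = 0"
      using b by (intro AE_I2) (force simp: not_le)
  qed (use f B in auto)
qed

lemma integrable_continuous_bounded_support:
  fixes f :: "'a::euclidean_space \<Rightarrow> real"
  assumes "continuous_on UNIV f" and "bounded_support f"
  shows "integrable lborel f"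
proof -
  obtain B where "\<And>x. \<bar>f x\<bar> \<le> B" using bounded_support_bounded[OF assms] by blast
  then show ?thesis
    using assms by (intro integrable_bounded_support borel_measurable_continuous_onI) auto
qed

text \<open>Differentiability along a single axis, with continuity of both functions. Every
  integration by parts takes place in one fixed direction, and this notion also admits the
  non-compactly supported factors such as coordinates, sines and cosines.\<close>

definition has_partial :: "'n::finite \<Rightarrow> (real^'n \<Rightarrow> real) \<Rightarrow> (real^'n \<Rightarrow> real) \<Rightarrow> bool" where
  "has_partial j f g \<longleftrightarrow> continuous_on UNIV f \<and> continuous_on UNIV g \<and>
     (\<forall>x. ((\<lambda>s. f (x + s *\<^sub>R axis j 1)) has_real_derivative g x) (at 0))"

lemma has_partial_continuous:
  assumes "has_partial j f g" shows "continuous_on UNIV f" "continuous_on UNIV g"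
  using assms by (auto simp: has_partial_def)

lemma has_partial_deriv:
  assumes "has_partial j f g"
  shows "((\<lambda>s. f (x + s *\<^sub>R axis j 1)) has_real_derivative g (x + s *\<^sub>R axis j 1)) (at s)"
proof -
  have "((\<lambda>r. f (x + s *\<^sub>R axis j 1 + r *\<^sub>R axis j 1)) has_real_derivative g (x + s *\<^sub>R axis j 1)) (at 0)"
    using assms by (auto simp: has_partial_def)
  then have "((\<lambda>r. f (x + (r + s) *\<^sub>R axis j 1)) has_real_derivative g (x + s *\<^sub>R axis j 1)) (at 0)"
    by (simp add: algebra_simps)
  then show ?thesis using DERIV_shift[of "\<lambda>r. f (x + r *\<^sub>R axis j 1)" _ 0 s] by simp
qed

lemma has_partial_mult:
  assumes "has_partial j f f'" "has_partial j g g'"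
  shows "has_partial j (\<lambda>x. f x * g x) (\<lambda>x. f' x * g x + f x * g' x)"
  unfolding has_partial_def
proof (intro conjI allI)
  fix x
  from assms have "((\<lambda>s. f (x + s *\<^sub>R axis j 1)) has_real_derivative f' x) (at 0)"
    "((\<lambda>s. g (x + s *\<^sub>R axis j 1)) has_real_derivative g' x) (at 0)"
    by (auto simp: has_partial_def)
  from DERIV_mult[OF this]
  show "((\<lambda>s. f (x + s *\<^sub>R axis j 1) * g (x + s *\<^sub>R axis j 1)) has_real_derivative (f' x * g x + f x * g' x)) (at 0)"
    by (simp add: algebra_simps)
qed (use assms in \<open>auto simp: has_partial_def intro!: continuous_intros\<close>)

lemma has_partial_affine:
  assumes f: "has_partial j f f'"
  shows "has_partial j (\<lambda>x. f (b + c *\<^sub>R x)) (\<lambda>x. c * f' (b + c *\<^sub>R x))"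
  unfolding has_partial_def
proof (intro conjI allI)
  note cf = has_partial_continuous[OF f]
  show "continuous_on UNIV (\<lambda>x. f (b + c *\<^sub>R x))" "continuous_on UNIV (\<lambda>x. c * f' (b + c *\<^sub>R x))"
    by (auto intro!: continuous_intros continuous_on_compose2[OF cf(1)] continuous_on_compose2[OF cf(2)])
  fix x
  have "((\<lambda>s. f ((b + c *\<^sub>R x) + s *\<^sub>R axis j 1)) has_real_derivative f' (b + c *\<^sub>R x)) (at (c * 0))"
    using f by (auto simp: has_partial_def)
  from DERIV_chain2[where f="\<lambda>s. f ((b + c *\<^sub>R x) + s *\<^sub>R axis j 1)" and g="\<lambda>s. c * s" and s=UNIV, OF this, of c]
  have "((\<lambda>s. f ((b + c *\<^sub>R x) + (c * s) *\<^sub>R axis j 1)) has_real_derivative f' (b + c *\<^sub>R x) * c) (at 0)"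
    by (auto intro!: derivative_eq_intros)
  then show "((\<lambda>s. f (b + c *\<^sub>R (x + s *\<^sub>R axis j 1))) has_real_derivative c * f' (b + c *\<^sub>R x)) (at 0)"
    by (simp add: scaleR_right_distrib add.assoc mult.commute)
qed

lemma has_partial_component:
  "has_partial j (\<lambda>x. x $ i - a) (\<lambda>x. if i = j then 1 else 0)"
  unfolding has_partial_def
  by (auto intro!: continuous_intros derivative_eq_intros simp: axis_def)

lemma has_partial_inner:
  assumes p: "\<And>s. (p has_real_derivative p' s) (at s)" and c: "continuous_on UNIV p'"
  shows "has_partial j (\<lambda>x. p (\<xi> \<bullet> x)) (\<lambda>x. \<xi> $ j * p' (\<xi> \<bullet> x))"
  unfolding has_partial_def
proof (intro conjI allI)
  have "continuous_on UNIV p" using p by (meson DERIV_isCont continuous_at_imp_continuous_on)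
  then show "continuous_on UNIV (\<lambda>x. p (\<xi> \<bullet> x))" by (rule continuous_on_compose2) (auto intro!: continuous_intros)
  show "continuous_on UNIV (\<lambda>x. \<xi> $ j * p' (\<xi> \<bullet> x))"
    by (intro continuous_intros continuous_on_compose2[OF c]) auto
  fix x
  have "((\<lambda>s. p (\<xi> \<bullet> x + s * \<xi> $ j)) has_real_derivative p' (\<xi> \<bullet> x + 0 * \<xi> $ j) * \<xi> $ j) (at 0)"
    by (rule DERIV_chain2[OF p]) (auto intro!: derivative_eq_intros)
  then show "((\<lambda>s. p (\<xi> \<bullet> (x + s *\<^sub>R axis j 1))) has_real_derivative \<xi> $ j * p' (\<xi> \<bullet> x)) (at 0)"
    by (simp add: inner_add_right inner_axis mult.commute)
qed

lemma has_partial_zero_on_open: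
  assumes f: "has_partial j f f'" and U: "open U" "x \<in> U" and 0: "\<And>x. x \<in> U \<Longrightarrow> f x = 0"
  shows "f' x = 0"
proof -
  have "open ((\<lambda>s. x + s *\<^sub>R axis j 1) -` U)"
    by (intro open_vimage U continuous_intros)
  moreover have "(0::real) \<in> (\<lambda>s. x + s *\<^sub>R axis j 1) -` U" using U by simp
  ultimately have "\<forall>\<^sub>F s in nhds 0. s \<in> (\<lambda>s. x + s *\<^sub>R axis j 1) -` U"
    by (rule eventually_nhds_in_open)
  then have "\<forall>\<^sub>F s in nhds 0. f (x + s *\<^sub>R axis j 1) = 0"
    by eventually_elim (use 0 in auto)
  moreover have "((\<lambda>s. f (x + s *\<^sub>R axis j 1)) has_real_derivative f' x) (at 0)"
    using f by (auto simp: has_partial_def)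
  ultimately have "((\<lambda>s. 0) has_real_derivative f' x) (at (0::real))"
    using DERIV_cong_ev[of 0 0 "\<lambda>s. f (x + s *\<^sub>R axis j 1)" "\<lambda>s. 0"] by auto
  then show ?thesis using DERIV_const DERIV_unique by blast
qed

lemma has_partial_bounded_support:
  assumes f: "has_partial j f f'" and s: "bounded_support f"
  shows "bounded_support f'"
proof -
  obtain b where b: "\<And>x. f x \<noteq> 0 \<Longrightarrow> norm x \<le> b" using s unfolding bounded_support_def by metis
  have "f' x = 0" if "norm x > b" for x
  proof (rule has_partial_zero_on_open[OF f])
    show "open {x::real^'a. norm x > b}" by (intro open_Collect_less continuous_intros)
    show "x \<in> {x. norm x > b}" using that by simp
    show "f y = 0" if "y \<in> {x. norm x > b}" for y using that b[of y] by fastforce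
  qed
  then show ?thesis unfolding bounded_support_def by (meson not_le)
qed

text \<open>Difference quotients integrate to 0 by translation invariance. The mean value theorem
  bounds them and their supports stay in one ball, so dominated convergence passes to the
  derivative.\<close>

lemma integral_partial_zero:
  assumes f: "has_partial j f f'" and s: "bounded_support f"
  shows "(\<integral>x. f' x \<partial>lborel) = 0"
proof -
  note cf = has_partial_continuous[OF f]
  have s': "bounded_support f'" by (rule has_partial_bounded_support[OF f s])
  obtain b where b: "\<And>x. f x \<noteq> 0 \<Longrightarrow> norm x \<le> b" using s unfolding bounded_support_def by metis
  obtain B where B: "\<And>x. \<bar>f' x\<bar> \<le> B" using bounded_support_bounded[OF cf(2) s'] by blast
  have [measurable]: "f \<in> borel_measurable borel" "f' \<in> borel_measurable borel"
    using cf by (auto intro: borel_measurable_continuous_onI)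
  define e where "e k = 1 / real (Suc k)" for k
  have e0: "e \<longlonglongrightarrow> 0" unfolding e_def[abs_def] by (rule LIMSEQ_Suc[OF lim_1_over_n])
  have e: "0 < e k" "e k \<le> 1" for k by (auto simp: e_def)
  define q where "q k x = (f (x + e k *\<^sub>R axis j 1) - f x) / e k" for k x
  have if1: "integrable lborel f" by (rule integrable_continuous_bounded_support[OF cf(1) s])
  have q0: "(\<integral>x. q k x \<partial>lborel) = 0" for k
  proof -
    have 1: "integrable lborel (\<lambda>x. f (x + e k *\<^sub>R axis j 1))"
      using integrable_affine_iff[of 1 f "e k *\<^sub>R axis j 1"] if1 by (simp add: add.commute)
    have "(\<integral>x. f (x + e k *\<^sub>R axis j 1) \<partial>lborel) = (\<integral>x. f x \<partial>lborel)"
      using integral_affine[of 1 f "e k *\<^sub>R axis j 1"] by (simp add: add.commute)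
    then show ?thesis unfolding q_def using 1 if1 by simp
  qed
  have "(\<lambda>k. \<integral>x. q k x \<partial>lborel) \<longlonglongrightarrow> (\<integral>x. f' x \<partial>lborel)"
  proof (rule Bochner_Integration.integral_dominated_convergence)
    \<comment> \<open>The radius grows by 1 because the increments \<open>e k\<close> are at most
      1.\<close>
    show "integrable lborel (\<lambda>x::real^'a. B * indicator (cball 0 (b + 1)) x)"
      by (intro integrable_mult_right integrable_real_indicator) (use emeasure_lborel_cball_finite in \<open>auto simp: top.not_eq_extremum\<close>)
    show "AE x in lborel. (\<lambda>k. q k x) \<longlonglongrightarrow> f' x"
    proof (rule AE_I2)
      fix x
      have "((\<lambda>s. (f (x + s *\<^sub>R axis j 1) - f x) / s) \<longlongrightarrow> f' x) (at 0)"
        using f by (auto simp: has_partial_def has_field_derivative_iff)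
      then have "((\<lambda>s. (f (x + s *\<^sub>R axis j 1) - f x) / s) \<circ> e) \<longlonglongrightarrow> f' x"
        by (subst (asm) tendsto_at_iff_sequentially) (use e0 e in \<open>auto simp: less_imp_neq[symmetric]\<close>)
      then show "(\<lambda>k. q k x) \<longlonglongrightarrow> f' x" by (simp add: o_def q_def)
    qed
    show "AE x in lborel. norm (q k x) \<le> B * indicator (cball 0 (b + 1)) x" for k
    proof (rule AE_I2)
      fix x :: "real^'a"
      obtain z where "f (x + e k *\<^sub>R axis j 1) - f (x + 0 *\<^sub>R axis j 1) = (e k - 0) * f' (x + z *\<^sub>R axis j 1)"
        using MVT2[of 0 "e k" "\<lambda>s. f (x + s *\<^sub>R axis j 1)" "\<lambda>s. f' (x + s *\<^sub>R axis j 1)"] e has_partial_deriv[OF f] by metis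
      then have q: "q k x = f' (x + z *\<^sub>R axis j 1)" using e[of k] by (simp add: q_def)
      show "norm (q k x) \<le> B * indicator (cball 0 (b + 1)) x"
      proof (cases "norm x \<le> b + 1")
        case True then show ?thesis using q B by simp
      next
        case False
        have "norm x \<le> norm (x + e k *\<^sub>R axis j 1) + norm (e k *\<^sub>R axis j 1 :: real^'a)"
          by (metis add_diff_cancel_right' norm_triangle_ineq4)
        then have "norm x \<le> norm (x + e k *\<^sub>R axis j 1) + 1" using e[of k] by (simp add: norm_axis_1)
        then have "f x = 0" "f (x + e k *\<^sub>R axis j 1) = 0" using b[of x] b[of "x + e k *\<^sub>R axis j 1"] False by auto
        then show ?thesis using False by (simp add: q_def)
      qed
    qed
  qed (auto simp: q_def)
  then show ?thesis unfolding q0 using LIMSEQ_unique tendsto_const by blast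
qed

lemma integration_by_parts_partial:
  assumes f: "has_partial j f f'" and p: "has_partial j p p'" and s: "bounded_support f"
  shows "(\<integral>x. p x * f' x \<partial>lborel) = - (\<integral>x. p' x * f x \<partial>lborel)"
proof -
  note cf = has_partial_continuous[OF f] has_partial_continuous[OF p]
  have "integrable lborel (\<lambda>x. p x * f' x)" "integrable lborel (\<lambda>x. p' x * f x)"
    using cf s has_partial_bounded_support[OF f s]
    by (auto intro!: integrable_continuous_bounded_support continuous_intros bounded_support_mult)
  moreover have "(\<integral>x. p' x * f x + p x * f' x \<partial>lborel) = 0"
    by (rule integral_partial_zero[OF has_partial_mult[OF p f]]) (intro bounded_support_mult s)
  ultimately show ?thesis by simp
qed

text \<open>Reduces the transform to real integrals, since \<open>has_partial\<close> and its
  integration by parts concern real functions.\<close>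

lemma fourier_eq_cos_sin:
  assumes h: "integrable lborel h"
  shows "fourier h \<xi> = Complex (\<integral>x. cos (\<xi> \<bullet> x) * h x \<partial>lborel) (- (\<integral>x. sin (\<xi> \<bullet> x) * h x \<partial>lborel))"
proof (rule complex_eqI)
  show "Re (fourier h \<xi>) = Re (Complex (\<integral>x. cos (\<xi> \<bullet> x) * h x \<partial>lborel) (- (\<integral>x. sin (\<xi> \<bullet> x) * h x \<partial>lborel)))"
    unfolding fourier_def by (subst integral_Re[symmetric]) (auto intro: integrable_cis_mult h)
  show "Im (fourier h \<xi>) = Im (Complex (\<integral>x. cos (\<xi> \<bullet> x) * h x \<partial>lborel) (- (\<integral>x. sin (\<xi> \<bullet> x) * h x \<partial>lborel)))"
    unfolding fourier_def by (subst integral_Im[symmetric]) (auto intro: integrable_cis_mult h)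
qed

lemma fourier_partial:
  assumes f: "has_partial j f f'" and s: "bounded_support f"
  shows "fourier f' \<xi> = \<i> * of_real (\<xi> $ j) * fourier f \<xi>"
proof -
  have i: "integrable lborel f" "integrable lborel f'"
    using has_partial_continuous[OF f] s has_partial_bounded_support[OF f s]
    by (auto intro: integrable_continuous_bounded_support)
  have "has_partial j (\<lambda>x. cos (\<xi> \<bullet> x)) (\<lambda>x. \<xi> $ j * (- sin (\<xi> \<bullet> x)))"
    by (rule has_partial_inner) (auto intro!: derivative_eq_intros continuous_intros)
  from integration_by_parts_partial[OF f this s]
  have 1: "(\<integral>x. cos (\<xi> \<bullet> x) * f' x \<partial>lborel) = \<xi> $ j * (\<integral>x. sin (\<xi> \<bullet> x) * f x \<partial>lborel)"
    by (simp add: mult.assoc)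
  have "has_partial j (\<lambda>x. sin (\<xi> \<bullet> x)) (\<lambda>x. \<xi> $ j * (cos (\<xi> \<bullet> x)))"
    by (rule has_partial_inner) (auto intro!: derivative_eq_intros continuous_intros)
  from integration_by_parts_partial[OF f this s]
  have 2: "(\<integral>x. sin (\<xi> \<bullet> x) * f' x \<partial>lborel) = - \<xi> $ j * (\<integral>x. cos (\<xi> \<bullet> x) * f x \<partial>lborel)"
    by (simp add: mult.assoc)
  show ?thesis
    unfolding fourier_eq_cos_sin[OF i(1)] fourier_eq_cos_sin[OF i(2)] 1 2
    by (simp add: complex_eq_iff)
qed

section \<open>Closure properties of smooth functions\<close>

lemma iter_partial_simps [simp]:
  "iter_partial [] f = f" "iter_partial (i # is) f = partial_deriv i (iter_partial is f)"
  by (simp_all add: iter_partial_def)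

lemma smooth_differentiable: "smooth f \<Longrightarrow> iter_partial is f differentiable (at x)"
  by (auto simp: smooth_def)

lemma smooth_continuous:
  assumes "smooth f" shows "continuous_on UNIV (iter_partial is f)"
  using smooth_differentiable[OF assms]
  by (intro continuous_at_imp_continuous_on) (auto intro: differentiable_imp_continuous_within)

lemma smooth_has_partial:
  assumes f: "smooth f"
  shows "has_partial j (iter_partial is f) (partial_deriv j (iter_partial is f))"
  unfolding has_partial_def
proof (intro conjI allI)
  show "continuous_on UNIV (iter_partial is f)" by (rule smooth_continuous[OF f])
  show "continuous_on UNIV (partial_deriv j (iter_partial is f))"
    using smooth_continuous[OF f, of "j # is"] by simp
  fix x
  let ?D = "frechet_derivative (iter_partial is f) (at x)"
  have D: "(iter_partial is f has_derivative ?D) (at (x + 0 *\<^sub>R axis j 1))"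
    using smooth_differentiable[OF f, of "is" x] by (simp add: frechet_derivative_works)
  have "((\<lambda>s. iter_partial is f (x + s *\<^sub>R axis j 1)) has_derivative (\<lambda>s. ?D (s *\<^sub>R axis j 1))) (at 0)"
    by (rule has_derivative_compose[where g="iter_partial is f" and f="\<lambda>s. x + s *\<^sub>R axis j 1", OF _ D])
       (auto intro!: derivative_eq_intros)
  moreover have "?D (s *\<^sub>R axis j 1) = partial_deriv j (iter_partial is f) x * s" for s
    using has_derivative_bounded_linear[OF D]
    by (simp add: partial_deriv_def linear_simps mult.commute)
  ultimately show "((\<lambda>s. iter_partial is f (x + s *\<^sub>R axis j 1)) has_real_derivative partial_deriv j (iter_partial is f) x) (at 0)"
    by (simp add: has_field_derivative_def)
qed

lemma partial_deriv_add:
  assumes "\<And>x. f differentiable (at x)" "\<And>x. g differentiable (at x)"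
  shows "partial_deriv i (\<lambda>x. a * f x + b * g x) = (\<lambda>x. a * partial_deriv i f x + b * partial_deriv i g x)"
proof
  fix x
  have "((\<lambda>x. a * f x + b * g x) has_derivative
      (\<lambda>h. a * frechet_derivative f (at x) h + b * frechet_derivative g (at x) h)) (at x)"
    using assms by (auto intro!: derivative_eq_intros simp: frechet_derivative_works)
  from frechet_derivative_at[OF this, symmetric]
  show "partial_deriv i (\<lambda>x. a * f x + b * g x) x = a * partial_deriv i f x + b * partial_deriv i g x"
    by (simp add: partial_deriv_def)
qed

lemma iter_partial_add:
  assumes f: "smooth f" and g: "smooth g"
  shows "iter_partial is (\<lambda>x. a * f x + b * g x) = (\<lambda>x. a * iter_partial is f x + b * iter_partial is g x)"
  by (induction "is") (auto simp: partial_deriv_add smooth_differentiable f g)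

lemma smooth_add:
  assumes f: "smooth f" and g: "smooth g"
  shows "smooth (\<lambda>x. a * f x + b * g x)"
  unfolding smooth_def iter_partial_add[OF assms]
  by (auto intro!: derivative_intros smooth_differentiable f g)

lemma partial_deriv_affine:
  assumes f: "\<And>x. f differentiable (at x)"
  shows "partial_deriv i (\<lambda>x. k * f (b + c *\<^sub>R x)) = (\<lambda>x. k * c * partial_deriv i f (b + c *\<^sub>R x))"
proof
  fix x
  have D: "(f has_derivative frechet_derivative f (at (b + c *\<^sub>R x))) (at (b + c *\<^sub>R x))"
    using f by (simp add: frechet_derivative_works)
  have "((\<lambda>x. f (b + c *\<^sub>R x)) has_derivative (\<lambda>h. frechet_derivative f (at (b + c *\<^sub>R x)) (c *\<^sub>R h))) (at x)"
    by (rule has_derivative_compose[where g=f and f="\<lambda>x. b + c *\<^sub>R x", OF _ D]) (auto intro!: derivative_eq_intros)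
  then have "((\<lambda>x. k * f (b + c *\<^sub>R x)) has_derivative (\<lambda>h. k * frechet_derivative f (at (b + c *\<^sub>R x)) (c *\<^sub>R h))) (at x)"
    by (intro derivative_intros)
  from frechet_derivative_at[OF this, symmetric]
  show "partial_deriv i (\<lambda>x. k * f (b + c *\<^sub>R x)) x = k * c * partial_deriv i f (b + c *\<^sub>R x)"
    using has_derivative_bounded_linear[OF D] by (simp add: partial_deriv_def linear_simps)
qed

lemma iter_partial_affine:
  assumes f: "smooth f"
  shows "iter_partial is (\<lambda>x. f (b + c *\<^sub>R x)) = (\<lambda>x. c ^ length is * iter_partial is f (b + c *\<^sub>R x))"
proof (induction "is")
  case (Cons i "is")
  then show ?case
    using partial_deriv_affine[of "iter_partial is f" i "c ^ length is" b c] smooth_differentiable[OF f]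
    by (simp add: mult.commute)
qed simp

text \<open>Translated and rescaled copies of the weight serve as mollifiers later, and this makes
  them smooth.\<close>

lemma smooth_affine:
  assumes f: "smooth f"
  shows "smooth (\<lambda>x. f (b + c *\<^sub>R x))"
  unfolding smooth_def iter_partial_affine[OF assms]
proof (intro allI)
  fix "is" x
  have "(\<lambda>x. iter_partial is f (b + c *\<^sub>R x)) differentiable at x"
    by (rule differentiable_chain_at[of "\<lambda>x. b + c *\<^sub>R x" x "iter_partial is f", unfolded o_def])
       (auto intro!: derivative_intros smooth_differentiable f)
  then show "(\<lambda>x. c ^ length is * iter_partial is f (b + c *\<^sub>R x)) differentiable at x"
    by (intro derivative_intros)
qed

section \<open>Test functions\<close>

lemma test_functions_zero: "\<phi> \<in> test_functions \<Omega> \<Longrightarrow> x \<notin> \<Omega> \<Longrightarrow> \<phi> x = 0"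
  using closure_subset[of "{x. \<phi> x \<noteq> 0}"] unfolding test_functions_def by auto

lemma test_functions_smooth: "\<phi> \<in> test_functions \<Omega> \<Longrightarrow> smooth \<phi>"
  unfolding test_functions_def by auto

lemma test_functions_bounded_support:
  assumes "\<phi> \<in> test_functions \<Omega>" shows "bounded_support \<phi>"
proof -
  have "bounded (closure {x. \<phi> x \<noteq> 0})" using assms by (auto simp: test_functions_def compact_imp_bounded)
  then have "bounded {x. \<phi> x \<noteq> 0}" by (rule bounded_subset[OF _ closure_subset])
  then show ?thesis by (auto simp: bounded_support_def bounded_iff)
qed

lemma test_functions_has_partial:
  assumes "\<phi> \<in> test_functions \<Omega>" shows "has_partial j \<phi> (partial_deriv j \<phi>)"
  using smooth_has_partial[OF test_functions_smooth[OF assms], of j "[]"] by simp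

lemma test_functions_continuous:
  assumes "\<phi> \<in> test_functions \<Omega>" shows "continuous_on UNIV \<phi>"
  using has_partial_continuous(1)[OF test_functions_has_partial[OF assms]] .

text \<open>Makes the test functions a linear space, on which the Riesz argument takes midpoints and
  variations.\<close>

lemma test_functions_add:
  assumes f: "\<phi> \<in> test_functions \<Omega>" and g: "\<psi> \<in> test_functions \<Omega>"
  shows "(\<lambda>x. a * \<phi> x + b * \<psi> x) \<in> test_functions \<Omega>"
proof -
  have "closure {x. a * \<phi> x + b * \<psi> x \<noteq> 0} \<subseteq> closure ({x. \<phi> x \<noteq> 0} \<union> {x. \<psi> x \<noteq> 0})"
    by (intro closure_mono) auto
  also have "\<dots> = closure {x. \<phi> x \<noteq> 0} \<union> closure {x. \<psi> x \<noteq> 0}" by (rule closure_Un)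
  finally have s: "closure {x. a * \<phi> x + b * \<psi> x \<noteq> 0} \<subseteq> closure {x. \<phi> x \<noteq> 0} \<union> closure {x. \<psi> x \<noteq> 0}" .
  moreover have "compact (closure {x. \<phi> x \<noteq> 0} \<union> closure {x. \<psi> x \<noteq> 0})"
    using f g by (auto simp: test_functions_def)
  ultimately have "compact (closure {x. a * \<phi> x + b * \<psi> x \<noteq> 0})"
    by (meson bounded_subset closed_closure compact_eq_bounded_closed)
  then show ?thesis
    using f g s smooth_add[OF test_functions_smooth[OF f] test_functions_smooth[OF g], of a b]
    by (auto simp: test_functions_def)
qed

lemma zero_test_function: "(\<lambda>x. 0) \<in> test_functions \<Omega>"
proof -
  have "iter_partial is (\<lambda>x. 0) = (\<lambda>x. 0)" for "is" :: "'a list"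
    by (induction "is") (auto simp: partial_deriv_def)
  then show ?thesis by (auto simp: test_functions_def smooth_def)
qed

section \<open>The Fourier estimate for averages along rays\<close>

text \<open>The function \<open>arctan (t / (\<rho> * \<bar>a\<bar>)) / \<rho>\<close> is an
  antiderivative. Enlarging the range to \<open>t \<ge> 0\<close> makes the value independent of
  \<open>a\<close>, which stands for a frequency component.\<close>

lemma nn_integral_arctan_kernel_le:
  assumes r: "\<rho> > 0"
  shows "(\<integral>\<^sup>+t. ennreal (\<bar>a\<bar> / (t\<^sup>2 + \<rho>\<^sup>2 * a\<^sup>2)) * indicator {2..} t \<partial>lborel) \<le> ennreal (pi / (2 * \<rho>))"
proof (cases "a = 0")
  case False
  let ?b = "\<rho> * \<bar>a\<bar>"
  have b: "?b > 0" using r False by simp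
  have "(\<integral>\<^sup>+t. ennreal (\<bar>a\<bar> / (t\<^sup>2 + \<rho>\<^sup>2 * a\<^sup>2)) * indicator {2..} t \<partial>lborel)
     \<le> (\<integral>\<^sup>+t. ennreal (\<bar>a\<bar> / (t\<^sup>2 + \<rho>\<^sup>2 * a\<^sup>2)) * indicator {0..} t \<partial>lborel)"
    by (intro nn_integral_mono) (auto simp: indicator_def)
  also have "\<dots> = ennreal (pi / 2 / \<rho> - arctan (0 / ?b) / \<rho>)"
  proof (rule nn_integral_FTC_atLeast)
    fix t :: real
    have "((\<lambda>t. t / ?b) has_real_derivative 1 / ?b) (at t)"
      by (rule DERIV_cdivide[OF DERIV_ident])
    from DERIV_cdivide[OF DERIV_chain2[OF DERIV_arctan this], of \<rho>]
    have "((\<lambda>t. arctan (t / ?b) / \<rho>) has_real_derivative (1 / ?b) * (inverse (1 + (t / ?b)\<^sup>2)) / \<rho>) (at t)"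
      by (simp add: mult.commute)
    moreover have "(1 / ?b) * (inverse (1 + (t / ?b)\<^sup>2)) / \<rho> = \<bar>a\<bar> / (t\<^sup>2 + \<rho>\<^sup>2 * a\<^sup>2)"
    proof -
      have "1 + (t / c)\<^sup>2 = (t\<^sup>2 + c\<^sup>2) / c\<^sup>2" if "c > 0" for c
        using that by (simp add: power_divide add_divide_distrib)
      from this[OF b] have "1 + (t / ?b)\<^sup>2 = (t\<^sup>2 + ?b\<^sup>2) / ?b\<^sup>2" .
      then have "(1 / ?b) * (inverse (1 + (t / ?b)\<^sup>2)) / \<rho> = ?b / \<rho> / (t\<^sup>2 + ?b\<^sup>2)"
        using b by (simp add: power2_eq_square)
      also have "?b\<^sup>2 = \<rho>\<^sup>2 * a\<^sup>2" by (simp add: power_mult_distrib)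
      finally show ?thesis using r by simp
    qed
    ultimately show "((\<lambda>t. arctan (t / ?b) / \<rho>) has_real_derivative \<bar>a\<bar> / (t\<^sup>2 + \<rho>\<^sup>2 * a\<^sup>2)) (at t)" by simp
    show "0 \<le> \<bar>a\<bar> / (t\<^sup>2 + \<rho>\<^sup>2 * a\<^sup>2)" by simp
  next
    have "filterlim (\<lambda>t. t / ?b) at_top at_top"
      using filterlim_tendsto_pos_mult_at_top[OF tendsto_const _ filterlim_ident, of "1 / ?b"] b by simp
    then have "((\<lambda>t. arctan (t / ?b)) \<longlongrightarrow> pi / 2) at_top"
      by (rule filterlim_compose[OF tendsto_arctan_at_top])
    then show "((\<lambda>t. arctan (t / ?b) / \<rho>) \<longlongrightarrow> pi / 2 / \<rho>) at_top"
      using r by (intro tendsto_intros) auto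
  qed simp
  finally show ?thesis by simp
qed simp

text \<open>The weight \<open>(t - 1)^(n - k) * t^(k - 1)\<close> of the kernel at
  \<open>k = n - l + 1\<close>.\<close>

definition ray_weight :: "nat \<Rightarrow> nat \<Rightarrow> real \<Rightarrow> real" where
  "ray_weight n l t = (t - 1) ^ (l - 1) * t ^ (n - l)"

text \<open>The weight has total degree \<open>n - 1\<close> in \<open>t\<close>. The divisor
  \<open>t ^ n\<close> stems from a dilation by \<open>t\<close>, the single \<open>t\<close> from
  the coordinate difference along the ray; what remains is integrable at infinity.\<close>

lemma ray_weight_bounds:
  assumes l: "1 \<le> l" "l \<le> n" and t: "t \<ge> 1"
  shows "0 \<le> ray_weight n l t" "ray_weight n l t / (t * t ^ n) \<le> 1 / t\<^sup>2"
proof -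
  show "0 \<le> ray_weight n l t" using t by (simp add: ray_weight_def)
  have "ray_weight n l t \<le> t ^ (l - 1) * t ^ (n - l)"
    unfolding ray_weight_def using t by (intro mult_right_mono power_mono) auto
  also have "\<dots> = t ^ (n - 1)" using l by (simp add: power_add[symmetric])
  finally have "ray_weight n l t / (t * t ^ n) \<le> t ^ (n - 1) / (t * t ^ n)"
    using t by (intro divide_right_mono) auto
  also have "\<dots> = t ^ (n - 1) / (t ^ (n - 1) * t\<^sup>2)" using l by (cases n) (auto simp: power2_eq_square)
  also have "\<dots> = 1 / t\<^sup>2" using t by simp
  finally show "ray_weight n l t / (t * t ^ n) \<le> 1 / t\<^sup>2" .
qed

lemma borel_measurable_ray_weight [measurable]: "ray_weight n l \<in> borel_measurable borel"
  unfolding ray_weight_def by measurable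

text \<open>Since \<open>t - 1 \<ge> t / 2\<close>, one dilation factor can replace the other at the
  cost \<open>2 ^ n\<close>.\<close>

lemma ray_weight_le:
  assumes l: "1 \<le> l" "l \<le> CARD('n::finite)" and t: "t \<ge> 2"
  shows "0 \<le> ray_weight CARD('n) l t / (t * (t - 1) ^ CARD('n))"
    and "ray_weight CARD('n) l t / (t * (t - 1) ^ CARD('n)) \<le> 2 ^ CARD('n) / t\<^sup>2"
proof -
  let ?n = "CARD('n)"
  have w: "0 \<le> ray_weight ?n l t" using ray_weight_bounds[OF l, of t] t by auto
  then show "0 \<le> ray_weight ?n l t / (t * (t - 1) ^ ?n)" using t by simp
  have "(t / 2) ^ ?n \<le> (t - 1) ^ ?n" using t by (intro power_mono) auto
  then have "ray_weight ?n l t / (t * (t - 1) ^ ?n) \<le> ray_weight ?n l t / (t * (t / 2) ^ ?n)"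
    using w t by (intro divide_left_mono mult_left_mono mult_pos_pos) auto
  also have "\<dots> = 2 ^ ?n * (ray_weight ?n l t / (t * t ^ ?n))" by (simp add: power_divide)
  also have "\<dots> \<le> 2 ^ ?n * (1 / t\<^sup>2)"
    using ray_weight_bounds(2)[OF l, of t] t by (intro mult_left_mono) auto
  finally show "ray_weight ?n l t / (t * (t - 1) ^ ?n) \<le> 2 ^ ?n / t\<^sup>2" by simp
qed

text \<open>Here \<open>p = (t, z)\<close> with \<open>z = x + t *\<^sub>R (y - x)\<close>. The
  argument of \<open>\<psi>\<close> is \<open>x\<close> recovered from \<open>y\<close> and
  \<open>z\<close>, and \<open>(t - 1) ^ n\<close> is the Jacobian of that substitution. The further
  division by \<open>t\<close> pays for the factor that turns \<open>x_i - y_i\<close> into the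
  difference of the coordinates of \<open>x\<close> and \<open>z\<close>.\<close>

definition ray_mean :: "nat \<Rightarrow> (real^'n::finite \<Rightarrow> real) \<Rightarrow> (real^'n \<Rightarrow> real) \<Rightarrow> real \<times> (real^'n) \<Rightarrow> real^'n \<Rightarrow> real" where
  "ray_mean l \<phi> \<psi> p y = indicator {2..} (fst p) * (ray_weight CARD('n) l (fst p) / (fst p * (fst p - 1) ^ CARD('n)))
     * \<phi> (snd p) * \<psi> ((1 / (fst p - 1)) *\<^sub>R (fst p *\<^sub>R y - snd p))"

text \<open>Acts on the side of the test function: paired with \<open>f\<close> in \<open>y\<close>,
  it gives a part of the bilinear form over \<open>t \<ge> 2\<close>.\<close>

definition ray_transform :: "nat \<Rightarrow> (real^'n::finite \<Rightarrow> real) \<Rightarrow> (real^'n \<Rightarrow> real) \<Rightarrow> real^'n \<Rightarrow> real" where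
  "ray_transform l \<phi> \<psi> y = (\<integral>p. ray_mean l \<phi> \<psi> p y \<partial>(lborel \<Otimes>\<^sub>M lborel))"

lemma integrable_inverse_square: "integrable lborel (\<lambda>t::real. indicator {1..} t * (c / t\<^sup>2))"
proof -
  have "(\<integral>\<^sup>+t. ennreal (1 / t\<^sup>2) * indicator {1..} t \<partial>lborel) = ennreal (0 - (- 1 / 1))"
  proof (rule nn_integral_FTC_atLeast[where F="\<lambda>t. - 1 / t"])
    show "((\<lambda>t::real. - 1 / t) \<longlongrightarrow> 0) at_top"
      by (rule real_tendsto_divide_at_top[OF tendsto_const filterlim_ident])
  qed (auto intro!: derivative_eq_intros simp: power2_eq_square)
  moreover have "(\<integral>\<^sup>+t. ennreal (1 / t\<^sup>2) * indicator {1..} t \<partial>lborel) = (\<integral>\<^sup>+t. ennreal (norm (indicator {1..} t * (1 / (t::real)\<^sup>2))) \<partial>lborel)"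
    by (intro nn_integral_cong) (auto simp: indicator_def)
  ultimately have "integrable lborel (\<lambda>t::real. indicator {1..} t * (1 / t\<^sup>2))"
    by (intro integrableI_bounded) auto
  from integrable_mult_right[OF this, of c] show ?thesis by (simp add: mult_ac)
qed

section \<open>Ray transforms of continuous functions with bounded support\<close>

context
  fixes l :: nat and \<phi> \<psi> :: "real^'n::finite \<Rightarrow> real"
  assumes l: "1 \<le> l" "l \<le> CARD('n)"
    and \<phi>: "continuous_on UNIV \<phi>" "bounded_support \<phi>"
    and \<psi>: "continuous_on UNIV \<psi>" "bounded_support \<psi>"
begin

private lemma meas: "\<phi> \<in> borel_measurable borel" "\<psi> \<in> borel_measurable borel"
  using \<phi> \<psi> by (auto intro: borel_measurable_continuous_onI)

lemma ray_mean_measurable: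
  "(\<lambda>q. ray_mean l \<phi> \<psi> (fst q) (snd q)) \<in> borel_measurable ((lborel \<Otimes>\<^sub>M lborel) \<Otimes>\<^sub>M lborel)"
proof -
  note [measurable] = meas
  show ?thesis unfolding ray_mean_def by measurable
qed

text \<open>A single majorant for all \<open>y\<close> serves integrability in \<open>p\<close>,
  continuity of the transform in \<open>y\<close>, and the Fubini argument against
  \<open>f\<close>.\<close>

lemma ray_mean_dominated:
  obtains W where "integrable (lborel \<Otimes>\<^sub>M lborel) W" "\<And>p y. norm (ray_mean l \<phi> \<psi> p y) \<le> W p"
proof -
  obtain B where B: "\<And>x. \<bar>\<psi> x\<bar> \<le> B" using bounded_support_bounded[OF \<psi>] by blast
  then have B0: "0 \<le> B" using abs_ge_zero order_trans by blast
  have "integrable lborel (\<lambda>x. \<bar>\<phi> x\<bar>)" by (intro integrable_abs integrable_continuous_bounded_support \<phi>)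
  then have "integrable (lborel \<Otimes>\<^sub>M lborel) (\<lambda>p. (indicator {1..} (fst p) * (2 ^ CARD('n) * B / (fst p)\<^sup>2)) * \<bar>\<phi> (snd p)\<bar>)"
    by (rule lborel_pair.integrable_mult_prod[OF integrable_inverse_square])
  moreover have "norm (ray_mean l \<phi> \<psi> p y) \<le> (indicator {1..} (fst p) * (2 ^ CARD('n) * B / (fst p)\<^sup>2)) * \<bar>\<phi> (snd p)\<bar>" for p y
  proof (cases "fst p \<ge> 2")
    case True
    have "\<bar>ray_weight CARD('n) l (fst p) / (fst p * (fst p - 1) ^ CARD('n))\<bar> \<le> 2 ^ CARD('n) / (fst p)\<^sup>2"
      using ray_weight_le[OF l True] by simp
    then have "\<bar>ray_weight CARD('n) l (fst p) / (fst p * (fst p - 1) ^ CARD('n))\<bar> * \<bar>\<phi> (snd p)\<bar> * \<bar>\<psi> ((1 / (fst p - 1)) *\<^sub>R (fst p *\<^sub>R y - snd p))\<bar>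
      \<le> 2 ^ CARD('n) / (fst p)\<^sup>2 * \<bar>\<phi> (snd p)\<bar> * B"
      by (intro mult_mono B) auto
    then show ?thesis using True by (simp add: ray_mean_def abs_mult mult_ac)
  next
    case False
    then show ?thesis using B0 by (simp add: ray_mean_def)
  qed
  ultimately show ?thesis by (rule that)
qed

lemma integrable_ray_mean: "integrable (lborel \<Otimes>\<^sub>M lborel) (\<lambda>p. ray_mean l \<phi> \<psi> p y)"
proof -
  obtain W where W: "integrable (lborel \<Otimes>\<^sub>M lborel) W" "\<And>p y. norm (ray_mean l \<phi> \<psi> p y) \<le> W p"
    using ray_mean_dominated by blast
  show ?thesis
  proof (rule Bochner_Integration.integrable_bound[OF W(1)])
    show "AE p in lborel \<Otimes>\<^sub>M lborel. norm (ray_mean l \<phi> \<psi> p y) \<le> norm (W p)"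
      using W(2)[of _ y] by (intro AE_I2) (metis norm_ge_zero order_trans real_norm_def abs_ge_self)
  qed (use meas in \<open>unfold ray_mean_def, measurable\<close>)
qed

lemma continuous_on_ray_transform: "continuous_on UNIV (ray_transform l \<phi> \<psi>)"
  unfolding continuous_on_sequentially
proof (intro allI ballI impI)
  fix y :: "nat \<Rightarrow> real^'n" and a
  assume "(\<forall>n. y n \<in> UNIV) \<and> y \<longlonglongrightarrow> a"
  then have y: "y \<longlonglongrightarrow> a" by simp
  obtain W where W: "integrable (lborel \<Otimes>\<^sub>M lborel) W" "\<And>p y. norm (ray_mean l \<phi> \<psi> p y) \<le> W p"
    using ray_mean_dominated by blast
  have "(\<lambda>k. \<integral>p. ray_mean l \<phi> \<psi> p (y k) \<partial>(lborel \<Otimes>\<^sub>M lborel)) \<longlonglongrightarrow> (\<integral>p. ray_mean l \<phi> \<psi> p a \<partial>(lborel \<Otimes>\<^sub>M lborel))"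
  proof (rule Bochner_Integration.integral_dominated_convergence[OF _ _ W(1)])
    show "AE p in lborel \<Otimes>\<^sub>M lborel. (\<lambda>k. ray_mean l \<phi> \<psi> p (y k)) \<longlonglongrightarrow> ray_mean l \<phi> \<psi> p a"
      unfolding ray_mean_def
      by (intro AE_I2 tendsto_intros continuous_on_tendsto_compose[OF \<psi>(1)] y) auto
  qed (use W(2) in \<open>auto intro: borel_measurable_integrable integrable_ray_mean\<close>)
  then show "(ray_transform l \<phi> \<psi> \<circ> y) \<longlonglongrightarrow> ray_transform l \<phi> \<psi> a"
    by (simp add: ray_transform_def o_def)
qed

lemma bounded_support_ray_transform: "bounded_support (ray_transform l \<phi> \<psi>)"
proof -
  obtain b c where b: "\<And>x. \<phi> x \<noteq> 0 \<Longrightarrow> norm x \<le> b" and c: "\<And>x. \<psi> x \<noteq> 0 \<Longrightarrow> norm x \<le> c"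
    using \<phi> \<psi> unfolding bounded_support_def by metis
  have "norm y \<le> b + c" if y: "ray_transform l \<phi> \<psi> y \<noteq> 0" for y
  proof -
    obtain p where "ray_mean l \<phi> \<psi> p y \<noteq> 0"
      using y unfolding ray_transform_def by (metis (no_types) integral_zero Bochner_Integration.integral_cong)
    then obtain t z where t: "t \<ge> 2" and z: "\<phi> z \<noteq> 0" "\<psi> ((1 / (t - 1)) *\<^sub>R (t *\<^sub>R y - z)) \<noteq> 0"
      by (cases p) (auto simp: ray_mean_def split: split_indicator_asm)
    let ?x = "(1 / (t - 1)) *\<^sub>R (t *\<^sub>R y - z)"
    \<comment> \<open>The point \<open>y\<close> is a convex combination of \<open>x\<close> and
      \<open>z\<close>, so its norm is bounded uniformly in \<open>t\<close>.\<close>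
    have "y = ((t - 1) / t) *\<^sub>R ?x + (1 / t) *\<^sub>R z"
      using t by (simp add: scaleR_right_diff_distrib)
    then have "norm y \<le> \<bar>(t - 1) / t\<bar> * norm ?x + \<bar>1 / t\<bar> * norm z"
      by (metis norm_triangle_ineq norm_scaleR)
    also have "\<dots> \<le> 1 * norm ?x + 1 * norm z"
      using t by (intro add_mono mult_right_mono) auto
    finally show ?thesis using b[OF z(1)] c[OF z(2)] by simp
  qed
  then show ?thesis unfolding bounded_support_def by blast
qed

lemma integrable_ray_mean_pair:
  "integrable ((lborel \<Otimes>\<^sub>M lborel) \<Otimes>\<^sub>M lborel) (\<lambda>q. ray_mean l \<phi> \<psi> (fst q) (snd q))"
proof (rule integrableI_bounded)
  note [measurable] = ray_mean_measurable meas
  have "(\<integral>\<^sup>+q. ennreal (norm (ray_mean l \<phi> \<psi> (fst q) (snd q))) \<partial>((lborel \<Otimes>\<^sub>M lborel) \<Otimes>\<^sub>M lborel))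
    = (\<integral>\<^sup>+p. \<integral>\<^sup>+y. ennreal (norm (ray_mean l \<phi> \<psi> p y)) \<partial>lborel \<partial>(lborel \<Otimes>\<^sub>M lborel))"
    by (subst lborel.nn_integral_fst[symmetric]) auto
  also have "\<dots> \<le> (\<integral>\<^sup>+p. ennreal (indicator {1..} (fst p) * (2 ^ CARD('n) / (fst p)\<^sup>2)) * ennreal \<bar>\<phi> (snd p)\<bar> * ennreal (\<integral>x. \<bar>\<psi> x\<bar> \<partial>lborel) \<partial>(lborel \<Otimes>\<^sub>M lborel))"
  proof (rule nn_integral_mono)
    fix p :: "real \<times> (real^'n)"
    obtain t z where p: "p = (t, z)" by (cases p)
    show "(\<integral>\<^sup>+y. ennreal (norm (ray_mean l \<phi> \<psi> p y)) \<partial>lborel)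
      \<le> ennreal (indicator {1..} (fst p) * (2 ^ CARD('n) / (fst p)\<^sup>2)) * ennreal \<bar>\<phi> (snd p)\<bar> * ennreal (\<integral>x. \<bar>\<psi> x\<bar> \<partial>lborel)"
    proof (cases "t \<ge> 2")
      case True
      let ?w = "ray_weight CARD('n) l t / (t * (t - 1) ^ CARD('n))"
      have "(\<integral>\<^sup>+y. ennreal (norm (ray_mean l \<phi> \<psi> p y)) \<partial>lborel) =
        (\<integral>\<^sup>+y. ennreal (?w * \<bar>\<phi> z\<bar>) * ennreal \<bar>\<psi> (- (1 / (t - 1)) *\<^sub>R z + (t / (t - 1)) *\<^sub>R y)\<bar> \<partial>lborel)"
      proof (rule nn_integral_cong)
        fix y
        have "(1 / (t - 1)) *\<^sub>R (t *\<^sub>R y - z) = - (1 / (t - 1)) *\<^sub>R z + (t / (t - 1)) *\<^sub>R y"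
          by (simp add: scaleR_right_diff_distrib)
        then have "norm (ray_mean l \<phi> \<psi> p y) = (?w * \<bar>\<phi> z\<bar>) * \<bar>\<psi> (- (1 / (t - 1)) *\<^sub>R z + (t / (t - 1)) *\<^sub>R y)\<bar>"
          unfolding ray_mean_def p fst_conv snd_conv real_norm_def abs_mult
          using True abs_of_nonneg[OF ray_weight_le(1)[OF l True]] by (simp only:) simp
        then show "ennreal (norm (ray_mean l \<phi> \<psi> p y)) = ennreal (?w * \<bar>\<phi> z\<bar>) * ennreal \<bar>\<psi> (- (1 / (t - 1)) *\<^sub>R z + (t / (t - 1)) *\<^sub>R y)\<bar>"
          using ray_weight_le(1)[OF l True] by (simp only: ennreal_mult' mult_nonneg_nonneg abs_ge_zero)
      qed
      also have "\<dots> = ennreal (?w * \<bar>\<phi> z\<bar>) * (ennreal (1 / \<bar>t / (t - 1)\<bar> ^ CARD('n)) * (\<integral>\<^sup>+x. ennreal \<bar>\<psi> x\<bar> \<partial>lborel))"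
        using True by (subst nn_integral_cmult, simp, subst nn_integral_affine[where f="\<lambda>x. ennreal \<bar>\<psi> x\<bar>"]) auto
      \<comment> \<open>The dilation factor \<open>((t - 1) / t) ^ n\<close> is at most 1.\<close>
      also have "\<dots> \<le> ennreal (2 ^ CARD('n) / t\<^sup>2 * \<bar>\<phi> z\<bar>) * (1 * (\<integral>\<^sup>+x. ennreal \<bar>\<psi> x\<bar> \<partial>lborel))"
        using True ray_weight_le[OF l True]
        by (intro mult_mono ennreal_leI mult_right_mono) (auto simp: ennreal_le_1 power_divide intro!: divide_le_eq_1_pos[THEN iffD2] power_mono)
      also have "(\<integral>\<^sup>+x. ennreal \<bar>\<psi> x\<bar> \<partial>lborel) = ennreal (\<integral>x. \<bar>\<psi> x\<bar> \<partial>lborel)"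
        by (intro nn_integral_eq_integral integrable_abs integrable_continuous_bounded_support \<psi>) auto
      also have "ennreal (2 ^ CARD('n) / t\<^sup>2 * \<bar>\<phi> z\<bar>) = ennreal (2 ^ CARD('n) / t\<^sup>2) * ennreal \<bar>\<phi> z\<bar>"
        by (rule ennreal_mult') simp
      finally show ?thesis using True by (simp add: p mult.assoc)
    qed (simp add: p ray_mean_def)
  qed
  also have "\<dots> = (\<integral>\<^sup>+t. ennreal (indicator {1..} t * (2 ^ CARD('n) / t\<^sup>2)) \<partial>lborel) * (\<integral>\<^sup>+z. ennreal \<bar>\<phi> z\<bar> \<partial>lborel) * ennreal (\<integral>x. \<bar>\<psi> x\<bar> \<partial>lborel)"
    by (subst lborel.nn_integral_fst[symmetric])
       (auto simp: nn_integral_cmult nn_integral_multc)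
  also have "\<dots> < \<infinity>"
    using integrable_inverse_square[of "2 ^ CARD('n)"] integrable_continuous_bounded_support[OF \<phi>]
    unfolding integrable_iff_bounded by (auto simp: ennreal_mult_less_top abs_mult)
  finally show "(\<integral>\<^sup>+q. ennreal (norm (ray_mean l \<phi> \<psi> (fst q) (snd q))) \<partial>((lborel \<Otimes>\<^sub>M lborel) \<Otimes>\<^sub>M lborel)) < \<infinity>" .
qed (rule ray_mean_measurable)

text \<open>Because \<open>y\<close> is \<open>(1 - 1 / t) u + (1 / t) z\<close>, the character at
  \<open>y\<close> splits and for each \<open>t\<close> the transform becomes a product: frequency
  \<open>\<xi> / t\<close> for \<open>\<phi>\<close>, and \<open>(1 - 1 / t) \<xi>\<close> for
  \<open>\<psi>\<close>. The dilation in \<open>y\<close> trades \<open>(t - 1) ^ n\<close> for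
  \<open>t ^ n\<close>, after which the weight is at most \<open>1 / t\<^sup>2\<close>.\<close>

lemma cmod_fourier_ray_transform_le:
  "ennreal (cmod (fourier (ray_transform l \<phi> \<psi>) \<xi>))
    \<le> (\<integral>\<^sup>+t. ennreal (1 / t\<^sup>2 * cmod (fourier \<phi> ((1 / t) *\<^sub>R \<xi>)) * cmod (fourier \<psi> ((1 - 1 / t) *\<^sub>R \<xi>))) * indicator {2..} t \<partial>lborel)"
proof -
  interpret pair_sigma_finite "lborel \<Otimes>\<^sub>M lborel :: (real \<times> (real^'n)) measure" "lborel :: (real^'n) measure" ..
  note [measurable] = ray_mean_measurable meas
  define E where "E p y = cis (- (\<xi> \<bullet> y)) * of_real (ray_mean l \<phi> \<psi> p y)" for p y
  have E: "integrable ((lborel \<Otimes>\<^sub>M lborel) \<Otimes>\<^sub>M lborel) (\<lambda>q. E (fst q) (snd q))"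
    by (rule Bochner_Integration.integrable_bound[OF integrable_ray_mean_pair]) (auto simp: E_def norm_mult)
  define w where "w t = indicator {2..} t * (ray_weight CARD('n) l t / (t * t ^ CARD('n)))" for t
  \<comment> \<open>For fixed \<open>(t, z)\<close> the integral over \<open>y\<close> is an affine
    substitution to the point where \<open>\<psi>\<close> is evaluated.\<close>
  have Ey: "(\<integral>y. E (t, z) y \<partial>lborel) = of_real (w t) * (cis (- (((1 / t) *\<^sub>R \<xi>) \<bullet> z)) * of_real (\<phi> z)) * fourier \<psi> ((1 - 1 / t) *\<^sub>R \<xi>)" for t z
  proof (cases "t \<ge> 2")
    case t: True
    let ?w = "ray_weight CARD('n) l t / (t * (t - 1) ^ CARD('n))"
    define F where "F u = cis (- (((1 - 1 / t) *\<^sub>R \<xi>) \<bullet> u)) * complex_of_real (\<psi> u)" for u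
    have "E (t, z) y = of_real (?w * \<phi> z) * cis (- (((1 / t) *\<^sub>R \<xi>) \<bullet> z)) * F (- (1 / (t - 1)) *\<^sub>R z + (t / (t - 1)) *\<^sub>R y)" for y
    proof -
      let ?u = "- (1 / (t - 1)) *\<^sub>R z + (t / (t - 1)) *\<^sub>R y"
      have u: "?u = (1 / (t - 1)) *\<^sub>R (t *\<^sub>R y - z)" by (simp add: algebra_simps)
      have "y = (1 - 1 / t) *\<^sub>R ?u + (1 / t) *\<^sub>R z"
      proof -
        have "(1 - 1 / t) *\<^sub>R ?u = (- ((1 - 1 / t) * (1 / (t - 1)))) *\<^sub>R z + ((1 - 1 / t) * (t / (t - 1))) *\<^sub>R y"
          by (simp only: scaleR_right_distrib scaleR_scaleR mult_minus_right)
        moreover have "(1 - 1 / t) * (1 / (t - 1)) = 1 / t" "(1 - 1 / t) * (t / (t - 1)) = 1"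
          using t by (simp_all add: field_simps)
        ultimately have "(1 - 1 / t) *\<^sub>R ?u = (- (1 / t)) *\<^sub>R z + 1 *\<^sub>R y" by (simp only:)
        then have "(1 - 1 / t) *\<^sub>R ?u + (1 / t) *\<^sub>R z = ((- (1 / t)) *\<^sub>R z + 1 *\<^sub>R y) + (1 / t) *\<^sub>R z"
          by (rule arg_cong)
        also have "\<dots> = y" by simp
        finally show ?thesis by (rule sym)
      qed
      then have "\<xi> \<bullet> y = \<xi> \<bullet> ((1 - 1 / t) *\<^sub>R ?u + (1 / t) *\<^sub>R z)"
        by (rule arg_cong)
      also have "\<dots> = ((1 - 1 / t) *\<^sub>R \<xi>) \<bullet> ?u + ((1 / t) *\<^sub>R \<xi>) \<bullet> z"
        by (subst inner_add_right) (simp only: inner_scaleR_left inner_scaleR_right)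
      finally have "\<xi> \<bullet> y = ((1 - 1 / t) *\<^sub>R \<xi>) \<bullet> ?u + ((1 / t) *\<^sub>R \<xi>) \<bullet> z" .
      then have "cis (- (\<xi> \<bullet> y)) = cis (- (((1 / t) *\<^sub>R \<xi>) \<bullet> z)) * cis (- (((1 - 1 / t) *\<^sub>R \<xi>) \<bullet> ?u))"
        by (simp only: cis_mult minus_add_distrib add.commute)
      then show ?thesis
        unfolding E_def ray_mean_def F_def u fst_conv snd_conv of_real_mult using t by simp
    qed
    then have "(\<integral>y. E (t, z) y \<partial>lborel) = of_real (?w * \<phi> z) * cis (- (((1 / t) *\<^sub>R \<xi>) \<bullet> z)) * (\<integral>y. F (- (1 / (t - 1)) *\<^sub>R z + (t / (t - 1)) *\<^sub>R y) \<partial>lborel)"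
      by simp
    also have "(\<integral>y. F (- (1 / (t - 1)) *\<^sub>R z + (t / (t - 1)) *\<^sub>R y) \<partial>lborel) = (1 / \<bar>t / (t - 1)\<bar> ^ CARD('n)) *\<^sub>R fourier \<psi> ((1 - 1 / t) *\<^sub>R \<xi>)"
      using t by (subst integral_affine) (auto simp: F_def[abs_def] fourier_def)
    also have "1 / \<bar>t / (t - 1)\<bar> ^ CARD('n) = (t - 1) ^ CARD('n) / t ^ CARD('n)"
      using t by (simp add: power_divide)
    finally have "(\<integral>y. E (t, z) y \<partial>lborel) = of_real (?w * \<phi> z) * cis (- (((1 / t) *\<^sub>R \<xi>) \<bullet> z)) * ((t - 1) ^ CARD('n) / t ^ CARD('n)) *\<^sub>R fourier \<psi> ((1 - 1 / t) *\<^sub>R \<xi>)" .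
    also have "\<dots> = of_real (?w * ((t - 1) ^ CARD('n) / t ^ CARD('n))) * (cis (- (((1 / t) *\<^sub>R \<xi>) \<bullet> z)) * of_real (\<phi> z)) * fourier \<psi> ((1 - 1 / t) *\<^sub>R \<xi>)"
      unfolding scaleR_conv_of_real of_real_mult by (simp only: mult_ac)
    also have "?w * ((t - 1) ^ CARD('n) / t ^ CARD('n)) = w t"
      using t by (simp add: w_def)
    finally show ?thesis .
  qed (simp add: E_def ray_mean_def w_def)
  have "fourier (ray_transform l \<phi> \<psi>) \<xi> = (\<integral>y. \<integral>p. E p y \<partial>(lborel \<Otimes>\<^sub>M lborel) \<partial>lborel)"
    unfolding fourier_def E_def ray_transform_def by simp
  also have "\<dots> = (\<integral>p. \<integral>y. E p y \<partial>lborel \<partial>(lborel \<Otimes>\<^sub>M lborel))"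
    using Fubini_integral[of E] E by (simp add: case_prod_beta')
  also have "\<dots> = (\<integral>t. \<integral>z. (\<integral>y. E (t, z) y \<partial>lborel) \<partial>lborel \<partial>lborel)"
    using lborel_pair.integral_fst'[OF integrable_fst'[OF E]] by simp
  also have "\<dots> = (\<integral>t. of_real (w t) * fourier \<phi> ((1 / t) *\<^sub>R \<xi>) * fourier \<psi> ((1 - 1 / t) *\<^sub>R \<xi>) \<partial>lborel)"
    by (simp add: Ey) (simp add: fourier_def)
  finally have eq: "fourier (ray_transform l \<phi> \<psi>) \<xi> = (\<integral>t. of_real (w t) * fourier \<phi> ((1 / t) *\<^sub>R \<xi>) * fourier \<psi> ((1 - 1 / t) *\<^sub>R \<xi>) \<partial>lborel)" .
  have "ennreal (cmod (fourier (ray_transform l \<phi> \<psi>) \<xi>))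
     \<le> (\<integral>\<^sup>+t. ennreal (norm (of_real (w t) * fourier \<phi> ((1 / t) *\<^sub>R \<xi>) * fourier \<psi> ((1 - 1 / t) *\<^sub>R \<xi>))) \<partial>lborel)"
    unfolding eq by (rule integral_norm_bound_ennreal')
  also have "\<dots> \<le> (\<integral>\<^sup>+t. ennreal (1 / t\<^sup>2 * cmod (fourier \<phi> ((1 / t) *\<^sub>R \<xi>)) * cmod (fourier \<psi> ((1 - 1 / t) *\<^sub>R \<xi>))) * indicator {2..} t \<partial>lborel)"
  proof (rule nn_integral_mono)
    fix t
    have "\<bar>w t\<bar> \<le> 1 / t\<^sup>2" if "t \<ge> 2"
      using ray_weight_bounds[OF l, of t] that by (simp add: w_def)
    then show "ennreal (norm (complex_of_real (w t) * fourier \<phi> ((1 / t) *\<^sub>R \<xi>) * fourier \<psi> ((1 - 1 / t) *\<^sub>R \<xi>)))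
      \<le> ennreal (1 / t\<^sup>2 * cmod (fourier \<phi> ((1 / t) *\<^sub>R \<xi>)) * cmod (fourier \<psi> ((1 - 1 / t) *\<^sub>R \<xi>))) * indicator {2..} t"
      unfolding norm_mult norm_of_real
      by (cases "t \<ge> 2") (auto simp: w_def[of t] intro!: ennreal_leI mult_right_mono simp del: times_divide_eq_left)
  qed
  finally show ?thesis .
qed

end

text \<open>Schur's test on the frequency side. Cauchy-Schwarz in \<open>t\<close> with respect to
  \<open>K\<close> uses its mass once, and integrating \<open>K\<close> again after the exchange of
  integrals uses it a second time, whence the square of \<open>pi / (2 * \<rho>)\<close>. The two
  Plancherel inequalities translate back, and their constants cancel.\<close>

lemma ray_transform_bound:
  fixes \<phi> \<psi> \<psi>' :: "real^'n::finite \<Rightarrow> real"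
  assumes l: "1 \<le> l" "l \<le> CARD('n)"
    and \<phi>: "continuous_on UNIV \<phi>" "bounded_support \<phi>"
    and \<psi>: "has_partial j \<psi> \<psi>'" "bounded_support \<psi>"
    and r: "\<rho> > 0" and A: "0 \<le> A"
    and dec: "\<And>\<zeta>. cmod (fourier \<phi> \<zeta>) \<le> A / (1 + \<rho>\<^sup>2 * (\<zeta> $ j)\<^sup>2)"
  shows "(\<integral>y. (ray_transform l \<phi> \<psi>' y)\<^sup>2 \<partial>lborel) \<le> (A * pi / (2 * \<rho>))\<^sup>2 * 2 ^ (CARD('n) + 1) * (\<integral>x. (\<psi> x)\<^sup>2 \<partial>lborel)"
proof -
  let ?n = "CARD('n)" and ?Z = "gauss_mass TYPE(real^'n)"
  let ?H = "ray_transform l \<phi> \<psi>'"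
  have \<psi>': "continuous_on UNIV \<psi>'" "bounded_support \<psi>'"
    using has_partial_continuous[OF \<psi>(1)] has_partial_bounded_support[OF \<psi>] by auto
  have [measurable]: "\<psi> \<in> borel_measurable borel"
    using has_partial_continuous[OF \<psi>(1)] by (auto intro: borel_measurable_continuous_onI)
  define k where "k t \<xi> = \<bar>\<xi> $ j\<bar> / (t\<^sup>2 + \<rho>\<^sup>2 * (\<xi> $ j)\<^sup>2)" for t and \<xi> :: "real^'n"
  have k0: "0 \<le> k t \<xi>" for t \<xi> by (simp add: k_def)
  define K where "K t \<xi> = ennreal (k t \<xi>) * indicator {2..} t" for t and \<xi> :: "real^'n"
  define g where "g \<xi> = cmod (fourier \<psi> \<xi>)" for \<xi>
  have g0: "0 \<le> g \<xi>" for \<xi> by (simp add: g_def)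
  have [measurable]: "g \<in> borel_measurable borel" unfolding g_def by measurable
  have [measurable]: "(\<lambda>\<xi>::real^'n. \<xi> $ j) \<in> borel_measurable borel"
    by (intro borel_measurable_continuous_onI continuous_intros)
  have [measurable]: "(\<lambda>p. k (fst p) (snd p)) \<in> borel_measurable (borel \<Otimes>\<^sub>M borel)"
    unfolding k_def by measurable
  have [measurable]: "k t \<in> borel_measurable borel" "(\<lambda>t. k t \<xi>) \<in> borel_measurable borel" for t \<xi>
    unfolding k_def by measurable
  have mass: "(\<integral>\<^sup>+t. K t \<xi> \<partial>lborel) \<le> ennreal (pi / (2 * \<rho>))" for \<xi>
    unfolding K_def k_def by (rule nn_integral_arctan_kernel_le[OF r])
  have Hhat: "ennreal (cmod (fourier ?H \<xi>)) \<le> ennreal A * (\<integral>\<^sup>+t. K t \<xi> * ennreal (g ((1 - 1 / t) *\<^sub>R \<xi>)) \<partial>lborel)" for \<xi>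
  proof -
    have "ennreal (cmod (fourier ?H \<xi>)) \<le> (\<integral>\<^sup>+t. ennreal (1 / t\<^sup>2 * cmod (fourier \<phi> ((1 / t) *\<^sub>R \<xi>)) * cmod (fourier \<psi>' ((1 - 1 / t) *\<^sub>R \<xi>))) * indicator {2..} t \<partial>lborel)"
      by (rule cmod_fourier_ray_transform_le[OF l \<phi> \<psi>'])
    also have "\<dots> \<le> (\<integral>\<^sup>+t. ennreal A * (K t \<xi> * ennreal (g ((1 - 1 / t) *\<^sub>R \<xi>))) \<partial>lborel)"
    proof (rule nn_integral_mono)
      fix t :: real
      have "1 / t\<^sup>2 * cmod (fourier \<phi> ((1 / t) *\<^sub>R \<xi>)) * cmod (fourier \<psi>' ((1 - 1 / t) *\<^sub>R \<xi>)) \<le> A * (k t \<xi> * g ((1 - 1 / t) *\<^sub>R \<xi>))"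
        if t: "t \<ge> 2"
      proof -
        have "1 / t\<^sup>2 * cmod (fourier \<phi> ((1 / t) *\<^sub>R \<xi>)) \<le> 1 / t\<^sup>2 * (A / (1 + \<rho>\<^sup>2 * (((1 / t) *\<^sub>R \<xi>) $ j)\<^sup>2))"
          by (intro mult_left_mono dec) auto
        also have "\<dots> = A / (t\<^sup>2 * (1 + \<rho>\<^sup>2 * (\<xi> $ j)\<^sup>2 / t\<^sup>2))"
          by (simp add: power_mult_distrib power_divide)
        also have "t\<^sup>2 * (1 + \<rho>\<^sup>2 * (\<xi> $ j)\<^sup>2 / t\<^sup>2) = t\<^sup>2 + \<rho>\<^sup>2 * (\<xi> $ j)\<^sup>2"
          using t by (simp add: distrib_left)
        finally have 1: "1 / t\<^sup>2 * cmod (fourier \<phi> ((1 / t) *\<^sub>R \<xi>)) \<le> A / (t\<^sup>2 + \<rho>\<^sup>2 * (\<xi> $ j)\<^sup>2)" .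
        \<comment> \<open>The derivative supplies the \<open>\<bar>\<xi> $ j\<bar>\<close> in the
          numerator of \<open>k\<close>; its dilation factor is at most 1.\<close>
        have "cmod (fourier \<psi>' ((1 - 1 / t) *\<^sub>R \<xi>)) = (\<bar>1 - 1 / t\<bar> * \<bar>\<xi> $ j\<bar>) * g ((1 - 1 / t) *\<^sub>R \<xi>)"
          unfolding fourier_partial[OF \<psi>] norm_mult norm_of_real by (simp add: g_def abs_mult)
        also have "\<dots> \<le> (1 * \<bar>\<xi> $ j\<bar>) * g ((1 - 1 / t) *\<^sub>R \<xi>)"
          using t by (intro mult_right_mono g0) auto
        finally have 2: "cmod (fourier \<psi>' ((1 - 1 / t) *\<^sub>R \<xi>)) \<le> \<bar>\<xi> $ j\<bar> * g ((1 - 1 / t) *\<^sub>R \<xi>)" by simp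
        have "1 / t\<^sup>2 * cmod (fourier \<phi> ((1 / t) *\<^sub>R \<xi>)) * cmod (fourier \<psi>' ((1 - 1 / t) *\<^sub>R \<xi>))
          \<le> A / (t\<^sup>2 + \<rho>\<^sup>2 * (\<xi> $ j)\<^sup>2) * (\<bar>\<xi> $ j\<bar> * g ((1 - 1 / t) *\<^sub>R \<xi>))"
          using A by (intro mult_mono 1 2) auto
        then show ?thesis by (simp add: k_def)
      qed
      then show "ennreal (1 / t\<^sup>2 * cmod (fourier \<phi> ((1 / t) *\<^sub>R \<xi>)) * cmod (fourier \<psi>' ((1 - 1 / t) *\<^sub>R \<xi>))) * indicator {2..} t
        \<le> ennreal A * (K t \<xi> * ennreal (g ((1 - 1 / t) *\<^sub>R \<xi>)))"
        using A k0[of t \<xi>] g0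
        by (cases "t \<ge> 2") (auto simp: K_def ennreal_mult'[symmetric] intro!: ennreal_leI)
    qed
    also have "\<dots> = ennreal A * (\<integral>\<^sup>+t. K t \<xi> * ennreal (g ((1 - 1 / t) *\<^sub>R \<xi>)) \<partial>lborel)"
      unfolding K_def by (rule nn_integral_cmult) measurable
    finally show ?thesis .
  qed
  have sq: "ennreal ((cmod (fourier ?H \<xi>))\<^sup>2) \<le> ennreal (A\<^sup>2 * (pi / (2 * \<rho>))) * (\<integral>\<^sup>+t. K t \<xi> * ennreal ((g ((1 - 1 / t) *\<^sub>R \<xi>))\<^sup>2) \<partial>lborel)" for \<xi>
  proof -
    have "ennreal ((cmod (fourier ?H \<xi>))\<^sup>2) = (ennreal (cmod (fourier ?H \<xi>)))\<^sup>2"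
      by (simp add: ennreal_power)
    also have "\<dots> \<le> (ennreal A * (\<integral>\<^sup>+t. K t \<xi> * ennreal (g ((1 - 1 / t) *\<^sub>R \<xi>)) \<partial>lborel))\<^sup>2"
      by (intro power_mono Hhat) auto
    \<comment> \<open>One square root of \<open>K\<close> carries the mass, the other carries
      \<open>g\<close>.\<close>
    also have "\<dots> = (ennreal A)\<^sup>2 * (\<integral>\<^sup>+t. (ennreal (sqrt (k t \<xi>)) * indicator {2..} t) * (ennreal (sqrt (k t \<xi>)) * indicator {2..} t * ennreal (g ((1 - 1 / t) *\<^sub>R \<xi>))) \<partial>lborel)\<^sup>2"
      unfolding power_mult_distrib
    proof (intro arg_cong[where f="\<lambda>x. (ennreal A)\<^sup>2 * x\<^sup>2"] nn_integral_cong)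
      fix t
      have "ennreal (k t \<xi>) = ennreal (sqrt (k t \<xi>)) * ennreal (sqrt (k t \<xi>))"
        using k0[of t \<xi>] by (simp add: ennreal_mult'[symmetric])
      then show "K t \<xi> * ennreal (g ((1 - 1 / t) *\<^sub>R \<xi>)) = (ennreal (sqrt (k t \<xi>)) * indicator {2..} t) * (ennreal (sqrt (k t \<xi>)) * indicator {2..} t * ennreal (g ((1 - 1 / t) *\<^sub>R \<xi>)))"
        by (cases "t \<ge> 2") (simp_all add: K_def mult.assoc)
    qed
    also have "\<dots> \<le> (ennreal A)\<^sup>2 * ((\<integral>\<^sup>+t. (ennreal (sqrt (k t \<xi>)) * indicator {2..} t)\<^sup>2 \<partial>lborel) * (\<integral>\<^sup>+t. (ennreal (sqrt (k t \<xi>)) * indicator {2..} t * ennreal (g ((1 - 1 / t) *\<^sub>R \<xi>)))\<^sup>2 \<partial>lborel))"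
      by (intro mult_left_mono Cauchy_Schwarz_nn_integral) auto
    also have "(\<integral>\<^sup>+t. (ennreal (sqrt (k t \<xi>)) * indicator {2..} t)\<^sup>2 \<partial>lborel) = (\<integral>\<^sup>+t. K t \<xi> \<partial>lborel)"
      using k0 by (intro nn_integral_cong) (auto simp: K_def power_mult_distrib ennreal_power indicator_def)
    also have "(\<integral>\<^sup>+t. (ennreal (sqrt (k t \<xi>)) * indicator {2..} t * ennreal (g ((1 - 1 / t) *\<^sub>R \<xi>)))\<^sup>2 \<partial>lborel) = (\<integral>\<^sup>+t. K t \<xi> * ennreal ((g ((1 - 1 / t) *\<^sub>R \<xi>))\<^sup>2) \<partial>lborel)"
      using k0 g0 by (intro nn_integral_cong) (auto simp: K_def power_mult_distrib ennreal_power indicator_def)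
    also have "(ennreal A)\<^sup>2 * ((\<integral>\<^sup>+t. K t \<xi> \<partial>lborel) * (\<integral>\<^sup>+t. K t \<xi> * ennreal ((g ((1 - 1 / t) *\<^sub>R \<xi>))\<^sup>2) \<partial>lborel))
      \<le> (ennreal A)\<^sup>2 * (ennreal (pi / (2 * \<rho>)) * (\<integral>\<^sup>+t. K t \<xi> * ennreal ((g ((1 - 1 / t) *\<^sub>R \<xi>))\<^sup>2) \<partial>lborel))"
      by (intro mult_left_mono mult_right_mono mass) auto
    also have "\<dots> = ennreal (A\<^sup>2 * (pi / (2 * \<rho>))) * (\<integral>\<^sup>+t. K t \<xi> * ennreal ((g ((1 - 1 / t) *\<^sub>R \<xi>))\<^sup>2) \<partial>lborel)"
      using A by (subst ennreal_mult') (auto simp only: zero_le_power2 ennreal_power mult.assoc)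
    finally show ?thesis .
  qed
  \<comment> \<open>Comparing \<open>k\<close> at the two frequencies costs 2, since
    \<open>1 - 1 / t\<close> lies between 1/2 and 1; the Jacobian costs
    \<open>2 ^ n\<close>.\<close>
  have scale: "(\<integral>\<^sup>+\<xi>. K t \<xi> * ennreal ((g ((1 - 1 / t) *\<^sub>R \<xi>))\<^sup>2) \<partial>lborel) \<le> ennreal (2 ^ (?n + 1)) * (\<integral>\<^sup>+\<xi>. K t \<xi> * ennreal ((g \<xi>)\<^sup>2) \<partial>lborel)" for t
  proof (cases "t \<ge> 2")
    case t: True
    let ?s = "1 - 1 / t"
    have s: "1 / 2 \<le> ?s" "?s \<le> 1" using t by (auto simp: field_simps)
    have le: "k t \<xi> \<le> 2 * k t (0 + ?s *\<^sub>R \<xi>)" for \<xi>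
    proof -
      have "2 * k t (0 + ?s *\<^sub>R \<xi>) = (2 * ?s) * \<bar>\<xi> $ j\<bar> / (t\<^sup>2 + \<rho>\<^sup>2 * (?s\<^sup>2 * (\<xi> $ j)\<^sup>2))"
        using s by (simp add: k_def abs_mult power_mult_distrib)
      moreover have "\<bar>\<xi> $ j\<bar> / (t\<^sup>2 + \<rho>\<^sup>2 * (\<xi> $ j)\<^sup>2) \<le> (2 * ?s) * \<bar>\<xi> $ j\<bar> / (t\<^sup>2 + \<rho>\<^sup>2 * (?s\<^sup>2 * (\<xi> $ j)\<^sup>2))"
      proof (rule frac_le)
        show "\<bar>\<xi> $ j\<bar> \<le> 2 * ?s * \<bar>\<xi> $ j\<bar>" using mult_right_mono[of 1 "2 * ?s" "\<bar>\<xi> $ j\<bar>"] s by simp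
        show "0 < t\<^sup>2 + \<rho>\<^sup>2 * (?s\<^sup>2 * (\<xi> $ j)\<^sup>2)" using t by (intro add_pos_nonneg) auto
        have "?s\<^sup>2 * (\<xi> $ j)\<^sup>2 \<le> 1 * (\<xi> $ j)\<^sup>2" using s by (intro mult_right_mono) (auto simp: power_le_one)
        then show "t\<^sup>2 + \<rho>\<^sup>2 * (?s\<^sup>2 * (\<xi> $ j)\<^sup>2) \<le> t\<^sup>2 + \<rho>\<^sup>2 * (\<xi> $ j)\<^sup>2"
          by (intro add_left_mono mult_left_mono) auto
        show "0 \<le> 2 * ?s * \<bar>\<xi> $ j\<bar>" using s by simp
      qed
      ultimately show ?thesis by (simp add: k_def)
    qed
    have "(\<integral>\<^sup>+\<xi>. K t \<xi> * ennreal ((g (?s *\<^sub>R \<xi>))\<^sup>2) \<partial>lborel) \<le> (\<integral>\<^sup>+\<xi>. (\<lambda>\<eta>. ennreal 2 * (K t \<eta> * ennreal ((g \<eta>)\<^sup>2))) (0 + ?s *\<^sub>R \<xi>) \<partial>lborel)"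
    proof (rule nn_integral_mono)
      fix \<xi>
      have "ennreal (k t \<xi>) * ennreal ((g (?s *\<^sub>R \<xi>))\<^sup>2) \<le> ennreal (2 * k t (0 + ?s *\<^sub>R \<xi>)) * ennreal ((g (?s *\<^sub>R \<xi>))\<^sup>2)"
        by (intro mult_right_mono ennreal_leI le) auto
      also have "\<dots> = ennreal 2 * (ennreal (k t (0 + ?s *\<^sub>R \<xi>)) * ennreal ((g (?s *\<^sub>R \<xi>))\<^sup>2))"
        by (subst ennreal_mult') (auto simp: mult.assoc)
      finally show "K t \<xi> * ennreal ((g (?s *\<^sub>R \<xi>))\<^sup>2) \<le> (\<lambda>\<eta>. ennreal 2 * (K t \<eta> * ennreal ((g \<eta>)\<^sup>2))) (0 + ?s *\<^sub>R \<xi>)"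
        using t by (simp add: K_def)
    qed
    also have "\<dots> = ennreal (1 / \<bar>?s\<bar> ^ DIM(real^'n)) * (\<integral>\<^sup>+\<eta>. ennreal 2 * (K t \<eta> * ennreal ((g \<eta>)\<^sup>2)) \<partial>lborel)"
      using s unfolding K_def by (intro nn_integral_affine) auto
    also have "\<dots> = ennreal (1 / ?s ^ ?n * 2) * (\<integral>\<^sup>+\<eta>. K t \<eta> * ennreal ((g \<eta>)\<^sup>2) \<partial>lborel)"
    proof -
      have "(\<integral>\<^sup>+\<eta>. ennreal 2 * (K t \<eta> * ennreal ((g \<eta>)\<^sup>2)) \<partial>lborel) = ennreal 2 * (\<integral>\<^sup>+\<eta>. K t \<eta> * ennreal ((g \<eta>)\<^sup>2) \<partial>lborel)"
        unfolding K_def by (rule nn_integral_cmult) measurable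
      moreover have "ennreal (1 / ?s ^ ?n * 2) = ennreal (1 / ?s ^ ?n) * ennreal 2"
        using s by (intro ennreal_mult) auto
      moreover have "\<bar>?s\<bar> = ?s" using s by linarith
      ultimately show ?thesis by (simp only: mult.assoc DIM_cart DIM_real mult_1_right)
    qed
    also have "\<dots> \<le> ennreal (2 ^ (?n + 1)) * (\<integral>\<^sup>+\<eta>. K t \<eta> * ennreal ((g \<eta>)\<^sup>2) \<partial>lborel)"
    proof (intro mult_right_mono ennreal_leI)
      have "(1 / 2) ^ ?n \<le> ?s ^ ?n" using s by (intro power_mono) auto
      then have "1 / ?s ^ ?n \<le> 1 / (1 / 2) ^ ?n" using s by (intro divide_left_mono) auto
      then show "1 / ?s ^ ?n * 2 \<le> 2 ^ (?n + 1)" by (simp add: power_divide)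
    qed auto
    finally show ?thesis .
  qed (simp add: K_def)
  have i2: "integrable lborel (\<lambda>x. (\<psi> x)\<^sup>2)" and i1: "integrable lborel \<psi>"
    using has_partial_continuous[OF \<psi>(1)] \<psi>(2)
    by (auto intro!: integrable_continuous_bounded_support continuous_intros bounded_support_mult simp: power2_eq_square)
  have iH: "integrable lborel ?H"
    by (intro integrable_continuous_bounded_support continuous_on_ray_transform bounded_support_ray_transform l \<phi> \<psi>')
  have "ennreal (?Z\<^sup>2 * (\<integral>y. (?H y)\<^sup>2 \<partial>lborel)) \<le> (\<integral>\<^sup>+\<xi>. ennreal ((cmod (fourier ?H \<xi>))\<^sup>2) \<partial>lborel)"
  proof -
    obtain B where "\<And>x. \<bar>?H x\<bar> \<le> B"
      using bounded_support_bounded[OF continuous_on_ray_transform[OF l \<phi> \<psi>'] bounded_support_ray_transform[OF l \<phi> \<psi>']] by blast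
    then show ?thesis
      by (intro le_nn_integral_cmod_fourier[OF iH] continuous_on_ray_transform l \<phi> \<psi>')
  qed
  also have "\<dots> \<le> (\<integral>\<^sup>+\<xi>. ennreal (A\<^sup>2 * (pi / (2 * \<rho>))) * (\<integral>\<^sup>+t. K t \<xi> * ennreal ((g ((1 - 1 / t) *\<^sub>R \<xi>))\<^sup>2) \<partial>lborel) \<partial>lborel)"
    by (intro nn_integral_mono sq)
  also have "\<dots> = ennreal (A\<^sup>2 * (pi / (2 * \<rho>))) * (\<integral>\<^sup>+\<xi>. \<integral>\<^sup>+t. K t \<xi> * ennreal ((g ((1 - 1 / t) *\<^sub>R \<xi>))\<^sup>2) \<partial>lborel \<partial>lborel)"
    unfolding K_def k_def by (rule nn_integral_cmult) measurable
  also have "(\<integral>\<^sup>+\<xi>. \<integral>\<^sup>+t. K t \<xi> * ennreal ((g ((1 - 1 / t) *\<^sub>R \<xi>))\<^sup>2) \<partial>lborel \<partial>lborel) = (\<integral>\<^sup>+t. \<integral>\<^sup>+\<xi>. K t \<xi> * ennreal ((g ((1 - 1 / t) *\<^sub>R \<xi>))\<^sup>2) \<partial>lborel \<partial>lborel)"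
    unfolding K_def k_def by (rule lborel_pair.Fubini') measurable
  also have "\<dots> \<le> (\<integral>\<^sup>+t. ennreal (2 ^ (?n + 1)) * (\<integral>\<^sup>+\<xi>. K t \<xi> * ennreal ((g \<xi>)\<^sup>2) \<partial>lborel) \<partial>lborel)"
    by (intro nn_integral_mono scale)
  also have "\<dots> = ennreal (2 ^ (?n + 1)) * (\<integral>\<^sup>+t. \<integral>\<^sup>+\<xi>. K t \<xi> * ennreal ((g \<xi>)\<^sup>2) \<partial>lborel \<partial>lborel)"
    unfolding K_def k_def by (rule nn_integral_cmult) measurable
  also have "(\<integral>\<^sup>+t. \<integral>\<^sup>+\<xi>. K t \<xi> * ennreal ((g \<xi>)\<^sup>2) \<partial>lborel \<partial>lborel) = (\<integral>\<^sup>+\<xi>. \<integral>\<^sup>+t. K t \<xi> * ennreal ((g \<xi>)\<^sup>2) \<partial>lborel \<partial>lborel)"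
    unfolding K_def k_def by (rule lborel_pair.Fubini') measurable
  also have "\<dots> = (\<integral>\<^sup>+\<xi>. (\<integral>\<^sup>+t. K t \<xi> \<partial>lborel) * ennreal ((g \<xi>)\<^sup>2) \<partial>lborel)"
    unfolding K_def by (intro nn_integral_cong nn_integral_multc) measurable
  also have "\<dots> \<le> (\<integral>\<^sup>+\<xi>. ennreal (pi / (2 * \<rho>)) * ennreal ((g \<xi>)\<^sup>2) \<partial>lborel)"
    by (intro nn_integral_mono mult_right_mono mass) auto
  also have "\<dots> = ennreal (pi / (2 * \<rho>)) * (\<integral>\<^sup>+\<xi>. ennreal ((cmod (fourier \<psi> \<xi>))\<^sup>2) \<partial>lborel)"
    unfolding g_def by (rule nn_integral_cmult) measurable
  also have "\<dots> \<le> ennreal (pi / (2 * \<rho>)) * ennreal (?Z\<^sup>2 * (\<integral>x. (\<psi> x)\<^sup>2 \<partial>lborel))"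
    by (intro mult_left_mono nn_integral_cmod_fourier_le i1 i2) auto
  finally have "ennreal (?Z\<^sup>2 * (\<integral>y. (?H y)\<^sup>2 \<partial>lborel))
     \<le> ennreal (A\<^sup>2 * (pi / (2 * \<rho>))) * (ennreal (2 ^ (?n + 1)) * (ennreal (pi / (2 * \<rho>)) * ennreal (?Z\<^sup>2 * (\<integral>x. (\<psi> x)\<^sup>2 \<partial>lborel))))"
    by (simp add: mult_left_mono)
  also have "\<dots> = ennreal ((A\<^sup>2 * (pi / (2 * \<rho>))) * (2 ^ (?n + 1) * ((pi / (2 * \<rho>)) * (?Z\<^sup>2 * (\<integral>x. (\<psi> x)\<^sup>2 \<partial>lborel)))))"
    using r by (simp only: ennreal_mult' zero_le_power zero_le_numeral mult_nonneg_nonneg zero_le_power2 divide_nonneg_nonneg pi_ge_zero less_imp_le)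
  finally have "?Z\<^sup>2 * (\<integral>y. (?H y)\<^sup>2 \<partial>lborel) \<le> (A\<^sup>2 * (pi / (2 * \<rho>))) * (2 ^ (?n + 1) * ((pi / (2 * \<rho>)) * (?Z\<^sup>2 * (\<integral>x. (\<psi> x)\<^sup>2 \<partial>lborel))))"
    using r by (subst (asm) ennreal_le_iff) auto
  also have "\<dots> = ?Z\<^sup>2 * ((A * pi / (2 * \<rho>))\<^sup>2 * 2 ^ (?n + 1) * (\<integral>x. (\<psi> x)\<^sup>2 \<partial>lborel))"
    by (simp add: power_mult_distrib power_divide power2_eq_square mult_ac)
  finally show ?thesis
    using gauss_mass_pos[where 'a="real^'n"] by simp
qed

section \<open>Square integrable functions\<close>

text \<open>Borel functions on the whole space, so that products and Fubini arguments stay within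
  \<open>lborel\<close>. The Lebesgue measurable functions of \<open>L2\<close> are tied to these by
  Borel representatives that vanish outside \<open>\<Omega>\<close>.\<close>

definition square_integrable :: "('a::euclidean_space \<Rightarrow> real) \<Rightarrow> bool" where
  "square_integrable f \<longleftrightarrow> f \<in> borel_measurable borel \<and> integrable lborel (\<lambda>x. (f x)\<^sup>2)"

definition l2norm :: "('a::euclidean_space \<Rightarrow> real) \<Rightarrow> real" where
  "l2norm f = sqrt (\<integral>x. (f x)\<^sup>2 \<partial>lborel)"

lemma l2norm_nonneg [simp]: "0 \<le> l2norm f"
  by (simp add: l2norm_def)

lemma l2norm_power2: "(l2norm f)\<^sup>2 = (\<integral>x. (f x)\<^sup>2 \<partial>lborel)"
  by (simp add: l2norm_def)

lemma nn_integral_square: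
  assumes "square_integrable f"
  shows "(\<integral>\<^sup>+x. ennreal ((f x)\<^sup>2) \<partial>lborel) = ennreal ((l2norm f)\<^sup>2)"
  using assms unfolding l2norm_power2 square_integrable_def by (intro nn_integral_eq_integral) auto

text \<open>Extracts the root from the Cauchy-Schwarz inequality for nonnegative integrals, which
  bounds a square.\<close>

lemma ennreal_power2_le_imp_le:
  fixes a b :: ennreal
  assumes "a\<^sup>2 \<le> b\<^sup>2" shows "a \<le> b"
proof (cases "b = top")
  case False
  then have "a \<noteq> top" using assms by (auto simp: top_unique power_eq_top_ennreal)
  with False obtain x y where xy: "a = ennreal x" "0 \<le> x" "b = ennreal y" "0 \<le> y"
    by (metis ennreal_cases)
  have "ennreal (x\<^sup>2) \<le> ennreal (y\<^sup>2)"
    using assms unfolding xy(1,3) ennreal_power[OF xy(2)] ennreal_power[OF xy(4)] .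
  then have "x\<^sup>2 \<le> y\<^sup>2" by (subst (asm) ennreal_le_iff) auto
  then have "x \<le> y" using xy(4) by (rule power2_le_imp_le)
  then show ?thesis unfolding xy(1,3) by (rule ennreal_leI)
qed simp

lemma nn_integral_mult_le_l2norm:
  assumes f: "square_integrable f" and g: "square_integrable g"
  shows "(\<integral>\<^sup>+x. ennreal (\<bar>f x\<bar> * \<bar>g x\<bar>) \<partial>lborel) \<le> ennreal (l2norm f * l2norm g)"
proof -
  have [measurable]: "f \<in> borel_measurable borel" "g \<in> borel_measurable borel"
    using f g by (auto simp: square_integrable_def)
  have "(\<integral>\<^sup>+x. ennreal (\<bar>f x\<bar> * \<bar>g x\<bar>) \<partial>lborel)\<^sup>2 = (\<integral>\<^sup>+x. ennreal \<bar>f x\<bar> * ennreal \<bar>g x\<bar> \<partial>lborel)\<^sup>2"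
    by (simp add: ennreal_mult')
  also have "\<dots> \<le> (\<integral>\<^sup>+x. (ennreal \<bar>f x\<bar>)\<^sup>2 \<partial>lborel) * (\<integral>\<^sup>+x. (ennreal \<bar>g x\<bar>)\<^sup>2 \<partial>lborel)"
    by (rule Cauchy_Schwarz_nn_integral) auto
  also have "\<dots> = ennreal ((l2norm f)\<^sup>2) * ennreal ((l2norm g)\<^sup>2)"
    by (simp add: ennreal_power nn_integral_square f g)
  also have "\<dots> = (ennreal (l2norm f * l2norm g))\<^sup>2"
    by (simp add: ennreal_mult' ennreal_power power_mult_distrib)
  finally show ?thesis
    by (rule ennreal_power2_le_imp_le)
qed

lemma integrable_mult_square_integrable:
  assumes f: "square_integrable f" and g: "square_integrable g"
  shows "integrable lborel (\<lambda>x. f x * g x)"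
proof (rule integrableI_bounded)
  show "(\<lambda>x. f x * g x) \<in> borel_measurable lborel"
    using f g by (auto simp: square_integrable_def)
  show "(\<integral>\<^sup>+x. ennreal (norm (f x * g x)) \<partial>lborel) < \<infinity>"
    using nn_integral_mult_le_l2norm[OF f g] by (simp add: abs_mult le_less_trans[OF _ ennreal_less_top])
qed

text \<open>Pairs \<open>f\<close> with the indicator of a set of finite measure.\<close>

lemma integrable_of_square_integrable:
  assumes f: "square_integrable f" and \<Omega>: "\<Omega> \<in> sets borel" "emeasure lborel \<Omega> < \<infinity>" and f0: "\<And>x. x \<notin> \<Omega> \<Longrightarrow> f x = 0"
  shows "integrable lborel f"
proof -
  have ind: "square_integrable (indicator \<Omega> :: 'a \<Rightarrow> real)"
    using \<Omega> by (auto simp: square_integrable_def power2_eq_square indicator_inter_arith[symmetric] intro!: integrable_real_indicator)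
  have "integrable lborel (\<lambda>x. indicator \<Omega> x * f x)"
    by (rule integrable_mult_square_integrable[OF ind f])
  moreover have "(\<lambda>x. indicator \<Omega> x * f x) = f" using f0 by (auto simp: indicator_def fun_eq_iff)
  ultimately show ?thesis by simp
qed

lemma abs_integral_mult_le_l2norm:
  assumes f: "square_integrable f" and g: "square_integrable g"
  shows "\<bar>\<integral>x. f x * g x \<partial>lborel\<bar> \<le> l2norm f * l2norm g"
proof -
  have "ennreal (norm (\<integral>x. f x * g x \<partial>lborel)) \<le> ennreal (l2norm f * l2norm g)"
    using order_trans[OF integral_norm_bound_ennreal' nn_integral_mult_le_l2norm[OF f g, folded abs_mult real_norm_def]] .
  then show ?thesis by (subst (asm) ennreal_le_iff) auto
qed

lemma square_integrable_bounded_support: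
  assumes "continuous_on UNIV f" "bounded_support f"
  shows "square_integrable f"
  unfolding square_integrable_def power2_eq_square
  using assms by (auto intro!: borel_measurable_continuous_onI integrable_continuous_bounded_support continuous_intros bounded_support_mult)

lemma l2norm_le_mult:
  assumes f: "square_integrable f" and le: "\<And>x. \<bar>g x\<bar> \<le> c * \<bar>f x\<bar>" and c: "0 \<le> c"
  shows "l2norm g \<le> c * l2norm f"
proof -
  have "(\<integral>x. (g x)\<^sup>2 \<partial>lborel) \<le> (\<integral>x. c\<^sup>2 * (f x)\<^sup>2 \<partial>lborel)"
  proof (rule integral_mono_AE')
    show "integrable lborel (\<lambda>x. c\<^sup>2 * (f x)\<^sup>2)"
      using f by (intro integrable_mult_right) (simp add: square_integrable_def)
    show "AE x in lborel. (g x)\<^sup>2 \<le> c\<^sup>2 * (f x)\<^sup>2"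
    proof (rule AE_I2)
      fix x
      have "\<bar>g x\<bar>\<^sup>2 \<le> (c * \<bar>f x\<bar>)\<^sup>2" by (intro power_mono le) auto
      then show "(g x)\<^sup>2 \<le> c\<^sup>2 * (f x)\<^sup>2" by (simp add: power_mult_distrib)
    qed
  qed auto
  then have "l2norm g \<le> sqrt (c\<^sup>2 * (\<integral>x. (f x)\<^sup>2 \<partial>lborel))"
    unfolding l2norm_def by simp
  then show ?thesis using c by (simp add: l2norm_def real_sqrt_mult)
qed

text \<open>The two bounds for the bilinear form with kernel \<open>\<eta> (x + t (y - x))\<close>: the first is Schur's
  test, the second Cauchy-Schwarz in \<open>y\<close> alone, which does not degenerate as \<open>t\<close> tends to \<open>1\<close>.\<close>

lemma ray_form_schur:
  fixes \<eta> f g :: "real^'n::finite \<Rightarrow> real"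
  assumes \<eta>: "integrable lborel \<eta>" and f: "square_integrable f" and g: "square_integrable g" and t: "t > 1"
  shows "(\<integral>\<^sup>+x. \<integral>\<^sup>+y. ennreal (\<bar>\<eta> (x + t *\<^sub>R (y - x))\<bar> * \<bar>f y\<bar> * \<bar>g x\<bar>) \<partial>lborel \<partial>lborel)
    \<le> ennreal ((1 / sqrt ((t * (t - 1)) ^ CARD('n))) * (\<integral>x. \<bar>\<eta> x\<bar> \<partial>lborel) * l2norm f * l2norm g)"
proof -
  let ?N = "\<integral>x. \<bar>\<eta> x\<bar> \<partial>lborel"
  have [measurable]: "\<eta> \<in> borel_measurable borel" "f \<in> borel_measurable borel" "g \<in> borel_measurable borel"
    using \<eta> f g by (auto simp: square_integrable_def)
  have N: "(\<integral>\<^sup>+x. ennreal \<bar>\<eta> x\<bar> \<partial>lborel) = ennreal ?N"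
    by (intro nn_integral_eq_integral integrable_abs \<eta>) auto
  have N0: "0 \<le> ?N" by simp
  \<comment> \<open>Each factor of Cauchy-Schwarz receives one square root of the kernel. After
    squaring, the kernel meets \<open>f\<close> in one factor and \<open>g\<close> in the other, and
    only its two marginals are left to compute.\<close>
  let ?e = "\<lambda>p. sqrt \<bar>\<eta> (fst p + t *\<^sub>R (snd p - fst p))\<bar>"
  have my: "(\<integral>\<^sup>+y. ennreal \<bar>\<eta> (x + t *\<^sub>R (y - x))\<bar> \<partial>lborel) = ennreal (?N / t ^ CARD('n))" for x
  proof -
    have "(\<integral>\<^sup>+y. ennreal \<bar>\<eta> (x + t *\<^sub>R (y - x))\<bar> \<partial>lborel) = (\<integral>\<^sup>+y. ennreal \<bar>\<eta> ((1 - t) *\<^sub>R x + t *\<^sub>R y)\<bar> \<partial>lborel)"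
      by (simp add: algebra_simps)
    also have "\<dots> = ennreal (1 / \<bar>t\<bar> ^ DIM(real^'n)) * ennreal ?N"
      using t N by (subst nn_integral_affine[where f="\<lambda>x. ennreal \<bar>\<eta> x\<bar>"]) auto
    finally show ?thesis using t by (simp add: ennreal_mult'[symmetric])
  qed
  have mx: "(\<integral>\<^sup>+x. ennreal \<bar>\<eta> (x + t *\<^sub>R (y - x))\<bar> \<partial>lborel) = ennreal (?N / (t - 1) ^ CARD('n))" for y
  proof -
    have "(\<integral>\<^sup>+x. ennreal \<bar>\<eta> (x + t *\<^sub>R (y - x))\<bar> \<partial>lborel) = (\<integral>\<^sup>+x. ennreal \<bar>\<eta> (t *\<^sub>R y + (1 - t) *\<^sub>R x)\<bar> \<partial>lborel)"
      by (simp add: algebra_simps)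
    also have "\<dots> = ennreal (1 / \<bar>1 - t\<bar> ^ DIM(real^'n)) * ennreal ?N"
      using t N by (subst nn_integral_affine[where f="\<lambda>x. ennreal \<bar>\<eta> x\<bar>"]) auto
    finally show ?thesis using t by (simp add: ennreal_mult'[symmetric])
  qed
  have A: "(\<integral>\<^sup>+p. (ennreal (?e p) * ennreal \<bar>f (snd p)\<bar>)\<^sup>2 \<partial>(lborel \<Otimes>\<^sub>M lborel)) = ennreal (?N / (t - 1) ^ CARD('n) * (l2norm f)\<^sup>2)"
  proof -
    have "(\<integral>\<^sup>+p. (ennreal (?e p) * ennreal \<bar>f (snd p)\<bar>)\<^sup>2 \<partial>(lborel \<Otimes>\<^sub>M lborel)) =
      (\<integral>\<^sup>+y. \<integral>\<^sup>+x. ennreal \<bar>\<eta> (x + t *\<^sub>R (y - x))\<bar> * ennreal ((f y)\<^sup>2) \<partial>lborel \<partial>lborel)"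
      by (subst lborel_pair.nn_integral_snd[symmetric]) (auto simp: power_mult_distrib ennreal_power)
    also have "\<dots> = (\<integral>\<^sup>+y. ennreal (?N / (t - 1) ^ CARD('n)) * ennreal ((f y)\<^sup>2) \<partial>lborel)"
      by (simp add: nn_integral_multc mx)
    also have "\<dots> = ennreal (?N / (t - 1) ^ CARD('n)) * ennreal ((l2norm f)\<^sup>2)"
      by (simp add: nn_integral_cmult nn_integral_square f)
    finally show ?thesis using t N0 by (subst ennreal_mult') auto
  qed
  have B: "(\<integral>\<^sup>+p. (ennreal (?e p) * ennreal \<bar>g (fst p)\<bar>)\<^sup>2 \<partial>(lborel \<Otimes>\<^sub>M lborel)) = ennreal (?N / t ^ CARD('n) * (l2norm g)\<^sup>2)"
  proof -
    have "(\<integral>\<^sup>+p. (ennreal (?e p) * ennreal \<bar>g (fst p)\<bar>)\<^sup>2 \<partial>(lborel \<Otimes>\<^sub>M lborel)) =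
      (\<integral>\<^sup>+x. \<integral>\<^sup>+y. ennreal \<bar>\<eta> (x + t *\<^sub>R (y - x))\<bar> * ennreal ((g x)\<^sup>2) \<partial>lborel \<partial>lborel)"
      by (subst lborel.nn_integral_fst[symmetric]) (auto simp: power_mult_distrib ennreal_power)
    also have "\<dots> = (\<integral>\<^sup>+x. ennreal (?N / t ^ CARD('n)) * ennreal ((g x)\<^sup>2) \<partial>lborel)"
      by (simp add: nn_integral_multc my)
    also have "\<dots> = ennreal (?N / t ^ CARD('n)) * ennreal ((l2norm g)\<^sup>2)"
      by (simp add: nn_integral_cmult nn_integral_square g)
    finally show ?thesis using t N0 by (subst ennreal_mult') auto
  qed
  have "(\<integral>\<^sup>+x. \<integral>\<^sup>+y. ennreal (\<bar>\<eta> (x + t *\<^sub>R (y - x))\<bar> * \<bar>f y\<bar> * \<bar>g x\<bar>) \<partial>lborel \<partial>lborel)\<^sup>2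
    = (\<integral>\<^sup>+p. (ennreal (?e p) * ennreal \<bar>f (snd p)\<bar>) * (ennreal (?e p) * ennreal \<bar>g (fst p)\<bar>) \<partial>(lborel \<Otimes>\<^sub>M lborel))\<^sup>2"
  proof -
    have "ennreal (?e p) * ennreal \<bar>f (snd p)\<bar> * (ennreal (?e p) * ennreal \<bar>g (fst p)\<bar>) =
        ennreal (\<bar>\<eta> (fst p + t *\<^sub>R (snd p - fst p))\<bar> * \<bar>f (snd p)\<bar> * \<bar>g (fst p)\<bar>)" for p
    proof -
      have "?e p * \<bar>f (snd p)\<bar> * (?e p * \<bar>g (fst p)\<bar>) = (?e p * ?e p) * \<bar>f (snd p)\<bar> * \<bar>g (fst p)\<bar>" by (simp only: mult_ac)
      also have "?e p * ?e p = \<bar>\<eta> (fst p + t *\<^sub>R (snd p - fst p))\<bar>" by simp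
      finally show ?thesis by (simp only: ennreal_mult'[symmetric] abs_ge_zero real_sqrt_ge_zero mult_nonneg_nonneg)
    qed
    then show ?thesis by (simp only:) (subst lborel.nn_integral_fst[symmetric], auto)
  qed
  also have "\<dots> \<le> (\<integral>\<^sup>+p. (ennreal (?e p) * ennreal \<bar>f (snd p)\<bar>)\<^sup>2 \<partial>(lborel \<Otimes>\<^sub>M lborel)) * (\<integral>\<^sup>+p. (ennreal (?e p) * ennreal \<bar>g (fst p)\<bar>)\<^sup>2 \<partial>(lborel \<Otimes>\<^sub>M lborel))"
    by (rule Cauchy_Schwarz_nn_integral) auto
  also have "\<dots> = ennreal ((?N / (t - 1) ^ CARD('n) * (l2norm f)\<^sup>2) * (?N / t ^ CARD('n) * (l2norm g)\<^sup>2))"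
    unfolding A B using t N0 by (intro ennreal_mult'[symmetric] mult_nonneg_nonneg divide_nonneg_nonneg) auto
  also have "(?N / (t - 1) ^ CARD('n) * (l2norm f)\<^sup>2) * (?N / t ^ CARD('n) * (l2norm g)\<^sup>2)
     = ((1 / sqrt ((t * (t - 1)) ^ CARD('n))) * ?N * l2norm f * l2norm g)\<^sup>2"
    using t by (simp add: power_mult_distrib power_divide power2_eq_square[of ?N] mult_ac)
  also have "ennreal (((1 / sqrt ((t * (t - 1)) ^ CARD('n))) * ?N * l2norm f * l2norm g)\<^sup>2) = (ennreal ((1 / sqrt ((t * (t - 1)) ^ CARD('n))) * ?N * l2norm f * l2norm g))\<^sup>2"
    using t N0 by (intro ennreal_power[symmetric] mult_nonneg_nonneg) auto
  finally show ?thesis by (rule ennreal_power2_le_imp_le)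
qed

lemma ray_form_volume:
  fixes \<eta> f g :: "real^'n::finite \<Rightarrow> real"
  assumes \<eta>: "square_integrable \<eta>" and f: "square_integrable f" and g: "square_integrable g" and t: "t \<ge> 1"
    and \<Omega>: "\<Omega> \<in> sets borel" "emeasure lborel \<Omega> < \<infinity>" and g0: "\<And>x. x \<notin> \<Omega> \<Longrightarrow> g x = 0"
  shows "(\<integral>\<^sup>+x. \<integral>\<^sup>+y. ennreal (\<bar>\<eta> (x + t *\<^sub>R (y - x))\<bar> * \<bar>f y\<bar> * \<bar>g x\<bar>) \<partial>lborel \<partial>lborel)
    \<le> ennreal (sqrt (measure lborel \<Omega>) * l2norm \<eta> * l2norm f * l2norm g)"
proof -
  have [measurable]: "\<eta> \<in> borel_measurable borel" "f \<in> borel_measurable borel" "g \<in> borel_measurable borel"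
    using \<eta> f g by (auto simp: square_integrable_def)
  \<comment> \<open>For \<open>t \<ge> 1\<close> the dilation in \<open>y\<close> can only lower the
    L2 norm of the kernel.\<close>
  have inner: "(\<integral>\<^sup>+y. ennreal (\<bar>\<eta> (x + t *\<^sub>R (y - x))\<bar> * \<bar>f y\<bar>) \<partial>lborel) \<le> ennreal (l2norm \<eta> * l2norm f)" for x
  proof -
    let ?h = "\<lambda>y. \<eta> (x + t *\<^sub>R (y - x))"
    have e: "?h y = \<eta> ((1 - t) *\<^sub>R x + t *\<^sub>R y)" for y by (simp add: algebra_simps)
    have "integrable lborel (\<lambda>y. (\<eta> ((1 - t) *\<^sub>R x + t *\<^sub>R y))\<^sup>2)"
      using integrable_affine_iff[of t "\<lambda>y. (\<eta> y)\<^sup>2" "(1 - t) *\<^sub>R x"] t \<eta> by (simp add: square_integrable_def)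
    then have sq: "square_integrable ?h"
      unfolding square_integrable_def e by simp
    have "(\<integral>y. (?h y)\<^sup>2 \<partial>lborel) = (1 / \<bar>t\<bar> ^ DIM(real^'n)) *\<^sub>R (\<integral>y. (\<eta> y)\<^sup>2 \<partial>lborel)"
      unfolding e using t by (subst integral_affine[where f="\<lambda>y. (\<eta> y)\<^sup>2"]) auto
    also have "\<dots> \<le> 1 * (\<integral>y. (\<eta> y)\<^sup>2 \<partial>lborel)"
      using t by (subst real_scaleR_def, intro mult_right_mono) (auto simp: divide_le_eq_1)
    finally have "l2norm ?h \<le> l2norm \<eta>" by (simp add: l2norm_def)
    then have "l2norm ?h * l2norm f \<le> l2norm \<eta> * l2norm f" by (intro mult_right_mono) auto
    then show ?thesis using nn_integral_mult_le_l2norm[OF sq f] by (meson ennreal_leI order_trans)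
  qed
  have ind: "square_integrable (indicator \<Omega> :: real^'n \<Rightarrow> real)"
    using \<Omega> by (auto simp: square_integrable_def power2_eq_square indicator_inter_arith[symmetric] intro!: integrable_real_indicator)
  have ind': "l2norm (indicator \<Omega> :: real^'n \<Rightarrow> real) = sqrt (measure lborel \<Omega>)"
  proof -
    have "(\<lambda>x. (indicator \<Omega> x :: real)\<^sup>2) = indicator \<Omega>" by (auto simp: indicator_def)
    then show ?thesis using \<Omega> by (simp add: l2norm_def)
  qed
  have "(\<integral>\<^sup>+x. \<integral>\<^sup>+y. ennreal (\<bar>\<eta> (x + t *\<^sub>R (y - x))\<bar> * \<bar>f y\<bar> * \<bar>g x\<bar>) \<partial>lborel \<partial>lborel)
    = (\<integral>\<^sup>+x. (\<integral>\<^sup>+y. ennreal (\<bar>\<eta> (x + t *\<^sub>R (y - x))\<bar> * \<bar>f y\<bar>) \<partial>lborel) * ennreal \<bar>g x\<bar> \<partial>lborel)"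
    by (intro nn_integral_cong) (subst nn_integral_multc[symmetric], auto simp: ennreal_mult'')
  also have "\<dots> \<le> (\<integral>\<^sup>+x. ennreal (l2norm \<eta> * l2norm f) * ennreal \<bar>g x\<bar> \<partial>lborel)"
    by (intro nn_integral_mono mult_right_mono inner) auto
  \<comment> \<open>Pairing \<open>\<bar>g x\<bar>\<close> with the indicator of
    \<open>\<Omega>\<close> will produce the square root of the volume.\<close>
  also have "\<dots> = ennreal (l2norm \<eta> * l2norm f) * (\<integral>\<^sup>+x. ennreal (\<bar>indicator \<Omega> x\<bar> * \<bar>g x\<bar>) \<partial>lborel)"
  proof -
    have "(\<integral>\<^sup>+x. ennreal \<bar>g x\<bar> \<partial>lborel) = (\<integral>\<^sup>+x. ennreal (\<bar>indicator \<Omega> x\<bar> * \<bar>g x\<bar>) \<partial>lborel)"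
      using g0 by (intro nn_integral_cong) (auto simp: indicator_def)
    then show ?thesis by (simp add: nn_integral_cmult)
  qed
  also have "\<dots> \<le> ennreal (l2norm \<eta> * l2norm f) * ennreal (l2norm (indicator \<Omega> :: real^'n \<Rightarrow> real) * l2norm g)"
    by (intro mult_left_mono nn_integral_mult_le_l2norm ind g) auto
  also have "\<dots> = ennreal (sqrt (measure lborel \<Omega>) * l2norm \<eta> * l2norm f * l2norm g)"
    unfolding ind' by (subst ennreal_mult'[symmetric]) (auto simp: mult_ac)
  finally show ?thesis .
qed

lemma borel_measurable_vec_nth_compose [measurable (raw)]:
  fixes f :: "'a \<Rightarrow> real^'n::finite"
  shows "f \<in> borel_measurable M \<Longrightarrow> (\<lambda>x. f x $ i) \<in> borel_measurable M"
  by (rule measurable_compose[where N=borel and g="\<lambda>x. x $ i"])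
     (auto intro!: borel_measurable_continuous_onI continuous_intros)

section \<open>The scalar ray operator and its weak derivative\<close>

text \<open>The kernel of the operator at index \<open>n - l + 1\<close>, with its arguments
  exchanged: the line starts at \<open>x\<close>, meets \<open>y\<close> at \<open>t = 1\<close>,
  and is followed beyond \<open>y\<close> through the support of the weight.\<close>

definition ray_kernel :: "nat \<Rightarrow> (real^'n::finite \<Rightarrow> real) \<Rightarrow> real^'n \<Rightarrow> real^'n \<Rightarrow> real" where
  "ray_kernel l \<theta> x y = (\<integral>t. indicator {1..} t * ray_weight CARD('n) l t * \<theta> (x + t *\<^sub>R (y - x)) \<partial>lborel)"

text \<open>The scalar building block: every coefficient of the form \<open>poincare\<close> is a
  finite signed sum of such terms.\<close>

definition ray_operator :: "nat \<Rightarrow> (real^'n::finite \<Rightarrow> real) \<Rightarrow> 'n \<Rightarrow> (real^'n \<Rightarrow> real) \<Rightarrow> real^'n \<Rightarrow> real" where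
  "ray_operator l \<theta> i f x = (\<integral>y. ray_kernel l \<theta> x y * (x $ i - y $ i) * f y \<partial>lborel)"

text \<open>The bilinear form at one \<open>t\<close>, without the weight.\<close>

definition ray_slice :: "(real^'n::finite \<Rightarrow> real) \<Rightarrow> 'n \<Rightarrow> (real^'n \<Rightarrow> real) \<Rightarrow> (real^'n \<Rightarrow> real) \<Rightarrow> real \<Rightarrow> real" where
  "ray_slice \<theta> i f \<psi> t = (\<integral>y. f y * (\<integral>x. \<theta> (x + t *\<^sub>R (y - x)) * (x $ i - y $ i) * \<psi> x \<partial>lborel) \<partial>lborel)"

lemma ray_point:
  fixes x y :: "'a::real_vector"
  shows "x + t *\<^sub>R (y - x) = (1 - t) *\<^sub>R x + t *\<^sub>R y" "x + t *\<^sub>R (y - x) = t *\<^sub>R y + (1 - t) *\<^sub>R x"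
  by (simp_all add: algebra_simps)

section \<open>Mapping properties of the scalar ray operator\<close>

locale ray_setting =
  fixes l :: nat and \<Omega> :: "(real^'n::finite) set" and a :: "real^'n" and r :: real and \<theta> :: "real^'n \<Rightarrow> real"
  assumes l: "1 \<le> l" "l \<le> CARD('n)"
    and \<Omega>: "open \<Omega>" "bounded \<Omega>" and r: "0 < r" and ball: "ball a r \<subseteq> \<Omega>"
    and smooth: "smooth \<theta>" and \<theta>0: "\<And>x. x \<notin> ball a r \<Longrightarrow> \<theta> x = 0"
begin

abbreviation R where "R \<equiv> diameter \<Omega>"

lemma bounded_support_\<theta>: "bounded_support \<theta>"
proof -
  have "bounded (ball a r)" by simp
  then obtain b where "\<And>x. x \<in> ball a r \<Longrightarrow> norm x \<le> b" unfolding bounded_iff by blast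
  then show ?thesis using \<theta>0 unfolding bounded_support_def by blast
qed

lemma continuous_\<theta>: "continuous_on UNIV \<theta>"
  using smooth_continuous[OF smooth, of "[]"] by simp

lemma meas_\<theta> [measurable]: "\<theta> \<in> borel_measurable borel"
  by (rule borel_measurable_continuous_onI[OF continuous_\<theta>])

lemma meas_\<Omega> [measurable]: "\<Omega> \<in> sets borel"
  using \<Omega> by simp

lemma emeasure_\<Omega>: "emeasure lborel \<Omega> < \<infinity>"
  using emeasure_bounded_finite[OF \<Omega>(2)] .

lemma a_in: "a \<in> \<Omega>" using r ball by auto

lemma coord_diff_le:
  assumes "x \<in> \<Omega>" "z \<in> \<Omega>" shows "\<bar>x $ i - z $ i\<bar> \<le> R"
proof -
  have "\<bar>x $ i - z $ i\<bar> \<le> norm (x - z)" using component_le_norm_cart[of "x - z" i] by simp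
  also have "\<dots> \<le> R" using diameter_bounded_bound[OF \<Omega>(2) assms] by (simp add: dist_norm)
  finally show ?thesis .
qed

lemma R_nonneg: "0 \<le> R"
  using coord_diff_le[OF a_in a_in] by simp

lemma rho_le_R: "2 * r \<le> R"
proof -
  have "diameter (ball a r) \<le> R" by (rule diameter_subset[OF ball \<Omega>(2)])
  moreover have "diameter (ball a r) = 2 * r" using r by (simp add: diameter_ball)
  ultimately show ?thesis by simp
qed

text \<open>Both \<open>x\<close> and the point of the support that the ray reaches at
  \<open>t\<close> lie in \<open>\<Omega>\<close>, and their difference is \<open>t\<close> times
  \<open>x - y\<close>; so the diameter gets divided by \<open>t\<close>, wherever \<open>y\<close>
  lies.\<close>

lemma ray_diff_le:
  assumes x: "x \<in> \<Omega>" and t: "t \<ge> 1" and z: "\<eta> (x + t *\<^sub>R (y - x)) \<noteq> 0" and \<eta>: "\<And>x. x \<notin> ball a r \<Longrightarrow> \<eta> x = 0"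
  shows "\<bar>x $ i - y $ i\<bar> \<le> R / t"
proof -
  let ?z = "x + t *\<^sub>R (y - x)"
  have "?z \<in> \<Omega>" using z \<eta> ball by blast
  then have "\<bar>x $ i - ?z $ i\<bar> \<le> R" by (rule coord_diff_le[OF x])
  moreover have "x $ i - ?z $ i = t * (x $ i - y $ i)" by (simp add: algebra_simps)
  ultimately have "\<bar>t * (x $ i - y $ i)\<bar> \<le> R" by (simp only:)
  then have "t * \<bar>x $ i - y $ i\<bar> \<le> R" using t by (simp add: abs_mult)
  then show ?thesis using t by (simp add: pos_le_divide_eq mult.commute)
qed

text \<open>By \<open>ray_diff_le\<close> the coordinate difference has become \<open>1 / t\<close>,
  with the diameter kept apart as a constant.\<close>

definition slice_majorant :: "real \<Rightarrow> real^'n \<Rightarrow> real^'n \<Rightarrow> real" where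
  "slice_majorant t x y = indicator {1..} t * (ray_weight CARD('n) l t / t) * \<bar>\<theta> (x + t *\<^sub>R (y - x))\<bar>"

lemma slice_majorant_nonneg: "0 \<le> slice_majorant t x y"
  using ray_weight_bounds(1)[OF l, of t] by (simp add: slice_majorant_def indicator_def)

lemma integrable_\<theta>: "integrable lborel \<theta>"
  by (rule integrable_continuous_bounded_support[OF continuous_\<theta> bounded_support_\<theta>])

lemma nn_integral_\<theta>: "(\<integral>\<^sup>+x. ennreal \<bar>\<theta> x\<bar> \<partial>lborel) = ennreal (\<integral>x. \<bar>\<theta> x\<bar> \<partial>lborel)"
  by (intro nn_integral_eq_integral integrable_abs integrable_\<theta>) auto

lemma nn_integral_inverse_square_finite: "(\<integral>\<^sup>+t. ennreal (indicator {1..} t * (c / t\<^sup>2)) \<partial>lborel) < \<infinity>"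
proof -
  have "(\<integral>\<^sup>+t. ennreal (indicator {1..} t * (c / t\<^sup>2)) \<partial>lborel) \<le> (\<integral>\<^sup>+t. ennreal (norm (indicator {1..} t * (c / t\<^sup>2))) \<partial>lborel)"
    by (intro nn_integral_mono ennreal_leI) (simp only: real_norm_def abs_ge_self)
  also have "\<dots> < \<infinity>" using integrable_inverse_square[of c] unfolding integrable_iff_bounded by simp
  finally show ?thesis .
qed

lemma slice_majorant_integral_y: "\<exists>M<\<infinity>. \<forall>x. (\<integral>\<^sup>+t. \<integral>\<^sup>+y. ennreal (slice_majorant t x y) \<partial>lborel \<partial>lborel) \<le> M"
proof (intro exI conjI allI)
  let ?N = "\<integral>x. \<bar>\<theta> x\<bar> \<partial>lborel"
  show "(\<integral>\<^sup>+t. ennreal (indicator {1..} t * (?N / t\<^sup>2)) \<partial>lborel) < \<infinity>" by (rule nn_integral_inverse_square_finite)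
  fix x
  show "(\<integral>\<^sup>+t. \<integral>\<^sup>+y. ennreal (slice_majorant t x y) \<partial>lborel \<partial>lborel) \<le> (\<integral>\<^sup>+t. ennreal (indicator {1..} t * (?N / t\<^sup>2)) \<partial>lborel)"
  proof (rule nn_integral_mono)
    fix t
    show "(\<integral>\<^sup>+y. ennreal (slice_majorant t x y) \<partial>lborel) \<le> ennreal (indicator {1..} t * (?N / t\<^sup>2))"
    proof (cases "t \<ge> 1")
      case t: True
      have w: "0 \<le> ray_weight CARD('n) l t / t" using ray_weight_bounds(1)[OF l t] t by simp
      have "(\<integral>\<^sup>+y. ennreal (slice_majorant t x y) \<partial>lborel) = (\<integral>\<^sup>+y. ennreal (ray_weight CARD('n) l t / t) * ennreal \<bar>\<theta> ((1 - t) *\<^sub>R x + t *\<^sub>R y)\<bar> \<partial>lborel)"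
        unfolding slice_majorant_def ray_point(1) using t w by (intro nn_integral_cong) (simp add: ennreal_mult'[symmetric])
      also have "\<dots> = ennreal (ray_weight CARD('n) l t / t) * (ennreal (1 / \<bar>t\<bar> ^ DIM(real^'n)) * (\<integral>\<^sup>+y. ennreal \<bar>\<theta> y\<bar> \<partial>lborel))"
        using t by (subst nn_integral_cmult, simp, subst nn_integral_affine[where f="\<lambda>x. ennreal \<bar>\<theta> x\<bar>"]) auto
      also have "\<dots> = ennreal (ray_weight CARD('n) l t / (t * t ^ CARD('n)) * ?N)"
        unfolding nn_integral_\<theta> using t w by (simp add: ennreal_mult'[symmetric])
      also have "\<dots> \<le> ennreal (1 / t\<^sup>2 * ?N)"
        by (intro ennreal_leI mult_right_mono ray_weight_bounds(2)[OF l t]) auto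
      finally show ?thesis using t by simp
    qed (simp add: slice_majorant_def)
  qed
qed

text \<open>The marginal in \<open>x\<close> scales like \<open>1 / (t - 1) ^ n\<close>, which is
  useless near \<open>t = 1\<close>. There the supremum of \<open>\<theta>\<close> and the finite
  volume of \<open>\<Omega>\<close> take over.\<close>

lemma slice_majorant_integral_x: "\<exists>M<\<infinity>. \<forall>y. (\<integral>\<^sup>+t. \<integral>\<^sup>+x. ennreal (indicator \<Omega> x * slice_majorant t x y) \<partial>lborel \<partial>lborel) \<le> M"
proof -
  let ?N = "\<integral>x. \<bar>\<theta> x\<bar> \<partial>lborel"
  obtain B where B: "\<And>x. \<bar>\<theta> x\<bar> \<le> B" using bounded_support_bounded[OF continuous_\<theta> bounded_support_\<theta>] by blast
  then have B0: "0 \<le> B" using abs_ge_zero order_trans by blast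
  \<comment> \<open>The first summand serves \<open>t \<ge> 2\<close>, the second serves
    \<open>1 \<le> t < 2\<close>.\<close>
  define c where "c = 2 ^ CARD('n) * ?N + 2 ^ CARD('n) * 4 * B * measure lborel \<Omega>"
  have "(\<integral>\<^sup>+x. ennreal (indicator \<Omega> x * slice_majorant t x y) \<partial>lborel) \<le> ennreal (indicator {1..} t * (c / t\<^sup>2))" for t y
  proof -
    consider "t < 1" | "1 \<le> t" "t < 2" | "2 \<le> t" by linarith
    then show ?thesis
    proof cases
      case 1 then show ?thesis by (simp add: slice_majorant_def)
    next
      case 2
      have "(\<integral>\<^sup>+x. ennreal (indicator \<Omega> x * slice_majorant t x y) \<partial>lborel) \<le> (\<integral>\<^sup>+x. ennreal (2 ^ CARD('n) * 4 / t\<^sup>2 * B) * indicator \<Omega> x \<partial>lborel)"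
      proof (rule nn_integral_mono)
        fix x
        have "ray_weight CARD('n) l t / t = t ^ CARD('n) * (ray_weight CARD('n) l t / (t * t ^ CARD('n)))" using 2 by simp
        also have "\<dots> \<le> 2 ^ CARD('n) * (1 / t\<^sup>2)"
          using 2 ray_weight_bounds[OF l, of t] by (intro mult_mono power_mono) auto
        also have "\<dots> \<le> 2 ^ CARD('n) * 4 / t\<^sup>2" by (simp add: divide_right_mono)
        finally have "slice_majorant t x y \<le> 2 ^ CARD('n) * 4 / t\<^sup>2 * B"
          using 2 B[of "x + t *\<^sub>R (y - x)"] by (simp only: slice_majorant_def indicator_simps(1) atLeast_iff mult_1 mult_mono' abs_ge_zero)
            (intro mult_mono, auto)
        then show "ennreal (indicator \<Omega> x * slice_majorant t x y) \<le> ennreal (2 ^ CARD('n) * 4 / t\<^sup>2 * B) * indicator \<Omega> x"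
          by (cases "x \<in> \<Omega>") (auto intro: ennreal_leI)
      qed
      also have "\<dots> = ennreal (2 ^ CARD('n) * 4 / t\<^sup>2 * B) * ennreal (measure lborel \<Omega>)"
        using emeasure_\<Omega> by (simp add: nn_integral_cmult_indicator emeasure_eq_ennreal_measure top.not_eq_extremum)
      also have "\<dots> = ennreal (2 ^ CARD('n) * 4 * B * measure lborel \<Omega> / t\<^sup>2)"
        using B0 by (simp add: ennreal_mult'[symmetric])
      also have "\<dots> \<le> ennreal (c / t\<^sup>2)"
        unfolding c_def by (intro ennreal_leI divide_right_mono) auto
      finally show ?thesis using 2 by simp
    next
      case 3
      have w: "0 \<le> ray_weight CARD('n) l t / t" using ray_weight_bounds(1)[OF l, of t] 3 by simp
      have "(\<integral>\<^sup>+x. ennreal (indicator \<Omega> x * slice_majorant t x y) \<partial>lborel) \<le> (\<integral>\<^sup>+x. ennreal (ray_weight CARD('n) l t / t) * ennreal \<bar>\<theta> (t *\<^sub>R y + (1 - t) *\<^sub>R x)\<bar> \<partial>lborel)"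
      proof (rule nn_integral_mono)
        fix x
        have "indicator \<Omega> x * slice_majorant t x y \<le> 1 * slice_majorant t x y" by (intro mult_right_mono slice_majorant_nonneg) (auto simp: indicator_def)
        also have "\<dots> = ray_weight CARD('n) l t / t * \<bar>\<theta> (t *\<^sub>R y + (1 - t) *\<^sub>R x)\<bar>"
          unfolding slice_majorant_def ray_point(2) using 3 by simp
        finally show "ennreal (indicator \<Omega> x * slice_majorant t x y) \<le> ennreal (ray_weight CARD('n) l t / t) * ennreal \<bar>\<theta> (t *\<^sub>R y + (1 - t) *\<^sub>R x)\<bar>"
          using w by (simp only: ennreal_mult'[symmetric] ennreal_leI)
      qed
      also have "\<dots> = ennreal (ray_weight CARD('n) l t / t) * (ennreal (1 / \<bar>1 - t\<bar> ^ DIM(real^'n)) * (\<integral>\<^sup>+y. ennreal \<bar>\<theta> y\<bar> \<partial>lborel))"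
        using 3 by (subst nn_integral_cmult, simp, subst nn_integral_affine[where f="\<lambda>x. ennreal \<bar>\<theta> x\<bar>"]) auto
      also have "\<dots> = ennreal (ray_weight CARD('n) l t / (t * (t - 1) ^ CARD('n)) * ?N)"
        unfolding nn_integral_\<theta> using 3 w by (simp add: ennreal_mult'[symmetric])
      also have "\<dots> \<le> ennreal (2 ^ CARD('n) / t\<^sup>2 * ?N)"
        by (intro ennreal_leI mult_right_mono ray_weight_le(2)[OF l 3]) auto
      also have "\<dots> \<le> ennreal (c / t\<^sup>2)"
        unfolding c_def times_divide_eq_left using B0 by (intro ennreal_leI divide_right_mono) auto
      finally show ?thesis using 3 by simp
    qed
  qed
  then show ?thesis
    using nn_integral_inverse_square_finite[of c]
    by (intro exI[of _ "\<integral>\<^sup>+t. ennreal (indicator {1..} t * (c / t\<^sup>2)) \<partial>lborel"] conjI allI nn_integral_mono)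
qed

text \<open>The value lives in \<open>ennreal\<close> because the integral can diverge, for instance
  at \<open>x = y\<close> when \<open>\<theta> x\<close> is not 0. Its two marginals are uniformly
  bounded, as Schur's test requires.\<close>

definition kernel_majorant :: "real^'n \<Rightarrow> real^'n \<Rightarrow> ennreal" where
  "kernel_majorant x y = (\<integral>\<^sup>+t. ennreal (indicator \<Omega> x * slice_majorant t x y) \<partial>lborel)"

lemma kernel_majorant_measurable [measurable (raw)]:
  assumes "g \<in> borel_measurable M" "h \<in> borel_measurable M"
  shows "(\<lambda>x. kernel_majorant (g x) (h x)) \<in> borel_measurable M"
proof -
  have "(\<lambda>p. kernel_majorant (fst p) (snd p)) \<in> borel_measurable (borel \<Otimes>\<^sub>M borel)"
    unfolding kernel_majorant_def slice_majorant_def by measurable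
  from measurable_compose[OF measurable_Pair[OF assms] this] show ?thesis by simp
qed

lemma kernel_majorant_integral_y: "\<exists>M<\<infinity>. \<forall>x. (\<integral>\<^sup>+y. kernel_majorant x y \<partial>lborel) \<le> M"
proof -
  obtain M where M: "M < \<infinity>" "\<And>x. (\<integral>\<^sup>+t. \<integral>\<^sup>+y. ennreal (slice_majorant t x y) \<partial>lborel \<partial>lborel) \<le> M"
    using slice_majorant_integral_y by blast
  have "(\<integral>\<^sup>+y. kernel_majorant x y \<partial>lborel) \<le> M" for x
  proof -
    have "(\<integral>\<^sup>+y. kernel_majorant x y \<partial>lborel) \<le> (\<integral>\<^sup>+y. \<integral>\<^sup>+t. ennreal (slice_majorant t x y) \<partial>lborel \<partial>lborel)"
      unfolding kernel_majorant_def using slice_majorant_nonneg by (intro nn_integral_mono ennreal_leI) (auto simp: indicator_def)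
    also have "\<dots> = (\<integral>\<^sup>+t. \<integral>\<^sup>+y. ennreal (slice_majorant t x y) \<partial>lborel \<partial>lborel)"
      unfolding slice_majorant_def by (rule lborel_pair.Fubini') measurable
    finally show ?thesis using M(2)[of x] by simp
  qed
  then show ?thesis using M(1) by blast
qed

lemma kernel_majorant_integral_x: "\<exists>M<\<infinity>. \<forall>y. (\<integral>\<^sup>+x. kernel_majorant x y \<partial>lborel) \<le> M"
proof -
  obtain M where M: "M < \<infinity>" "\<And>y. (\<integral>\<^sup>+t. \<integral>\<^sup>+x. ennreal (indicator \<Omega> x * slice_majorant t x y) \<partial>lborel \<partial>lborel) \<le> M"
    using slice_majorant_integral_x by blast
  have "(\<integral>\<^sup>+x. kernel_majorant x y \<partial>lborel) \<le> M" for y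
  proof -
    have "(\<integral>\<^sup>+x. kernel_majorant x y \<partial>lborel) = (\<integral>\<^sup>+t. \<integral>\<^sup>+x. ennreal (indicator \<Omega> x * slice_majorant t x y) \<partial>lborel \<partial>lborel)"
      unfolding kernel_majorant_def slice_majorant_def by (rule lborel_pair.Fubini') measurable
    then show ?thesis using M(2)[of y] by simp
  qed
  then show ?thesis using M(1) by blast
qed

lemma kernel_majorant_integral_finite:
  assumes [measurable]: "F \<in> borel_measurable borel" and F: "(\<integral>\<^sup>+y. F y \<partial>lborel) < \<infinity>"
  shows "(\<integral>\<^sup>+x. \<integral>\<^sup>+y. kernel_majorant x y * F y \<partial>lborel \<partial>lborel) < \<infinity>"
proof -
  obtain M where M: "M < \<infinity>" "\<And>y. (\<integral>\<^sup>+x. kernel_majorant x y \<partial>lborel) \<le> M"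
    using kernel_majorant_integral_x by blast
  have "(\<integral>\<^sup>+x. \<integral>\<^sup>+y. kernel_majorant x y * F y \<partial>lborel \<partial>lborel) = (\<integral>\<^sup>+y. \<integral>\<^sup>+x. kernel_majorant x y * F y \<partial>lborel \<partial>lborel)"
    by (rule lborel_pair.Fubini') measurable
  also have "\<dots> = (\<integral>\<^sup>+y. (\<integral>\<^sup>+x. kernel_majorant x y \<partial>lborel) * F y \<partial>lborel)"
    by (intro nn_integral_cong nn_integral_multc) measurable
  also have "\<dots> \<le> (\<integral>\<^sup>+y. M * F y \<partial>lborel)"
    by (intro nn_integral_mono mult_right_mono M) auto
  also have "\<dots> = M * (\<integral>\<^sup>+y. F y \<partial>lborel)" by (rule nn_integral_cmult) measurable
  also have "\<dots> < \<infinity>" using M(1) F by (simp add: ennreal_mult_less_top)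
  finally show ?thesis .
qed

lemma ray_kernel_measurable [measurable (raw)]:
  assumes "g \<in> borel_measurable M" "h \<in> borel_measurable M"
  shows "(\<lambda>x. ray_kernel l \<theta> (g x) (h x)) \<in> borel_measurable M"
proof -
  have "(\<lambda>p. ray_kernel l \<theta> (fst p) (snd p)) \<in> borel_measurable (borel \<Otimes>\<^sub>M borel)"
    unfolding ray_kernel_def by measurable
  from measurable_compose[OF measurable_Pair[OF assms] this] show ?thesis by simp
qed

lemma ray_integrand_le:
  assumes x: "x \<in> \<Omega>"
  shows "ennreal \<bar>indicator {1..} t * ray_weight CARD('n) l t * \<theta> (x + t *\<^sub>R (y - x)) * (x $ i - y $ i)\<bar> \<le> ennreal R * ennreal (indicator \<Omega> x * slice_majorant t x y)"
proof -
  have "\<bar>indicator {1..} t * ray_weight CARD('n) l t * \<theta> (x + t *\<^sub>R (y - x)) * (x $ i - y $ i)\<bar> \<le> R * slice_majorant t x y"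
  proof (cases "t \<ge> 1 \<and> \<theta> (x + t *\<^sub>R (y - x)) \<noteq> 0")
    case True
    then have t: "t \<ge> 1" by simp
    have w: "0 \<le> ray_weight CARD('n) l t" by (rule ray_weight_bounds(1)[OF l t])
    have "ray_weight CARD('n) l t * \<bar>\<theta> (x + t *\<^sub>R (y - x))\<bar> * \<bar>x $ i - y $ i\<bar> \<le> ray_weight CARD('n) l t * \<bar>\<theta> (x + t *\<^sub>R (y - x))\<bar> * (R / t)"
      using w True by (intro mult_left_mono ray_diff_le[OF x t _ \<theta>0]) auto
    then show ?thesis using t w by (simp add: abs_mult slice_majorant_def mult_ac)
  next
    case False
    then show ?thesis using slice_majorant_nonneg R_nonneg by (auto simp: indicator_def)
  qed
  then show ?thesis using x R_nonneg by (simp add: ennreal_mult'[symmetric] ennreal_leI)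
qed

lemma ray_kernel_le:
  assumes x: "x \<in> \<Omega>"
  shows "ennreal \<bar>ray_kernel l \<theta> x y * (x $ i - y $ i)\<bar> \<le> ennreal R * kernel_majorant x y"
proof -
  have "ray_kernel l \<theta> x y * (x $ i - y $ i) = (\<integral>t. indicator {1..} t * ray_weight CARD('n) l t * \<theta> (x + t *\<^sub>R (y - x)) * (x $ i - y $ i) \<partial>lborel)"
    unfolding ray_kernel_def by simp
  then have "ennreal (norm (ray_kernel l \<theta> x y * (x $ i - y $ i)))
    \<le> (\<integral>\<^sup>+t. ennreal (norm (indicator {1..} t * ray_weight CARD('n) l t * \<theta> (x + t *\<^sub>R (y - x)) * (x $ i - y $ i))) \<partial>lborel)"
    by (simp only: integral_norm_bound_ennreal')
  also have "\<dots> \<le> (\<integral>\<^sup>+t. ennreal R * ennreal (indicator \<Omega> x * slice_majorant t x y) \<partial>lborel)"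
    using ray_integrand_le[OF x] by (intro nn_integral_mono) simp
  also have "\<dots> = ennreal R * kernel_majorant x y"
    unfolding kernel_majorant_def slice_majorant_def by (rule nn_integral_cmult) measurable
  finally show ?thesis by simp
qed

lemma ray_kernel_mult_le:
  assumes x: "x \<in> \<Omega>"
  shows "ennreal (norm (ray_kernel l \<theta> x y * (x $ i - y $ i) * c)) \<le> ennreal R * (kernel_majorant x y * ennreal \<bar>c\<bar>)"
proof -
  have "ennreal (norm (ray_kernel l \<theta> x y * (x $ i - y $ i) * c)) = ennreal \<bar>ray_kernel l \<theta> x y * (x $ i - y $ i)\<bar> * ennreal \<bar>c\<bar>"
    unfolding real_norm_def abs_mult[of _ c] by (rule ennreal_mult') simp
  also have "\<dots> \<le> (ennreal R * kernel_majorant x y) * ennreal \<bar>c\<bar>"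
    by (intro mult_right_mono ray_kernel_le x) simp
  finally show ?thesis by (simp add: mult.assoc)
qed

context
  fixes f :: "real^'n \<Rightarrow> real"
  assumes f: "square_integrable f" and f0: "\<And>x. x \<notin> \<Omega> \<Longrightarrow> f x = 0"
begin

lemma integrable_f: "integrable lborel f"
  by (rule integrable_of_square_integrable[OF f meas_\<Omega> emeasure_\<Omega> f0])

lemma meas_f: "f \<in> borel_measurable borel"
  using f by (auto simp: square_integrable_def)

lemma nn_f_finite: "(\<integral>\<^sup>+y. ennreal \<bar>f y\<bar> \<partial>lborel) < \<infinity>"
  using integrable_f unfolding integrable_iff_bounded by simp

text \<open>The double integral of the majorant against \<open>\<bar>f y\<bar>\<close> is finite, so
  almost every slice is. At such \<open>x\<close> the integral may later be exchanged with the
  finite sums over components.\<close>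

lemma AE_integrable_ray_kernel:
  "AE x in lborel. x \<in> \<Omega> \<longrightarrow> integrable lborel (\<lambda>y. ray_kernel l \<theta> x y * (x $ i - y $ i) * f y)"
proof -
  note [measurable] = meas_f
  have "(\<integral>\<^sup>+x. \<integral>\<^sup>+y. kernel_majorant x y * ennreal \<bar>f y\<bar> \<partial>lborel \<partial>lborel) \<noteq> \<infinity>"
    using kernel_majorant_integral_finite[of "\<lambda>y. ennreal \<bar>f y\<bar>"] nn_f_finite by auto
  then have "AE x in lborel. (\<integral>\<^sup>+y. kernel_majorant x y * ennreal \<bar>f y\<bar> \<partial>lborel) \<noteq> \<infinity>"
    by (intro nn_integral_PInf_AE) measurable
  then show ?thesis
  proof eventually_elim
    fix x assume fin: "(\<integral>\<^sup>+y. kernel_majorant x y * ennreal \<bar>f y\<bar> \<partial>lborel) \<noteq> \<infinity>"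
    show "x \<in> \<Omega> \<longrightarrow> integrable lborel (\<lambda>y. ray_kernel l \<theta> x y * (x $ i - y $ i) * f y)"
    proof
      assume x: "x \<in> \<Omega>"
      show "integrable lborel (\<lambda>y. ray_kernel l \<theta> x y * (x $ i - y $ i) * f y)"
      proof (rule integrableI_bounded)
        have "(\<integral>\<^sup>+y. ennreal (norm (ray_kernel l \<theta> x y * (x $ i - y $ i) * f y)) \<partial>lborel) \<le> (\<integral>\<^sup>+y. ennreal R * (kernel_majorant x y * ennreal \<bar>f y\<bar>) \<partial>lborel)"
          by (intro nn_integral_mono ray_kernel_mult_le x)
        also have "\<dots> = ennreal R * (\<integral>\<^sup>+y. kernel_majorant x y * ennreal \<bar>f y\<bar> \<partial>lborel)"
          by (rule nn_integral_cmult) measurable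
        also have "\<dots> < \<infinity>" using fin by (simp add: ennreal_mult_less_top top.not_eq_extremum)
        finally show "(\<integral>\<^sup>+y. ennreal (norm (ray_kernel l \<theta> x y * (x $ i - y $ i) * f y)) \<partial>lborel) < \<infinity>" .
      qed measurable
    qed
  qed
qed

lemma ray_operator_measurable: "ray_operator l \<theta> i f \<in> borel_measurable borel"
proof -
  note [measurable] = meas_f
  show ?thesis unfolding ray_operator_def by measurable
qed

text \<open>Schur's test: the marginal of \<open>kernel_majorant\<close> in \<open>y\<close> bounds
  the first Cauchy-Schwarz factor, and its marginal in \<open>x\<close> bounds the integral of the
  second. The resulting norm only has to be finite; the sharp constants come from the weak estimate
  of the derivative.\<close>

lemma square_integrable_ray_operator: "square_integrable (\<lambda>x. indicator \<Omega> x * ray_operator l \<theta> i f x)"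
  unfolding square_integrable_def
proof
  note [measurable] = meas_f ray_operator_measurable
  show m: "(\<lambda>x. indicator \<Omega> x * ray_operator l \<theta> i f x) \<in> borel_measurable borel" by measurable
  obtain M where M: "M < \<infinity>" "\<And>x. (\<integral>\<^sup>+y. kernel_majorant x y \<partial>lborel) \<le> M"
    using kernel_majorant_integral_y by blast
  have "ennreal ((indicator \<Omega> x * ray_operator l \<theta> i f x)\<^sup>2) \<le> (ennreal R)\<^sup>2 * (M * (\<integral>\<^sup>+y. kernel_majorant x y * ennreal ((f y)\<^sup>2) \<partial>lborel))" for x
  proof (cases "x \<in> \<Omega>")
    case x: True
    \<comment> \<open>The majorant is finite for almost every \<open>y\<close>, so its root can be
      taken in the reals; \<open>enn2real\<close> would return 0 at the exceptional points.\<close>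
    let ?s = "\<lambda>y. sqrt (enn2real (kernel_majorant x y))"
    have fin: "kernel_majorant x y \<noteq> \<infinity> \<Longrightarrow> ennreal (?s y) * ennreal (?s y) = kernel_majorant x y" for y
      by (subst ennreal_mult'[symmetric]) (auto simp: ennreal_enn2real top.not_eq_extremum)
    have "(\<integral>\<^sup>+y. kernel_majorant x y \<partial>lborel) \<noteq> \<infinity>" using M(1) M(2)[of x] by auto
    then have "AE y in lborel. kernel_majorant x y \<noteq> \<infinity>"
      by (intro nn_integral_PInf_AE) measurable
    then have AEs: "AE y in lborel. ennreal (?s y) * ennreal (?s y) = kernel_majorant x y"
      by eventually_elim (rule fin)
    have sq: "(ennreal c * ennreal \<bar>d\<bar>)\<^sup>2 = (ennreal c * ennreal c) * ennreal (d\<^sup>2)" for c d :: real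
      by (simp add: power_mult_distrib power2_eq_square[of "ennreal c"] ennreal_power)
    have "ennreal (norm (ray_operator l \<theta> i f x)) \<le> (\<integral>\<^sup>+y. ennreal (norm (ray_kernel l \<theta> x y * (x $ i - y $ i) * f y)) \<partial>lborel)"
      unfolding ray_operator_def by (rule integral_norm_bound_ennreal')
    also have "\<dots> \<le> (\<integral>\<^sup>+y. ennreal R * (kernel_majorant x y * ennreal \<bar>f y\<bar>) \<partial>lborel)"
      by (intro nn_integral_mono ray_kernel_mult_le x)
    also have "\<dots> = ennreal R * (\<integral>\<^sup>+y. kernel_majorant x y * ennreal \<bar>f y\<bar> \<partial>lborel)"
      by (rule nn_integral_cmult) measurable
    also have "(\<integral>\<^sup>+y. kernel_majorant x y * ennreal \<bar>f y\<bar> \<partial>lborel) = (\<integral>\<^sup>+y. ennreal (?s y) * (ennreal (?s y) * ennreal \<bar>f y\<bar>) \<partial>lborel)"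
      by (rule nn_integral_cong_AE) (use AEs in eventually_elim, simp only: mult.assoc[symmetric])
    finally have "ennreal \<bar>ray_operator l \<theta> i f x\<bar> \<le> ennreal R * (\<integral>\<^sup>+y. ennreal (?s y) * (ennreal (?s y) * ennreal \<bar>f y\<bar>) \<partial>lborel)" by simp
    then have "(ennreal \<bar>ray_operator l \<theta> i f x\<bar>)\<^sup>2 \<le> (ennreal R * (\<integral>\<^sup>+y. ennreal (?s y) * (ennreal (?s y) * ennreal \<bar>f y\<bar>) \<partial>lborel))\<^sup>2"
      by (rule power_mono) simp
    also have "\<dots> = (ennreal R)\<^sup>2 * (\<integral>\<^sup>+y. ennreal (?s y) * (ennreal (?s y) * ennreal \<bar>f y\<bar>) \<partial>lborel)\<^sup>2"
      by (rule power_mult_distrib)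
    also have "\<dots> \<le> (ennreal R)\<^sup>2 * ((\<integral>\<^sup>+y. (ennreal (?s y))\<^sup>2 \<partial>lborel) * (\<integral>\<^sup>+y. (ennreal (?s y) * ennreal \<bar>f y\<bar>)\<^sup>2 \<partial>lborel))"
      by (intro mult_left_mono Cauchy_Schwarz_nn_integral) auto
    also have "(\<integral>\<^sup>+y. (ennreal (?s y))\<^sup>2 \<partial>lborel) = (\<integral>\<^sup>+y. kernel_majorant x y \<partial>lborel)"
      by (rule nn_integral_cong_AE) (use AEs in eventually_elim, simp only: power2_eq_square)
    also have "(\<integral>\<^sup>+y. (ennreal (?s y) * ennreal \<bar>f y\<bar>)\<^sup>2 \<partial>lborel) = (\<integral>\<^sup>+y. kernel_majorant x y * ennreal ((f y)\<^sup>2) \<partial>lborel)"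
      by (rule nn_integral_cong_AE) (use AEs in eventually_elim, simp only: sq)
    also have "(ennreal R)\<^sup>2 * ((\<integral>\<^sup>+y. kernel_majorant x y \<partial>lborel) * (\<integral>\<^sup>+y. kernel_majorant x y * ennreal ((f y)\<^sup>2) \<partial>lborel)) \<le> (ennreal R)\<^sup>2 * (M * (\<integral>\<^sup>+y. kernel_majorant x y * ennreal ((f y)\<^sup>2) \<partial>lborel))"
      by (intro mult_left_mono mult_right_mono M) auto
    finally show ?thesis using x by (simp add: ennreal_power)
  qed simp
  then have "(\<integral>\<^sup>+x. ennreal ((indicator \<Omega> x * ray_operator l \<theta> i f x)\<^sup>2) \<partial>lborel) \<le> (\<integral>\<^sup>+x. (ennreal R)\<^sup>2 * (M * (\<integral>\<^sup>+y. kernel_majorant x y * ennreal ((f y)\<^sup>2) \<partial>lborel)) \<partial>lborel)"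
    by (intro nn_integral_mono)
  also have "\<dots> = (ennreal R)\<^sup>2 * (M * (\<integral>\<^sup>+x. \<integral>\<^sup>+y. kernel_majorant x y * ennreal ((f y)\<^sup>2) \<partial>lborel \<partial>lborel))"
    by (simp add: nn_integral_cmult)
  also have "\<dots> < \<infinity>"
    using M(1) kernel_majorant_integral_finite[of "\<lambda>y. ennreal ((f y)\<^sup>2)"] nn_integral_square[OF f] R_nonneg
    by (auto simp: ennreal_mult_less_top ennreal_power[of R])
  finally show "integrable lborel (\<lambda>x. (indicator \<Omega> x * ray_operator l \<theta> i f x)\<^sup>2)"
    using m by (intro integrableI_bounded) auto
qed

text \<open>Fubini in \<open>(x, y, t)\<close>, justified by \<open>kernel_majorant\<close>. It
  reduces the pairing to one \<open>t\<close> at a time; in use, \<open>\<psi>\<close> is a partial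
  derivative of a test function.\<close>

lemma ray_operator_pairing:
  assumes \<psi>: "continuous_on UNIV \<psi>" "bounded_support \<psi>" and \<psi>0: "\<And>x. x \<notin> \<Omega> \<Longrightarrow> \<psi> x = 0"
  shows "integrable lborel (\<lambda>t. indicator {1..} t * ray_weight CARD('n) l t * ray_slice \<theta> i f \<psi> t)"
    and "(\<integral>x. ray_operator l \<theta> i f x * \<psi> x \<partial>lborel) = (\<integral>t. indicator {1..} t * ray_weight CARD('n) l t * ray_slice \<theta> i f \<psi> t \<partial>lborel)"
proof -
  note [measurable] = meas_f
  have [measurable]: "\<psi> \<in> borel_measurable borel" by (rule borel_measurable_continuous_onI[OF \<psi>(1)])
  obtain B where B: "\<And>x. \<bar>\<psi> x\<bar> \<le> B" using bounded_support_bounded[OF \<psi>] by blast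
  then have B0: "0 \<le> B" using abs_ge_zero order_trans by blast
  define Q where "Q t p = indicator {1..} t * ray_weight CARD('n) l t * \<theta> (fst p + t *\<^sub>R (snd p - fst p)) * (fst p $ i - snd p $ i) * (f (snd p) * \<psi> (fst p))" for t and p :: "(real^'n) \<times> (real^'n)"
  interpret pair_sigma_finite "lborel \<Otimes>\<^sub>M lborel :: ((real^'n) \<times> (real^'n)) measure" "lborel :: real measure" ..
  have Qm [measurable]: "(\<lambda>q. Q (snd q) (fst q)) \<in> borel_measurable ((lborel \<Otimes>\<^sub>M lborel) \<Otimes>\<^sub>M lborel)"
    unfolding Q_def by measurable
  have Qle: "ennreal (norm (Q t (x, y))) \<le> ennreal (B * R) * (ennreal (indicator \<Omega> x * slice_majorant t x y) * ennreal \<bar>f y\<bar>)" for t x y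
  proof (cases "x \<in> \<Omega>")
    case True
    have "ennreal (norm (Q t (x, y))) = ennreal \<bar>indicator {1..} t * ray_weight CARD('n) l t * \<theta> (x + t *\<^sub>R (y - x)) * (x $ i - y $ i)\<bar> * (ennreal \<bar>f y\<bar> * ennreal \<bar>\<psi> x\<bar>)"
      unfolding Q_def fst_conv snd_conv real_norm_def abs_mult[of _ "f y * _"] abs_mult[of "f y"]
      by (simp only: ennreal_mult'' abs_ge_zero mult_nonneg_nonneg)
    also have "\<dots> \<le> (ennreal R * ennreal (indicator \<Omega> x * slice_majorant t x y)) * (ennreal \<bar>f y\<bar> * ennreal B)"
      by (intro mult_mono ray_integrand_le[OF True] ennreal_leI B) auto
    also have "\<dots> = ennreal (B * R) * (ennreal (indicator \<Omega> x * slice_majorant t x y) * ennreal \<bar>f y\<bar>)"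
      using B0 R_nonneg by (simp add: ennreal_mult mult_ac)
    finally show ?thesis .
  qed (simp add: Q_def \<psi>0)
  have Qi: "integrable ((lborel \<Otimes>\<^sub>M lborel) \<Otimes>\<^sub>M lborel) (\<lambda>q. Q (snd q) (fst q))"
  proof (rule integrableI_bounded)
    have "(\<integral>\<^sup>+q. ennreal (norm (Q (snd q) (fst q))) \<partial>((lborel \<Otimes>\<^sub>M lborel) \<Otimes>\<^sub>M lborel)) = (\<integral>\<^sup>+x. \<integral>\<^sup>+y. \<integral>\<^sup>+t. ennreal (norm (Q t (x, y))) \<partial>lborel \<partial>lborel \<partial>lborel)"
      by (subst lborel.nn_integral_fst[symmetric], measurable) (subst lborel.nn_integral_fst[symmetric], auto)
    also have "\<dots> \<le> (\<integral>\<^sup>+x. \<integral>\<^sup>+y. \<integral>\<^sup>+t. ennreal (B * R) * (ennreal (indicator \<Omega> x * slice_majorant t x y) * ennreal \<bar>f y\<bar>) \<partial>lborel \<partial>lborel \<partial>lborel)"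
      by (intro nn_integral_mono Qle)
    also have "\<dots> = ennreal (B * R) * (\<integral>\<^sup>+x. \<integral>\<^sup>+y. kernel_majorant x y * ennreal \<bar>f y\<bar> \<partial>lborel \<partial>lborel)"
      unfolding kernel_majorant_def slice_majorant_def by (simp add: nn_integral_cmult nn_integral_multc)
    also have "\<dots> < \<infinity>"
      using kernel_majorant_integral_finite[of "\<lambda>y. ennreal \<bar>f y\<bar>"] nn_f_finite by (auto simp: ennreal_mult_less_top)
    finally show "(\<integral>\<^sup>+q. ennreal (norm (Q (snd q) (fst q))) \<partial>((lborel \<Otimes>\<^sub>M lborel) \<Otimes>\<^sub>M lborel)) < \<infinity>" .
  qed (rule Qm)
  have J: "(\<integral>p. Q t p \<partial>(lborel \<Otimes>\<^sub>M lborel)) = indicator {1..} t * ray_weight CARD('n) l t * ray_slice \<theta> i f \<psi> t" for t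
  proof (cases "t \<ge> 1")
    case t: True
    obtain C where C: "\<And>x. \<bar>\<theta> x\<bar> \<le> C" using bounded_support_bounded[OF continuous_\<theta> bounded_support_\<theta>] by blast
    have "integrable (lborel \<Otimes>\<^sub>M lborel) (\<lambda>p. Q t p)"
    proof (rule Bochner_Integration.integrable_bound)
      have "integrable (lborel \<Otimes>\<^sub>M lborel) (\<lambda>p. \<psi> (fst p) * f (snd p))"
        by (intro lborel_pair.integrable_mult_prod integrable_f integrable_continuous_bounded_support \<psi>)
      then show "integrable (lborel \<Otimes>\<^sub>M lborel) (\<lambda>p. (ray_weight CARD('n) l t * C * R) * (\<psi> (fst p) * f (snd p)))"
        by (rule integrable_mult_right)
      show "AE p in lborel \<Otimes>\<^sub>M lborel. norm (Q t p) \<le> norm ((ray_weight CARD('n) l t * C * R) * (\<psi> (fst p) * f (snd p)))"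
      proof (rule AE_I2)
        fix p :: "(real^'n) \<times> (real^'n)"
        obtain x y where p: "p = (x, y)" by (cases p)
        have C0: "0 \<le> C" using C[of 0] by linarith
        show "norm (Q t p) \<le> norm ((ray_weight CARD('n) l t * C * R) * (\<psi> (fst p) * f (snd p)))"
        proof (cases "x \<in> \<Omega> \<and> y \<in> \<Omega>")
          case True
          have "\<bar>ray_weight CARD('n) l t\<bar> * \<bar>\<theta> (x + t *\<^sub>R (y - x))\<bar> * \<bar>x $ i - y $ i\<bar> * (\<bar>f y\<bar> * \<bar>\<psi> x\<bar>) \<le> \<bar>ray_weight CARD('n) l t\<bar> * C * R * (\<bar>f y\<bar> * \<bar>\<psi> x\<bar>)"
            using True C0 by (intro mult_right_mono mult_mono C coord_diff_le) auto
          then show ?thesis using t C0 R_nonneg by (simp add: p Q_def abs_mult mult_ac)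
        next
          case False
          then show ?thesis using f0 \<psi>0 by (auto simp: p Q_def)
        qed
      qed
    qed (unfold Q_def, measurable)
    then have "(\<integral>p. Q t p \<partial>(lborel \<Otimes>\<^sub>M lborel)) = (\<integral>y. \<integral>x. Q t (x, y) \<partial>lborel \<partial>lborel)"
      using lborel_pair.integral_snd[of "\<lambda>x y. Q t (x, y)"] by (simp add: case_prod_beta')
    also have "\<dots> = (\<integral>y. ray_weight CARD('n) l t * (f y * (\<integral>x. \<theta> (x + t *\<^sub>R (y - x)) * (x $ i - y $ i) * \<psi> x \<partial>lborel)) \<partial>lborel)"
      using t by (intro Bochner_Integration.integral_cong refl) (simp add: Q_def integral_mult_right_zero[symmetric] mult_ac del: integral_mult_right_zero)
    finally show ?thesis using t by (simp add: ray_slice_def)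
  qed (simp add: Q_def)
  have "(\<integral>x. ray_operator l \<theta> i f x * \<psi> x \<partial>lborel) = (\<integral>x. \<integral>y. (\<integral>t. Q t (x, y) \<partial>lborel) \<partial>lborel \<partial>lborel)"
  proof (rule Bochner_Integration.integral_cong[OF refl])
    fix x
    have "(\<integral>t. Q t (x, y) \<partial>lborel) = ray_kernel l \<theta> x y * (x $ i - y $ i) * f y * \<psi> x" for y
    proof -
      have "(\<integral>t. Q t (x, y) \<partial>lborel) = (\<integral>t. (indicator {1..} t * ray_weight CARD('n) l t * \<theta> (x + t *\<^sub>R (y - x))) * ((x $ i - y $ i) * f y * \<psi> x) \<partial>lborel)"
        unfolding Q_def fst_conv snd_conv by (simp only: mult.assoc)
      also have "\<dots> = ray_kernel l \<theta> x y * ((x $ i - y $ i) * f y * \<psi> x)"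
        unfolding ray_kernel_def by (rule integral_mult_left_zero)
      finally show ?thesis by (simp only: mult.assoc)
    qed
    then show "ray_operator l \<theta> i f x * \<psi> x = (\<integral>y. \<integral>t. Q t (x, y) \<partial>lborel \<partial>lborel)"
      by (simp add: ray_operator_def)
  qed
  also have "\<dots> = (\<integral>p. \<integral>t. Q t p \<partial>lborel \<partial>(lborel \<Otimes>\<^sub>M lborel))"
    using lborel_pair.integral_fst'[OF integrable_fst'[OF Qi]] by simp
  also have "\<dots> = (\<integral>t. \<integral>p. Q t p \<partial>(lborel \<Otimes>\<^sub>M lborel) \<partial>lborel)"
    using Fubini_integral[of "\<lambda>p t. Q t p"] Qi by (simp add: case_prod_beta')
  finally show "(\<integral>x. ray_operator l \<theta> i f x * \<psi> x \<partial>lborel) = (\<integral>t. indicator {1..} t * ray_weight CARD('n) l t * ray_slice \<theta> i f \<psi> t \<partial>lborel)"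
    by (simp add: J)
  show "integrable lborel (\<lambda>t. indicator {1..} t * ray_weight CARD('n) l t * ray_slice \<theta> i f \<psi> t)"
    using integrable_snd[of "\<lambda>p t. Q t p"] Qi by (simp add: case_prod_beta' J)
qed

end

end

lemma test_functions_partial_zero:
  assumes \<phi>: "\<phi> \<in> test_functions \<Omega>" and x: "x \<notin> \<Omega>"
  shows "partial_deriv j \<phi> x = 0"
proof (rule has_partial_zero_on_open[OF test_functions_has_partial[OF \<phi>], where U="- closure {x. \<phi> x \<noteq> 0}"])
  show "x \<in> - closure {x. \<phi> x \<noteq> 0}" using \<phi> x by (auto simp: test_functions_def)
  fix y assume "y \<in> - closure {x. \<phi> x \<noteq> 0}"
  then show "\<phi> y = 0" using closure_subset[of "{x. \<phi> x \<noteq> 0}"] by auto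
qed auto

section \<open>Interpolation and the weak bound for one component\<close>

lemma sqrt_power_powr:
  assumes "0 < s" shows "sqrt (s ^ n) = s powr (real n / 2)"
proof -
  have "sqrt (s ^ n) = (s powr real n) powr (1 / 2)"
    using assms by (simp add: powr_half_sqrt powr_realpow)
  then show ?thesis by (simp add: powr_powr)
qed

lemma ennreal_mult_add:
  assumes "0 \<le> c" "0 \<le> x" "0 \<le> y"
  shows "ennreal (c * x + y) = ennreal c * ennreal x + ennreal y"
  using assms by (simp add: ennreal_mult')

text \<open>The minimum of \<open>A\<close> and \<open>B\<close> lies below each of their weighted
  geometric means.\<close>

lemma interpolate_le:
  fixes X A B c :: real
  assumes "X \<le> A * c" "X \<le> B * c" "0 < A" "0 < B" "0 \<le> c" "0 \<le> lam" "lam \<le> 1"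
  shows "X \<le> A powr (1 - lam) * B powr lam * c"
proof -
  have "min A B = min A B powr (1 - lam) * min A B powr lam"
    using assms by (simp add: powr_add[symmetric])
  also have "\<dots> \<le> A powr (1 - lam) * B powr lam"
    using assms by (intro mult_mono powr_mono2) auto
  finally have "min A B * c \<le> A powr (1 - lam) * B powr lam * c"
    using assms by (intro mult_right_mono)
  moreover have "X \<le> min A B * c" using assms by (auto simp: min_def)
  ultimately show ?thesis by linarith
qed

text \<open>The source of the factor \<open>1 / e\<close> in the bound for
  \<open>t < 2\<close>.\<close>

lemma nn_integral_powr_shift:
  assumes e: "e > 0"
  shows "(\<integral>\<^sup>+t. ennreal (indicator {1..2} t * (t - 1) powr (e - 1)) \<partial>lborel) = ennreal (1 / e)"
proof -
  have "((\<lambda>x. x powr (e - 1)) has_integral (1 powr (e - 1 + 1) / (e - 1 + 1))) {0..1}"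
    using e by (intro has_integral_powr_from_0) auto
  then have "((\<lambda>x. x powr (e - 1)) has_integral (1 / e)) {0..1}" by simp
  then have "(\<integral>\<^sup>+x. ennreal (indicator {0..1} x * x powr (e - 1)) \<partial>lborel) = ennreal (1 / e)"
    by (intro nn_integral_has_integral_lebesgue) auto
  moreover have "(\<integral>\<^sup>+t. ennreal (indicator {1..2} t * (t - 1) powr (e - 1)) \<partial>lborel) = (\<integral>\<^sup>+t. (\<lambda>x. ennreal (indicator {0..1} x * x powr (e - 1))) (-1 + 1 *\<^sub>R t) \<partial>lborel)"
    by (intro nn_integral_cong) (auto simp: indicator_def)
  ultimately show ?thesis
    using nn_integral_affine[of "\<lambda>x. ennreal (indicator {0..1} x * x powr (e - 1))" 1 "-1"] by simp
qed

text \<open>One coefficient \<open>f\<close>, one coordinate \<open>i\<close> of the contraction,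
  one direction \<open>j\<close> of differentiation and one test function. All norms of the weight
  enter through a single \<open>M\<close>, with the powers of the diameter of the ball that scaling
  dictates.\<close>

locale ray_estimate = ray_setting l \<Omega> a r \<theta> for l and \<Omega> :: "(real^'n::finite) set" and a r \<theta> +
  fixes f :: "real^'n \<Rightarrow> real" and \<psi> :: "real^'n \<Rightarrow> real" and i j :: 'n and M :: real
  assumes \<theta>1: "\<And>x. x \<notin> ball a r \<Longrightarrow> partial_deriv j \<theta> x = 0"
    and f: "square_integrable f" and f0: "\<And>x. x \<notin> \<Omega> \<Longrightarrow> f x = 0"
    and \<psi>: "\<psi> \<in> test_functions \<Omega>"
    and M: "0 \<le> M"
    and N0: "(\<integral>x. \<bar>\<theta> x\<bar> \<partial>lborel) \<le> M"
    and N1: "(\<integral>x. \<bar>partial_deriv j \<theta> x\<bar> \<partial>lborel) \<le> M / (2 * r)"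
    and N2: "(\<integral>x. \<bar>partial_deriv j (partial_deriv j \<theta>) x\<bar> \<partial>lborel) \<le> M / (2 * r)\<^sup>2"
    and L0: "l2norm \<theta> \<le> M / sqrt ((2 * r) ^ CARD('n))"
    and L1: "l2norm (partial_deriv j \<theta>) \<le> M / (2 * r) / sqrt ((2 * r) ^ CARD('n))"
begin

abbreviation \<rho> where "\<rho> \<equiv> 2 * r"
abbreviation \<psi>' where "\<psi>' \<equiv> partial_deriv j \<psi>"
abbreviation \<theta>' where "\<theta>' \<equiv> partial_deriv j \<theta>"
abbreviation \<delta> where "\<delta> \<equiv> (if i = j then 1 else 0 :: real)"

lemma \<rho>_pos: "0 < \<rho>" using r by simp

lemma hp_\<psi>: "has_partial j \<psi> \<psi>'" by (rule test_functions_has_partial[OF \<psi>])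
lemma bs_\<psi>: "bounded_support \<psi>" by (rule test_functions_bounded_support[OF \<psi>])
lemma bs_\<psi>': "bounded_support \<psi>'" by (rule has_partial_bounded_support[OF hp_\<psi> bs_\<psi>])
lemmas cont_\<psi> = has_partial_continuous[OF hp_\<psi>]
lemma \<psi>0: "x \<notin> \<Omega> \<Longrightarrow> \<psi> x = 0" by (rule test_functions_zero[OF \<psi>])
lemma \<psi>'0: "x \<notin> \<Omega> \<Longrightarrow> \<psi>' x = 0" by (rule test_functions_partial_zero[OF \<psi>])
lemma sq_\<psi>: "square_integrable \<psi>" by (rule square_integrable_bounded_support[OF cont_\<psi>(1) bs_\<psi>])

lemma hp_\<theta>: "has_partial j \<theta> \<theta>'" using smooth_has_partial[OF smooth, of j "[]"] by simp
lemma hp_\<theta>': "has_partial j \<theta>' (partial_deriv j \<theta>')" using smooth_has_partial[OF smooth, of j "[j]"] by simp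
lemmas cont_\<theta> = has_partial_continuous[OF hp_\<theta>]
lemma bs_\<theta>': "bounded_support \<theta>'" by (rule has_partial_bounded_support[OF hp_\<theta> bounded_support_\<theta>])
lemma sq_\<theta>: "square_integrable \<theta>" "square_integrable \<theta>'"
  by (auto intro: square_integrable_bounded_support cont_\<theta> bounded_support_\<theta> bs_\<theta>')
lemma int_\<theta>': "integrable lborel \<theta>'"
  by (rule integrable_continuous_bounded_support[OF cont_\<theta>(2) bs_\<theta>'])

text \<open>What remains when all cancellation is given up. This suffices for \<open>t < 2\<close>
  and for the middle term beyond 2.\<close>

definition ray_form :: "(real^'n \<Rightarrow> real) \<Rightarrow> real \<Rightarrow> ennreal" where
  "ray_form \<eta> t = (\<integral>\<^sup>+x. \<integral>\<^sup>+y. ennreal (\<bar>\<eta> (x + t *\<^sub>R (y - x))\<bar> * \<bar>f y\<bar> * \<bar>\<psi> x\<bar>) \<partial>lborel \<partial>lborel)"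

lemma meas_f': "f \<in> borel_measurable borel" by (rule meas_f[OF f f0])
lemma meas_\<psi>: "\<psi> \<in> borel_measurable borel" using sq_\<psi> by (simp add: square_integrable_def)
lemma meas_\<theta>': "\<theta>' \<in> borel_measurable borel" using sq_\<theta> by (simp add: square_integrable_def)

lemma ray_form_swap:
  assumes [measurable]: "\<eta> \<in> borel_measurable borel"
  shows "ray_form \<eta> t = (\<integral>\<^sup>+y. \<integral>\<^sup>+x. ennreal (\<bar>\<eta> (x + t *\<^sub>R (y - x))\<bar> * \<bar>f y\<bar> * \<bar>\<psi> x\<bar>) \<partial>lborel \<partial>lborel)"
proof -
  note [measurable] = meas_f' meas_\<psi>
  show ?thesis unfolding ray_form_def by (rule lborel_pair.Fubini') measurable
qed

text \<open>The derivative moved onto \<open>\<theta>\<close> brings down \<open>1 - t\<close>,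
  which the bound \<open>R / t\<close> on the coordinate difference absorbs. Differentiating the
  coordinate itself, for \<open>i = j\<close>, gives the second term.\<close>

lemma ray_slice_low:
  assumes t: "1 \<le> t"
  shows "ennreal \<bar>ray_slice \<theta> i f \<psi>' t\<bar> \<le> ennreal R * ray_form \<theta>' t + ray_form \<theta> t"
proof -
  note [measurable] = meas_f' meas_\<psi> meas_\<theta>'
  \<comment> \<open>The partial derivative in direction \<open>j\<close>, with respect to
    \<open>x\<close>, of the weight times the coordinate difference.\<close>
  define D where "D x y = (1 - t) * \<theta>' (x + t *\<^sub>R (y - x)) * (x $ i - y $ i) + \<theta> (x + t *\<^sub>R (y - x)) * \<delta>" for x y
  have parts: "(\<integral>x. \<theta> (x + t *\<^sub>R (y - x)) * (x $ i - y $ i) * \<psi>' x \<partial>lborel) = - (\<integral>x. D x y * \<psi> x \<partial>lborel)" for y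
  proof -
    have "has_partial j (\<lambda>x. \<theta> (t *\<^sub>R y + (1 - t) *\<^sub>R x) * (x $ i - y $ i))
      (\<lambda>x. (1 - t) * \<theta>' (t *\<^sub>R y + (1 - t) *\<^sub>R x) * (x $ i - y $ i) + \<theta> (t *\<^sub>R y + (1 - t) *\<^sub>R x) * \<delta>)"
      by (rule has_partial_mult[OF has_partial_affine[OF hp_\<theta>] has_partial_component])
    from integration_by_parts_partial[OF hp_\<psi> this bs_\<psi>]
    show ?thesis unfolding D_def ray_point(2) .
  qed
  have D: "\<bar>D x y * \<psi> x\<bar> \<le> R * (\<bar>\<theta>' (x + t *\<^sub>R (y - x))\<bar> * \<bar>\<psi> x\<bar>) + \<bar>\<theta> (x + t *\<^sub>R (y - x))\<bar> * \<bar>\<psi> x\<bar>" for x y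
  proof (cases "x \<in> \<Omega>")
    case x: True
    let ?z = "x + t *\<^sub>R (y - x)"
    have "\<bar>(1 - t) * \<theta>' ?z * (x $ i - y $ i)\<bar> \<le> R * \<bar>\<theta>' ?z\<bar>"
    proof (cases "\<theta>' ?z = 0")
      case False
      have "\<bar>1 - t\<bar> * \<bar>x $ i - y $ i\<bar> \<le> t * (R / t)"
        using t by (intro mult_mono ray_diff_le[where \<eta>=\<theta>', OF x t False \<theta>1]) auto
      also have "t * (R / t) = R" using t by simp
      finally have "\<bar>1 - t\<bar> * \<bar>x $ i - y $ i\<bar> * \<bar>\<theta>' ?z\<bar> \<le> R * \<bar>\<theta>' ?z\<bar>" by (rule mult_right_mono) simp
      then show ?thesis by (simp add: abs_mult mult_ac)
    qed simp
    moreover have "\<bar>\<theta> ?z * \<delta>\<bar> \<le> \<bar>\<theta> ?z\<bar>" by simp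
    ultimately have "\<bar>D x y\<bar> \<le> R * \<bar>\<theta>' ?z\<bar> + \<bar>\<theta> ?z\<bar>"
      unfolding D_def by (intro order_trans[OF abs_triangle_ineq] add_mono)
    then have "\<bar>D x y\<bar> * \<bar>\<psi> x\<bar> \<le> (R * \<bar>\<theta>' ?z\<bar> + \<bar>\<theta> ?z\<bar>) * \<bar>\<psi> x\<bar>" by (rule mult_right_mono) simp
    then show ?thesis by (simp add: abs_mult algebra_simps)
  qed (simp add: \<psi>0)
  have "ennreal \<bar>ray_slice \<theta> i f \<psi>' t\<bar> \<le> (\<integral>\<^sup>+y. ennreal (norm (f y * (\<integral>x. \<theta> (x + t *\<^sub>R (y - x)) * (x $ i - y $ i) * \<psi>' x \<partial>lborel))) \<partial>lborel)"
    unfolding ray_slice_def real_norm_def[symmetric] by (rule integral_norm_bound_ennreal')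
  also have "\<dots> \<le> (\<integral>\<^sup>+y. (\<integral>\<^sup>+x. ennreal R * ennreal (\<bar>\<theta>' (x + t *\<^sub>R (y - x))\<bar> * \<bar>f y\<bar> * \<bar>\<psi> x\<bar>) + ennreal (\<bar>\<theta> (x + t *\<^sub>R (y - x))\<bar> * \<bar>f y\<bar> * \<bar>\<psi> x\<bar>) \<partial>lborel) \<partial>lborel)"
  proof (rule nn_integral_mono)
    fix y
    have "ennreal (norm (f y * (\<integral>x. \<theta> (x + t *\<^sub>R (y - x)) * (x $ i - y $ i) * \<psi>' x \<partial>lborel))) = ennreal (norm (\<integral>x. f y * (D x y * \<psi> x) \<partial>lborel))"
      unfolding parts by (simp add: abs_mult)
    also have "\<dots> \<le> (\<integral>\<^sup>+x. ennreal (norm (f y * (D x y * \<psi> x))) \<partial>lborel)" by (rule integral_norm_bound_ennreal')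
    also have "\<dots> \<le> (\<integral>\<^sup>+x. ennreal R * ennreal (\<bar>\<theta>' (x + t *\<^sub>R (y - x))\<bar> * \<bar>f y\<bar> * \<bar>\<psi> x\<bar>) + ennreal (\<bar>\<theta> (x + t *\<^sub>R (y - x))\<bar> * \<bar>f y\<bar> * \<bar>\<psi> x\<bar>) \<partial>lborel)"
    proof (rule nn_integral_mono)
      fix x
      have "norm (f y * (D x y * \<psi> x)) \<le> \<bar>f y\<bar> * (R * (\<bar>\<theta>' (x + t *\<^sub>R (y - x))\<bar> * \<bar>\<psi> x\<bar>) + \<bar>\<theta> (x + t *\<^sub>R (y - x))\<bar> * \<bar>\<psi> x\<bar>)"
        unfolding real_norm_def abs_mult[of "f y"] by (intro mult_left_mono D) auto
      also have "\<dots> = R * (\<bar>\<theta>' (x + t *\<^sub>R (y - x))\<bar> * \<bar>f y\<bar> * \<bar>\<psi> x\<bar>) + \<bar>\<theta> (x + t *\<^sub>R (y - x))\<bar> * \<bar>f y\<bar> * \<bar>\<psi> x\<bar>"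
        by (simp add: distrib_left mult_ac)
      finally have "ennreal (norm (f y * (D x y * \<psi> x))) \<le> ennreal (R * (\<bar>\<theta>' (x + t *\<^sub>R (y - x))\<bar> * \<bar>f y\<bar> * \<bar>\<psi> x\<bar>) + \<bar>\<theta> (x + t *\<^sub>R (y - x))\<bar> * \<bar>f y\<bar> * \<bar>\<psi> x\<bar>)"
        by (rule ennreal_leI)
      then show "ennreal (norm (f y * (D x y * \<psi> x))) \<le> ennreal R * ennreal (\<bar>\<theta>' (x + t *\<^sub>R (y - x))\<bar> * \<bar>f y\<bar> * \<bar>\<psi> x\<bar>) + ennreal (\<bar>\<theta> (x + t *\<^sub>R (y - x))\<bar> * \<bar>f y\<bar> * \<bar>\<psi> x\<bar>)"
        by (subst (asm) ennreal_mult_add) (simp_all only: R_nonneg mult_nonneg_nonneg abs_ge_zero)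
    qed
    finally show "ennreal (norm (f y * (\<integral>x. \<theta> (x + t *\<^sub>R (y - x)) * (x $ i - y $ i) * \<psi>' x \<partial>lborel)))
      \<le> (\<integral>\<^sup>+x. ennreal R * ennreal (\<bar>\<theta>' (x + t *\<^sub>R (y - x))\<bar> * \<bar>f y\<bar> * \<bar>\<psi> x\<bar>) + ennreal (\<bar>\<theta> (x + t *\<^sub>R (y - x))\<bar> * \<bar>f y\<bar> * \<bar>\<psi> x\<bar>) \<partial>lborel)" .
  qed
  also have "\<dots> = ennreal R * ray_form \<theta>' t + ray_form \<theta> t"
    unfolding ray_form_swap[OF meas_\<theta>'] ray_form_swap[OF meas_\<theta>]
    by (simp add: nn_integral_add nn_integral_cmult)
  finally show ?thesis .
qed

text \<open>Agrees with the volume ratio up to a dimensional factor, since \<open>\<rho> ^ n\<close>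
  is proportional to the volume of the ball.\<close>

abbreviation Q where "Q \<equiv> measure lborel \<Omega> / \<rho> ^ CARD('n)"
abbreviation l2norms where "l2norms \<equiv> l2norm f * l2norm \<psi>"

lemma measure_\<Omega>_pos: "0 < measure lborel \<Omega>"
proof -
  have "0 < measure lborel (ball a r)"
    using r content_ball_pos[of r a] by (simp add: measure_completion)
  also have "\<dots> \<le> measure lborel \<Omega>"
    using ball emeasure_\<Omega> by (intro measure_mono_fmeasurable) (auto simp: fmeasurable_def)
  finally show ?thesis .
qed

text \<open>Weight \<open>1 - lam\<close> goes to Schur's bound and weight \<open>lam\<close> to the
  volume bound: a larger \<open>lam\<close> softens the singularity at \<open>t = 1\<close> and pays
  with a higher power of \<open>Q\<close>.\<close>

lemma ray_form_interpolate:
  assumes t: "1 < t" and lam: "0 \<le> lam" "lam \<le> 1"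
    and \<eta>: "integrable lborel \<eta>" "square_integrable \<eta>" and c: "0 \<le> c"
    and n1: "(\<integral>x. \<bar>\<eta> x\<bar> \<partial>lborel) \<le> c" and n2: "l2norm \<eta> \<le> c / sqrt (\<rho> ^ CARD('n))"
  shows "ray_form \<eta> t \<le> ennreal ((t - 1) powr (- (real CARD('n) / 2) * (1 - lam)) * Q powr (lam / 2) * (c * l2norms))"
proof -
  let ?A = "(t - 1) powr (- (real CARD('n) / 2))" and ?B = "sqrt Q"
  have nn0: "0 \<le> l2norms" by simp
  have "ray_form \<eta> t \<le> ennreal ((1 / sqrt ((t * (t - 1)) ^ CARD('n))) * (\<integral>x. \<bar>\<eta> x\<bar> \<partial>lborel) * l2norm f * l2norm \<psi>)"
    unfolding ray_form_def by (rule ray_form_schur[OF \<eta>(1) f sq_\<psi> t])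
  also have "\<dots> \<le> ennreal (?A * (c * l2norms))"
  proof (rule ennreal_leI)
    have "(t - 1) ^ CARD('n) \<le> (t * (t - 1)) ^ CARD('n)" using t by (intro power_mono) auto
    then have "1 / sqrt ((t * (t - 1)) ^ CARD('n)) \<le> 1 / sqrt ((t - 1) ^ CARD('n))"
      using t by (intro divide_left_mono real_sqrt_le_mono mult_pos_pos) auto
    also have "\<dots> = ?A"
      unfolding powr_minus_divide using t by (subst sqrt_power_powr) auto
    finally have "1 / sqrt ((t * (t - 1)) ^ CARD('n)) * (\<integral>x. \<bar>\<eta> x\<bar> \<partial>lborel) \<le> ?A * c"
      using n1 by (intro mult_mono) auto
    then have "1 / sqrt ((t * (t - 1)) ^ CARD('n)) * (\<integral>x. \<bar>\<eta> x\<bar> \<partial>lborel) * l2norms \<le> ?A * c * l2norms"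
      using nn0 by (rule mult_right_mono)
    then show "1 / sqrt ((t * (t - 1)) ^ CARD('n)) * (\<integral>x. \<bar>\<eta> x\<bar> \<partial>lborel) * l2norm f * l2norm \<psi> \<le> ?A * (c * l2norms)"
      by (simp only: mult.assoc)
  qed
  finally have 1: "ray_form \<eta> t \<le> ennreal (?A * (c * l2norms))" .
  have "ray_form \<eta> t \<le> ennreal (sqrt (measure lborel \<Omega>) * l2norm \<eta> * l2norm f * l2norm \<psi>)"
    unfolding ray_form_def using t \<psi>0 by (intro ray_form_volume[OF \<eta>(2) f sq_\<psi> _ meas_\<Omega> emeasure_\<Omega>]) auto
  also have "\<dots> \<le> ennreal (?B * (c * l2norms))"
  proof (rule ennreal_leI)
    have "sqrt (measure lborel \<Omega>) * l2norm \<eta> \<le> sqrt (measure lborel \<Omega>) * (c / sqrt (\<rho> ^ CARD('n)))"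
      by (intro mult_left_mono n2) auto
    also have "\<dots> = ?B * c" by (simp add: real_sqrt_divide)
    finally have "sqrt (measure lborel \<Omega>) * l2norm \<eta> * l2norms \<le> ?B * c * l2norms"
      using nn0 by (rule mult_right_mono)
    then show "sqrt (measure lborel \<Omega>) * l2norm \<eta> * l2norm f * l2norm \<psi> \<le> ?B * (c * l2norms)"
      by (simp only: mult.assoc)
  qed
  finally have 2: "ray_form \<eta> t \<le> ennreal (?B * (c * l2norms))" .
  \<comment> \<open>Finite by the first bound, so the interpolation can be done in the
    reals.\<close>
  have fin: "ray_form \<eta> t = ennreal (enn2real (ray_form \<eta> t))"
    using 1 by (metis ennreal_enn2real ennreal_less_top le_less_trans)
  have "enn2real (ray_form \<eta> t) \<le> ?A powr (1 - lam) * ?B powr lam * (c * l2norms)"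
  proof (rule interpolate_le)
    show "enn2real (ray_form \<eta> t) \<le> ?A * (c * l2norms)" "enn2real (ray_form \<eta> t) \<le> ?B * (c * l2norms)"
      by (rule enn2real_leI[OF _ 1], use c nn0 in \<open>simp add: mult_nonneg_nonneg\<close>)
         (rule enn2real_leI[OF _ 2], use c nn0 measure_\<Omega>_pos \<rho>_pos in \<open>intro mult_nonneg_nonneg real_sqrt_ge_zero divide_nonneg_nonneg, auto\<close>)
    show "0 < ?B" using measure_\<Omega>_pos \<rho>_pos by simp
    show "0 < ?A" using t by simp
  qed (use c nn0 lam in auto)
  also have "?A powr (1 - lam) = (t - 1) powr (- (real CARD('n) / 2) * (1 - lam))" by (rule powr_powr)
  also have "?B powr lam = Q powr (lam / 2)"
    using measure_\<Omega>_pos \<rho>_pos by (simp add: powr_half_sqrt[symmetric] powr_powr)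
  finally show ?thesis by (subst fin) (rule ennreal_leI)
qed

text \<open>The power \<open>l - 1\<close> of \<open>t - 1\<close> in the weight and the
  interpolated singularity combine to the exponent \<open>e - 1\<close>, so \<open>0 < e\<close> is
  precisely integrability at \<open>t = 1\<close>.\<close>

lemma low_part:
  assumes lam: "0 \<le> lam" "lam \<le> 1" and e: "e = real l - (real CARD('n) / 2) * (1 - lam)" "0 < e"
  shows "(\<integral>\<^sup>+t. ennreal \<bar>indicator {1..<2} t * ray_weight CARD('n) l t * ray_slice \<theta> i f \<psi>' t\<bar> \<partial>lborel)
    \<le> ennreal (2 ^ CARD('n) * (2 * (R / \<rho>) * M * Q powr (lam / 2) * l2norms) / e)"
proof -
  let ?C = "2 ^ CARD('n) * (2 * (R / \<rho>) * M * Q powr (lam / 2) * l2norms)"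
  have C0: "0 \<le> ?C" using R_nonneg \<rho>_pos M by simp
  have "(\<integral>\<^sup>+t. ennreal \<bar>indicator {1..<2} t * ray_weight CARD('n) l t * ray_slice \<theta> i f \<psi>' t\<bar> \<partial>lborel)
     \<le> (\<integral>\<^sup>+t. ennreal ?C * ennreal (indicator {1..2} t * (t - 1) powr (e - 1)) \<partial>lborel)"
  proof (rule nn_integral_mono_AE)
    show "AE t in lborel. ennreal \<bar>indicator {1..<2} t * ray_weight CARD('n) l t * ray_slice \<theta> i f \<psi>' t\<bar> \<le> ennreal ?C * ennreal (indicator {1..2} t * (t - 1) powr (e - 1))"
    \<comment> \<open>The interpolated bound holds for \<open>t > 1\<close>; the endpoint is a null
      set.\<close>
    proof (rule eventually_mono[OF AE_lborel_singleton[of 1]])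
      fix t :: real assume t1: "t \<noteq> 1"
      show "ennreal \<bar>indicator {1..<2} t * ray_weight CARD('n) l t * ray_slice \<theta> i f \<psi>' t\<bar> \<le> ennreal ?C * ennreal (indicator {1..2} t * (t - 1) powr (e - 1))"
      proof (cases "1 < t \<and> t < 2")
        case True
        let ?P = "(t - 1) powr (- (real CARD('n) / 2) * (1 - lam)) * Q powr (lam / 2)"
        have w0: "0 \<le> ray_weight CARD('n) l t" using ray_weight_bounds(1)[OF l, of t] True by simp
        have w: "ray_weight CARD('n) l t \<le> (t - 1) powr (real l - 1) * 2 ^ CARD('n)"
        proof -
          have "t ^ (CARD('n) - l) \<le> 2 ^ (CARD('n) - l)" using True by (intro power_mono) auto
          also have "\<dots> \<le> 2 ^ CARD('n)" by (intro power_increasing) auto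
          finally have "ray_weight CARD('n) l t \<le> (t - 1) ^ (l - 1) * 2 ^ CARD('n)"
            unfolding ray_weight_def using True by (intro mult_left_mono) auto
          also have "(t - 1) ^ (l - 1) = (t - 1) powr (real l - 1)"
            using True l by (simp add: powr_realpow[symmetric] of_nat_diff)
          finally show ?thesis .
        qed
        have X1: "ray_form \<theta>' t \<le> ennreal (?P * (M / \<rho> * l2norms))"
          using True \<rho>_pos M N1 L1 by (intro ray_form_interpolate lam int_\<theta>' sq_\<theta>) auto
        have X0: "ray_form \<theta> t \<le> ennreal (?P * (M * l2norms))"
          using True M N0 L0 by (intro ray_form_interpolate lam integrable_\<theta> sq_\<theta>) auto
        have "ennreal \<bar>ray_slice \<theta> i f \<psi>' t\<bar> \<le> ennreal R * ray_form \<theta>' t + ray_form \<theta> t"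
          using True by (intro ray_slice_low) auto
        also have "\<dots> \<le> ennreal R * ennreal (?P * (M / \<rho> * l2norms)) + ennreal (?P * (M * l2norms))"
          by (intro add_mono mult_left_mono X1 X0) auto
        also have "\<dots> = ennreal (R * (?P * (M / \<rho> * l2norms)) + ?P * (M * l2norms))"
          using R_nonneg M \<rho>_pos
          by (subst ennreal_mult'[OF R_nonneg, symmetric], subst ennreal_plus[symmetric])
             (auto intro!: mult_nonneg_nonneg divide_nonneg_nonneg)
        also have "R * (?P * (M / \<rho> * l2norms)) + ?P * (M * l2norms) = (R / \<rho> + 1) * (?P * (M * l2norms))"
          by (simp add: field_simps)
        finally have "\<bar>ray_slice \<theta> i f \<psi>' t\<bar> \<le> (R / \<rho> + 1) * (?P * (M * l2norms))"
          using R_nonneg M \<rho>_pos by (subst (asm) ennreal_le_iff) (auto intro!: mult_nonneg_nonneg add_nonneg_nonneg divide_nonneg_nonneg)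
        \<comment> \<open>The term without derivative is absorbed by
          \<open>\<rho> \<le> R\<close>.\<close>
        also have "\<dots> \<le> (2 * (R / \<rho>)) * (?P * (M * l2norms))"
          using rho_le_R \<rho>_pos M by (intro mult_right_mono) (auto simp: field_simps)
        finally have s: "\<bar>ray_slice \<theta> i f \<psi>' t\<bar> \<le> (2 * (R / \<rho>)) * (?P * (M * l2norms))" .
        have "\<bar>indicator {1..<2} t * ray_weight CARD('n) l t * ray_slice \<theta> i f \<psi>' t\<bar> = ray_weight CARD('n) l t * \<bar>ray_slice \<theta> i f \<psi>' t\<bar>"
          using True w0 by (simp add: abs_mult)
        also have "\<dots> \<le> ((t - 1) powr (real l - 1) * 2 ^ CARD('n)) * ((2 * (R / \<rho>)) * (?P * (M * l2norms)))"
          using w w0 s by (intro mult_mono) auto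
        also have "\<dots> = ?C * ((t - 1) powr (real l - 1) * (t - 1) powr (- (real CARD('n) / 2) * (1 - lam)))"
          by (simp only: mult_ac)
        also have "(t - 1) powr (real l - 1) * (t - 1) powr (- (real CARD('n) / 2) * (1 - lam)) = (t - 1) powr (e - 1)"
          unfolding powr_add[symmetric] e(1) by (rule arg_cong[where f="\<lambda>x. (t - 1) powr x"]) (simp add: algebra_simps)
        finally have "\<bar>indicator {1..<2} t * ray_weight CARD('n) l t * ray_slice \<theta> i f \<psi>' t\<bar> \<le> ?C * (indicator {1..2} t * (t - 1) powr (e - 1))"
          using True by simp
        then have "ennreal \<bar>indicator {1..<2} t * ray_weight CARD('n) l t * ray_slice \<theta> i f \<psi>' t\<bar> \<le> ennreal (?C * (indicator {1..2} t * (t - 1) powr (e - 1)))"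
          by (rule ennreal_leI)
        also have "\<dots> = ennreal ?C * ennreal (indicator {1..2} t * (t - 1) powr (e - 1))"
          by (rule ennreal_mult'[OF C0])
        finally show ?thesis .
      qed (use t1 in \<open>auto simp: indicator_def\<close>)
    qed
  qed
  also have "\<dots> = ennreal ?C * ennreal (1 / e)"
    by (subst nn_integral_cmult) (auto simp: nn_integral_powr_shift[OF e(2)])
  also have "\<dots> = ennreal (?C / e)" using ennreal_mult'[OF C0, of "1 / e"] by simp
  finally show ?thesis .
qed

section \<open>The part of the ray beyond \<open>t = 2\<close>\<close>

definition pair :: "(real^'n \<Rightarrow> real) \<Rightarrow> (real^'n \<Rightarrow> real) \<Rightarrow> real \<Rightarrow> real" where
  "pair \<phi> \<omega> t = (\<integral>y. f y * (\<integral>x. \<phi> (x + t *\<^sub>R (y - x)) * \<omega> x \<partial>lborel) \<partial>lborel)"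

lemma integrable_f': "integrable lborel f" by (rule integrable_f[OF f f0])

context
  fixes \<phi> \<omega> :: "real^'n \<Rightarrow> real"
  assumes \<phi>: "continuous_on UNIV \<phi>" "bounded_support \<phi>" and \<omega>: "continuous_on UNIV \<omega>" "bounded_support \<omega>"
begin

lemma meas_\<phi>\<omega>: "\<phi> \<in> borel_measurable borel" "\<omega> \<in> borel_measurable borel"
  using \<phi> \<omega> by (auto intro: borel_measurable_continuous_onI)

lemma integrable_pair_inner: "integrable lborel (\<lambda>x. \<phi> (x + t *\<^sub>R (y - x)) * \<omega> x)"
  by (intro integrable_continuous_bounded_support bounded_support_mult(2) \<omega> continuous_intros continuous_on_compose2[OF \<phi>(1)]) auto

lemma integrable_pair_outer: "integrable lborel (\<lambda>y. f y * (\<integral>x. \<phi> (x + t *\<^sub>R (y - x)) * \<omega> x \<partial>lborel))"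
proof -
  note [measurable] = meas_\<phi>\<omega> meas_f'
  obtain B where B: "\<And>x. \<bar>\<phi> x\<bar> \<le> B" using bounded_support_bounded[OF \<phi>] by blast
  have \<omega>i: "integrable lborel \<omega>" by (rule integrable_continuous_bounded_support[OF \<omega>])
  show ?thesis
  proof (rule Bochner_Integration.integrable_bound)
    show "integrable lborel (\<lambda>y. (\<integral>x. B * \<bar>\<omega> x\<bar> \<partial>lborel) * f y)" by (intro integrable_mult_right integrable_f')
    show "AE y in lborel. norm (f y * (\<integral>x. \<phi> (x + t *\<^sub>R (y - x)) * \<omega> x \<partial>lborel)) \<le> norm ((\<integral>x. B * \<bar>\<omega> x\<bar> \<partial>lborel) * f y)"
    proof (rule AE_I2)
      fix y
      have "norm (\<integral>x. \<phi> (x + t *\<^sub>R (y - x)) * \<omega> x \<partial>lborel) \<le> (\<integral>x. B * \<bar>\<omega> x\<bar> \<partial>lborel)"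
        by (rule integral_norm_bound_integral') (auto intro!: integrable_mult_right integrable_abs \<omega>i mult_right_mono B simp: abs_mult)
      then have "norm (\<integral>x. \<phi> (x + t *\<^sub>R (y - x)) * \<omega> x \<partial>lborel) \<le> norm (\<integral>x. B * \<bar>\<omega> x\<bar> \<partial>lborel)"
        unfolding real_norm_def by linarith
      then show "norm (f y * (\<integral>x. \<phi> (x + t *\<^sub>R (y - x)) * \<omega> x \<partial>lborel)) \<le> norm ((\<integral>x. B * \<bar>\<omega> x\<bar> \<partial>lborel) * f y)"
        unfolding norm_mult by (subst mult.commute) (rule mult_right_mono, auto)
    qed
  qed measurable
qed

text \<open>The substitution \<open>z = t y + (1 - t) x\<close> for fixed \<open>y\<close>, which
  links the two descriptions of a ray: by its starting point and by its point in the support of the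
  weight.\<close>

lemma pair_inner_eq:
  assumes t: "t \<ge> 2"
  shows "(\<integral>z. \<phi> z * \<omega> ((1 / (t - 1)) *\<^sub>R (t *\<^sub>R y - z)) \<partial>lborel) = (t - 1) ^ CARD('n) * (\<integral>x. \<phi> (x + t *\<^sub>R (y - x)) * \<omega> x \<partial>lborel)"
proof -
  let ?G = "\<lambda>z. \<phi> z * \<omega> ((1 / (t - 1)) *\<^sub>R (t *\<^sub>R y - z))"
  have "(1 / (t - 1)) *\<^sub>R (t *\<^sub>R y - (t *\<^sub>R y + (1 - t) *\<^sub>R x)) = x" for x
  proof -
    have "t *\<^sub>R y - (t *\<^sub>R y + (1 - t) *\<^sub>R x) = (t - 1) *\<^sub>R x" by (simp add: algebra_simps)
    then show ?thesis using t by simp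
  qed
  then have "(\<integral>x. \<phi> (x + t *\<^sub>R (y - x)) * \<omega> x \<partial>lborel) = (\<integral>x. ?G (t *\<^sub>R y + (1 - t) *\<^sub>R x) \<partial>lborel)"
    unfolding ray_point(2) by simp
  also have "\<dots> = (1 / \<bar>1 - t\<bar> ^ DIM(real^'n)) *\<^sub>R (\<integral>z. ?G z \<partial>lborel)"
    using t by (intro integral_affine) auto
  finally show ?thesis using t by simp
qed

text \<open>The Jacobian built into \<open>ray_mean\<close> cancels against the substitution, and
  Fubini exchanges \<open>(t, z)\<close> with \<open>y\<close>.\<close>

lemma pair_high:
  shows "integrable lborel (\<lambda>t. indicator {2..} t * (ray_weight CARD('n) l t / t) * pair \<phi> \<omega> t)"
    and "(\<integral>t. indicator {2..} t * (ray_weight CARD('n) l t / t) * pair \<phi> \<omega> t \<partial>lborel) = (\<integral>y. f y * ray_transform l \<phi> \<omega> y \<partial>lborel)"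
proof -
  note [measurable] = meas_\<phi>\<omega> meas_f' ray_mean_measurable[OF l \<phi> \<omega>]
  obtain W where W: "integrable (lborel \<Otimes>\<^sub>M lborel) W" "\<And>p y. norm (ray_mean l \<phi> \<omega> p y) \<le> W p"
    using ray_mean_dominated[OF l \<phi> \<omega>] by blast
  interpret pair_sigma_finite "lborel \<Otimes>\<^sub>M lborel :: (real \<times> (real^'n)) measure" "lborel :: (real^'n) measure" ..
  define E where "E p y = ray_mean l \<phi> \<omega> p y * f y" for p y
  have E: "integrable ((lborel \<Otimes>\<^sub>M lborel) \<Otimes>\<^sub>M lborel) (\<lambda>q. E (fst q) (snd q))"
  proof (rule Bochner_Integration.integrable_bound[OF integrable_mult_prod[OF W(1) integrable_f']])
    show "AE q in (lborel \<Otimes>\<^sub>M lborel) \<Otimes>\<^sub>M lborel. norm (E (fst q) (snd q)) \<le> norm (W (fst q) * f (snd q))"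
      unfolding E_def norm_mult
      by (intro AE_I2 mult_right_mono order_trans[OF W(2)]) auto
  qed (unfold E_def, measurable)
  have slice: "(\<integral>z. \<integral>y. E (t, z) y \<partial>lborel \<partial>lborel) = indicator {2..} t * (ray_weight CARD('n) l t / t) * pair \<phi> \<omega> t" for t
  proof (cases "t \<ge> 2")
    case t: True
    let ?w = "ray_weight CARD('n) l t / (t * (t - 1) ^ CARD('n))"
    obtain B where B: "\<And>x. \<bar>\<omega> x\<bar> \<le> B" using bounded_support_bounded[OF \<omega>] by blast
    have i: "integrable (lborel \<Otimes>\<^sub>M lborel) (\<lambda>p. E (t, fst p) (snd p))"
    proof (rule Bochner_Integration.integrable_bound[OF integrable_mult_right[OF lborel_pair.integrable_mult_prod[OF integrable_continuous_bounded_support[OF \<phi>] integrable_f'], of "?w * B"]])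
      show "AE p in lborel \<Otimes>\<^sub>M lborel. norm (E (t, fst p) (snd p)) \<le> norm (?w * B * (\<phi> (fst p) * f (snd p)))"
      proof (rule AE_I2)
        fix p :: "(real^'n) \<times> (real^'n)"
        have "\<bar>\<omega> ((1 / (t - 1)) *\<^sub>R (t *\<^sub>R snd p - fst p))\<bar> \<le> \<bar>B\<bar>" using B order_trans[OF B abs_ge_self] by blast
        then have "\<bar>?w\<bar> * \<bar>\<phi> (fst p)\<bar> * \<bar>\<omega> ((1 / (t - 1)) *\<^sub>R (t *\<^sub>R snd p - fst p))\<bar> * \<bar>f (snd p)\<bar> \<le> \<bar>?w\<bar> * \<bar>\<phi> (fst p)\<bar> * \<bar>B\<bar> * \<bar>f (snd p)\<bar>"
          by (intro mult_right_mono mult_left_mono) auto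
        then show "norm (E (t, fst p) (snd p)) \<le> norm (?w * B * (\<phi> (fst p) * f (snd p)))"
          unfolding E_def ray_mean_def fst_conv snd_conv real_norm_def abs_mult using t by (simp add: mult_ac)
      qed
    qed (unfold E_def ray_mean_def fst_conv snd_conv, measurable)
    have "(\<integral>z. \<integral>y. E (t, z) y \<partial>lborel \<partial>lborel) = (\<integral>y. \<integral>z. E (t, z) y \<partial>lborel \<partial>lborel)"
      using lborel_pair.Fubini_integral[of "\<lambda>z y. E (t, z) y"] i by (simp add: case_prod_beta')
    also have "\<dots> = (\<integral>y. (ray_weight CARD('n) l t / t) * (f y * (\<integral>x. \<phi> (x + t *\<^sub>R (y - x)) * \<omega> x \<partial>lborel)) \<partial>lborel)"
    proof (rule Bochner_Integration.integral_cong[OF refl])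
      fix y
      have "E (t, z) y = (?w * f y) * (\<phi> z * \<omega> ((1 / (t - 1)) *\<^sub>R (t *\<^sub>R y - z)))" for z
        unfolding E_def ray_mean_def fst_conv snd_conv using t by simp
      then have "(\<integral>z. E (t, z) y \<partial>lborel) = (?w * f y) * (\<integral>z. \<phi> z * \<omega> ((1 / (t - 1)) *\<^sub>R (t *\<^sub>R y - z)) \<partial>lborel)"
        by (simp only: integral_mult_right_zero)
      also have "\<dots> = (?w * f y) * ((t - 1) ^ CARD('n) * (\<integral>x. \<phi> (x + t *\<^sub>R (y - x)) * \<omega> x \<partial>lborel))"
        by (simp only: pair_inner_eq[OF t])
      finally show "(\<integral>z. E (t, z) y \<partial>lborel) = (ray_weight CARD('n) l t / t) * (f y * (\<integral>x. \<phi> (x + t *\<^sub>R (y - x)) * \<omega> x \<partial>lborel))"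
        using t by simp
    qed
    also have "\<dots> = (ray_weight CARD('n) l t / t) * pair \<phi> \<omega> t" unfolding pair_def by (rule integral_mult_right_zero)
    finally show ?thesis using t by simp
  qed (simp add: E_def ray_mean_def)
  have "(\<integral>y. f y * ray_transform l \<phi> \<omega> y \<partial>lborel) = (\<integral>y. \<integral>p. E p y \<partial>(lborel \<Otimes>\<^sub>M lborel) \<partial>lborel)"
    unfolding ray_transform_def E_def by (simp add: mult.commute)
  also have "\<dots> = (\<integral>p. \<integral>y. E p y \<partial>lborel \<partial>(lborel \<Otimes>\<^sub>M lborel))"
    using Fubini_integral[of E] E by (simp add: case_prod_beta')
  also have "\<dots> = (\<integral>t. \<integral>z. \<integral>y. E (t, z) y \<partial>lborel \<partial>lborel \<partial>lborel)"
    using lborel_pair.integral_fst'[OF integrable_fst'[OF E]] by simp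
  finally show "(\<integral>t. indicator {2..} t * (ray_weight CARD('n) l t / t) * pair \<phi> \<omega> t \<partial>lborel) = (\<integral>y. f y * ray_transform l \<phi> \<omega> y \<partial>lborel)"
    by (simp only: slice)
  show "integrable lborel (\<lambda>t. indicator {2..} t * (ray_weight CARD('n) l t / t) * pair \<phi> \<omega> t)"
    using lborel_pair.integrable_fst'[OF integrable_fst'[OF E]] by (simp add: slice)
qed

lemma square_integrable_ray_transform: "square_integrable (ray_transform l \<phi> \<omega>)"
  by (intro square_integrable_bounded_support continuous_on_ray_transform bounded_support_ray_transform l \<phi> \<omega>)

end

text \<open>Measuring the coordinate from the centre \<open>a\<close> keeps it at most
  \<open>\<rho>\<close> on the support, so this weight is of size \<open>\<rho>\<close> relative to
  \<open>\<theta>\<close>.\<close>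

definition \<theta>\<^sub>1 :: "real^'n \<Rightarrow> real" where "\<theta>\<^sub>1 z = (z $ i - a $ i) * \<theta> z"

text \<open>The partial derivative in direction \<open>j\<close> of
  \<open>(x_i - a_i) * \<psi> x\<close>, expanded by the product rule.\<close>

definition \<omega>\<^sub>1 :: "real^'n \<Rightarrow> real" where "\<omega>\<^sub>1 x = \<delta> * \<psi> x + (x $ i - a $ i) * \<psi>' x"

lemma hp_\<omega>\<^sub>1: "has_partial j (\<lambda>x. (x $ i - a $ i) * \<psi> x) \<omega>\<^sub>1"
  using has_partial_mult[OF has_partial_component hp_\<psi>] unfolding \<omega>\<^sub>1_def .

lemma bs_\<omega>\<^sub>1: "bounded_support (\<lambda>x. (x $ i - a $ i) * \<psi> x)" "bounded_support \<omega>\<^sub>1"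
proof -
  show "bounded_support (\<lambda>x. (x $ i - a $ i) * \<psi> x)" by (rule bounded_support_mult(2)[OF bs_\<psi>])
  then show "bounded_support \<omega>\<^sub>1" by (rule has_partial_bounded_support[OF hp_\<omega>\<^sub>1])
qed

lemma cont_\<theta>\<^sub>1: "continuous_on UNIV \<theta>\<^sub>1"
  unfolding \<theta>\<^sub>1_def by (intro continuous_intros continuous_\<theta>)

lemma bs_\<theta>\<^sub>1: "bounded_support \<theta>\<^sub>1"
  unfolding \<theta>\<^sub>1_def by (rule bounded_support_mult(2)[OF bounded_support_\<theta>])

lemmas cont_\<omega>\<^sub>1 = has_partial_continuous(2)[OF hp_\<omega>\<^sub>1]

text \<open>The coordinate of \<open>x\<close> cannot simply join \<open>\<psi>'\<close>, because
  the Fourier estimate needs a full derivative. By the product rule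
  \<open>(x_i - a_i) * \<psi>'\<close> is \<open>\<omega>\<^sub>1\<close> minus
  \<open>\<delta> * \<psi>\<close>, and this correction is the middle term; the coordinate of
  \<open>z\<close> goes into \<open>\<theta>\<^sub>1\<close>.\<close>

lemma ray_slice_decompose:
  "t * ray_slice \<theta> i f \<psi>' t = pair \<theta> \<omega>\<^sub>1 t - \<delta> * pair \<theta> \<psi> t - pair \<theta>\<^sub>1 \<psi>' t"
proof -
  let ?I = "\<lambda>\<phi> \<omega> y. \<integral>x. \<phi> (x + t *\<^sub>R (y - x)) * \<omega> x \<partial>lborel"
  note ii = integrable_pair_inner[OF continuous_\<theta> bounded_support_\<theta> cont_\<omega>\<^sub>1 bs_\<omega>\<^sub>1(2)]
    integrable_pair_inner[OF continuous_\<theta> bounded_support_\<theta> cont_\<psi>(1) bs_\<psi>]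
    integrable_pair_inner[OF cont_\<theta>\<^sub>1 bs_\<theta>\<^sub>1 cont_\<psi>(2) bs_\<psi>']
  note oo = integrable_pair_outer[OF continuous_\<theta> bounded_support_\<theta> cont_\<omega>\<^sub>1 bs_\<omega>\<^sub>1(2)]
    integrable_pair_outer[OF continuous_\<theta> bounded_support_\<theta> cont_\<psi>(1) bs_\<psi>]
    integrable_pair_outer[OF cont_\<theta>\<^sub>1 bs_\<theta>\<^sub>1 cont_\<psi>(2) bs_\<psi>']
  have inner: "t * (\<integral>x. \<theta> (x + t *\<^sub>R (y - x)) * (x $ i - y $ i) * \<psi>' x \<partial>lborel) = ?I \<theta> \<omega>\<^sub>1 y - \<delta> * ?I \<theta> \<psi> y - ?I \<theta>\<^sub>1 \<psi>' y" for y
  proof -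
    have "t * (\<integral>x. \<theta> (x + t *\<^sub>R (y - x)) * (x $ i - y $ i) * \<psi>' x \<partial>lborel)
      = (\<integral>x. t * (\<theta> (x + t *\<^sub>R (y - x)) * (x $ i - y $ i) * \<psi>' x) \<partial>lborel)"
      by (rule integral_mult_right_zero[symmetric])
    also have "\<dots> = (\<integral>x. \<theta> (x + t *\<^sub>R (y - x)) * \<omega>\<^sub>1 x - \<delta> * (\<theta> (x + t *\<^sub>R (y - x)) * \<psi> x) - \<theta>\<^sub>1 (x + t *\<^sub>R (y - x)) * \<psi>' x \<partial>lborel)"
    proof (rule Bochner_Integration.integral_cong[OF refl])
      fix x
      let ?z = "x + t *\<^sub>R (y - x)"
      have z: "?z $ i = x $ i + t * (y $ i - x $ i)" by simp
      show "t * (\<theta> ?z * (x $ i - y $ i) * \<psi>' x) = \<theta> ?z * \<omega>\<^sub>1 x - \<delta> * (\<theta> ?z * \<psi> x) - \<theta>\<^sub>1 ?z * \<psi>' x"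
        unfolding \<omega>\<^sub>1_def \<theta>\<^sub>1_def z by (simp add: algebra_simps)
    qed
    also have "\<dots> = ?I \<theta> \<omega>\<^sub>1 y - \<delta> * ?I \<theta> \<psi> y - ?I \<theta>\<^sub>1 \<psi>' y"
      using ii by (simp add: integrable_mult_right)
    finally show ?thesis .
  qed
  have "t * ray_slice \<theta> i f \<psi>' t = (\<integral>y. f y * (t * (\<integral>x. \<theta> (x + t *\<^sub>R (y - x)) * (x $ i - y $ i) * \<psi>' x \<partial>lborel)) \<partial>lborel)"
  proof -
    have "(\<integral>y. f y * (t * (\<integral>x. \<theta> (x + t *\<^sub>R (y - x)) * (x $ i - y $ i) * \<psi>' x \<partial>lborel)) \<partial>lborel) = (\<integral>y. t * (f y * (\<integral>x. \<theta> (x + t *\<^sub>R (y - x)) * (x $ i - y $ i) * \<psi>' x \<partial>lborel)) \<partial>lborel)"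
      by (rule Bochner_Integration.integral_cong[OF refl], rule mult.left_commute)
    then show ?thesis unfolding ray_slice_def by (simp only: integral_mult_right_zero)
  qed
  also have "\<dots> = (\<integral>y. f y * ?I \<theta> \<omega>\<^sub>1 y - \<delta> * (f y * ?I \<theta> \<psi> y) - f y * ?I \<theta>\<^sub>1 \<psi>' y \<partial>lborel)"
    unfolding inner by (simp only: right_diff_distrib mult.left_commute)
  also have "\<dots> = pair \<theta> \<omega>\<^sub>1 t - \<delta> * pair \<theta> \<psi> t - pair \<theta>\<^sub>1 \<psi>' t"
    unfolding pair_def using oo by (subst Bochner_Integration.integral_diff, simp, simp, subst Bochner_Integration.integral_diff) auto
  finally show ?thesis .
qed

lemma ray_slice_high_eq:
  "(\<integral>t. indicator {2..} t * ray_weight CARD('n) l t * ray_slice \<theta> i f \<psi>' t \<partial>lborel)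
    = (\<integral>y. f y * ray_transform l \<theta> \<omega>\<^sub>1 y \<partial>lborel) - \<delta> * (\<integral>t. indicator {2..} t * (ray_weight CARD('n) l t / t) * pair \<theta> \<psi> t \<partial>lborel)
      - (\<integral>y. f y * ray_transform l \<theta>\<^sub>1 \<psi>' y \<partial>lborel)"
proof -
  note hh = pair_high[OF continuous_\<theta> bounded_support_\<theta> cont_\<omega>\<^sub>1 bs_\<omega>\<^sub>1(2)]
    pair_high[OF continuous_\<theta> bounded_support_\<theta> cont_\<psi>(1) bs_\<psi>]
    pair_high[OF cont_\<theta>\<^sub>1 bs_\<theta>\<^sub>1 cont_\<psi>(2) bs_\<psi>']
  let ?w = "\<lambda>t. indicator {2..} t * (ray_weight CARD('n) l t / t)"
  have "indicator {2..} t * ray_weight CARD('n) l t * ray_slice \<theta> i f \<psi>' t = ?w t * pair \<theta> \<omega>\<^sub>1 t - \<delta> * (?w t * pair \<theta> \<psi> t) - ?w t * pair \<theta>\<^sub>1 \<psi>' t" for t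
  proof (cases "t \<ge> 2")
    case True
    have "indicator {2..} t * ray_weight CARD('n) l t * ray_slice \<theta> i f \<psi>' t = ?w t * (t * ray_slice \<theta> i f \<psi>' t)" using True by simp
    also have "\<dots> = ?w t * (pair \<theta> \<omega>\<^sub>1 t - \<delta> * pair \<theta> \<psi> t - pair \<theta>\<^sub>1 \<psi>' t)" using True by (subst ray_slice_decompose) auto
    finally show ?thesis by (simp only: right_diff_distrib mult.left_commute)
  qed simp
  then have "(\<integral>t. indicator {2..} t * ray_weight CARD('n) l t * ray_slice \<theta> i f \<psi>' t \<partial>lborel) = (\<integral>t. ?w t * pair \<theta> \<omega>\<^sub>1 t - \<delta> * (?w t * pair \<theta> \<psi> t) - ?w t * pair \<theta>\<^sub>1 \<psi>' t \<partial>lborel)"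
    by (simp only:)
  also have "\<dots> = (\<integral>t. ?w t * pair \<theta> \<omega>\<^sub>1 t \<partial>lborel) - \<delta> * (\<integral>t. ?w t * pair \<theta> \<psi> t \<partial>lborel) - (\<integral>t. ?w t * pair \<theta>\<^sub>1 \<psi>' t \<partial>lborel)"
    using hh(1,3,5) by (subst Bochner_Integration.integral_diff, simp, simp, subst Bochner_Integration.integral_diff) auto
  finally show ?thesis unfolding hh(2,6) .
qed

text \<open>The L1 norm of \<open>\<phi>\<close> bounds the transform, that of
  \<open>\<phi>''\<close> bounds the transform times the squared frequency component. Adding the
  first bound to \<open>\<rho>\<^sup>2\<close> times the second gives the denominator.\<close>

lemma fourier_decay:
  assumes \<phi>: "has_partial j \<phi> \<phi>'" "has_partial j \<phi>' \<phi>''" and bs: "bounded_support \<phi>"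
    and A: "(\<integral>x. \<bar>\<phi> x\<bar> \<partial>lborel) \<le> A" "(\<integral>x. \<bar>\<phi>'' x\<bar> \<partial>lborel) \<le> B / \<rho>\<^sup>2"
  shows "cmod (fourier \<phi> \<zeta>) \<le> (A + B) / (1 + \<rho>\<^sup>2 * (\<zeta> $ j)\<^sup>2)"
proof -
  have "fourier \<phi>'' \<zeta> = \<i> * of_real (\<zeta> $ j) * (\<i> * of_real (\<zeta> $ j) * fourier \<phi> \<zeta>)"
    by (simp only: fourier_partial[OF \<phi>(2) has_partial_bounded_support[OF \<phi>(1) bs]] fourier_partial[OF \<phi>(1) bs])
  then have "cmod (fourier \<phi>'' \<zeta>) = (\<zeta> $ j)\<^sup>2 * cmod (fourier \<phi> \<zeta>)"
    by (simp add: norm_mult power2_eq_square)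
  with cmod_fourier_le[of \<phi>'' \<zeta>] A(2) have "(\<zeta> $ j)\<^sup>2 * cmod (fourier \<phi> \<zeta>) \<le> B / \<rho>\<^sup>2" by simp
  then have "\<rho>\<^sup>2 * ((\<zeta> $ j)\<^sup>2 * cmod (fourier \<phi> \<zeta>)) \<le> B"
    using \<rho>_pos by (subst (asm) pos_le_divide_eq) (auto simp: mult.commute)
  moreover have "cmod (fourier \<phi> \<zeta>) \<le> A" using cmod_fourier_le[of \<phi> \<zeta>] A(1) by simp
  ultimately have "cmod (fourier \<phi> \<zeta>) * (1 + \<rho>\<^sup>2 * (\<zeta> $ j)\<^sup>2) \<le> A + B" by (simp add: algebra_simps)
  moreover have "0 < 1 + \<rho>\<^sup>2 * (\<zeta> $ j)\<^sup>2" by (intro add_pos_nonneg) auto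
  ultimately show ?thesis by (simp add: pos_le_divide_eq)
qed

lemma l2norm_ray_transform_le:
  assumes \<phi>: "has_partial j \<phi> \<phi>'" "has_partial j \<phi>' \<phi>''" "bounded_support \<phi>"
    and A: "(\<integral>x. \<bar>\<phi> x\<bar> \<partial>lborel) \<le> A" "(\<integral>x. \<bar>\<phi>'' x\<bar> \<partial>lborel) \<le> B / \<rho>\<^sup>2" "0 \<le> A" "0 \<le> B"
    and \<omega>: "has_partial j \<omega> \<omega>'" "bounded_support \<omega>"
  shows "l2norm (ray_transform l \<phi> \<omega>') \<le> (A + B) * pi / (2 * \<rho>) * sqrt (2 ^ (CARD('n) + 1)) * l2norm \<omega>"
proof -
  have "(\<integral>y. (ray_transform l \<phi> \<omega>' y)\<^sup>2 \<partial>lborel) \<le> ((A + B) * pi / (2 * \<rho>))\<^sup>2 * 2 ^ (CARD('n) + 1) * (\<integral>x. (\<omega> x)\<^sup>2 \<partial>lborel)"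
    using A by (intro ray_transform_bound[OF l has_partial_continuous(1)[OF \<phi>(1)] \<phi>(3) \<omega> \<rho>_pos _ fourier_decay[OF \<phi> A(1,2)]]) auto
  then have "l2norm (ray_transform l \<phi> \<omega>') \<le> sqrt (((A + B) * pi / (2 * \<rho>))\<^sup>2 * 2 ^ (CARD('n) + 1) * (\<integral>x. (\<omega> x)\<^sup>2 \<partial>lborel))"
    unfolding l2norm_def by (rule real_sqrt_le_mono)
  also have "\<dots> = (A + B) * pi / (2 * \<rho>) * sqrt (2 ^ (CARD('n) + 1)) * l2norm \<omega>"
    using A \<rho>_pos by (simp add: real_sqrt_mult l2norm_def)
  finally show ?thesis .
qed

text \<open>No derivative is left in this term, so Schur's test decays like \<open>t ^ (- n)\<close>
  against a weight of order \<open>t ^ (n - 2)\<close> and the integral converges. The root of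
  \<open>2 ^ n\<close> comes from \<open>t - 1 \<ge> t / 2\<close>.\<close>

lemma middle_part:
  "\<bar>\<integral>t. indicator {2..} t * (ray_weight CARD('n) l t / t) * pair \<theta> \<psi> t \<partial>lborel\<bar> \<le> sqrt (2 ^ CARD('n)) * M * l2norms"
proof -
  let ?c = "sqrt (2 ^ CARD('n)) * M * l2norms"
  have c0: "0 \<le> ?c" using M by simp
  have pt: "ennreal \<bar>pair \<theta> \<psi> t\<bar> \<le> ray_form \<theta> t" for t
  proof -
    have "ennreal (norm (pair \<theta> \<psi> t)) \<le> (\<integral>\<^sup>+y. ennreal (norm (f y * (\<integral>x. \<theta> (x + t *\<^sub>R (y - x)) * \<psi> x \<partial>lborel))) \<partial>lborel)"
      unfolding pair_def by (rule integral_norm_bound_ennreal')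
    also have "\<dots> = (\<integral>\<^sup>+y. ennreal (norm (\<integral>x. f y * (\<theta> (x + t *\<^sub>R (y - x)) * \<psi> x) \<partial>lborel)) \<partial>lborel)"
      by (simp only: integral_mult_right_zero)
    also have "\<dots> \<le> (\<integral>\<^sup>+y. \<integral>\<^sup>+x. ennreal (norm (f y * (\<theta> (x + t *\<^sub>R (y - x)) * \<psi> x))) \<partial>lborel \<partial>lborel)"
      by (intro nn_integral_mono integral_norm_bound_ennreal')
    also have "\<dots> = ray_form \<theta> t" unfolding ray_form_swap[OF meas_\<theta>] by (simp add: abs_mult mult_ac)
    finally show ?thesis by simp
  qed
  have "ennreal (norm (\<integral>t. indicator {2..} t * (ray_weight CARD('n) l t / t) * pair \<theta> \<psi> t \<partial>lborel))
     \<le> (\<integral>\<^sup>+t. ennreal (norm (indicator {2..} t * (ray_weight CARD('n) l t / t) * pair \<theta> \<psi> t)) \<partial>lborel)"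
    by (rule integral_norm_bound_ennreal')
  also have "\<dots> \<le> (\<integral>\<^sup>+t. ennreal ?c * (ennreal (1 / t\<^sup>2) * indicator {1..} t) \<partial>lborel)"
  proof (rule nn_integral_mono)
    fix t :: real
    show "ennreal (norm (indicator {2..} t * (ray_weight CARD('n) l t / t) * pair \<theta> \<psi> t)) \<le> ennreal ?c * (ennreal (1 / t\<^sup>2) * indicator {1..} t)"
    proof (cases "t \<ge> 2")
      case t: True
      have w0: "0 \<le> ray_weight CARD('n) l t" using ray_weight_bounds(1)[OF l, of t] t by simp
      have "ennreal \<bar>pair \<theta> \<psi> t\<bar> \<le> ennreal ((1 / sqrt ((t * (t - 1)) ^ CARD('n))) * (\<integral>x. \<bar>\<theta> x\<bar> \<partial>lborel) * l2norm f * l2norm \<psi>)"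
        using t by (intro order_trans[OF pt] ray_form_schur[OF integrable_\<theta> f sq_\<psi>, folded ray_form_def]) simp
      then have "\<bar>pair \<theta> \<psi> t\<bar> \<le> (1 / sqrt ((t * (t - 1)) ^ CARD('n))) * (\<integral>x. \<bar>\<theta> x\<bar> \<partial>lborel) * l2norm f * l2norm \<psi>"
        using t by (subst (asm) ennreal_le_iff) (auto intro!: mult_nonneg_nonneg divide_nonneg_nonneg)
      also have "\<dots> \<le> (sqrt (2 ^ CARD('n)) / t ^ CARD('n)) * M * l2norm f * l2norm \<psi>"
      proof (intro mult_right_mono mult_mono N0)
        have "(t\<^sup>2 / 2) ^ CARD('n) \<le> (t * (t - 1)) ^ CARD('n)"
        proof (rule power_mono)
          have "t * (t / 2) \<le> t * (t - 1)" using t by (intro mult_left_mono) auto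
          then show "t\<^sup>2 / 2 \<le> t * (t - 1)" by (simp add: power2_eq_square)
        qed simp
        then have "1 / sqrt ((t * (t - 1)) ^ CARD('n)) \<le> 1 / sqrt ((t\<^sup>2 / 2) ^ CARD('n))"
          using t by (intro divide_left_mono real_sqrt_le_mono mult_pos_pos) auto
        also have "sqrt ((t\<^sup>2 / 2) ^ CARD('n)) = t ^ CARD('n) / sqrt (2 ^ CARD('n))"
          unfolding real_sqrt_power real_sqrt_divide power_divide using t by simp
        finally show "1 / sqrt ((t * (t - 1)) ^ CARD('n)) \<le> sqrt (2 ^ CARD('n)) / t ^ CARD('n)" by simp
      qed (use M t in auto)
      finally have p: "\<bar>pair \<theta> \<psi> t\<bar> \<le> ?c / t ^ CARD('n)" by simp
      have "\<bar>indicator {2..} t * (ray_weight CARD('n) l t / t) * pair \<theta> \<psi> t\<bar> = ray_weight CARD('n) l t / t * \<bar>pair \<theta> \<psi> t\<bar>"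
        using t w0 by (simp add: abs_mult)
      also have "\<dots> \<le> ray_weight CARD('n) l t / t * (?c / t ^ CARD('n))"
        using w0 t by (intro mult_left_mono p) auto
      also have "\<dots> = ?c * (ray_weight CARD('n) l t / (t * t ^ CARD('n)))" by (simp add: mult_ac)
      also have "\<dots> \<le> ?c * (1 / t\<^sup>2)" using t by (intro mult_left_mono ray_weight_bounds(2)[OF l] c0) simp
      finally have "ennreal \<bar>indicator {2..} t * (ray_weight CARD('n) l t / t) * pair \<theta> \<psi> t\<bar> \<le> ennreal (?c * (1 / t\<^sup>2))"
        by (rule ennreal_leI)
      also have "\<dots> = ennreal ?c * ennreal (1 / t\<^sup>2)" by (rule ennreal_mult'[OF c0])
      finally show ?thesis using t by simp
    qed simp
  qed
  also have "\<dots> = ennreal ?c * (\<integral>\<^sup>+t. ennreal (1 / t\<^sup>2) * indicator {1..} t \<partial>lborel)"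
    by (rule nn_integral_cmult) simp
  also have "(\<integral>\<^sup>+t. ennreal (1 / t\<^sup>2) * indicator {1..} t \<partial>lborel) = ennreal (0 - (- 1 / 1))"
  proof (rule nn_integral_FTC_atLeast[where F="\<lambda>t. - 1 / t"])
    show "((\<lambda>t::real. - 1 / t) \<longlongrightarrow> 0) at_top"
      by (rule real_tendsto_divide_at_top[OF tendsto_const filterlim_ident])
  qed (auto intro!: derivative_eq_intros simp: power2_eq_square)
  finally have "ennreal \<bar>\<integral>t. indicator {2..} t * (ray_weight CARD('n) l t / t) * pair \<theta> \<psi> t \<partial>lborel\<bar> \<le> ennreal ?c" by simp
  then show ?thesis using c0 by (subst (asm) ennreal_le_iff) auto
qed

text \<open>The same bounds as for \<open>\<theta>\<close>, larger by the factor
  \<open>\<rho>\<close>. The 3 collects two copies of the first derivative from the product rule and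
  one second derivative.\<close>

lemma integral_\<theta>\<^sub>1:
  "(\<integral>x. \<bar>\<theta>\<^sub>1 x\<bar> \<partial>lborel) \<le> \<rho> * M"
  "has_partial j \<theta>\<^sub>1 (\<lambda>x. \<delta> * \<theta> x + (x $ i - a $ i) * \<theta>' x)"
  "has_partial j (\<lambda>x. \<delta> * \<theta> x + (x $ i - a $ i) * \<theta>' x) (\<lambda>x. 2 * \<delta> * \<theta>' x + (x $ i - a $ i) * partial_deriv j \<theta>' x)"
  "(\<integral>x. \<bar>2 * \<delta> * \<theta>' x + (x $ i - a $ i) * partial_deriv j \<theta>' x\<bar> \<partial>lborel) \<le> 3 * \<rho> * M / \<rho>\<^sup>2"
proof -
  have near: "\<bar>x $ i - a $ i\<bar> \<le> \<rho>" if "x \<in> ball a r" for x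
  proof -
    have "\<bar>x $ i - a $ i\<bar> \<le> norm (x - a)" using component_le_norm_cart[of "x - a" i] by simp
    then show ?thesis using that r by (simp add: dist_norm norm_minus_commute)
  qed
  show "has_partial j \<theta>\<^sub>1 (\<lambda>x. \<delta> * \<theta> x + (x $ i - a $ i) * \<theta>' x)"
    using has_partial_mult[OF has_partial_component hp_\<theta>] unfolding \<theta>\<^sub>1_def .
  show "has_partial j (\<lambda>x. \<delta> * \<theta> x + (x $ i - a $ i) * \<theta>' x) (\<lambda>x. 2 * \<delta> * \<theta>' x + (x $ i - a $ i) * partial_deriv j \<theta>' x)"
    unfolding has_partial_def
  proof (intro conjI allI)
    fix x
    have "((\<lambda>s. \<theta> (x + s *\<^sub>R axis j 1)) has_real_derivative \<theta>' x) (at 0)"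
      using hp_\<theta> by (auto simp: has_partial_def)
    moreover have "((\<lambda>s. ((x + s *\<^sub>R axis j 1) $ i - a $ i) * \<theta>' (x + s *\<^sub>R axis j 1)) has_real_derivative \<delta> * \<theta>' x + (x $ i - a $ i) * partial_deriv j \<theta>' x) (at 0)"
      using has_partial_mult[OF has_partial_component hp_\<theta>', of i "a $ i"] by (auto simp: has_partial_def)
    ultimately have "((\<lambda>s. \<delta> * \<theta> (x + s *\<^sub>R axis j 1) + ((x + s *\<^sub>R axis j 1) $ i - a $ i) * \<theta>' (x + s *\<^sub>R axis j 1)) has_real_derivative
       \<delta> * \<theta>' x + (\<delta> * \<theta>' x + (x $ i - a $ i) * partial_deriv j \<theta>' x)) (at 0)"
      by (intro DERIV_add DERIV_cmult)
    then show "((\<lambda>s. \<delta> * \<theta> (x + s *\<^sub>R axis j 1) + ((x + s *\<^sub>R axis j 1) $ i - a $ i) * \<theta>' (x + s *\<^sub>R axis j 1)) has_real_derivative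
       2 * \<delta> * \<theta>' x + (x $ i - a $ i) * partial_deriv j \<theta>' x) (at 0)"
      by (rule DERIV_cong) simp
  qed (auto intro!: continuous_intros continuous_\<theta> cont_\<theta> has_partial_continuous[OF hp_\<theta>'])
  have "(\<integral>x. \<bar>\<theta>\<^sub>1 x\<bar> \<partial>lborel) \<le> (\<integral>x. \<rho> * \<bar>\<theta> x\<bar> \<partial>lborel)"
  proof (rule integral_mono_AE')
    show "integrable lborel (\<lambda>x. \<rho> * \<bar>\<theta> x\<bar>)" by (intro integrable_mult_right integrable_abs integrable_\<theta>)
    show "AE x in lborel. \<bar>\<theta>\<^sub>1 x\<bar> \<le> \<rho> * \<bar>\<theta> x\<bar>"
    proof (rule AE_I2)
      fix x show "\<bar>\<theta>\<^sub>1 x\<bar> \<le> \<rho> * \<bar>\<theta> x\<bar>"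
        using near[of x] \<theta>0[of x] unfolding \<theta>\<^sub>1_def abs_mult by (cases "x \<in> ball a r") (auto intro: mult_right_mono)
    qed
  qed (use r in auto)
  also have "\<dots> \<le> \<rho> * M" using N0 \<rho>_pos by simp
  finally show "(\<integral>x. \<bar>\<theta>\<^sub>1 x\<bar> \<partial>lborel) \<le> \<rho> * M" .
  \<comment> \<open>A derivative vanishes where the function vanishes on a neighbourhood, hence the
    closed ball.\<close>
  have \<theta>2: "partial_deriv j \<theta>' x = 0" if "x \<notin> cball a r" for x
    by (rule has_partial_zero_on_open[OF hp_\<theta>', where U="- cball a r"]) (use that \<theta>1 in auto)
  have i2: "integrable lborel (partial_deriv j \<theta>')"
    by (rule integrable_continuous_bounded_support[OF has_partial_continuous(2)[OF hp_\<theta>'] has_partial_bounded_support[OF hp_\<theta>' bs_\<theta>']])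
  have "(\<integral>x. \<bar>2 * \<delta> * \<theta>' x + (x $ i - a $ i) * partial_deriv j \<theta>' x\<bar> \<partial>lborel) \<le> (\<integral>x. 2 * \<bar>\<theta>' x\<bar> + \<rho> * \<bar>partial_deriv j \<theta>' x\<bar> \<partial>lborel)"
  proof (rule integral_mono_AE')
    show "integrable lborel (\<lambda>x. 2 * \<bar>\<theta>' x\<bar> + \<rho> * \<bar>partial_deriv j \<theta>' x\<bar>)"
      by (intro Bochner_Integration.integrable_add integrable_mult_right integrable_abs int_\<theta>' i2)
    show "AE x in lborel. \<bar>2 * \<delta> * \<theta>' x + (x $ i - a $ i) * partial_deriv j \<theta>' x\<bar> \<le> 2 * \<bar>\<theta>' x\<bar> + \<rho> * \<bar>partial_deriv j \<theta>' x\<bar>"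
    proof (rule AE_I2)
      fix x
      have "\<bar>(x $ i - a $ i) * partial_deriv j \<theta>' x\<bar> \<le> \<rho> * \<bar>partial_deriv j \<theta>' x\<bar>"
      proof (cases "x \<in> cball a r")
        case True
        have "\<bar>x $ i - a $ i\<bar> \<le> norm (x - a)" using component_le_norm_cart[of "x - a" i] by simp
        then have "\<bar>x $ i - a $ i\<bar> \<le> \<rho>" using True r by (simp add: dist_norm norm_minus_commute)
        then show ?thesis unfolding abs_mult by (rule mult_right_mono) simp
      qed (simp add: \<theta>2)
      moreover have "\<bar>2 * \<delta> * \<theta>' x\<bar> \<le> 2 * \<bar>\<theta>' x\<bar>" by (simp add: abs_mult)
      ultimately show "\<bar>2 * \<delta> * \<theta>' x + (x $ i - a $ i) * partial_deriv j \<theta>' x\<bar> \<le> 2 * \<bar>\<theta>' x\<bar> + \<rho> * \<bar>partial_deriv j \<theta>' x\<bar>"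
        by (intro order_trans[OF abs_triangle_ineq] add_mono)
    qed
  qed (use r in auto)
  also have "\<dots> = 2 * (\<integral>x. \<bar>\<theta>' x\<bar> \<partial>lborel) + \<rho> * (\<integral>x. \<bar>partial_deriv j \<theta>' x\<bar> \<partial>lborel)"
    by (subst Bochner_Integration.integral_add) (auto intro: integrable_abs int_\<theta>' i2)
  also have "\<dots> \<le> 2 * (M / \<rho>) + \<rho> * (M / \<rho>\<^sup>2)"
    using \<rho>_pos by (intro add_mono mult_left_mono N1 N2) auto
  also have "\<dots> = 3 * \<rho> * M / \<rho>\<^sup>2" using \<rho>_pos by (simp add: power2_eq_square field_simps)
  finally show "(\<integral>x. \<bar>2 * \<delta> * \<theta>' x + (x $ i - a $ i) * partial_deriv j \<theta>' x\<bar> \<partial>lborel) \<le> 3 * \<rho> * M / \<rho>\<^sup>2" .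
qed

text \<open>The three summands belong to the part \<open>t < 2\<close>, to the middle term and to
  the two ray transforms; of the \<open>3 * pi\<close>, one share comes from the weight
  \<open>\<theta>\<close> and two from \<open>\<theta>\<^sub>1\<close>.\<close>

definition K :: real where
  "K = 2 ^ (CARD('n) + 1) + sqrt (2 ^ CARD('n)) + 3 * pi * sqrt (2 ^ (CARD('n) + 1))"

text \<open>The quotient \<open>R / \<rho>\<close> arises in the term with weight
  \<open>\<theta>\<close>: the function \<open>(x_i - a_i) * \<psi> x\<close> has norm at most
  \<open>R\<close> times that of \<open>\<psi>\<close>, and the transform costs
  \<open>1 / \<rho>\<close>. In the term with \<open>\<theta>\<^sub>1\<close> this cost is
  compensated by the size of the weight; it and the middle term are merely raised to the common form
  by \<open>\<rho> \<le> R\<close>.\<close>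

lemma high_part:
  "\<bar>\<integral>t. indicator {2..} t * ray_weight CARD('n) l t * ray_slice \<theta> i f \<psi>' t \<partial>lborel\<bar>
    \<le> (sqrt (2 ^ CARD('n)) + 3 * pi * sqrt (2 ^ (CARD('n) + 1))) * M * (R / \<rho>) * l2norms"
proof -
  let ?s = "sqrt (2 ^ (CARD('n) + 1)) :: real"
  have R1: "1 \<le> R / \<rho>" using rho_le_R \<rho>_pos by simp
  have 1: "\<bar>\<integral>y. f y * ray_transform l \<theta> \<omega>\<^sub>1 y \<partial>lborel\<bar> \<le> pi * ?s * M * (R / \<rho>) * l2norms"
  proof -
    have "l2norm (ray_transform l \<theta> \<omega>\<^sub>1) \<le> (M + M) * pi / (2 * \<rho>) * ?s * l2norm (\<lambda>x. (x $ i - a $ i) * \<psi> x)"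
      using N0 N2 M by (intro l2norm_ray_transform_le[OF hp_\<theta> hp_\<theta>' bounded_support_\<theta> _ _ _ _ hp_\<omega>\<^sub>1 bs_\<omega>\<^sub>1(1)])
    also have "\<dots> \<le> (M + M) * pi / (2 * \<rho>) * ?s * (R * l2norm \<psi>)"
    proof (rule mult_left_mono)
      show "l2norm (\<lambda>x. (x $ i - a $ i) * \<psi> x) \<le> R * l2norm \<psi>"
      proof (rule l2norm_le_mult[OF sq_\<psi> _ R_nonneg])
        fix x show "\<bar>(x $ i - a $ i) * \<psi> x\<bar> \<le> R * \<bar>\<psi> x\<bar>"
          using coord_diff_le[OF _ a_in, of x i] \<psi>0[of x] unfolding abs_mult by (cases "x \<in> \<Omega>") (auto intro: mult_right_mono)
      qed
    qed (use M \<rho>_pos in auto)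
    also have "\<dots> = pi * ?s * M * (R / \<rho>) * l2norm \<psi>" using \<rho>_pos by (simp add: field_simps)
    finally have "l2norm f * l2norm (ray_transform l \<theta> \<omega>\<^sub>1) \<le> l2norm f * (pi * ?s * M * (R / \<rho>) * l2norm \<psi>)"
      by (rule mult_left_mono) simp
    also have "\<dots> = pi * ?s * M * (R / \<rho>) * l2norms" by (simp only: mult_ac)
    finally show ?thesis
      using abs_integral_mult_le_l2norm[OF f square_integrable_ray_transform[OF continuous_\<theta> bounded_support_\<theta> cont_\<omega>\<^sub>1 bs_\<omega>\<^sub>1(2)]] by linarith
  qed
  have 2: "\<bar>\<integral>y. f y * ray_transform l \<theta>\<^sub>1 \<psi>' y \<partial>lborel\<bar> \<le> 2 * pi * ?s * M * (R / \<rho>) * l2norms"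
  proof -
    have "l2norm (ray_transform l \<theta>\<^sub>1 \<psi>') \<le> (\<rho> * M + 3 * \<rho> * M) * pi / (2 * \<rho>) * ?s * l2norm \<psi>"
      using \<rho>_pos M by (intro l2norm_ray_transform_le[OF integral_\<theta>\<^sub>1(2,3) bs_\<theta>\<^sub>1 integral_\<theta>\<^sub>1(1,4) _ _ hp_\<psi> bs_\<psi>]) auto
    also have "\<dots> = 2 * pi * ?s * M * l2norm \<psi> * 1" using \<rho>_pos by (simp add: field_simps)
    also have "\<dots> \<le> 2 * pi * ?s * M * l2norm \<psi> * (R / \<rho>)" using M by (intro mult_left_mono R1) auto
    finally have "l2norm f * l2norm (ray_transform l \<theta>\<^sub>1 \<psi>') \<le> l2norm f * (2 * pi * ?s * M * l2norm \<psi> * (R / \<rho>))"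
      by (rule mult_left_mono) simp
    also have "\<dots> = 2 * pi * ?s * M * (R / \<rho>) * l2norms" by (simp only: mult_ac)
    finally show ?thesis
      using abs_integral_mult_le_l2norm[OF f square_integrable_ray_transform[OF cont_\<theta>\<^sub>1 bs_\<theta>\<^sub>1 cont_\<psi>(2) bs_\<psi>']] by linarith
  qed
  have 3: "\<bar>\<delta> * (\<integral>t. indicator {2..} t * (ray_weight CARD('n) l t / t) * pair \<theta> \<psi> t \<partial>lborel)\<bar> \<le> sqrt (2 ^ CARD('n)) * M * (R / \<rho>) * l2norms"
  proof -
    have "\<bar>\<delta> * (\<integral>t. indicator {2..} t * (ray_weight CARD('n) l t / t) * pair \<theta> \<psi> t \<partial>lborel)\<bar> \<le> sqrt (2 ^ CARD('n)) * M * l2norms * 1"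
      using middle_part M by (auto simp: abs_mult)
    also have "\<dots> \<le> sqrt (2 ^ CARD('n)) * M * l2norms * (R / \<rho>)" using M by (intro mult_left_mono R1) auto
    finally show ?thesis by (simp only: mult_ac)
  qed
  have tri: "\<bar>p - q - s\<bar> \<le> \<bar>p\<bar> + \<bar>q\<bar> + \<bar>s\<bar>" for p q s :: real by linarith
  show ?thesis
    unfolding ray_slice_high_eq
    by (rule order_trans[OF tri], rule order_trans[OF add_mono[OF add_mono[OF 1 3] 2]]) (simp add: algebra_simps)
qed

lemma ray_operator_weak_bound:
  assumes lam: "0 \<le> lam" "lam \<le> 1" and e: "e = real l - (real CARD('n) / 2) * (1 - lam)" "0 < e"
  shows "\<bar>\<integral>x. ray_operator l \<theta> i f x * \<psi>' x \<partial>lborel\<bar> \<le> K * M * (R / \<rho>) * (1 + Q powr (lam / 2) / e) * l2norms"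
proof -
  let ?g = "\<lambda>t. ray_weight CARD('n) l t * ray_slice \<theta> i f \<psi>' t"
  let ?C = "2 ^ CARD('n) * (2 * (R / \<rho>) * M * Q powr (lam / 2) * l2norms) / e"
  have C0: "0 \<le> ?C" using R_nonneg \<rho>_pos M e by simp
  note P = ray_operator_pairing[where i=i, OF f f0 cont_\<psi>(2) bs_\<psi>' \<psi>'0]
  have i1: "integrable lborel (\<lambda>t. indicator {1..} t * ?g t)" using P(1) by (simp add: mult.assoc)
  have i2: "integrable lborel (\<lambda>t. indicator S t * (indicator {1..} t * ?g t))" if "S \<in> sets borel" for S
    using integrable_mult_indicator[OF _ i1, of S] that by simp
  have "(\<lambda>t. indicator {2..} t * (indicator {1..} t * ?g t)) = (\<lambda>t. indicator {2..} t * ?g t)"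
    and "(\<lambda>t. indicator {1..<2} t * (indicator {1..} t * ?g t)) = (\<lambda>t. indicator {1..<2} t * ?g t)"
    by (auto simp: indicator_def fun_eq_iff)
  with i2[of "{2..}"] i2[of "{1..<2}"] have i3: "integrable lborel (\<lambda>t. indicator {2..} t * ?g t)" "integrable lborel (\<lambda>t. indicator {1..<2} t * ?g t)"
    by auto
  have "(\<integral>x. ray_operator l \<theta> i f x * \<psi>' x \<partial>lborel) = (\<integral>t. indicator {1..} t * ?g t \<partial>lborel)"
    using P(2) by (simp add: mult.assoc)
  also have "\<dots> = (\<integral>t. indicator {1..<2} t * ?g t + indicator {2..} t * ?g t \<partial>lborel)"
    by (intro Bochner_Integration.integral_cong) (auto simp: indicator_def)
  also have "\<dots> = (\<integral>t. indicator {1..<2} t * ?g t \<partial>lborel) + (\<integral>t. indicator {2..} t * ?g t \<partial>lborel)"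
    by (rule Bochner_Integration.integral_add[OF i3(2,1)])
  finally have eq: "(\<integral>x. ray_operator l \<theta> i f x * \<psi>' x \<partial>lborel) = (\<integral>t. indicator {1..<2} t * ?g t \<partial>lborel) + (\<integral>t. indicator {2..} t * ?g t \<partial>lborel)" .
  have "ennreal (norm (\<integral>t. indicator {1..<2} t * ?g t \<partial>lborel)) \<le> (\<integral>\<^sup>+t. ennreal (norm (indicator {1..<2} t * ?g t)) \<partial>lborel)"
    by (rule integral_norm_bound_ennreal')
  also have "\<dots> \<le> ennreal ?C"
    using low_part[OF lam e] by (simp only: mult.assoc real_norm_def)
  finally have low: "\<bar>\<integral>t. indicator {1..<2} t * ?g t \<partial>lborel\<bar> \<le> ?C"
    using C0 by (subst (asm) ennreal_le_iff) auto
  let ?H = "(sqrt (2 ^ CARD('n)) + 3 * pi * sqrt (2 ^ (CARD('n) + 1)))"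
  have high: "\<bar>\<integral>t. indicator {2..} t * ?g t \<partial>lborel\<bar> \<le> ?H * M * (R / \<rho>) * l2norms"
    using high_part by (simp only: mult.assoc)
  have "\<bar>\<integral>x. ray_operator l \<theta> i f x * \<psi>' x \<partial>lborel\<bar> \<le> ?C + ?H * M * (R / \<rho>) * l2norms"
    unfolding eq by (intro order_trans[OF abs_triangle_ineq] add_mono low high)
  also have "\<dots> = (2 ^ (CARD('n) + 1) * (Q powr (lam / 2) / e) + ?H) * (M * (R / \<rho>) * l2norms)"
    by (simp add: algebra_simps)
  also have "\<dots> \<le> (K * (1 + Q powr (lam / 2) / e)) * (M * (R / \<rho>) * l2norms)"
  proof (rule mult_right_mono)
    have "0 \<le> ?H" by simp
    have "2 ^ (CARD('n) + 1) * (Q powr (lam / 2) / e) + ?H \<le> K * (Q powr (lam / 2) / e) + K"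
      unfolding K_def using e by (intro add_mono mult_right_mono) auto
    then show "2 ^ (CARD('n) + 1) * (Q powr (lam / 2) / e) + ?H \<le> K * (1 + Q powr (lam / 2) / e)"
      by (simp add: distrib_left)
  qed (use M R_nonneg \<rho>_pos in auto)
  finally show ?thesis by (simp only: mult_ac)
qed

end

section \<open>Riesz representation on test functions\<close>

definition l2inner :: "('a::euclidean_space \<Rightarrow> real) \<Rightarrow> ('a \<Rightarrow> real) \<Rightarrow> real" where
  "l2inner f g = (\<integral>x. f x * g x \<partial>lborel)"

lemma l2inner_self: "l2inner f f = (l2norm f)\<^sup>2"
  unfolding l2inner_def l2norm_power2 by (simp add: power2_eq_square)

lemma abs_l2inner_le: "square_integrable f \<Longrightarrow> square_integrable g \<Longrightarrow> \<bar>l2inner f g\<bar> \<le> l2norm f * l2norm g"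
  unfolding l2inner_def by (rule abs_integral_mult_le_l2norm)

lemma l2inner_commute: "l2inner f g = l2inner g f"
  by (simp add: l2inner_def mult.commute)

lemma square_integrable_add:
  assumes f: "square_integrable f" and g: "square_integrable g"
  shows "square_integrable (\<lambda>x. a * f x + b * g x)"
proof -
  have "(\<lambda>x. (a * f x + b * g x)\<^sup>2) = (\<lambda>x. a\<^sup>2 * (f x)\<^sup>2 + b\<^sup>2 * (g x)\<^sup>2 + 2 * a * b * (f x * g x))"
    by (simp add: fun_eq_iff power2_eq_square algebra_simps)
  moreover have "integrable lborel (\<lambda>x. a\<^sup>2 * (f x)\<^sup>2 + b\<^sup>2 * (g x)\<^sup>2 + 2 * a * b * (f x * g x))"
    using f g by (intro Bochner_Integration.integrable_add integrable_mult_right integrable_mult_square_integrable)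
       (auto simp: square_integrable_def)
  ultimately show ?thesis using f g by (auto simp: square_integrable_def)
qed

lemma l2inner_add_left:
  assumes f: "square_integrable f" and g: "square_integrable g" and h: "square_integrable h"
  shows "l2inner (\<lambda>x. a * f x + b * g x) h = a * l2inner f h + b * l2inner g h"
proof -
  have "(\<integral>x. (a * f x + b * g x) * h x \<partial>lborel) = (\<integral>x. a * (f x * h x) + b * (g x * h x) \<partial>lborel)"
    by (simp add: algebra_simps)
  also have "\<dots> = a * (\<integral>x. f x * h x \<partial>lborel) + b * (\<integral>x. g x * h x \<partial>lborel)"
    by (subst Bochner_Integration.integral_add)
       (auto intro!: integrable_mult_right integrable_mult_square_integrable f g h)
  finally show ?thesis by (simp add: l2inner_def)
qed

lemma l2norm_add_power2:
  assumes f: "square_integrable f" and g: "square_integrable g"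
  shows "(l2norm (\<lambda>x. a * f x + b * g x))\<^sup>2 = a\<^sup>2 * (l2norm f)\<^sup>2 + 2 * a * b * l2inner f g + b\<^sup>2 * (l2norm g)\<^sup>2"
proof -
  let ?s = "\<lambda>x. a * f x + b * g x"
  have "(l2norm ?s)\<^sup>2 = a * l2inner f ?s + b * l2inner g ?s"
    unfolding l2inner_self[symmetric] by (rule l2inner_add_left[OF f g square_integrable_add[OF f g]])
  also have "l2inner f ?s = a * (l2norm f)\<^sup>2 + b * l2inner f g"
    by (subst l2inner_commute) (simp only: l2inner_add_left[OF f g f] l2inner_self l2inner_commute[of g f])
  also have "l2inner g ?s = a * l2inner f g + b * (l2norm g)\<^sup>2"
    by (subst l2inner_commute) (simp only: l2inner_add_left[OF f g g] l2inner_self)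
  finally show ?thesis by (simp add: power2_eq_square algebra_simps)
qed

text \<open>On a set of finite measure the L1 norm is controlled by the L2 norm, so geometric decay
  makes the increments absolutely summable almost everywhere. Fatou's lemma carries the rate over to
  the limit.\<close>

lemma l2_complete:
  fixes \<psi> :: "nat \<Rightarrow> 'a::euclidean_space \<Rightarrow> real"
  assumes sq: "\<And>k. square_integrable (\<psi> k)" and fin: "emeasure lborel \<Omega> < \<infinity>" and \<Omega>: "\<Omega> \<in> sets borel"
    and supp: "\<And>k x. x \<notin> \<Omega> \<Longrightarrow> \<psi> k x = 0"
    and cauchy: "\<And>k m. k \<le> m \<Longrightarrow> l2norm (\<lambda>x. 1 * \<psi> k x + (-1) * \<psi> m x) \<le> (1 / 2) ^ k * C"
  obtains g where "square_integrable g" "\<And>x. x \<notin> \<Omega> \<Longrightarrow> g x = 0"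
    "\<And>k. l2norm (\<lambda>x. 1 * \<psi> k x + (-1) * g x) \<le> (1 / 2) ^ k * C"
proof -
  have \<psi>m [measurable]: "\<psi> k \<in> borel_measurable borel" for k using sq by (simp add: square_integrable_def)
  have C0: "0 \<le> C" using order_trans[OF l2norm_nonneg cauchy[of 0 0]] by simp
  \<comment> \<open>Where the sequence diverges, on a null set, \<open>lim\<close> is some arbitrary
    value.\<close>
  define g where "g x = lim (\<lambda>k. \<psi> k x)" for x
  have gm [measurable]: "g \<in> borel_measurable borel"
    unfolding g_def by (rule borel_measurable_lim_metric) measurable
  have g0: "g x = 0" if "x \<notin> \<Omega>" for x
    using supp[OF that] by (simp add: g_def)
  define d where "d k x = \<bar>\<psi> (Suc k) x - \<psi> k x\<bar>" for k x
  have [measurable]: "d k \<in> borel_measurable borel" for k unfolding d_def by measurable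
  have ind: "square_integrable (indicator \<Omega> :: 'a \<Rightarrow> real)"
    using fin \<Omega> by (auto simp: square_integrable_def power2_eq_square indicator_inter_arith[symmetric] intro!: integrable_real_indicator)
  let ?i = "l2norm (indicator \<Omega> :: 'a \<Rightarrow> real)"
  have "(\<integral>\<^sup>+x. (\<Sum>k. ennreal (d k x)) \<partial>lborel) = (\<Sum>k. \<integral>\<^sup>+x. ennreal (d k x) \<partial>lborel)"
    by (rule nn_integral_suminf) measurable
  also have "\<dots> \<le> (\<Sum>k. ennreal ((1 / 2) ^ k * C * ?i))"
  proof (intro suminf_le allI)
    fix k
    have "(\<integral>\<^sup>+x. ennreal (d k x) \<partial>lborel) = (\<integral>\<^sup>+x. ennreal (\<bar>1 * \<psi> k x + (-1) * \<psi> (Suc k) x\<bar> * \<bar>indicator \<Omega> x\<bar>) \<partial>lborel)"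
      using supp by (intro nn_integral_cong) (auto simp: d_def indicator_def abs_minus_commute)
    also have "\<dots> \<le> ennreal (l2norm (\<lambda>x. 1 * \<psi> k x + (-1) * \<psi> (Suc k) x) * ?i)"
      by (intro nn_integral_mult_le_l2norm square_integrable_add sq ind)
    also have "\<dots> \<le> ennreal ((1 / 2) ^ k * C * ?i)"
      by (intro ennreal_leI mult_right_mono cauchy) auto
    finally show "(\<integral>\<^sup>+x. ennreal (d k x) \<partial>lborel) \<le> ennreal ((1 / 2) ^ k * C * ?i)" .
  qed auto
  also have "\<dots> = ennreal (\<Sum>k. (1 / 2) ^ k * C * ?i)"
    using C0 by (intro suminf_ennreal2) (auto intro!: summable_mult2 summable_geometric)
  also have "\<dots> < \<infinity>" by simp
  finally have "AE x in lborel. (\<Sum>k. ennreal (d k x)) \<noteq> \<infinity>"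
    by (intro nn_integral_PInf_AE) auto
  then have conv: "AE x in lborel. (\<lambda>k. \<psi> k x) \<longlonglongrightarrow> g x"
  proof eventually_elim
    fix x assume "(\<Sum>k. ennreal (d k x)) \<noteq> \<infinity>"
    then have "summable (\<lambda>k. d k x)" by (intro summable_suminf_not_top) (auto simp: d_def)
    then have "summable (\<lambda>k. \<psi> (Suc k) x - \<psi> k x)" unfolding d_def by (rule summable_rabs_cancel)
    then have "convergent (\<lambda>m. \<Sum>k<m. \<psi> (Suc k) x - \<psi> k x)" by (simp add: summable_iff_convergent)
    then have "convergent (\<lambda>m. \<psi> m x - \<psi> 0 x)" by (simp only: sum_lessThan_telescope[of "\<lambda>k. \<psi> k x"])
    then have "convergent (\<lambda>m. \<psi> m x)" using convergent_diff_const_right_iff[of "\<lambda>m. \<psi> m x" "\<psi> 0 x"] by simp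
    then show "(\<lambda>k. \<psi> k x) \<longlonglongrightarrow> g x" unfolding g_def by (simp add: convergent_LIMSEQ_iff)
  qed
  have nn: "(\<integral>\<^sup>+x. ennreal ((1 * \<psi> k x + (-1) * g x)\<^sup>2) \<partial>lborel) \<le> ennreal (((1 / 2) ^ k * C)\<^sup>2)" for k
  proof -
    have "(\<integral>\<^sup>+x. ennreal ((1 * \<psi> k x + (-1) * g x)\<^sup>2) \<partial>lborel) = (\<integral>\<^sup>+x. liminf (\<lambda>m. ennreal ((1 * \<psi> k x + (-1) * \<psi> m x)\<^sup>2)) \<partial>lborel)"
    proof (rule nn_integral_cong_AE, use conv in eventually_elim)
      fix x assume "(\<lambda>k. \<psi> k x) \<longlonglongrightarrow> g x"
      then have "(\<lambda>m. ennreal ((1 * \<psi> k x + (-1) * \<psi> m x)\<^sup>2)) \<longlonglongrightarrow> ennreal ((1 * \<psi> k x + (-1) * g x)\<^sup>2)"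
        by (intro tendsto_ennrealI tendsto_intros)
      then show "ennreal ((1 * \<psi> k x + (-1) * g x)\<^sup>2) = liminf (\<lambda>m. ennreal ((1 * \<psi> k x + (-1) * \<psi> m x)\<^sup>2))"
        by (intro lim_imp_Liminf[symmetric]) auto
    qed
    also have "\<dots> \<le> liminf (\<lambda>m. \<integral>\<^sup>+x. ennreal ((1 * \<psi> k x + (-1) * \<psi> m x)\<^sup>2) \<partial>lborel)"
      by (rule nn_integral_liminf) measurable
    also have "\<dots> \<le> limsup (\<lambda>m. \<integral>\<^sup>+x. ennreal ((1 * \<psi> k x + (-1) * \<psi> m x)\<^sup>2) \<partial>lborel)"
      by (intro Liminf_le_Limsup) auto
    also have "\<dots> \<le> ennreal (((1 / 2) ^ k * C)\<^sup>2)"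
    proof (rule Limsup_bounded)
      show "\<forall>\<^sub>F m in sequentially. (\<integral>\<^sup>+x. ennreal ((1 * \<psi> k x + (-1) * \<psi> m x)\<^sup>2) \<partial>lborel) \<le> ennreal (((1 / 2) ^ k * C)\<^sup>2)"
        using eventually_ge_at_top[of k]
      proof eventually_elim
        fix m assume "k \<le> m"
        then show "(\<integral>\<^sup>+x. ennreal ((1 * \<psi> k x + (-1) * \<psi> m x)\<^sup>2) \<partial>lborel) \<le> ennreal (((1 / 2) ^ k * C)\<^sup>2)"
          unfolding nn_integral_square[OF square_integrable_add[OF sq sq]]
          by (intro ennreal_leI power_mono cauchy) auto
      qed
    qed
    finally show ?thesis .
  qed
  have sqd: "square_integrable (\<lambda>x. 1 * \<psi> k x + (-1) * g x)" for k
    unfolding square_integrable_def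
  proof
    show "integrable lborel (\<lambda>x. (1 * \<psi> k x + (-1) * g x)\<^sup>2)"
      by (rule integrableI_bounded) (use nn[of k] in \<open>auto simp: le_less_trans[OF _ ennreal_less_top]\<close>)
  qed measurable
  have "square_integrable (\<lambda>x. 1 * \<psi> 0 x + (-1) * (1 * \<psi> 0 x + (-1) * g x))"
    by (rule square_integrable_add[OF sq sqd])
  then have "square_integrable g" by simp
  moreover have "l2norm (\<lambda>x. 1 * \<psi> k x + (-1) * g x) \<le> (1 / 2) ^ k * C" for k
  proof -
    have "(l2norm (\<lambda>x. 1 * \<psi> k x + (-1) * g x))\<^sup>2 \<le> ((1 / 2) ^ k * C)\<^sup>2"
      using nn[of k] unfolding nn_integral_square[OF sqd] by (simp only: ennreal_le_iff zero_le_power2)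
    then show ?thesis by (rule power2_le_imp_le) (use C0 in simp)
  qed
  ultimately show ?thesis using g0 that by blast
qed

text \<open>A variational proof that works directly on the incomplete space of test functions: a
  maximising sequence for the functional \<open>J\<close> is Cauchy, its L2 limit \<open>g\<close>
  need not be a test function, and the first variation along the sequence passes to the limit and
  gives the representation.\<close>

lemma riesz_test_functions:
  fixes \<Omega> :: "(real^'n::finite) set" and L :: "(real^'n \<Rightarrow> real) \<Rightarrow> real"
  assumes \<Omega>: "open \<Omega>" "bounded \<Omega>" and c: "0 \<le> c"
    and lin: "\<And>\<phi> \<psi> a b. \<phi> \<in> test_functions \<Omega> \<Longrightarrow> \<psi> \<in> test_functions \<Omega> \<Longrightarrow> L (\<lambda>x. a * \<phi> x + b * \<psi> x) = a * L \<phi> + b * L \<psi>"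
    and bound: "\<And>\<phi>. \<phi> \<in> test_functions \<Omega> \<Longrightarrow> \<bar>L \<phi>\<bar> \<le> c * l2norm \<phi>"
  obtains g where "square_integrable g" "\<And>x. x \<notin> \<Omega> \<Longrightarrow> g x = 0" "l2norm g \<le> c"
    "\<And>\<phi>. \<phi> \<in> test_functions \<Omega> \<Longrightarrow> L \<phi> = l2inner g \<phi>"
proof -
  let ?V = "test_functions \<Omega>"
  have sqV: "square_integrable \<phi>" if "\<phi> \<in> ?V" for \<phi>
    by (intro square_integrable_bounded_support test_functions_continuous[OF that] test_functions_bounded_support[OF that])
  define J where "J \<phi> = L \<phi> - (l2norm \<phi>)\<^sup>2 / 2" for \<phi>
  have Jle: "J \<phi> \<le> c\<^sup>2 / 2" if "\<phi> \<in> ?V" for \<phi>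
  proof -
    have "0 \<le> (c - l2norm \<phi>)\<^sup>2" by simp
    then have "c * l2norm \<phi> - (l2norm \<phi>)\<^sup>2 / 2 \<le> c\<^sup>2 / 2" by (simp add: power2_diff)
    then show ?thesis using bound[OF that] unfolding J_def by linarith
  qed
  define S where "S = Sup (J ` ?V)"
  have ne: "J ` ?V \<noteq> {}" using zero_test_function by blast
  have bdd: "bdd_above (J ` ?V)" using Jle by (auto intro!: bdd_aboveI[where M="c\<^sup>2 / 2"])
  have JS: "J \<phi> \<le> S" if "\<phi> \<in> ?V" for \<phi> unfolding S_def using that bdd by (intro cSup_upper) auto
  have "\<exists>\<phi>\<in>?V. S - (1 / 4) ^ k < J \<phi>" for k
    using less_cSupD[OF ne, of "S - (1 / 4) ^ k"] by (auto simp: S_def)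
  \<comment> \<open>The defect \<open>(1 / 4) ^ k\<close> is quadratic in the distance, so the
    distances decay like \<open>(1 / 2) ^ k\<close>, the rate that \<open>l2_complete\<close>
    takes.\<close>
  then obtain \<psi> where \<psi>: "\<And>k. \<psi> k \<in> ?V" "\<And>k. S - (1 / 4) ^ k < J (\<psi> k)" by metis
  note sq\<psi> = sqV[OF \<psi>(1)]
  have cauchy: "l2norm (\<lambda>x. 1 * \<psi> k x + (-1) * \<psi> m x) \<le> (1 / 2) ^ k * sqrt 8" if "k \<le> m" for k m
  proof -
    \<comment> \<open>Parallelogram law: the midpoint is a competitor too, and \<open>J\<close>
      there cannot exceed the supremum.\<close>
    let ?h = "\<lambda>x. (1/2) * \<psi> k x + (1/2) * \<psi> m x"
    have hV: "?h \<in> ?V" by (rule test_functions_add[OF \<psi>(1) \<psi>(1)])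
    have "J ?h = L (\<psi> k) / 2 + L (\<psi> m) / 2 - ((l2norm (\<psi> k))\<^sup>2 / 4 + l2inner (\<psi> k) (\<psi> m) / 2 + (l2norm (\<psi> m))\<^sup>2 / 4) / 2"
      unfolding J_def lin[OF \<psi>(1) \<psi>(1)] l2norm_add_power2[OF sq\<psi> sq\<psi>] by (simp add: power2_eq_square)
    moreover have "(l2norm (\<lambda>x. 1 * \<psi> k x + (-1) * \<psi> m x))\<^sup>2 = (l2norm (\<psi> k))\<^sup>2 - 2 * l2inner (\<psi> k) (\<psi> m) + (l2norm (\<psi> m))\<^sup>2"
      unfolding l2norm_add_power2[OF sq\<psi> sq\<psi>] by simp
    ultimately have "(l2norm (\<lambda>x. 1 * \<psi> k x + (-1) * \<psi> m x))\<^sup>2 = 8 * (J ?h - J (\<psi> k) / 2 - J (\<psi> m) / 2)"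
      unfolding J_def[of "\<psi> k"] J_def[of "\<psi> m"] by (simp add: field_simps)
    also have "\<dots> \<le> 8 * ((1 / 4) ^ k / 2 + (1 / 4) ^ m / 2)" 
    proof -
      have "8 * (p - q / 2 - r / 2) \<le> 8 * (u / 2 + v / 2)" if "p \<le> S" "S - u < q" "S - v < r" for p q r u v :: real
      proof -
        have "8 * p \<le> 4 * S + 4 * S" "4 * S - 4 * u \<le> 4 * q" "4 * S - 4 * v \<le> 4 * r" using that by auto
        then have "8 * p - 4 * q - 4 * r \<le> 4 * u + 4 * v" by linarith
        then show ?thesis by (simp add: algebra_simps)
      qed
      from this[OF JS[OF hV] \<psi>(2) \<psi>(2)] show ?thesis .
    qed
    also have "\<dots> \<le> 8 * (1 / 4) ^ k"
      using power_decreasing[OF that, of "1/4::real"] by simp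
    also have "\<dots> = ((1 / 2) ^ k * sqrt 8)\<^sup>2" 
    proof -
      have "((1 / 2) ^ k)\<^sup>2 = ((1 / 2) * (1 / 2) :: real) ^ k" by (simp only: power2_eq_square power_mult_distrib)
      then show ?thesis by (simp add: power_mult_distrib)
    qed
    finally show ?thesis by (rule power2_le_imp_le) simp
  qed
  obtain g where g: "square_integrable g" "\<And>x. x \<notin> \<Omega> \<Longrightarrow> g x = 0"
    "\<And>k. l2norm (\<lambda>x. 1 * \<psi> k x + (-1) * g x) \<le> (1 / 2) ^ k * sqrt 8"
    using l2_complete[OF sq\<psi> emeasure_bounded_finite[OF \<Omega>(2)] _ test_functions_zero[OF \<psi>(1)] cauchy] \<Omega>(1)
    by (metis borel_open)
  define D where "D k = l2norm (\<lambda>x. 1 * \<psi> k x + (-1) * g x)" for k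
  have D0: "D \<longlonglongrightarrow> 0"
  proof (rule tendsto_sandwich[of "\<lambda>_. 0" D _ "\<lambda>k. (1 / 2) ^ k * sqrt 8"])
    show "(\<lambda>k. (1 / 2) ^ k * sqrt 8) \<longlonglongrightarrow> 0"
      by (intro tendsto_mult_left_zero LIMSEQ_power_zero) simp
  qed (use g(3) in \<open>auto simp: D_def\<close>)
  have ip: "(\<lambda>k. l2inner (\<psi> k) h) \<longlonglongrightarrow> l2inner g h" if h: "square_integrable h" for h
  proof -
    have le: "norm (l2inner (\<psi> k) h - l2inner g h) \<le> D k * l2norm h" for k
      using abs_l2inner_le[OF square_integrable_add[OF sq\<psi> g(1)] h, of 1 k "-1"]
      unfolding l2inner_add_left[OF sq\<psi> g(1) h] by (simp add: D_def)
    have "(\<lambda>k. D k * l2norm h) \<longlonglongrightarrow> 0" using D0 by (rule tendsto_mult_left_zero)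
    then have "(\<lambda>k. l2inner (\<psi> k) h - l2inner g h) \<longlonglongrightarrow> 0"
      by (rule Lim_null_comparison[OF always_eventually[OF allI[OF le]]])
    then show ?thesis by (simp add: LIM_zero_iff)
  qed
  have eps: "(\<lambda>k. (1 / 4 :: real) ^ k) \<longlonglongrightarrow> 0" by (intro LIMSEQ_power_zero) simp
  have rep: "L \<phi> = l2inner g \<phi>" if \<phi>: "\<phi> \<in> ?V" for \<phi>
  proof -
    \<comment> \<open>Perturbing a near-maximiser by \<open>s * \<phi>\<close> can gain at most its
      defect; in the limit a quadratic inequality in \<open>s\<close> remains.\<close>
    have le: "s * (L \<phi> - l2inner g \<phi>) \<le> s\<^sup>2 / 2 * (l2norm \<phi>)\<^sup>2" for s
    proof (rule LIMSEQ_le)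
      show "(\<lambda>k. s * (L \<phi> - l2inner (\<psi> k) \<phi>)) \<longlonglongrightarrow> s * (L \<phi> - l2inner g \<phi>)"
        by (intro tendsto_intros ip sqV \<phi>)
      show "(\<lambda>k. (1 / 4) ^ k + s\<^sup>2 / 2 * (l2norm \<phi>)\<^sup>2) \<longlonglongrightarrow> s\<^sup>2 / 2 * (l2norm \<phi>)\<^sup>2"
        using tendsto_add[OF eps tendsto_const[of "s\<^sup>2 / 2 * (l2norm \<phi>)\<^sup>2"]] by simp
      have "s * (L \<phi> - l2inner (\<psi> k) \<phi>) \<le> (1 / 4) ^ k + s\<^sup>2 / 2 * (l2norm \<phi>)\<^sup>2" for k
      proof -
        have "J (\<lambda>x. 1 * \<psi> k x + s * \<phi> x) = J (\<psi> k) + s * (L \<phi> - l2inner (\<psi> k) \<phi>) - s\<^sup>2 / 2 * (l2norm \<phi>)\<^sup>2"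
          unfolding J_def lin[OF \<psi>(1) \<phi>] l2norm_add_power2[OF sq\<psi> sqV[OF \<phi>]] by (simp add: algebra_simps)
        then show ?thesis using JS[OF test_functions_add[OF \<psi>(1)[of k] \<phi>, of 1 s]] \<psi>(2)[of k] by linarith
      qed
      then show "\<exists>N. \<forall>k\<ge>N. s * (L \<phi> - l2inner (\<psi> k) \<phi>) \<le> (1 / 4) ^ k + s\<^sup>2 / 2 * (l2norm \<phi>)\<^sup>2" by blast
    qed
    \<comment> \<open>The optimal \<open>s\<close> would divide by the squared norm of
      \<open>\<phi>\<close>; adding 1 keeps the divisor positive when that norm is 0, and the
      inequality still forces \<open>?v\<close> to vanish.\<close>
    let ?v = "L \<phi> - l2inner g \<phi>" and ?q = "(l2norm \<phi>)\<^sup>2 + 1"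
    have q: "0 < ?q" by (intro add_nonneg_pos) auto
    have "(?v / ?q) * ?v \<le> (?v / ?q)\<^sup>2 / 2 * ?q"
      using le[of "?v / ?q"] by (rule order_trans) (intro mult_left_mono, auto)
    also have "\<dots> = ((?v / ?q) * ?v) / 2" using q by (simp add: power2_eq_square)
    finally have le2: "(?v / ?q) * ?v \<le> ((?v / ?q) * ?v) / 2" .
    have "x \<le> 0" if "x \<le> x / 2" for x :: real using that by simp
    from this[OF le2] have "(?v / ?q) * ?v \<le> 0" .
    then have "?v * ?v / ?q \<le> 0" by simp
    then have "?v * ?v \<le> 0" using q by (simp add: divide_le_0_iff not_less)
    then show ?thesis by (metis eq_iff_diff_eq_0 mult_eq_0_iff not_real_square_gt_zero not_le order_antisym_conv zero_le_square)
  qed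
  \<comment> \<open>The functional cannot be evaluated at \<open>g\<close>, so it is tested on the
    \<open>\<psi> k\<close>, whose norms and inner products with \<open>g\<close> converge to those
    of \<open>g\<close>.\<close>
  have "l2norm g \<le> c"
  proof (cases "l2norm g = 0")
    case False
    have "(\<lambda>k. l2norm (\<psi> k)) \<longlonglongrightarrow> l2norm g"
    proof -
      have "(l2norm (\<psi> k))\<^sup>2 = (D k)\<^sup>2 + 2 * l2inner (\<psi> k) g - (l2norm g)\<^sup>2" for k
        unfolding D_def l2norm_add_power2[OF sq\<psi> g(1)] by simp
      moreover have "(\<lambda>k. (D k)\<^sup>2 + 2 * l2inner (\<psi> k) g - (l2norm g)\<^sup>2) \<longlonglongrightarrow> 0\<^sup>2 + 2 * l2inner g g - (l2norm g)\<^sup>2"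
        by (intro tendsto_intros D0 ip g)
      ultimately have "(\<lambda>k. (l2norm (\<psi> k))\<^sup>2) \<longlonglongrightarrow> (l2norm g)\<^sup>2" by (simp add: l2inner_self)
      from tendsto_real_sqrt[OF this] show ?thesis by simp
    qed
    then have "(\<lambda>k. c * l2norm (\<psi> k)) \<longlonglongrightarrow> c * l2norm g" by (intro tendsto_intros)
    moreover have "(\<lambda>k. l2inner (\<psi> k) g) \<longlonglongrightarrow> (l2norm g)\<^sup>2" using ip[OF g(1)] by (simp add: l2inner_self)
    moreover have "l2inner (\<psi> k) g \<le> c * l2norm (\<psi> k)" for k
      using bound[OF \<psi>(1)[of k]] rep[OF \<psi>(1)[of k]] by (simp add: l2inner_commute)
    ultimately have "(l2norm g)\<^sup>2 \<le> c * l2norm g" using LIMSEQ_le by blast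
    then show ?thesis using False l2norm_nonneg[of g] by (simp add: power2_eq_square mult_le_cancel_right less_le)
  qed (use c in simp)
  with g rep that show ?thesis by blast
qed

text \<open>The weight \<open>\<theta>\<close> itself serves as the mollifier, so that no smooth bump function has to be built.\<close>

lemma mollifier_test_function:
  fixes \<theta> :: "real^'n::finite \<Rightarrow> real"
  assumes \<theta>: "\<theta> \<in> test_functions (ball a r)" and d: "0 < d" and y: "cball y (d * r) \<subseteq> \<Omega>"
  shows "(\<lambda>x. \<theta> (a + (1 / d) *\<^sub>R (x - y))) \<in> test_functions \<Omega>"
proof -
  have eq: "a + (1 / d) *\<^sub>R (x - y) = (a - (1 / d) *\<^sub>R y) + (1 / d) *\<^sub>R x" for x
    by (simp add: scaleR_right_diff_distrib)
  have sm: "smooth (\<lambda>x. \<theta> (a + (1 / d) *\<^sub>R (x - y)))"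
    unfolding eq by (rule smooth_affine[OF test_functions_smooth[OF \<theta>]])
  have "{x. \<theta> (a + (1 / d) *\<^sub>R (x - y)) \<noteq> 0} \<subseteq> cball y (d * r)"
  proof
    fix x assume "x \<in> {x. \<theta> (a + (1 / d) *\<^sub>R (x - y)) \<noteq> 0}"
    then have "a + (1 / d) *\<^sub>R (x - y) \<in> ball a r" using test_functions_zero[OF \<theta>] by blast
    then have "norm (x - y) / d < r" using d by (simp add: dist_norm)
    then show "x \<in> cball y (d * r)" using d by (simp add: dist_norm norm_minus_commute pos_divide_less_eq mult.commute less_imp_le)
  qed
  then have cl: "closure {x. \<theta> (a + (1 / d) *\<^sub>R (x - y)) \<noteq> 0} \<subseteq> cball y (d * r)"
    by (rule closure_minimal) simp
  then have "compact (closure {x. \<theta> (a + (1 / d) *\<^sub>R (x - y)) \<noteq> 0})"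
    by (meson bounded_cball bounded_subset closed_closure compact_eq_bounded_closed)
  then show ?thesis using sm cl y by (auto simp: test_functions_def)
qed

section \<open>The fundamental lemma of the calculus of variations\<close>

lemma vanishing_on_test_functions_continuous:
  fixes \<theta> g k :: "real^'n::finite \<Rightarrow> real"
  assumes \<theta>: "\<theta> \<in> test_functions (ball a r)" "(\<integral>x. \<theta> x \<partial>lborel) = 1" and r: "0 < r"
    and g: "integrable lborel g" and van: "\<And>\<phi>. \<phi> \<in> test_functions \<Omega> \<Longrightarrow> (\<integral>x. g x * \<phi> x \<partial>lborel) = 0"
    and k: "continuous_on UNIV k" and S: "compact S" "S \<subseteq> \<Omega>" "\<And>x. x \<notin> S \<Longrightarrow> k x = 0" and \<Omega>: "open \<Omega>"
  shows "(\<integral>x. g x * k x \<partial>lborel) = 0"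
proof -
  have c\<theta>: "continuous_on UNIV \<theta>" and b\<theta>: "bounded_support \<theta>"
    using \<theta> by (auto intro: test_functions_continuous test_functions_bounded_support)
  have i\<theta>: "integrable lborel \<theta>" by (rule integrable_continuous_bounded_support[OF c\<theta> b\<theta>])
  have bk: "bounded_support k"
    using compact_imp_bounded[OF S(1)] S(3) unfolding bounded_iff bounded_support_def by blast
  have [measurable]: "g \<in> borel_measurable borel" "k \<in> borel_measurable borel" "\<theta> \<in> borel_measurable borel"
    using g k c\<theta> by (auto intro: borel_measurable_continuous_onI)
  obtain B where B: "\<And>x. \<bar>k x\<bar> \<le> B" using bounded_support_bounded[OF k bk] by blast
  obtain T where T: "\<And>x. \<bar>\<theta> x\<bar> \<le> T" using bounded_support_bounded[OF c\<theta> b\<theta>] by blast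
  obtain e where e: "e > 0" "(\<Union>x\<in>S. cball x e) \<subseteq> \<Omega>"
    using compact_subset_open_imp_cball_epsilon_subset[OF S(1) \<Omega> S(2)] by metis
  \<comment> \<open>At this scale the copies of the ball centred in \<open>S\<close> have radius at
    most \<open>e\<close> and stay inside \<open>\<Omega>\<close>.\<close>
  define d where "d m = e / r / real (Suc m)" for m
  have d: "0 < d m" "d m * r \<le> e" for m using e r by (auto simp: d_def divide_le_eq)
  have d0: "d \<longlonglongrightarrow> 0"
    using tendsto_mult_left[OF LIMSEQ_Suc[OF lim_1_over_n], of "e / r"] by (simp add: d_def[abs_def])
  \<comment> \<open>The mollification of \<open>k\<close>. It is a superposition of rescaled copies
    of \<open>\<theta>\<close> centred in \<open>S\<close>, all of them test functions on
    \<open>\<Omega>\<close>, so \<open>g\<close> annihilates it.\<close>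
  define km where "km m x = (\<integral>z. k (x - d m *\<^sub>R (z - a)) * \<theta> z \<partial>lborel)" for m x
  have [measurable]: "km m \<in> borel_measurable borel" for m unfolding km_def by measurable
  have kmle: "\<bar>km m x\<bar> \<le> (\<integral>z. B * \<bar>\<theta> z\<bar> \<partial>lborel)" for m x
    unfolding km_def real_norm_def[symmetric]
    by (rule integral_norm_bound_integral') (auto simp: abs_mult intro!: mult_right_mono B integrable_mult_right integrable_abs i\<theta>)
  have kmlim: "(\<lambda>m. km m x) \<longlonglongrightarrow> k x" for x
  proof -
    have "(\<lambda>m. km m x) \<longlonglongrightarrow> (\<integral>z. k x * \<theta> z \<partial>lborel)"
      unfolding km_def
    proof (rule Bochner_Integration.integral_dominated_convergence)
      show "integrable lborel (\<lambda>z. B * \<bar>\<theta> z\<bar>)" by (intro integrable_mult_right integrable_abs i\<theta>)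
      show "AE z in lborel. (\<lambda>m. k (x - d m *\<^sub>R (z - a)) * \<theta> z) \<longlonglongrightarrow> k x * \<theta> z"
      proof (rule AE_I2)
        fix z
        have "(\<lambda>m. k (x - d m *\<^sub>R (z - a))) \<longlonglongrightarrow> k (x - 0 *\<^sub>R (z - a))"
          by (intro continuous_on_tendsto_compose[OF k] tendsto_intros d0) auto
        then show "(\<lambda>m. k (x - d m *\<^sub>R (z - a)) * \<theta> z) \<longlonglongrightarrow> k x * \<theta> z" by (intro tendsto_intros) simp
      qed
    qed (auto simp: abs_mult intro!: mult_right_mono B)
    then show ?thesis by (simp add: \<theta>(2))
  qed
  have zero: "(\<integral>x. g x * km m x \<partial>lborel) = 0" for m
  proof -
    have km: "km m x = (1 / d m ^ CARD('n)) * (\<integral>y. k y * \<theta> (a + (1 / d m) *\<^sub>R (x - y)) \<partial>lborel)" for x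
    proof -
      have "(\<integral>y. k y * \<theta> (a + (1 / d m) *\<^sub>R (x - y)) \<partial>lborel) =
        (\<integral>y. (\<lambda>z. k (x - d m *\<^sub>R (z - a)) * \<theta> z) ((a + (1 / d m) *\<^sub>R x) + (- 1 / d m) *\<^sub>R y) \<partial>lborel)"
        using d(1)[of m] by (intro Bochner_Integration.integral_cong) (auto simp: algebra_simps)
      also have "\<dots> = (1 / \<bar>- 1 / d m\<bar> ^ DIM(real^'n)) *\<^sub>R km m x"
        unfolding km_def using d(1)[of m] by (intro integral_affine) auto
      finally show ?thesis using d(1)[of m] by (simp add: power_divide)
    qed
    define E where "E x y = g x * (k y * \<theta> (a + (1 / d m) *\<^sub>R (x - y)))" for x y
    have E: "integrable (lborel \<Otimes>\<^sub>M lborel) (\<lambda>p. E (fst p) (snd p))"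
    proof (rule Bochner_Integration.integrable_bound)
      show "integrable (lborel \<Otimes>\<^sub>M lborel) (\<lambda>p. T * (g (fst p) * k (snd p)))"
        by (intro integrable_mult_right lborel_pair.integrable_mult_prod g integrable_continuous_bounded_support k bk)
      show "AE p in lborel \<Otimes>\<^sub>M lborel. norm (E (fst p) (snd p)) \<le> norm (T * (g (fst p) * k (snd p)))"
      proof (rule AE_I2)
        fix p :: "(real^'n) \<times> (real^'n)"
        have "\<bar>\<theta> (a + (1 / d m) *\<^sub>R (fst p - snd p))\<bar> * \<bar>g (fst p) * k (snd p)\<bar> \<le> \<bar>T\<bar> * \<bar>g (fst p) * k (snd p)\<bar>"
          by (intro mult_right_mono order_trans[OF T abs_ge_self]) auto
        then show "norm (E (fst p) (snd p)) \<le> norm (T * (g (fst p) * k (snd p)))" by (simp add: E_def abs_mult mult_ac)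
      qed
    qed (unfold E_def, measurable)
    have "(\<integral>x. g x * km m x \<partial>lborel) = (1 / d m ^ CARD('n)) * (\<integral>x. \<integral>y. E x y \<partial>lborel \<partial>lborel)"
      unfolding km E_def by (simp add: mult.left_commute)
    also have "(\<integral>x. \<integral>y. E x y \<partial>lborel \<partial>lborel) = (\<integral>y. \<integral>x. E x y \<partial>lborel \<partial>lborel)"
      using lborel_pair.Fubini_integral[of E] E by (simp add: case_prod_beta')
    also have "\<dots> = (\<integral>y. 0 \<partial>(lborel :: (real^'n) measure))"
    proof (rule Bochner_Integration.integral_cong[OF refl])
      fix y
      show "(\<integral>x. E x y \<partial>lborel) = 0"
      proof (cases "y \<in> S")
        case True
        have "cball y (d m * r) \<subseteq> cball y e" using d(2)[of m] by auto
        then have "cball y (d m * r) \<subseteq> \<Omega>" using e(2) True by blast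
        from van[OF mollifier_test_function[OF \<theta>(1) d(1) this]]
        have "(\<integral>x. k y * (g x * \<theta> (a + (1 / d m) *\<^sub>R (x - y))) \<partial>lborel) = 0" by simp
        then show ?thesis by (simp add: E_def mult.left_commute)
      qed (simp add: E_def S(3))
    qed
    finally show ?thesis by simp
  qed
  have "(\<lambda>m. \<integral>x. g x * km m x \<partial>lborel) \<longlonglongrightarrow> (\<integral>x. g x * k x \<partial>lborel)"
  proof (rule Bochner_Integration.integral_dominated_convergence)
    show "integrable lborel (\<lambda>x. \<bar>g x\<bar> * (\<integral>z. B * \<bar>\<theta> z\<bar> \<partial>lborel))" by (intro integrable_mult_left integrable_abs g)
    show "AE x in lborel. (\<lambda>m. g x * km m x) \<longlonglongrightarrow> g x * k x" by (intro AE_I2 tendsto_intros kmlim)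
    show "AE x in lborel. norm (g x * km m x) \<le> \<bar>g x\<bar> * (\<integral>z. B * \<bar>\<theta> z\<bar> \<partial>lborel)" for m
      unfolding real_norm_def abs_mult by (intro AE_I2 mult_left_mono kmle) auto
  qed measurable
  then have "(\<lambda>m. 0 :: real) \<longlonglongrightarrow> (\<integral>x. g x * k x \<partial>lborel)" unfolding zero .
  then show ?thesis by (simp add: LIMSEQ_const_iff)
qed

text \<open>Continuous cutoffs built from the distance to \<open>K\<close> decrease to its
  indicator, and all of them live in one compact neighbourhood of \<open>K\<close> inside
  \<open>\<Omega>\<close>.\<close>

lemma vanishing_on_test_functions_compact:
  fixes \<theta> g :: "real^'n::finite \<Rightarrow> real"
  assumes \<theta>: "\<theta> \<in> test_functions (ball a r)" "(\<integral>x. \<theta> x \<partial>lborel) = 1" and r: "0 < r"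
    and g: "integrable lborel g" and van: "\<And>\<phi>. \<phi> \<in> test_functions \<Omega> \<Longrightarrow> (\<integral>x. g x * \<phi> x \<partial>lborel) = 0"
    and K: "compact K" "K \<subseteq> \<Omega>" and \<Omega>: "open \<Omega>"
  shows "(\<integral>x. g x * indicator K x \<partial>lborel) = 0"
proof (cases "K = {}")
  case False
  have [measurable]: "g \<in> borel_measurable borel" using g by auto
  have [measurable]: "K \<in> sets borel" using K(1) by (intro borel_closed compact_imp_closed)
  obtain e where e: "e > 0" "(\<Union>x\<in>K. cball x e) \<subseteq> \<Omega>"
    using compact_subset_open_imp_cball_epsilon_subset[OF K(1) \<Omega> K(2)] by metis
  define k where "k m x = max 0 (1 - real (Suc m) / e * infdist x K)" for m x
  have k01: "0 \<le> k m x" "k m x \<le> 1" for m x using e infdist_nonneg[of x K] by (auto simp: k_def)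
  have ck: "continuous_on UNIV (k m)" for m unfolding k_def by (intro continuous_intros)
  have [measurable]: "k m \<in> borel_measurable borel" for m by (rule borel_measurable_continuous_onI[OF ck])
  define S where "S = {x. infdist x K \<le> e}"
  have S: "compact S" "S \<subseteq> \<Omega>"
  proof -
    show "compact S" unfolding S_def using compact_infdist_le[OF False K(1) e(1)] by simp
    show "S \<subseteq> \<Omega>"
    proof
      fix x assume "x \<in> S"
      obtain y where "y \<in> K" "infdist x K = dist x y" using infdist_attains_inf[OF compact_imp_closed[OF K(1)] False] by metis
      then have "x \<in> cball y e" using \<open>x \<in> S\<close> by (simp add: S_def dist_commute)
      then show "x \<in> \<Omega>" using e(2) \<open>y \<in> K\<close> by blast
    qed
  qed
  have k0: "k m x = 0" if "x \<notin> S" for m x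
  proof -
    have "1 * e \<le> real (Suc m) * infdist x K" using that e(1) by (intro mult_mono) (auto simp: S_def)
    then have "1 \<le> real (Suc m) / e * infdist x K" using e(1) by (simp add: pos_le_divide_eq)
    then show ?thesis by (simp add: k_def)
  qed
  have zero: "(\<integral>x. g x * k m x \<partial>lborel) = 0" for m
    by (rule vanishing_on_test_functions_continuous[OF \<theta> r g van ck S k0 \<Omega>])
  have "(\<lambda>m. \<integral>x. g x * k m x \<partial>lborel) \<longlonglongrightarrow> (\<integral>x. g x * indicator K x \<partial>lborel)"
  proof (rule Bochner_Integration.integral_dominated_convergence)
    show "integrable lborel (\<lambda>x. \<bar>g x\<bar>)" by (intro integrable_abs g)
    show "AE x in lborel. norm (g x * k m x) \<le> \<bar>g x\<bar>" for m
      using k01 by (intro AE_I2) (auto simp: abs_mult intro!: mult_left_le)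
    show "AE x in lborel. (\<lambda>m. g x * k m x) \<longlonglongrightarrow> g x * indicator K x"
    proof (rule AE_I2)
      fix x
      show "(\<lambda>m. g x * k m x) \<longlonglongrightarrow> g x * indicator K x"
      proof (cases "x \<in> K")
        case True
        then have "k m x = 1" for m by (simp add: k_def)
        then show ?thesis using True by simp
      next
        case F: False
        then have pos: "0 < infdist x K" using False compact_imp_closed[OF K(1)] by (simp add: in_closed_iff_infdist_zero infdist_nonneg less_le)
        obtain N :: nat where N: "e / infdist x K < real N" using reals_Archimedean2 by blast
        have "k m x = 0" if "m \<ge> N" for m
        proof -
          have "e / infdist x K \<le> real (Suc m)" using N that by linarith
          then have "1 \<le> real (Suc m) / e * infdist x K" using pos e(1) by (simp add: field_simps)
          then show ?thesis by (simp add: k_def)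
        qed
        then have "\<forall>\<^sub>F m in sequentially. g x * k m x = g x * indicator K x"
          using F by (intro eventually_sequentiallyI[of N]) simp
        then show ?thesis by (rule tendsto_eventually)
      qed
    qed
  qed measurable
  then have "(\<lambda>m. 0 :: real) \<longlonglongrightarrow> (\<integral>x. g x * indicator K x \<partial>lborel)" unfolding zero .
  then show ?thesis by (simp add: LIMSEQ_const_iff)
qed simp

text \<open>By inner regularity a positivity set of positive measure would contain a compact set of
  positive measure, over which the integral of \<open>g\<close> would be both positive and
  0.\<close>

lemma vanishing_on_test_functions_AE_le:
  fixes \<theta> g :: "real^'n::finite \<Rightarrow> real"
  assumes \<theta>: "\<theta> \<in> test_functions (ball a r)" "(\<integral>x. \<theta> x \<partial>lborel) = 1" and r: "0 < r"
    and g: "integrable lborel g" and van: "\<And>\<phi>. \<phi> \<in> test_functions \<Omega> \<Longrightarrow> (\<integral>x. g x * \<phi> x \<partial>lborel) = 0"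
    and \<Omega>: "open \<Omega>" "bounded \<Omega>" and g0: "\<And>x. x \<notin> \<Omega> \<Longrightarrow> g x = 0"
  shows "AE x in lborel. g x \<le> 0"
proof (rule ccontr)
  assume not: "\<not> (AE x in lborel. g x \<le> 0)"
  have [measurable]: "g \<in> borel_measurable borel" using g by auto
  define E where "E = {x. 0 < g x}"
  have Em [measurable]: "E \<in> sets borel" unfolding E_def by measurable
  have EO: "E \<subseteq> \<Omega>" using g0 by (force simp: E_def)
  have "E \<notin> null_sets lborel"
  proof
    assume "E \<in> null_sets lborel"
    from AE_not_in[OF this] have "AE x in lborel. g x \<le> 0"
      by eventually_elim (simp add: E_def not_less)
    then show False using not by simp
  qed
  then have pos: "0 < emeasure lborel E" by (simp add: null_sets_def zero_less_iff_neq_zero)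
  have "emeasure lborel E < \<infinity>" using emeasure_bounded_finite[OF bounded_subset[OF \<Omega>(2) EO]] .
  then obtain c where c: "emeasure lborel E = ennreal c" "0 \<le> c" by (cases "emeasure lborel E") auto
  with pos have c0: "0 < c" by simp
  \<comment> \<open>The number \<open>c\<close> is the whole measure of \<open>E\<close>, so the
    complement of \<open>T\<close> in \<open>E\<close> is too small for \<open>T\<close> to be a
    null set.\<close>
  obtain T where T: "closed T" "T \<subseteq> E" "emeasure lebesgue (E - T) < ennreal c"
  proof -
    have "E \<in> sets lebesgue" by simp
    then show ?thesis using sets_lebesgue_inner_closed[of E c] c0 that by metis
  qed
  have Tm [measurable]: "T \<in> sets borel" using T(1) by simp
  have "compact T" using T EO \<Omega>(2) by (meson bounded_subset compact_eq_bounded_closed)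
  then have z: "(\<integral>x. g x * indicator T x \<partial>lborel) = 0"
    using T EO by (intro vanishing_on_test_functions_compact[OF \<theta> r g van _ _ \<Omega>(1)]) auto
  have "AE x in lborel. g x * indicator T x = 0"
  proof (subst integral_nonneg_eq_0_iff_AE[symmetric])
    show "integrable lborel (\<lambda>x. g x * indicator T x)"
      using integrable_mult_indicator[OF _ g, of T] by (simp add: mult.commute)
    show "AE x in lborel. 0 \<le> g x * indicator T x"
      using T(2) by (intro AE_I2) (auto simp: indicator_def E_def less_imp_le)
  qed (rule z)
  then have "AE x in lborel. x \<notin> T"
    by eventually_elim (use T(2) in \<open>auto simp: E_def indicator_def\<close>)
  then have "T \<in> null_sets lborel" using AE_iff_null_sets[of T lborel] by simp
  then have "emeasure lborel T = 0" by (rule null_setsD1)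
  moreover have "emeasure lborel (E - T) < ennreal c" using T(3) by (simp add: emeasure_completion)
  moreover have "emeasure lborel E \<le> emeasure lborel T + emeasure lborel (E - T)"
    using T(2) emeasure_subadditive[of T lborel "E - T"] by (simp add: Un_absorb1)
  ultimately show False using c by simp
qed

lemma vanishing_on_test_functions:
  fixes \<theta> g :: "real^'n::finite \<Rightarrow> real"
  assumes \<theta>: "\<theta> \<in> test_functions (ball a r)" "(\<integral>x. \<theta> x \<partial>lborel) = 1" and r: "0 < r"
    and g: "integrable lborel g" and van: "\<And>\<phi>. \<phi> \<in> test_functions \<Omega> \<Longrightarrow> (\<integral>x. g x * \<phi> x \<partial>lborel) = 0"
    and \<Omega>: "open \<Omega>" "bounded \<Omega>" and g0: "\<And>x. x \<notin> \<Omega> \<Longrightarrow> g x = 0"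
  shows "AE x in lborel. g x = 0"
proof -
  have "AE x in lborel. g x \<le> 0"
    by (rule vanishing_on_test_functions_AE_le[OF \<theta> r g van \<Omega> g0])
  moreover have "AE x in lborel. - g x \<le> 0"
    by (rule vanishing_on_test_functions_AE_le[OF \<theta> r _ _ \<Omega>]) (use g van g0 in auto)
  ultimately show ?thesis by eventually_elim simp
qed

section \<open>Differential forms\<close>

lemma finite_increasing_tuples: "finite (increasing_tuples k :: 'n::{finite,linorder} list set)"
proof (rule finite_subset)
  show "(increasing_tuples k :: 'n list set) \<subseteq> {xs. set xs \<subseteq> UNIV \<and> length xs = k}"
    by (auto simp: increasing_tuples_def)
  show "finite {xs :: 'n list. set xs \<subseteq> UNIV \<and> length xs = k}"
    by (rule finite_lists_length_eq) simp
qed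

lemma increasing_tuples_removed:
  assumes "I \<in> increasing_tuples l" and "m < l"
  shows "take m I @ drop (Suc m) I \<in> increasing_tuples (l - 1)"
proof -
  have I: "length I = l" "sorted_wrt (<) I" using assms by (auto simp: increasing_tuples_def)
  have "sorted_wrt (<) (take m I @ drop m I)" using I by simp
  moreover have "drop m I = I ! m # drop (Suc m) I" using I assms by (simp add: Cons_nth_drop_Suc)
  ultimately have "sorted_wrt (<) (take m I @ I ! m # drop (Suc m) I)" by simp
  then have "sorted_wrt (<) (take m I @ drop (Suc m) I)" by (simp add: sorted_wrt_append)
  then show ?thesis using I assms by (simp add: increasing_tuples_def)
qed

text \<open>A permutation contributes only if it matches the two tuples entry by entry. That forces
  equal sets, hence equal increasing tuples, and then distinctness of the entries leaves only the
  identity.\<close>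

lemma form_coeff_dx:
  fixes I J :: "'n::{finite,linorder} list"
  assumes I: "I \<in> increasing_tuples k" and J: "J \<in> increasing_tuples k"
  shows "form_coeff (dx I) J = (if I = J then 1 else 0)"
proof -
  have len: "length I = k" "length J = k" and so: "sorted_wrt (<) I" "sorted_wrt (<) J"
    using I J by (auto simp: increasing_tuples_def)
  have di: "distinct I" "distinct J" using so by (simp_all add: strict_sorted_iff)
  let ?t = "\<lambda>p. of_int (sign p) * (\<Prod>m<k. axis (J ! m) (1::real) $ (I ! p m))"
  have eq: "form_coeff (dx I) J = (\<Sum>p | p permutes {..<k}. ?t p)"
    using len by (auto simp: form_coeff_def dx_def intro!: sum.cong prod.cong)
  have term0: "?t p = 0" if p: "p permutes {..<k}" and ne: "\<not> (I = J \<and> p = id)" for p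
  proof -
    have "\<exists>m<k. J ! m \<noteq> I ! p m"
    proof (rule ccontr)
      assume "\<not> (\<exists>m<k. J ! m \<noteq> I ! p m)"
      then have e: "J ! m = I ! p m" if "m < k" for m using that by blast
      have pk: "p m < k" if "m < k" for m using permutes_in_image[OF p, of m] that by simp
      have "set J \<subseteq> set I" using e pk len by (auto simp: set_conv_nth)
      moreover have "card (set J) = card (set I)" using di len by (simp add: distinct_card)
      ultimately have "set J = set I" by (intro card_subset_eq) auto
      then have IJ: "I = J" using so strict_sorted_equal by metis
      have "p m = m" for m
      proof (cases "m < k")
        case True
        then have "I ! p m = I ! m" using e IJ by simp
        then show ?thesis using di(1) pk[OF True] True len by (simp add: nth_eq_iff_index_eq)
      qed (use p in \<open>simp add: permutes_def\<close>)
      then show False using ne IJ by (auto simp: fun_eq_iff)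
    qed
    then obtain m where m: "m < k" "J ! m \<noteq> I ! p m" by blast
    then have "axis (J ! m) (1::real) $ (I ! p m) = 0" by (simp add: axis_def)
    then have "(\<Prod>m<k. axis (J ! m) (1::real) $ (I ! p m)) = 0" using m(1) by (intro prod_zero) auto
    then show ?thesis by simp
  qed
  show ?thesis
  proof (cases "I = J")
    case True
    have "(\<Sum>p | p permutes {..<k}. ?t p) = (\<Sum>p\<in>{id}. ?t p)"
      using term0 by (intro sum.mono_neutral_right) (auto simp: finite_permutations permutes_id)
    also have "\<dots> = 1" using True by (simp add: axis_def)
    finally show ?thesis using True eq by simp
  next
    case False
    then show ?thesis unfolding eq using term0 by (simp add: sum.neutral)
  qed
qed

lemma form_coeff_form_integral:
  assumes J: "J \<in> increasing_tuples k"
  shows "form_coeff (form_integral k F) J = (LINT y|lebesgue. form_coeff (F y) J)"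
proof -
  have "form_coeff (form_integral k F) J = (\<Sum>I\<in>increasing_tuples k. (LINT y|lebesgue. form_coeff (F y) I) * form_coeff (dx I) J)"
    by (simp add: form_coeff_def form_integral_def)
  also have "\<dots> = (\<Sum>I\<in>increasing_tuples k. if I = J then (LINT y|lebesgue. form_coeff (F y) I) else 0)"
    using J by (intro sum.cong) (auto simp: form_coeff_dx)
  also have "\<dots> = (LINT y|lebesgue. form_coeff (F y) J)"
    using J by (simp add: sum.delta[OF finite_increasing_tuples])
  finally show ?thesis .
qed

lemma form_coeff_contraction:
  assumes J: "J \<in> increasing_tuples (l - 1)"
  shows "form_coeff (contraction l z \<omega>) J = (\<Sum>I\<in>increasing_tuples l. \<Sum>m<l.
    (if take m I @ drop (Suc m) I = J then (-1) ^ m * (z $ (I ! m) * form_coeff \<omega> I) else 0))"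
proof -
  have "form_coeff (contraction l z \<omega>) J = (\<Sum>I\<in>increasing_tuples l. form_coeff \<omega> I * (\<Sum>m<l. (-1)^m * z $ (I ! m) * form_coeff (dx (take m I @ drop (Suc m) I)) J))"
    by (simp add: form_coeff_def contraction_def)
  also have "\<dots> = (\<Sum>I\<in>increasing_tuples l. \<Sum>m<l. (if take m I @ drop (Suc m) I = J then (-1) ^ m * (z $ (I ! m) * form_coeff \<omega> I) else 0))"
    unfolding sum_distrib_left
    by (intro sum.cong refl) (auto simp: form_coeff_dx[OF increasing_tuples_removed J])
  finally show ?thesis .
qed

text \<open>Composing with the transposition of the two equal slots reverses the sign of every term
  of the determinant, so the sum equals its own negative.\<close>

lemma alternating_form_dx:
  fixes I :: "'n::finite list"
  assumes "length I = k"
  shows "alternating_form k (dx I)"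
  unfolding alternating_form_def
proof (intro conjI allI impI)
  fix vs :: "(real, 'n) vec list" assume "length vs \<noteq> k" then show "dx I vs = 0" using assms by (simp add: dx_def)
next
  fix vs :: "(real, 'n) vec list" and j assume vs: "length vs = k \<and> j < k"
  have "(\<Prod>m<k. (vs[j := v] ! m) $ (I ! p m)) = v $ (I ! p j) * (\<Prod>m\<in>{..<k} - {j}. (vs ! m) $ (I ! p m))" for v and p
    using vs by (subst prod.remove[of _ j]) (auto intro!: arg_cong2[where f="(*)"] prod.cong)
  then have "dx I (vs[j := v]) = (\<Sum>p | p permutes {..<k}. of_int (sign p) * (v $ (I ! p j) * (\<Prod>m\<in>{..<k} - {j}. (vs ! m) $ (I ! p m))))" for v
    using vs assms by (simp add: dx_def)
  then show "linear (\<lambda>v. dx I (vs[j := v]))"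
    by (simp only:) (intro linear_compose_sum ballI linearI; simp add: algebra_simps)
next
  fix vs :: "(real, 'n) vec list" and j m assume vs: "length vs = k \<and> j < m \<and> m < k \<and> vs ! j = vs ! m"
  let ?\<tau> = "Transposition.transpose j m"
  have \<tau>: "?\<tau> permutes {..<k}" using vs by (intro permutes_swap_id) auto
  define t where "t p = of_int (sign p) * (\<Prod>i<k. (vs ! i) $ (I ! p i))" for p :: "nat \<Rightarrow> nat"
  have "t (p \<circ> ?\<tau>) = - t p" if p: "p permutes {..<k}" for p
  proof -
    have "sign (p \<circ> ?\<tau>) = sign p * sign ?\<tau>"
      using p by (intro sign_compose permutation_permutes[THEN iffD2]) (auto intro!: exI[of _ "{..<k}"] \<tau>)
    moreover have "sign ?\<tau> = -1" using vs by (simp add: sign_swap_id)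
    moreover have "(\<Prod>i<k. (vs ! i) $ (I ! (p \<circ> ?\<tau>) i)) = (\<Prod>i<k. (vs ! i) $ (I ! p i))"
    proof -
      have "(\<Prod>i<k. (vs ! i) $ (I ! p i)) = (\<Prod>i<k. (vs ! ?\<tau> i) $ (I ! p (?\<tau> i)))"
        using prod.permute[OF \<tau>, of "\<lambda>i. (vs ! i) $ (I ! p i)"] by (simp add: o_def)
      also have "\<dots> = (\<Prod>i<k. (vs ! i) $ (I ! p (?\<tau> i)))"
        using vs by (intro prod.cong) (auto simp: Transposition.transpose_def)
      finally show ?thesis by simp
    qed
    ultimately show ?thesis by (simp add: t_def)
  qed
  then have "(\<Sum>p | p permutes {..<k}. t p) = (\<Sum>p | p permutes {..<k}. - t p)"
    by (subst sum_permutations_compose_right[OF \<tau>]) (auto intro: sum.cong)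
  then have "(\<Sum>p | p permutes {..<k}. t p) = 0" by (simp add: sum_negf)
  then show "dx I vs = 0" using vs assms by (simp add: dx_def t_def)
qed

lemma alternating_form_form_integral:
  fixes F :: "real^'n::{finite,linorder} \<Rightarrow> 'n form"
  shows "alternating_form k (form_integral k F)"
proof -
  have dx: "alternating_form k (dx I)" if "I \<in> increasing_tuples k" for I :: "'n list"
    using that by (intro alternating_form_dx) (simp add: increasing_tuples_def)
  show ?thesis
    unfolding alternating_form_def
  proof (intro conjI allI impI)
    fix vs :: "(real, 'n) vec list" and j assume vs: "length vs = k \<and> j < k"
    show "linear (\<lambda>v. form_integral k F (vs[j := v]))"
      unfolding form_integral_def
    proof (intro linear_compose_sum ballI)
      fix I :: "'n list" assume "I \<in> increasing_tuples k"
      then have "linear (\<lambda>v. dx I (vs[j := v]))" using dx vs by (auto simp: alternating_form_def)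
      from linear_compose_scale_right[OF this]
      show "linear (\<lambda>v. (LINT y|lebesgue. form_coeff (F y) I) * dx I (vs[j := v]))" by simp
    qed
  next
    fix vs :: "(real, 'n) vec list" assume "length vs \<noteq> k"
    then have "dx I vs = 0" if "I \<in> increasing_tuples k" for I
      using dx[OF that] unfolding alternating_form_def by blast
    then show "form_integral k F vs = 0" by (simp add: form_integral_def)
  next
    fix vs :: "(real, 'n) vec list" and j m assume "length vs = k \<and> j < m \<and> m < k \<and> vs ! j = vs ! m"
    then have "dx I vs = 0" if "I \<in> increasing_tuples k" for I
      using dx[OF that] unfolding alternating_form_def by blast
    then show "form_integral k F vs = 0" by (simp add: form_integral_def)
  qed
qed

text \<open>The estimates differentiate the weight in one direction only; this ties their repeated
  partial derivatives to the multi-indices of \<open>admissible_weight\<close>.\<close>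

lemma multi_deriv_single:
  fixes j :: "'n::{finite,linorder}"
  shows "multi_deriv (\<lambda>i. if i = j then k else 0) = iter_partial (replicate k j)"
proof -
  have 0: "concat (map (\<lambda>i. replicate (if i = j then k else 0) i) xs) = []" if "j \<notin> set xs" for xs
    using that by (induction xs) auto
  have "concat (map (\<lambda>i. replicate (if i = j then k else 0) i) xs) = replicate k j" if "distinct xs" "j \<in> set xs" for xs
    using that by (induction xs) (auto simp: 0)
  then show ?thesis by (simp add: multi_deriv_def)
qed

lemma multi_order_single: "multi_order (\<lambda>i. if i = j then k else 0) = k"
  by (simp add: multi_order_def)

lemma lint_lebesgue_eq_lborel:
  fixes f :: "'a::euclidean_space \<Rightarrow> real"
  assumes "f \<in> borel_measurable borel"
  shows "(LINT x|lebesgue. f x) = (\<integral>x. f x \<partial>lborel)"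
  using assms by (intro integral_completion) simp

text \<open>Interpolates the L2 norm between the essential supremum and the L1 norm.\<close>

lemma l2norm_le_sqrt:
  assumes f: "square_integrable f" "integrable lborel f" and b: "AE x in lborel. \<bar>f x\<bar> \<le> b" and d: "(\<integral>x. \<bar>f x\<bar> \<partial>lborel) \<le> d" and b0: "0 \<le> b"
  shows "l2norm f \<le> sqrt (b * d)"
proof -
  have "(\<integral>x. (f x)\<^sup>2 \<partial>lborel) \<le> (\<integral>x. b * \<bar>f x\<bar> \<partial>lborel)"
  proof (rule integral_mono_AE)
    show "integrable lborel (\<lambda>x. (f x)\<^sup>2)" using f by (simp add: square_integrable_def)
    show "integrable lborel (\<lambda>x. b * \<bar>f x\<bar>)" by (intro integrable_mult_right integrable_abs f)
    show "AE x in lborel. (f x)\<^sup>2 \<le> b * \<bar>f x\<bar>"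
      using b
    proof eventually_elim
      fix x assume "\<bar>f x\<bar> \<le> b"
      then have "\<bar>f x\<bar> * \<bar>f x\<bar> \<le> b * \<bar>f x\<bar>" by (rule mult_right_mono) simp
      then show "(f x)\<^sup>2 \<le> b * \<bar>f x\<bar>" by (simp add: power2_eq_square)
    qed
  qed
  also have "\<dots> \<le> b * d" using d b0 by (simp add: mult_left_mono)
  finally show ?thesis unfolding l2norm_def by (rule real_sqrt_le_mono)
qed

text \<open>Dominates the constants \<open>c\<close> of all pure derivatives of order at most 2. It
  is determined by \<open>c\<close> alone, so the final constant depends neither on the ball nor on
  the weight.\<close>

definition weight_bound :: "(('n::{finite,linorder} \<Rightarrow> nat) \<Rightarrow> real) \<Rightarrow> real" where
  "weight_bound c = \<bar>c (\<lambda>_. 0)\<bar> + (\<Sum>j\<in>UNIV. \<Sum>k\<in>{..2}. \<bar>c (\<lambda>i. if i = j then k else 0)\<bar>)"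

lemma weight_bound_ge:
  assumes "k \<le> 2" shows "\<bar>c (\<lambda>i. if i = j then k else 0)\<bar> \<le> weight_bound c"
proof -
  have "\<bar>c (\<lambda>i. if i = j then k else 0)\<bar> \<le> (\<Sum>k\<in>{..2}. \<bar>c (\<lambda>i. if i = j then k else 0)\<bar>)"
    using assms by (intro member_le_sum[of k "{..2}" "\<lambda>k. \<bar>c (\<lambda>i. if i = j then k else 0)\<bar>"]) auto
  also have "\<dots> \<le> (\<Sum>j\<in>UNIV. \<Sum>k\<in>{..2}. \<bar>c (\<lambda>i. if i = j then k else 0)\<bar>)"
    by (intro member_le_sum[of j UNIV "\<lambda>j. \<Sum>k\<in>{..2}. \<bar>c (\<lambda>i. if i = j then k else 0)\<bar>"]) (auto intro: sum_nonneg)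
  finally show ?thesis by (simp add: weight_bound_def)
qed

lemma weight_bound_nonneg: "0 \<le> weight_bound c"
  unfolding weight_bound_def by (intro add_nonneg_nonneg sum_nonneg) auto

lemma admissible_weight_bounds:
  fixes \<theta> :: "real^'n::{finite,linorder} \<Rightarrow> real" and j :: 'n
  assumes adm: "admissible_weight c (ball a r) \<theta>" and r: "0 < r" and k: "k \<le> 2"
  defines "\<eta> \<equiv> iter_partial (replicate k j) \<theta>"
  shows "(\<integral>x. \<bar>\<eta> x\<bar> \<partial>lborel) \<le> weight_bound c / (2 * r) ^ k"
    and "AE x in lborel. \<bar>\<eta> x\<bar> \<le> weight_bound c / (2 * r) ^ (CARD('n) + k)"
proof -
  let ?\<alpha> = "\<lambda>i. if i = j then k else 0"
  have d: "diameter (ball a r) = 2 * r" using r by (simp add: diameter_ball)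
  have \<theta>: "\<theta> \<in> test_functions (ball a r)" using adm by (simp add: admissible_weight_def)
  have [measurable]: "\<eta> \<in> borel_measurable borel"
    unfolding \<eta>_def by (intro borel_measurable_continuous_onI smooth_continuous test_functions_smooth[OF \<theta>])
  have le: "c ?\<alpha> / (2 * r) ^ m \<le> weight_bound c / (2 * r) ^ m" for m
    using weight_bound_ge[OF k, of c j] r by (intro divide_right_mono) auto
  have adm': "(LINT x|lebesgue. \<bar>multi_deriv ?\<alpha> \<theta> x\<bar>) \<le> c ?\<alpha> / (2 * r) ^ multi_order ?\<alpha>"
     "AE x in lebesgue. \<bar>multi_deriv ?\<alpha> \<theta> x\<bar> \<le> c ?\<alpha> / (2 * r) ^ (CARD('n) + multi_order ?\<alpha>)"
    using adm unfolding admissible_weight_def d by blast+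
  have "(LINT x|lebesgue. \<bar>\<eta> x\<bar>) \<le> c ?\<alpha> / (2 * r) ^ k"
    using adm'(1) unfolding multi_deriv_single multi_order_single \<eta>_def .
  also have "(LINT x|lebesgue. \<bar>\<eta> x\<bar>) = (\<integral>x. \<bar>\<eta> x\<bar> \<partial>lborel)" by (rule lint_lebesgue_eq_lborel) measurable
  finally show "(\<integral>x. \<bar>\<eta> x\<bar> \<partial>lborel) \<le> weight_bound c / (2 * r) ^ k" using le[of k] by linarith
  have "AE x in lebesgue. \<bar>\<eta> x\<bar> \<le> c ?\<alpha> / (2 * r) ^ (CARD('n) + k)"
    using adm'(2) unfolding multi_deriv_single multi_order_single \<eta>_def .
  then have "AE x in lborel. \<bar>\<eta> x\<bar> \<le> c ?\<alpha> / (2 * r) ^ (CARD('n) + k)"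
    by (simp add: AE_completion_iff)
  then show "AE x in lborel. \<bar>\<eta> x\<bar> \<le> weight_bound c / (2 * r) ^ (CARD('n) + k)"
    by eventually_elim (use le[of "CARD('n) + k"] in linarith)
qed

section \<open>The Sobolev bound for the Poincare operator\<close>

lemma borel_measurable_completion_AE:
  fixes f g :: "'a \<Rightarrow> real"
  assumes g: "g \<in> borel_measurable M" and ae: "AE x in M. f x = g x"
  shows "f \<in> borel_measurable (completion M)"
proof (rule measurableI)
  fix A :: "real set" assume A: "A \<in> sets borel"
  define P where "P x \<longleftrightarrow> f x \<noteq> g x \<and> f x \<in> A" for x
  define N where "N x \<longleftrightarrow> f x \<noteq> g x \<and> f x \<notin> A" for x
  have [measurable]: "Measurable.pred (completion M) P" "Measurable.pred (completion M) N"
    using ae by (auto intro!: sets_completion_AE simp: P_def N_def elim!: eventually_mono)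
  have [measurable]: "g \<in> borel_measurable (completion M)" by (rule measurable_completion[OF g])
  have [measurable]: "A \<in> sets borel" by (rule A)
  have "f -` A \<inter> space (completion M) = {x \<in> space (completion M). (g x \<in> A \<and> \<not> N x) \<or> P x}"
    by (auto simp: P_def N_def)
  also have "\<dots> \<in> sets (completion M)" by measurable
  finally show "f -` A \<inter> space (completion M) \<in> sets (completion M)" .
qed simp

lemma integral_lebesgue_cong:
  fixes f g :: "'a::euclidean_space \<Rightarrow> real"
  assumes g: "g \<in> borel_measurable borel" and ae: "AE x in lborel. f x = g x"
  shows "(LINT x|lebesgue. f x) = (\<integral>x. g x \<partial>lborel)"
proof -
  have "(LINT x|lebesgue. f x) = (LINT x|lebesgue. g x)"
    using g ae by (intro integral_cong_AE borel_measurable_completion_AE[of g]) (auto simp: AE_completion_iff intro: measurable_completion)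
  then show ?thesis using lint_lebesgue_eq_lborel[OF g] by simp
qed

text \<open>A Lebesgue measurable function agrees almost everywhere with a Borel one; cutting it off
  outside \<open>\<Omega>\<close> turns set integrals into integrals over the whole space.\<close>

lemma L2_borel_representative:
  fixes f :: "'a::euclidean_space \<Rightarrow> real"
  assumes f: "L2 \<Omega> f" and \<Omega>: "\<Omega> \<in> sets borel"
  obtains F where "square_integrable F" "\<And>x. x \<notin> \<Omega> \<Longrightarrow> F x = 0" "AE x in lborel. x \<in> \<Omega> \<longrightarrow> f x = F x" "L2_norm \<Omega> f = l2norm F"
proof -
  have "(\<lambda>x. indicator \<Omega> x *\<^sub>R f x) \<in> borel_measurable lebesgue"
    using f by (simp add: L2_def set_borel_measurable_def)
  then obtain g where g: "g \<in> borel_measurable lborel" "AE x in lborel. indicator \<Omega> x *\<^sub>R f x = g x"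
    using completion_ex_borel_measurable_real by blast
  define F where "F x = indicator \<Omega> x * g x" for x
  have [measurable]: "g \<in> borel_measurable borel" using g(1) by simp
  note [measurable] = \<Omega>
  have Fm [measurable]: "F \<in> borel_measurable borel" unfolding F_def by measurable
  have F0: "F x = 0" if "x \<notin> \<Omega>" for x using that by (simp add: F_def)
  have ae: "AE x in lborel. x \<in> \<Omega> \<longrightarrow> f x = F x"
    using g(2) by eventually_elim (auto simp: F_def)
  have sq: "AE x in lborel. indicator \<Omega> x *\<^sub>R (f x)\<^sup>2 = (F x)\<^sup>2"
    using ae by eventually_elim (auto simp: indicator_def F0)
  have "integrable lebesgue (\<lambda>x. indicator \<Omega> x *\<^sub>R (f x)\<^sup>2)"
    using f by (simp add: L2_def set_integrable_def)
  then have "integrable lebesgue (\<lambda>x. (F x)\<^sup>2)"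
    by (rule integrable_cong_AE_imp) (use sq in \<open>auto simp: AE_completion_iff intro: measurable_completion\<close>)
  then have si: "square_integrable F" by (simp add: square_integrable_def integrable_completion)
  have "(LINT x:\<Omega>|lebesgue. (f x)\<^sup>2) = (\<integral>x. (F x)\<^sup>2 \<partial>lborel)"
    unfolding set_lebesgue_integral_def by (rule integral_lebesgue_cong[OF _ sq]) measurable
  then have "L2_norm \<Omega> f = l2norm F" by (simp add: L2_norm_def l2norm_def)
  with si F0 ae that show ?thesis by blast
qed

lemma L2_of_square_integrable:
  fixes f F :: "'a::euclidean_space \<Rightarrow> real"
  assumes F: "square_integrable F" and ae: "AE x in lborel. x \<in> \<Omega> \<longrightarrow> f x = F x" and \<Omega>: "\<Omega> \<in> sets borel"
    and F0: "\<And>x. x \<notin> \<Omega> \<Longrightarrow> F x = 0"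
  shows "L2 \<Omega> f"
proof -
  have [measurable]: "F \<in> borel_measurable borel" using F by (simp add: square_integrable_def)
  have 1: "AE x in lborel. indicator \<Omega> x *\<^sub>R f x = F x"
    using ae by eventually_elim (auto simp: indicator_def F0)
  have 2: "AE x in lborel. indicator \<Omega> x *\<^sub>R (f x)\<^sup>2 = (F x)\<^sup>2"
    using ae by eventually_elim (auto simp: indicator_def F0)
  have m2: "(\<lambda>x. indicator \<Omega> x *\<^sub>R (f x)\<^sup>2) \<in> borel_measurable lebesgue"
    by (rule borel_measurable_completion_AE[OF _ 2]) measurable
  have "integrable lebesgue (\<lambda>x. (F x)\<^sup>2)" using F by (simp add: square_integrable_def integrable_completion)
  then have "integrable lebesgue (\<lambda>x. indicator \<Omega> x *\<^sub>R (f x)\<^sup>2)"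
    by (rule integrable_cong_AE_imp[OF _ m2]) (use 2 in \<open>auto simp: AE_completion_iff eq_commute\<close>)
  moreover have "(\<lambda>x. indicator \<Omega> x *\<^sub>R f x) \<in> borel_measurable lebesgue"
    by (rule borel_measurable_completion_AE[OF _ 1]) simp
  ultimately show ?thesis by (simp add: L2_def set_borel_measurable_def set_integrable_def)
qed

lemma set_integral_representative:
  fixes f F k :: "'a::euclidean_space \<Rightarrow> real"
  assumes F: "F \<in> borel_measurable borel" and k: "k \<in> borel_measurable borel"
    and ae: "AE x in lborel. x \<in> \<Omega> \<longrightarrow> f x = F x" and F0: "\<And>x. x \<notin> \<Omega> \<Longrightarrow> F x = 0"
  shows "(LINT x:\<Omega>|lebesgue. f x * k x) = l2inner F k"
  unfolding set_lebesgue_integral_def l2inner_def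
proof (rule integral_lebesgue_cong)
  show "(\<lambda>x. F x * k x) \<in> borel_measurable borel" using F k by measurable
  show "AE x in lborel. indicator \<Omega> x *\<^sub>R (f x * k x) = F x * k x"
    using ae by eventually_elim (auto simp: indicator_def F0)
qed

lemma square_integrable_partial_test_function:
  assumes "\<phi> \<in> test_functions \<Omega>"
  shows "square_integrable (partial_deriv j \<phi>)"
  using has_partial_continuous(2)[OF test_functions_has_partial[OF assms]]
    has_partial_bounded_support[OF test_functions_has_partial[OF assms] test_functions_bounded_support[OF assms]]
  by (rule square_integrable_bounded_support)

lemma square_integrable_test_function:
  assumes "\<phi> \<in> test_functions \<Omega>" shows "square_integrable \<phi>"
  by (intro square_integrable_bounded_support test_functions_continuous[OF assms] test_functions_bounded_support[OF assms])

text \<open>Riesz representation supplies one weak derivative with norm at most \<open>c\<close>.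
  Since \<open>weak_partial\<close> is chosen by \<open>SOME\<close>, the bound reaches it only
  through uniqueness almost everywhere.\<close>

lemma weak_partial_bound:
  fixes \<Omega> :: "(real^'n::finite) set" and \<theta> h H :: "real^'n \<Rightarrow> real"
  assumes \<Omega>: "open \<Omega>" "bounded \<Omega>" and r: "0 < r"
    and \<theta>: "\<theta> \<in> test_functions (ball a r)" "(\<integral>x. \<theta> x \<partial>lborel) = 1"
    and H: "square_integrable H" "\<And>x. x \<notin> \<Omega> \<Longrightarrow> H x = 0" "AE x in lborel. x \<in> \<Omega> \<longrightarrow> h x = H x"
    and c: "0 \<le> c" and bound: "\<And>\<phi>. \<phi> \<in> test_functions \<Omega> \<Longrightarrow> \<bar>l2inner H (partial_deriv j \<phi>)\<bar> \<le> c * l2norm \<phi>"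
  shows "\<exists>g. L2 \<Omega> g \<and> is_weak_partial \<Omega> j h g" and "L2_norm \<Omega> (weak_partial \<Omega> j h) \<le> c"
proof -
  have \<Omega>m: "\<Omega> \<in> sets borel" using \<Omega> by simp
  note fin = emeasure_bounded_finite[OF \<Omega>(2)]
  have Hm: "H \<in> borel_measurable borel" using H by (simp add: square_integrable_def)
  have pm: "partial_deriv j \<phi> \<in> borel_measurable borel" "\<phi> \<in> borel_measurable borel" if "\<phi> \<in> test_functions \<Omega>" for \<phi>
    using square_integrable_partial_test_function[OF that] square_integrable_test_function[OF that] by (auto simp: square_integrable_def)
  define L where "L \<phi> = - l2inner H (partial_deriv j \<phi>)" for \<phi>
  have lin: "L (\<lambda>x. s * \<phi> x + t * \<psi> x) = s * L \<phi> + t * L \<psi>" if "\<phi> \<in> test_functions \<Omega>" "\<psi> \<in> test_functions \<Omega>" for \<phi> \<psi> s t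
  proof -
    have "partial_deriv j (\<lambda>x. s * \<phi> x + t * \<psi> x) = (\<lambda>x. s * partial_deriv j \<phi> x + t * partial_deriv j \<psi> x)"
      using smooth_differentiable[OF test_functions_smooth[OF that(1)], of "[]"] smooth_differentiable[OF test_functions_smooth[OF that(2)], of "[]"]
      by (intro partial_deriv_add) auto
    then show ?thesis
      unfolding L_def l2inner_commute[of H]
      by (simp add: l2inner_add_left square_integrable_partial_test_function[OF that(1)] square_integrable_partial_test_function[OF that(2)] H)
  qed
  obtain g where g: "square_integrable g" "\<And>x. x \<notin> \<Omega> \<Longrightarrow> g x = 0" "l2norm g \<le> c"
    "\<And>\<phi>. \<phi> \<in> test_functions \<Omega> \<Longrightarrow> L \<phi> = l2inner g \<phi>"
    by (rule riesz_test_functions[OF \<Omega> c lin]) (use bound in \<open>auto simp: L_def\<close>)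
  have gm: "g \<in> borel_measurable borel" using g by (simp add: square_integrable_def)
  have Lg: "L2 \<Omega> g" by (rule L2_of_square_integrable[OF g(1) _ \<Omega>m g(2)]) auto
  have "is_weak_partial \<Omega> j h g"
    unfolding is_weak_partial_def
  proof
    fix \<phi> assume \<phi>: "\<phi> \<in> test_functions \<Omega>"
    have "(LINT x:\<Omega>|lebesgue. h x * partial_deriv j \<phi> x) = l2inner H (partial_deriv j \<phi>)"
      by (rule set_integral_representative[OF Hm pm(1)[OF \<phi>] H(3,2)])
    moreover have "(LINT x:\<Omega>|lebesgue. g x * \<phi> x) = l2inner g \<phi>"
      by (rule set_integral_representative[OF gm pm(2)[OF \<phi>] _ g(2)]) auto
    ultimately show "(LINT x:\<Omega>|lebesgue. h x * partial_deriv j \<phi> x) = - (LINT x:\<Omega>|lebesgue. g x * \<phi> x)"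
      using g(4)[OF \<phi>] by (simp add: L_def)
  qed
  with Lg show ex: "\<exists>g. L2 \<Omega> g \<and> is_weak_partial \<Omega> j h g" by blast
  define w where "w = weak_partial \<Omega> j h"
  have w: "L2 \<Omega> w" "is_weak_partial \<Omega> j h w"
    using someI_ex[OF ex] by (auto simp: w_def weak_partial_def)
  obtain W where W: "square_integrable W" "\<And>x. x \<notin> \<Omega> \<Longrightarrow> W x = 0" "AE x in lborel. x \<in> \<Omega> \<longrightarrow> w x = W x" "L2_norm \<Omega> w = l2norm W"
    using L2_borel_representative[OF w(1) \<Omega>m] by metis
  have Wm: "W \<in> borel_measurable borel" using W by (simp add: square_integrable_def)
  \<comment> \<open>Both functions represent the same functional, so their difference is orthogonal
    to every test function.\<close>
  have "AE x in lborel. 1 * W x + (-1) * g x = 0"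
  proof (rule vanishing_on_test_functions[OF \<theta> r _ _ \<Omega>])
    show "integrable lborel (\<lambda>x. 1 * W x + (-1) * g x)"
      by (rule integrable_of_square_integrable[OF square_integrable_add[OF W(1) g(1)] \<Omega>m fin]) (simp add: W g)
    fix \<phi> assume \<phi>: "\<phi> \<in> test_functions \<Omega>"
    have "l2inner H (partial_deriv j \<phi>) = - l2inner W \<phi>"
    proof -
      have "(LINT x:\<Omega>|lebesgue. h x * partial_deriv j \<phi> x) = l2inner H (partial_deriv j \<phi>)"
        by (rule set_integral_representative[OF Hm pm(1)[OF \<phi>] H(3,2)])
      moreover have "(LINT x:\<Omega>|lebesgue. w x * \<phi> x) = l2inner W \<phi>"
        by (rule set_integral_representative[OF Wm pm(2)[OF \<phi>] W(3,2)])
      ultimately show ?thesis using w(2) \<phi> unfolding is_weak_partial_def by simp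
    qed
    moreover have "- l2inner H (partial_deriv j \<phi>) = l2inner g \<phi>" using g(4)[OF \<phi>] by (simp add: L_def)
    ultimately have "l2inner (\<lambda>x. 1 * W x + (-1) * g x) \<phi> = 0"
      by (simp only: l2inner_add_left[OF W(1) g(1) square_integrable_test_function[OF \<phi>]])
    then show "(\<integral>x. (1 * W x + (-1) * g x) * \<phi> x \<partial>lborel) = 0" by (simp only: l2inner_def)
  qed (simp add: W g)
  then have "AE x in lborel. (W x)\<^sup>2 = (g x)\<^sup>2" by eventually_elim simp
  then have "(\<integral>x. (W x)\<^sup>2 \<partial>lborel) = (\<integral>x. (g x)\<^sup>2 \<partial>lborel)"
    using Wm gm by (intro integral_cong_AE) auto
  then have "l2norm W = l2norm g" by (simp add: l2norm_def)
  then show "L2_norm \<Omega> (weak_partial \<Omega> j h) \<le> c" using W(4) g(3) by (simp add: w_def)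
qed

text \<open>The interpolation exponent \<open>lam\<close> is chosen so that the low part of the kernel integrates to \<open>1 / e\<close>;
  in the critical case \<open>2 * l = CARD('n)\<close> it depends on the volume ratio and \<open>1 / e\<close> is the logarithm.\<close>

lemma poincare_kappa_bound:
  fixes l :: nat
  assumes l: "1 \<le> l" "l \<le> CARD('n::finite)"
  shows "\<exists>C. \<forall>(\<Omega> :: (real^'n) set) a r. 0 < r \<longrightarrow> ball a r \<subseteq> \<Omega> \<longrightarrow> open \<Omega> \<longrightarrow> bounded \<Omega> \<longrightarrow>
    (\<exists>lam e. 0 \<le> lam \<and> lam \<le> 1 \<and> e = real l - (real CARD('n) / 2) * (1 - lam) \<and> 0 < e \<and>
      1 + (measure lborel \<Omega> / (2 * r) ^ CARD('n)) powr (lam / 2) / e \<le> C * poincare_kappa l \<Omega> (ball a r))"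
proof -
  let ?n = "CARD('n)"
  \<comment> \<open>The volume of the ball is \<open>unit_ball_vol / 2 ^ n\<close> times
    \<open>(2 * r) ^ n\<close>. Taking the maximum with 1 lets \<open>V\<close> also dominate the
    powers of this factor with exponent between 0 and 1.\<close>
  define V where "V = max 1 (unit_ball_vol (real ?n) / 2 ^ ?n)"
  have V1: "1 \<le> V" by (simp add: V_def)
  have ratio: "1 \<le> measure lebesgue \<Omega> / measure lebesgue (ball a r)"
    "\<And>s. 0 \<le> s \<Longrightarrow> s \<le> 1 \<Longrightarrow> (measure lborel \<Omega> / (2 * r) ^ ?n) powr s \<le> V * (measure lebesgue \<Omega> / measure lebesgue (ball a r)) powr s"
    if r: "0 < r" and sub: "ball a r \<subseteq> \<Omega>" and \<Omega>: "open \<Omega>" "bounded \<Omega>" for \<Omega> :: "(real^'n) set" and a r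
  proof -
    let ?b = "measure lborel (ball a r)"
    have b: "?b = unit_ball_vol (real ?n) * r ^ ?n" using content_ball[of r a] r by simp
    have b0: "0 < ?b" unfolding b using r by simp
    have le: "?b \<le> measure lborel \<Omega>"
      using sub \<Omega> emeasure_bounded_finite[OF \<Omega>(2)] by (intro measure_mono_fmeasurable) (auto simp: fmeasurable_def)
    show "1 \<le> measure lebesgue \<Omega> / measure lebesgue (ball a r)" using le b0 \<Omega> by (simp add: measure_completion)
    fix s :: real assume s: "0 \<le> s" "s \<le> 1"
    have "measure lborel \<Omega> / (2 * r) ^ ?n = (unit_ball_vol (real ?n) / 2 ^ ?n) * (measure lborel \<Omega> / ?b)"
    proof -
      have "unit_ball_vol (real ?n) \<noteq> 0" by (metis of_nat_0_le_iff unit_ball_vol_pos less_irrefl)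
      then show ?thesis unfolding b using r by (simp add: power_mult_distrib)
    qed
    then have "(measure lborel \<Omega> / (2 * r) ^ ?n) powr s = (unit_ball_vol (real ?n) / 2 ^ ?n) powr s * (measure lborel \<Omega> / ?b) powr s"
      by (simp only: powr_mult)
    also have "\<dots> \<le> V * (measure lborel \<Omega> / ?b) powr s"
    proof (rule mult_right_mono)
      have "(unit_ball_vol (real ?n) / 2 ^ ?n) powr s \<le> V powr s" unfolding V_def using s by (intro powr_mono2) auto
      also have "\<dots> \<le> V powr 1" using V1 s by (intro powr_mono) auto
      finally show "(unit_ball_vol (real ?n) / 2 ^ ?n) powr s \<le> V" using V1 by simp
    qed simp
    finally show "(measure lborel \<Omega> / (2 * r) ^ ?n) powr s \<le> V * (measure lebesgue \<Omega> / measure lebesgue (ball a r)) powr s"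
      using \<Omega> by (simp add: measure_completion)
  qed
  consider "2 * l > ?n" | "2 * l = ?n" | "2 * l < ?n" by linarith
  then show ?thesis
  proof cases
    \<comment> \<open>Schur's bound alone is integrable at \<open>t = 1\<close>, so
      \<open>lam = 0\<close> and no power of the volume ratio appears.\<close>
    case 1
    define e where "e = real l - real ?n / 2"
    have e: "0 < e" using 1 by (simp add: e_def)
    define D where "D = 1 + V / e"
    show ?thesis
    proof (rule exI[of _ D], intro allI impI)
      fix \<Omega> :: "(real^'n) set" and a r assume a: "0 < r" "ball a r \<subseteq> \<Omega>" "open \<Omega>" "bounded \<Omega>"
      have "(measure lborel \<Omega> / (2 * r) ^ ?n) powr 0 / e \<le> (V * (measure lebesgue \<Omega> / measure lebesgue (ball a r)) powr 0) / e"
        using e by (intro divide_right_mono ratio(2)[OF a]) auto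
      also have "\<dots> = V / e"
      proof -
        have "measure lebesgue \<Omega> / measure lebesgue (ball a r) \<noteq> 0" using ratio(1)[OF a] by linarith
        then show ?thesis by (simp only: powr_zero_eq_one if_False mult_1_right)
      qed
      finally have "1 + (measure lborel \<Omega> / (2 * r) ^ ?n) powr (0 / 2) / e \<le> (1 + V / e) * poincare_kappa l \<Omega> (ball a r)"
        using 1 by (simp add: poincare_kappa_def)
      then show "\<exists>lam e. 0 \<le> lam \<and> lam \<le> 1 \<and> e = real l - (real ?n / 2) * (1 - lam) \<and> 0 < e \<and>
        1 + (measure lborel \<Omega> / (2 * r) ^ ?n) powr (lam / 2) / e \<le> D * poincare_kappa l \<Omega> (ball a r)"
        using e by (intro exI[of _ "0::real"] exI[of _ e]) (auto simp: e_def D_def)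
    qed
  next
    case 2
    show ?thesis
    proof (rule exI[of _ "1 + V * exp 1"], intro allI impI)
      fix \<Omega> :: "(real^'n) set" and a r assume a: "0 < r" "ball a r \<subseteq> \<Omega>" "open \<Omega>" "bounded \<Omega>"
      define q where "q = measure lebesgue \<Omega> / measure lebesgue (ball a r)"
      define lg where "lg = max 1 (ln q)"
      have q: "1 \<le> q" using ratio(1)[OF a] by (simp add: q_def)
      have lg: "1 \<le> lg" "ln q \<le> lg" by (auto simp: lg_def)
      \<comment> \<open>With this choice \<open>q powr (lam / 2)\<close> stays below
        \<open>exp 1\<close>, however large the ratio is.\<close>
      define lam where "lam = 1 / lg"
      have lam: "0 \<le> lam" "lam \<le> 1" using lg by (auto simp: lam_def)
      define e where "e = real l * lam"
      have nl: "real ?n = 2 * real l" using 2 by linarith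
      have e: "0 < e" "e = real l - (real ?n / 2) * (1 - lam)"
        using lg l unfolding nl by (auto simp: e_def lam_def algebra_simps)
      have "q powr (lam / 2) = exp (ln q / lg / 2)" using q by (simp add: powr_def lam_def)
      also have "\<dots> \<le> exp 1"
      proof -
        have "ln q / lg \<le> 1" using lg by simp
        then show ?thesis by simp
      qed
      finally have qe: "q powr (lam / 2) \<le> exp 1" .
      have inv: "1 / e \<le> lg"
      proof -
        have "1 * lg \<le> real l * lg" using l lg by (intro mult_right_mono) auto
        then show ?thesis using l lg by (simp add: e_def lam_def divide_le_eq mult.commute)
      qed
      \<comment> \<open>For \<open>n = 2 * l\<close> the two exponents in the factor are 0 and
        1.\<close>
      have kap: "poincare_kappa l \<Omega> (ball a r) = lg"
      proof -
        have "real ?n / (2 * (real ?n - real l)) = 1" using l unfolding nl by simp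
        moreover have "real ?n - 2 * real l = 0" using nl by simp
        moreover have "q powr 0 = 1" "lg powr 1 = lg" using q lg by auto
        ultimately show ?thesis
          using 2 unfolding poincare_kappa_def Let_def q_def[symmetric] lg_def[symmetric] by (simp only: if_False if_True simp_thms less_irrefl mult_1_left div_0)
      qed
      have "(measure lborel \<Omega> / (2 * r) ^ ?n) powr (lam / 2) / e \<le> (V * q powr (lam / 2)) / e"
        using lam e unfolding q_def by (intro divide_right_mono ratio(2)[OF a]) auto
      also have "\<dots> = (V * q powr (lam / 2)) * (1 / e)" by simp
      also have "\<dots> \<le> (V * exp 1) * lg"
        using V1 e qe inv by (intro mult_mono) auto
      finally have "1 + (measure lborel \<Omega> / (2 * r) ^ ?n) powr (lam / 2) / e \<le> (1 + V * exp 1) * poincare_kappa l \<Omega> (ball a r)"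
        unfolding kap using lg by (simp add: algebra_simps)
      then show "\<exists>lam e. 0 \<le> lam \<and> lam \<le> 1 \<and> e = real l - (real ?n / 2) * (1 - lam) \<and> 0 < e \<and>
        1 + (measure lborel \<Omega> / (2 * r) ^ ?n) powr (lam / 2) / e \<le> (1 + V * exp 1) * poincare_kappa l \<Omega> (ball a r)"
        using lam e by blast
    qed
  next
    case 3
    let ?d = "real ?n - real l"
    have d: "0 < ?d" "0 < real ?n - 2 * real l" using 3 by linarith+
    \<comment> \<open>Half of this is the exponent of the volume ratio in
      \<open>poincare_kappa\<close>. It lies above \<open>(n - 2 * l) / n\<close>, the value at
      which \<open>e\<close> would vanish.\<close>
    define lam where "lam = (real ?n - 2 * real l) / ?d"
    define e where "e = real l - (real ?n / 2) * (1 - lam)"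
    have lam: "0 \<le> lam" "lam \<le> 1" using d l by (auto simp: lam_def)
    have e: "0 < e"
    proof -
      have "1 - lam = real l / ?d" using d by (simp add: lam_def field_simps)
      then have "e = real l - (real ?n / 2) * (real l / ?d)" by (simp only: e_def)
      also have "\<dots> = real l * (real ?n - 2 * real l) / (2 * ?d)" using d by (simp add: field_simps)
      finally have "e = real l * (real ?n - 2 * real l) / (2 * ?d)" .
      then show ?thesis using d l by simp
    qed
    define D where "D = 1 + V / e"
    show ?thesis
    proof (rule exI[of _ D], intro allI impI)
      fix \<Omega> :: "(real^'n) set" and a r assume a: "0 < r" "ball a r \<subseteq> \<Omega>" "open \<Omega>" "bounded \<Omega>"
      define q where "q = measure lebesgue \<Omega> / measure lebesgue (ball a r)"
      define lg where "lg = max 1 (ln q)"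
      have q: "1 \<le> q" using ratio(1)[OF a] by (simp add: q_def)
      have lg: "1 \<le> lg" by (simp add: lg_def)
      have ex: "(real ?n - 2 * real l) / (2 * (real ?n - real l)) = lam / 2" by (simp add: lam_def)
      have kap: "q powr (lam / 2) \<le> poincare_kappa l \<Omega> (ball a r)"
      proof -
        \<comment> \<open>Since \<open>lg \<ge> 1\<close>, its powers with nonnegative exponent are
          at least 1; this covers both logarithmic exponents that occur for
          \<open>2 * l < n\<close>.\<close>
        have "q powr (lam / 2) * 1 \<le> q powr (lam / 2) * lg powr s" if "0 \<le> s" for s
          using that lg by (intro mult_left_mono) (auto simp: ge_one_powr_ge_zero)
        moreover have "0 \<le> real ?n / (2 * (real ?n - real l))" using d by simp
        moreover have "0 \<le> real ?n / (2 * (real ?n - real l - 1))" using 3 l by simp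
        ultimately show ?thesis using 3
          unfolding poincare_kappa_def Let_def q_def[symmetric] lg_def[symmetric] ex by auto
      qed
      have q1: "1 \<le> q powr (lam / 2)" using q lam by (simp add: ge_one_powr_ge_zero)
      have "(measure lborel \<Omega> / (2 * r) ^ ?n) powr (lam / 2) / e \<le> (V * q powr (lam / 2)) / e"
        using lam e unfolding q_def by (intro divide_right_mono ratio(2)[OF a]) auto
      then have "1 + (measure lborel \<Omega> / (2 * r) ^ ?n) powr (lam / 2) / e \<le> q powr (lam / 2) + (V / e) * q powr (lam / 2)"
        using q1 by simp
      also have "\<dots> = (1 + V / e) * q powr (lam / 2)" by (simp add: algebra_simps)
      also have "\<dots> \<le> (1 + V / e) * poincare_kappa l \<Omega> (ball a r)"
        using V1 e by (intro mult_left_mono kap) auto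
      finally have "1 + (measure lborel \<Omega> / (2 * r) ^ ?n) powr (lam / 2) / e \<le> D * poincare_kappa l \<Omega> (ball a r)"
        by (simp only: D_def)
      then show "\<exists>lam e. 0 \<le> lam \<and> lam \<le> 1 \<and> e = real l - (real ?n / 2) * (1 - lam) \<and> 0 < e \<and>
        1 + (measure lborel \<Omega> / (2 * r) ^ ?n) powr (lam / 2) / e \<le> D * poincare_kappa l \<Omega> (ball a r)"
        using lam e e_def by blast
    qed
  qed
qed

text \<open>At index \<open>k = n - l + 1\<close> the powers \<open>n - k\<close> and
  \<open>k - 1\<close> become \<open>l - 1\<close> and \<open>n - l\<close>; the latter is
  nonnegative, so \<open>powi\<close> is an ordinary power.\<close>

lemma poincare_kernel_eq:
  fixes \<theta> :: "real^'n::{finite,linorder} \<Rightarrow> real"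
  assumes l: "1 \<le> l" "l \<le> CARD('n)" and \<theta>: "\<theta> \<in> borel_measurable borel"
  shows "poincare_kernel \<theta> (CARD('n) - l + 1) y x = ray_kernel l \<theta> x y"
proof -
  have k: "CARD('n) - (CARD('n) - l + 1) = l - 1" using l by simp
  have p: "int (CARD('n) - l + 1) - 1 = int (CARD('n) - l)" by simp
  note [measurable] = \<theta>
  have "poincare_kernel \<theta> (CARD('n) - l + 1) y x
     = (LINT t|lebesgue. indicator {1..} t * ray_weight CARD('n) l t * \<theta> (x + t *\<^sub>R (y - x)))"
    unfolding poincare_kernel_def set_lebesgue_integral_def k p ray_weight_def power_int_of_nat
    by (simp add: mult.assoc)
  also have "\<dots> = ray_kernel l \<theta> x y"
    unfolding ray_kernel_def by (rule lint_lebesgue_eq_lborel) measurable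
  finally show ?thesis .
qed

text \<open>A pair \<open>(I, m)\<close> contributes to the coefficient at \<open>J\<close> exactly
  if removing the \<open>m\<close>-th index of \<open>I\<close> leaves \<open>J\<close>.
  Integrability at this \<open>x\<close> lets the integral pass through the finite sum.\<close>

lemma form_coeff_poincare:
  fixes \<theta> :: "real^'n::{finite,linorder} \<Rightarrow> real" and U :: "real^'n::{finite,linorder} \<Rightarrow> 'n form"
  assumes l: "1 \<le> l" "l \<le> CARD('n)" and \<theta>: "\<theta> \<in> borel_measurable borel"
    and F: "\<And>I. I \<in> increasing_tuples l \<Longrightarrow> F I \<in> borel_measurable borel"
      "\<And>I. I \<in> increasing_tuples l \<Longrightarrow> AE y in lborel. form_coeff (U y) I = F I y"
    and J: "J \<in> increasing_tuples (l - 1)"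
    and int: "\<And>I i. I \<in> increasing_tuples l \<Longrightarrow> integrable lborel (\<lambda>y. ray_kernel l \<theta> x y * (x $ i - y $ i) * F I y)"
  shows "form_coeff (poincare \<theta> l U x) J = (\<Sum>I\<in>increasing_tuples l. \<Sum>m<l.
    (if take m I @ drop (Suc m) I = J then (-1) ^ m * ray_operator l \<theta> (I ! m) (F I) x else 0))"
proof -
  let ?T = "increasing_tuples l :: 'n list set"
  let ?c = "\<lambda>I m. if take m I @ drop (Suc m) I = J then (-1) ^ m else (0::real)"
  let ?f = "\<lambda>I m y. ?c I m * (ray_kernel l \<theta> x y * (x $ (I ! m) - y $ (I ! m)) * F I y)"
  have int': "integrable lborel (?f I m)" if "I \<in> ?T" for I m
    by (rule integrable_mult_right[OF int[OF that]])
  have "form_coeff (poincare \<theta> l U x) J = (LINT y|lebesgue. ray_kernel l \<theta> x y * form_coeff (contraction l (x - y) (U y)) J)"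
    unfolding poincare_def form_coeff_form_integral[OF J] poincare_kernel_eq[OF l \<theta>] by (simp add: form_coeff_def)
  also have "\<dots> = (\<integral>y. (\<Sum>I\<in>?T. \<Sum>m<l. ?f I m y) \<partial>lborel)"
  proof (rule integral_lebesgue_cong)
    show "(\<lambda>y. \<Sum>I\<in>?T. \<Sum>m<l. ?f I m y) \<in> borel_measurable borel"
    proof (intro borel_measurable_sum)
      fix I m assume "I \<in> ?T"
      from borel_measurable_integrable[OF int'[OF this, of m]]
      show "?f I m \<in> borel_measurable borel" by simp
    qed
    have "AE y in lborel. \<forall>I\<in>?T. form_coeff (U y) I = F I y"
      using F(2) by (intro AE_finite_allI finite_increasing_tuples)
    then show "AE y in lborel. ray_kernel l \<theta> x y * form_coeff (contraction l (x - y) (U y)) J = (\<Sum>I\<in>?T. \<Sum>m<l. ?f I m y)"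
    proof eventually_elim
      fix y assume y: "\<forall>I\<in>?T. form_coeff (U y) I = F I y"
      show "ray_kernel l \<theta> x y * form_coeff (contraction l (x - y) (U y)) J = (\<Sum>I\<in>?T. \<Sum>m<l. ?f I m y)"
        unfolding form_coeff_contraction[OF J] sum_distrib_left
        by (intro sum.cong refl) (use y in \<open>auto simp: mult_ac\<close>)
    qed
  qed
  also have "\<dots> = (\<Sum>I\<in>?T. \<Sum>m<l. \<integral>y. ?f I m y \<partial>lborel)"
  proof -
    have "(\<integral>y. (\<Sum>I\<in>?T. \<Sum>m<l. ?f I m y) \<partial>lborel) = (\<Sum>I\<in>?T. \<integral>y. (\<Sum>m<l. ?f I m y) \<partial>lborel)"
      by (rule Bochner_Integration.integral_sum) (intro Bochner_Integration.integrable_sum int')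
    also have "\<dots> = (\<Sum>I\<in>?T. \<Sum>m<l. \<integral>y. ?f I m y \<partial>lborel)"
      by (rule sum.cong[OF refl], rule Bochner_Integration.integral_sum, rule int')
    finally show ?thesis .
  qed
  also have "\<dots> = (\<Sum>I\<in>?T. \<Sum>m<l. (if take m I @ drop (Suc m) I = J then (-1) ^ m * ray_operator l \<theta> (I ! m) (F I) x else 0))"
    by (intro sum.cong refl) (simp add: ray_operator_def)
  finally show ?thesis .
qed

text \<open>The two claims share one induction, because additivity of the inner product needs square
  integrability of the smaller sum.\<close>

lemma l2inner_sum_left:
  assumes "finite A" and f: "\<And>k. k \<in> A \<Longrightarrow> square_integrable (f k)" and h: "square_integrable h"
  shows "square_integrable (\<lambda>x. \<Sum>k\<in>A. f k x) \<and> l2inner (\<lambda>x. \<Sum>k\<in>A. f k x) h = (\<Sum>k\<in>A. l2inner (f k) h)"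
  using assms(1) f
proof (induction A rule: finite_induct)
  case empty
  then show ?case by (simp add: square_integrable_def l2inner_def)
next
  case (insert k A)
  then have IH: "square_integrable (\<lambda>x. \<Sum>k\<in>A. f k x)" "l2inner (\<lambda>x. \<Sum>k\<in>A. f k x) h = (\<Sum>k\<in>A. l2inner (f k) h)" by auto
  have k: "square_integrable (f k)" using insert by simp
  have "square_integrable (\<lambda>x. 1 * f k x + 1 * (\<Sum>k\<in>A. f k x))"
    "l2inner (\<lambda>x. 1 * f k x + 1 * (\<Sum>k\<in>A. f k x)) h = 1 * l2inner (f k) h + 1 * l2inner (\<lambda>x. \<Sum>k\<in>A. f k x) h"
    by (rule square_integrable_add[OF k IH(1)], rule l2inner_add_left[OF k IH(1) h])
  then show ?case using insert IH by simp
qed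

text \<open>The L2 bounds of the locale are obtained by multiplying the L1 and supremum bounds of
  the admissible weight and taking roots.\<close>

lemma ray_estimate_of_admissible:
  fixes \<theta> :: "real^'n::{finite,linorder} \<Rightarrow> real"
  assumes l: "1 \<le> l" "l \<le> CARD('n)" and \<Omega>: "open \<Omega>" "bounded \<Omega>" and r: "0 < r" "ball a r \<subseteq> \<Omega>"
    and adm: "admissible_weight c (ball a r) \<theta>"
    and f: "square_integrable f" "\<And>x. x \<notin> \<Omega> \<Longrightarrow> f x = 0" and \<psi>: "\<psi> \<in> test_functions \<Omega>"
  shows "ray_estimate l \<Omega> a r \<theta> f \<psi> j (weight_bound c)"
proof -
  let ?M = "weight_bound c" and ?n = "CARD('n)"
  have \<theta>: "\<theta> \<in> test_functions (ball a r)" using adm by (simp add: admissible_weight_def)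
  have b0: "(\<integral>x. \<bar>\<theta> x\<bar> \<partial>lborel) \<le> ?M" "AE x in lborel. \<bar>\<theta> x\<bar> \<le> ?M / (2 * r) ^ ?n"
    using admissible_weight_bounds[OF adm r(1), of 0] by simp_all
  have b1: "(\<integral>x. \<bar>partial_deriv j \<theta> x\<bar> \<partial>lborel) \<le> ?M / (2 * r)" "AE x in lborel. \<bar>partial_deriv j \<theta> x\<bar> \<le> ?M / (2 * r) ^ (?n + 1)"
    using admissible_weight_bounds[OF adm r(1), of 1 j] by simp_all
  have b2: "(\<integral>x. \<bar>partial_deriv j (partial_deriv j \<theta>) x\<bar> \<partial>lborel) \<le> ?M / (2 * r)\<^sup>2"
    using admissible_weight_bounds(1)[OF adm r(1), of 2 j] by (simp add: numeral_2_eq_2)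
  have sq: "square_integrable \<theta>" "square_integrable (partial_deriv j \<theta>)"
    by (rule square_integrable_test_function[OF \<theta>], rule square_integrable_partial_test_function[OF \<theta>])
  have i: "integrable lborel \<theta>" "integrable lborel (partial_deriv j \<theta>)"
    using has_partial_continuous[OF test_functions_has_partial[OF \<theta>, of j]] test_functions_bounded_support[OF \<theta>]
      has_partial_bounded_support[OF test_functions_has_partial[OF \<theta>] test_functions_bounded_support[OF \<theta>]]
    by (auto intro: integrable_continuous_bounded_support)
  have M: "0 \<le> ?M" by (rule weight_bound_nonneg)
  have "l2norm \<theta> \<le> sqrt (?M / (2 * r) ^ ?n * ?M)"
    using M r by (intro l2norm_le_sqrt sq i b0) simp
  also have "\<dots> = ?M / sqrt ((2 * r) ^ ?n)"
    using M by (simp add: real_sqrt_divide real_sqrt_mult)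
  finally have n0: "l2norm \<theta> \<le> ?M / sqrt ((2 * r) ^ ?n)" .
  have "l2norm (partial_deriv j \<theta>) \<le> sqrt (?M / (2 * r) ^ (?n + 1) * (?M / (2 * r)))"
    using M r by (intro l2norm_le_sqrt sq i b1) simp
  also have "?M / (2 * r) ^ (?n + 1) * (?M / (2 * r)) = (?M / (2 * r))\<^sup>2 / (2 * r) ^ ?n"
    using r by (simp add: power2_eq_square)
  also have "sqrt ((?M / (2 * r))\<^sup>2 / (2 * r) ^ ?n) = ?M / (2 * r) / sqrt ((2 * r) ^ ?n)"
    using M r by (simp only: real_sqrt_divide[of "(?M / (2 * r))\<^sup>2"] real_sqrt_abs) simp
  finally have n1: "l2norm (partial_deriv j \<theta>) \<le> ?M / (2 * r) / sqrt ((2 * r) ^ ?n)" .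
  show ?thesis
    by unfold_locales
      (use l \<Omega> r f \<psi> M b0 b1 b2 n0 n1 test_functions_smooth[OF \<theta>] test_functions_zero[OF \<theta>] test_functions_partial_zero[OF \<theta>] in auto)
qed

theorem corollary3p16:
  fixes l :: nat
    and c :: "('n::{finite,linorder} \<Rightarrow> nat) \<Rightarrow> real"
  assumes "1 \<le> l" and "l \<le> CARD('n)"
  shows "\<exists>C::real. \<forall>(\<Omega>::(real^'n::{finite,linorder}) set) a r (\<theta>::real^'n::{finite,linorder} \<Rightarrow> real) (u::real^'n::{finite,linorder} \<Rightarrow> 'n form).
    open \<Omega> \<and> connected \<Omega> \<and> bounded \<Omega> \<and> lipschitz_boundary \<Omega> \<and>
    0 < r \<and> ball a r \<subseteq> \<Omega> \<and> star_shaped_wrt \<Omega> (ball a r) \<and>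
    admissible_weight c (ball a r) \<theta> \<and> form_L2 \<Omega> l u \<longrightarrow>
      form_H1 \<Omega> (l - 1) (poincare \<theta> l (extend_by_zero \<Omega> u)) \<and>
      form_H1_seminorm \<Omega> (l - 1) (poincare \<theta> l (extend_by_zero \<Omega> u))
        \<le> C * (diameter \<Omega> / diameter (ball a r)) * poincare_kappa l \<Omega> (ball a r) * form_L2_norm \<Omega> l u"
proof -
  let ?n = "CARD('n)"
  let ?T = "increasing_tuples l :: 'n list set" and ?S = "increasing_tuples (l - 1) :: 'n list set"
  define K :: real where "K = 2 ^ (?n + 1) + sqrt (2 ^ ?n) + 3 * pi * sqrt (2 ^ (?n + 1))"
  have K0: "0 \<le> K" by (simp add: K_def)
  obtain C1 where C1: "\<And>(\<Omega> :: (real, 'n) vec set) a r. 0 < r \<Longrightarrow> ball a r \<subseteq> \<Omega> \<Longrightarrow> open \<Omega> \<Longrightarrow> bounded \<Omega> \<Longrightarrow>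
    (\<exists>lam e. 0 \<le> lam \<and> lam \<le> 1 \<and> e = real l - (real ?n / 2) * (1 - lam) \<and> 0 < e \<and>
      1 + (measure lborel \<Omega> / (2 * r) ^ ?n) powr (lam / 2) / e \<le> C1 * poincare_kappa l \<Omega> (ball a r))"
    using poincare_kappa_bound[where 'n='n, OF assms] by blast
  \<comment> \<open>Counts the pairs \<open>(I, m)\<close>, hence bounds the number of ray operators
    in one coefficient.\<close>
  define N where "N = real (card ?T) * real l"
  \<comment> \<open>The root counts the coefficients of the result times the directions of
    differentiation.\<close>
  define C where "C = sqrt (real (card ?S) * real ?n) * (N * (K * weight_bound c * C1))"
  show ?thesis
  proof (rule exI[of _ C], intro allI impI, elim conjE)
    fix \<Omega> :: "(real, 'n) vec set" and a r and \<theta> :: "(real, 'n) vec \<Rightarrow> real" and u :: "(real, 'n) vec \<Rightarrow> 'n form"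
    assume \<Omega>: "open \<Omega>" "bounded \<Omega>" and r: "0 < r" "ball a r \<subseteq> \<Omega>"
      and adm: "admissible_weight c (ball a r) \<theta>" and u: "form_L2 \<Omega> l u"
    let ?P = "poincare \<theta> l (extend_by_zero \<Omega> u)"
    define R where "R = diameter \<Omega> / (2 * r)"
    define \<kappa> where "\<kappa> = poincare_kappa l \<Omega> (ball a r)"
    have \<Omega>m: "\<Omega> \<in> sets borel" using \<Omega> by simp
    have diam: "diameter (ball a r) = 2 * r" using r by (simp add: diameter_ball)
    have R0: "0 \<le> R" using r diameter_ge_0[OF \<Omega>(2)] by (simp add: R_def)
    have \<theta>: "\<theta> \<in> test_functions (ball a r)" using adm by (simp add: admissible_weight_def)
    have \<theta>m: "\<theta> \<in> borel_measurable borel"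
      using square_integrable_test_function[OF \<theta>] by (simp add: square_integrable_def)
    have \<theta>1: "(\<integral>x. \<theta> x \<partial>lborel) = 1"
      using adm lint_lebesgue_eq_lborel[OF \<theta>m] by (simp add: admissible_weight_def)
    obtain lam e where lam: "0 \<le> lam" "lam \<le> 1" "e = real l - (real ?n / 2) * (1 - lam)" "0 < e"
      and C1': "1 + (measure lborel \<Omega> / (2 * r) ^ ?n) powr (lam / 2) / e \<le> C1 * \<kappa>"
      using C1[OF r \<Omega>] by (auto simp: \<kappa>_def)
    have C1\<kappa>: "0 \<le> C1 * \<kappa>"
      by (rule order_trans[OF _ C1']) (use lam(4) in simp)
    \<comment> \<open>The scalar estimates ask for Borel functions that vanish outside
      \<open>\<Omega>\<close>; these replace the coefficients of \<open>u\<close>.\<close>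
    have "\<forall>I\<in>?T. \<exists>F. square_integrable F \<and> (\<forall>x. x \<notin> \<Omega> \<longrightarrow> F x = 0) \<and>
      (AE x in lborel. x \<in> \<Omega> \<longrightarrow> form_coeff (u x) I = F x) \<and> L2_norm \<Omega> (\<lambda>x. form_coeff (u x) I) = l2norm F"
    proof
      fix I assume "I \<in> ?T"
      then have "L2 \<Omega> (\<lambda>x. form_coeff (u x) I)" using u by (simp add: form_L2_def)
      then show "\<exists>F. square_integrable F \<and> (\<forall>x. x \<notin> \<Omega> \<longrightarrow> F x = 0) \<and>
        (AE x in lborel. x \<in> \<Omega> \<longrightarrow> form_coeff (u x) I = F x) \<and> L2_norm \<Omega> (\<lambda>x. form_coeff (u x) I) = l2norm F"
        by (rule L2_borel_representative[OF _ \<Omega>m]) blast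
    qed
    from bchoice[OF this] obtain F where F: "\<And>I. I \<in> ?T \<Longrightarrow> square_integrable (F I)" "\<And>I x. I \<in> ?T \<Longrightarrow> x \<notin> \<Omega> \<Longrightarrow> F I x = 0"
      "\<And>I. I \<in> ?T \<Longrightarrow> AE x in lborel. x \<in> \<Omega> \<longrightarrow> form_coeff (u x) I = F I x"
      "\<And>I. I \<in> ?T \<Longrightarrow> L2_norm \<Omega> (\<lambda>x. form_coeff (u x) I) = l2norm (F I)"
      by blast
    have Fu: "l2norm (F I) \<le> form_L2_norm \<Omega> l u" if "I \<in> ?T" for I
    proof -
      have "(l2norm (F I))\<^sup>2 \<le> (\<Sum>I\<in>?T. (L2_norm \<Omega> (\<lambda>x. form_coeff (u x) I))\<^sup>2)"
        unfolding F(4)[OF that, symmetric]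
        by (rule member_le_sum[OF that _ finite_increasing_tuples]) simp
      then show ?thesis unfolding form_L2_norm_def by (rule real_le_rsqrt)
    qed
    have u0: "0 \<le> form_L2_norm \<Omega> l u" by (simp add: form_L2_norm_def sum_nonneg)
    have ext: "AE y in lborel. form_coeff (extend_by_zero \<Omega> u y) I = F I y" if "I \<in> ?T" for I
      using F(3)[OF that] by eventually_elim (auto simp: extend_by_zero_def form_coeff_def F(2)[OF that])
    have Fm: "F I \<in> borel_measurable borel" if "I \<in> ?T" for I
      using F(1)[OF that] by (simp add: square_integrable_def)
    interpret S: ray_setting l \<Omega> a r \<theta>
      using assms \<Omega> r test_functions_smooth[OF \<theta>] test_functions_zero[OF \<theta>] by unfold_locales auto
    define c0 where "c0 = N * (K * weight_bound c * R * (C1 * \<kappa>) * form_L2_norm \<Omega> l u)"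
    have A0: "0 \<le> K * weight_bound c * R"
      using K0 R0 weight_bound_nonneg[of c] by simp
    have c0: "0 \<le> c0"
      unfolding c0_def by (rule mult_nonneg_nonneg[OF _ mult_nonneg_nonneg[OF mult_nonneg_nonneg[OF A0 C1\<kappa>] u0]]) (simp add: N_def)
    \<comment> \<open>The sum \<open>H J\<close> represents the \<open>J\<close>-th coefficient on
      \<open>\<Omega>\<close>; the cutoff by the indicator makes each term square integrable on the
      whole space.\<close>
    define G where "G J I m x = (if take m I @ drop (Suc m) I = J then (-1) ^ m else 0) * (indicator \<Omega> x * ray_operator l \<theta> (I ! m) (F I) x)"
      for J :: "'n list" and I m x
    define H where "H J x = (\<Sum>p\<in>?T \<times> {..<l}. G J (fst p) (snd p) x)" for J x
    have Gsq: "square_integrable (G J I m)" if "I \<in> ?T" for J I m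
    proof -
      note s = S.square_integrable_ray_operator[OF F(1)[OF that] F(2)[OF that], of "I ! m"]
      \<comment> \<open>The second coefficient 0 lets the lemma on linear combinations serve for a
        scalar multiple.\<close>
      have "square_integrable (\<lambda>x. (if take m I @ drop (Suc m) I = J then (-1) ^ m else 0) * (indicator \<Omega> x * ray_operator l \<theta> (I ! m) (F I) x) + 0 * (indicator \<Omega> x * ray_operator l \<theta> (I ! m) (F I) x))"
        by (rule square_integrable_add[OF s s])
      then show ?thesis by (simp add: G_def[abs_def])
    qed
    have H0: "H J x = 0" if "x \<notin> \<Omega>" for J x using that by (simp add: H_def G_def)
    have Hae: "AE x in lborel. x \<in> \<Omega> \<longrightarrow> form_coeff (?P x) J = H J x" if J: "J \<in> ?S" for J
    proof -
      have "AE x in lborel. \<forall>I\<in>?T. \<forall>i\<in>UNIV. x \<in> \<Omega> \<longrightarrow> integrable lborel (\<lambda>y. ray_kernel l \<theta> x y * (x $ i - y $ i) * F I y)"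
        by (intro AE_finite_allI finite_increasing_tuples S.AE_integrable_ray_kernel F) auto
      then show ?thesis
      proof eventually_elim
        fix x assume x: "\<forall>I\<in>?T. \<forall>i\<in>UNIV. x \<in> \<Omega> \<longrightarrow> integrable lborel (\<lambda>y. ray_kernel l \<theta> x y * (x $ i - y $ i) * F I y)"
        show "x \<in> \<Omega> \<longrightarrow> form_coeff (?P x) J = H J x"
        proof
          assume "x \<in> \<Omega>"
          with x have "form_coeff (?P x) J = (\<Sum>I\<in>?T. \<Sum>m<l. (if take m I @ drop (Suc m) I = J then (-1) ^ m * ray_operator l \<theta> (I ! m) (F I) x else 0))"
            by (intro form_coeff_poincare assms \<theta>m Fm ext J) auto
          also have "\<dots> = (\<Sum>I\<in>?T. \<Sum>m<l. G J I m x)"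
            using \<open>x \<in> \<Omega>\<close> by (intro sum.cong refl) (simp add: G_def)
          also have "\<dots> = H J x" unfolding H_def by (simp add: sum.cartesian_product case_prod_beta')
          finally show "form_coeff (?P x) J = H J x" .
        qed
      qed
    qed
    have Hsum: "square_integrable (H J) \<and> l2inner (H J) h = (\<Sum>p\<in>?T \<times> {..<l}. l2inner (G J (fst p) (snd p)) h)" if "square_integrable h" for J h
      unfolding H_def[abs_def] by (rule l2inner_sum_left[OF _ _ that]) (auto intro: finite_increasing_tuples Gsq)
    have Hsq: "square_integrable (H J)" for J using Hsum[of "\<lambda>_. 0"] by (simp add: square_integrable_def)
    have Hb: "\<bar>l2inner (H J) (partial_deriv j \<phi>)\<bar> \<le> c0 * l2norm \<phi>" if \<phi>: "\<phi> \<in> test_functions \<Omega>" for J j \<phi>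
    proof -
      let ?b = "K * weight_bound c * R * (C1 * \<kappa>) * form_L2_norm \<Omega> l u * l2norm \<phi>"
      have G: "\<bar>l2inner (G J I m) (partial_deriv j \<phi>)\<bar> \<le> ?b" if I: "I \<in> ?T" for I m
      proof -
        interpret E: ray_estimate l \<Omega> a r \<theta> "F I" \<phi> "I ! m" j "weight_bound c"
          by (rule ray_estimate_of_admissible[OF assms \<Omega> r adm F(1)[OF I] F(2)[OF I] \<phi>])
        have "l2inner (G J I m) (partial_deriv j \<phi>) = (if take m I @ drop (Suc m) I = J then (-1) ^ m else 0) * (\<integral>x. ray_operator l \<theta> (I ! m) (F I) x * partial_deriv j \<phi> x \<partial>lborel)"
        proof -
          \<comment> \<open>The derivative of a test function vanishes outside
            \<open>\<Omega>\<close>, so the cutoff disappears from the pairing.\<close>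
          have "G J I m x * partial_deriv j \<phi> x = (if take m I @ drop (Suc m) I = J then (-1) ^ m else 0) * (ray_operator l \<theta> (I ! m) (F I) x * partial_deriv j \<phi> x)" for x
            using test_functions_partial_zero[OF \<phi>, of x j] by (cases "x \<in> \<Omega>") (simp_all add: G_def)
          then show ?thesis by (simp only: l2inner_def integral_mult_right_zero)
        qed
        then have "\<bar>l2inner (G J I m) (partial_deriv j \<phi>)\<bar> \<le> \<bar>\<integral>x. ray_operator l \<theta> (I ! m) (F I) x * partial_deriv j \<phi> x \<partial>lborel\<bar>"
          by (auto simp: abs_mult)
        also have "\<dots> \<le> K * weight_bound c * R * (1 + (measure lborel \<Omega> / (2 * r) ^ ?n) powr (lam / 2) / e) * (l2norm (F I) * l2norm \<phi>)"
          using E.ray_operator_weak_bound[OF lam] unfolding E.K_def K_def R_def .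
        also have "\<dots> \<le> K * weight_bound c * R * (C1 * \<kappa>) * (form_L2_norm \<Omega> l u * l2norm \<phi>)"
          by (rule mult_mono[OF mult_left_mono[OF C1' A0] mult_right_mono[OF Fu[OF I] l2norm_nonneg] mult_nonneg_nonneg[OF A0 C1\<kappa>]]) simp
        finally show ?thesis by (simp only: mult.assoc)
      qed
      have "\<bar>l2inner (H J) (partial_deriv j \<phi>)\<bar> \<le> (\<Sum>p\<in>?T \<times> {..<l}. \<bar>l2inner (G J (fst p) (snd p)) (partial_deriv j \<phi>)\<bar>)"
        using Hsum[OF square_integrable_partial_test_function[OF \<phi>]] by (simp add: sum_abs)
      also have "\<dots> \<le> (\<Sum>p\<in>?T \<times> {..<l}. ?b)" by (intro sum_mono G) auto
      also have "\<dots> = c0 * l2norm \<phi>" by (simp add: card_cartesian_product c0_def N_def mult_ac)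
      finally show ?thesis .
    qed
    note W = weak_partial_bound[OF \<Omega> r(1) \<theta> \<theta>1 Hsq H0 Hae c0 Hb]
    have "form_H1 \<Omega> (l - 1) ?P"
      unfolding form_H1_def H1_def
    proof (intro conjI ballI allI)
      show "alternating_form (l - 1) (?P x)" for x
        unfolding poincare_def by (rule alternating_form_form_integral)
      show "L2 \<Omega> (\<lambda>x. form_coeff (?P x) J)" if "J \<in> ?S" for J
        by (rule L2_of_square_integrable[OF Hsq Hae[OF that] \<Omega>m H0])
      show "\<exists>g. L2 \<Omega> g \<and> is_weak_partial \<Omega> i (\<lambda>x. form_coeff (?P x) J) g" if "J \<in> ?S" for J i
        by (rule W(1)) (use that in auto)
    qed
    moreover have "form_H1_seminorm \<Omega> (l - 1) ?P \<le> C * (diameter \<Omega> / diameter (ball a r)) * poincare_kappa l \<Omega> (ball a r) * form_L2_norm \<Omega> l u"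
    proof -
      have "(\<Sum>J\<in>?S. (H1_seminorm \<Omega> (\<lambda>x. form_coeff (?P x) J))\<^sup>2) \<le> (\<Sum>J\<in>?S. real ?n * c0\<^sup>2)"
      proof (rule sum_mono)
        fix J assume J: "J \<in> ?S"
        have "(H1_seminorm \<Omega> (\<lambda>x. form_coeff (?P x) J))\<^sup>2 = (\<Sum>i\<in>UNIV. (L2_norm \<Omega> (weak_partial \<Omega> i (\<lambda>x. form_coeff (?P x) J)))\<^sup>2)"
          by (simp add: H1_seminorm_def sum_nonneg)
        also have "\<dots> \<le> (\<Sum>i\<in>(UNIV::'n set). c0\<^sup>2)"
        proof (rule sum_mono)
          fix i :: 'n
          have "0 \<le> (LINT x:\<Omega>|lebesgue. (weak_partial \<Omega> i (\<lambda>x. form_coeff (?P x) J) x)\<^sup>2)"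
            unfolding set_lebesgue_integral_def by (intro Bochner_Integration.integral_nonneg) auto
          then have "0 \<le> L2_norm \<Omega> (weak_partial \<Omega> i (\<lambda>x. form_coeff (?P x) J))" by (simp add: L2_norm_def)
          then show "(L2_norm \<Omega> (weak_partial \<Omega> i (\<lambda>x. form_coeff (?P x) J)))\<^sup>2 \<le> c0\<^sup>2"
            by (intro power_mono W(2)) (use J in auto)
        qed
        finally show "(H1_seminorm \<Omega> (\<lambda>x. form_coeff (?P x) J))\<^sup>2 \<le> real ?n * c0\<^sup>2" by simp
      qed
      then have "form_H1_seminorm \<Omega> (l - 1) ?P \<le> sqrt (real (card ?S) * real ?n * c0\<^sup>2)"
        unfolding form_H1_seminorm_def by (intro real_sqrt_le_mono) (simp add: mult.assoc)
      also have "\<dots> = sqrt (real (card ?S) * real ?n) * c0" using c0 by (simp add: real_sqrt_mult)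
      also have "\<dots> = C * R * \<kappa> * form_L2_norm \<Omega> l u"
        by (simp only: C_def c0_def mult_ac)
      finally show ?thesis by (simp only: diam R_def \<kappa>_def)
    qed
    ultimately show "form_H1 \<Omega> (l - 1) ?P \<and> form_H1_seminorm \<Omega> (l - 1) ?P \<le> C * (diameter \<Omega> / diameter (ball a r)) * poincare_kappa l \<Omega> (ball a r) * form_L2_norm \<Omega> l u" ..
  qed
qed

end
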